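(* Let $\Omega\subset\mathbb{R}^n$ be an open set which is bounded in one direction, $s\in\mathbb{R}^+\setminus\mathbb{Z}$, and $q_1,q_2\in M_{\delta(\Omega)}(H^s\to H^{-s})+M_{\ge0}(H^s\to H^{-s})$. Let $W_1,W_2\subset\Omega_e:=\mathbb{R}^n\setminus\overline\Omega$ be nonempty open sets. If the exterior DN maps for the equations $(-\Delta)^su+q_ju=0$ in $\Omega$, $j=1,2$, satisfy $\Lambda_{q_1}f|_{W_2}=\Lambda_{q_2}f|_{W_2}$ for all $f\in C_c^\infty(W_1)$, then $q_1|_\Omega=q_2|_\Omega$.
   Context: An open set $\Omega\subset\mathbb{R}^n$ is bounded in one direction if there exist $n\ge k>0$, a bounded open set $\omega\subset\mathbb{R}^k$ and a rigid Euclidean motion $A(x)=Lx+x_0$ ($L$ a linear isometry) such that $\Omega\subset A(\mathbb{R}^{n-k}\times\omega)$. $H^s(\mathbb{R}^n)$ is the $L^2$-based (real) Bessel potential space, $\widetilde{H}^s(\Omega)$ the closure of $C_c^\infty(\Omega)$ in $H^s(\mathbb{R}^n)$, $(-\Delta)^{s}u=\mathcal{F}^{-1}(|\xi|^{2s}\hat u)$. Sobolev multipliers: $M(H^s\to H^{-s})$ is the set of distributions $a$ on $\mathbb{R}^n$ with $\|a\|_{s,-s}:=\sup\{|\langle a,uv\rangle|: u,v\in C_c^\infty(\mathbb{R}^n),\ \|u\|_{H^s}=\|v\|_{H^{s}}=1\}<\infty$; the form $(u,v)\mapsto\langle a,uv\rangle$ extends continuously to $H^s(\mathbb{R}^n)\times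 H^s(\mathbb{R}^n)$. Let $C(s,\Omega)$ be the optimal constant in $\|u\|_{L^2(\mathbb{R}^n)}\le C(s,\Omega)\|(-\Delta)^{s/2}u\|_{L^2(\mathbb{R}^n)}$ for all $u\in\widetilde{H}^s(\Omega)$ (finite when $\Omega$ is bounded in one direction) and $\delta(\Omega):=\left(\frac{2^{-s/2}}{1+C(s,\Omega)}\right)^2$. For $C>0$, $M_C(H^s\to H^{-s})=\{a\in M(H^s\to H^{-s}):\|a\|_{s,-s}<C\}$, and $M_{\ge0}(H^s\to H^{-s})=\{a\in M(H^s\to H^{-s}): \langle a,f^2\rangle\ge0\ \forall f\in C_c^\infty(\mathbb{R}^n)\}$. Let $B_q(v,w)=\langle(-\Delta)^{s/2}v,(-\Delta)^{s/2}w\rangle+\langle q,vw\rangle$ on $H^s(\mathbb{R}^n)$. For $q$ in the stated class and each $f\in H^s(\mathbb{R}^n)$ there is a unique $u_f\in H^s(\mathbb{R}^n)$ with $u_f-f\in\widetilde{H}^s(\Omega)$ and $B_q(u_f,v)=0$ for all $v\in\widetilde{H}^s(\Omega)$. The exterior DN map $\Lambda_q\colon X\to X^*$, $X=H^s(\mathbb{R}^n)/\widetilde{H}^s(\Omega)$, is $\langle\Lambda_qf,g\rangle:=B_q(u_f,g)$; $\Lambda_{q_1}f|_{W_2}=\Lambda_{q_2}f|_{W_2}$ means $\langle\Lambda_{q_1}f,g\rangle=\langle\Lambda_{q_2}f,g\rangle$ for all $g\in C_c^\infty(W_2)$. Equality of $q_1,q_2$ on $\Omega$ is in the sense of distributions.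 *)

theory Defs
  imports "HOL-Analysis.Analysis"
begin

section \<open>Geometry\<close>

text \<open>
  The factors of \<open>\<real>\<^sup>n = \<real>\<^sup>n\<^sup>-\<^sup>k \<times> \<real>\<^sup>k\<close> are the coordinate subspaces spanned by \<open>Basis - B\<close> and \<open>B\<close>,
  where \<open>k = card B\<close>. Which \<open>k\<close> coordinates are chosen is immaterial, because a permutation of
  the coordinates is an isometry and can be absorbed into \<open>L\<close>.
\<close>

definition bounded_in_one_direction :: "'a::euclidean_space set \<Rightarrow> bool" where
  "bounded_in_one_direction \<Omega> \<longleftrightarrow>
     (\<exists>(B :: 'a set) \<omega> L x0. B \<subseteq> Basis \<and> B \<noteq> {} \<and>
        \<omega> \<subseteq> span B \<and> openin (top_of_set (span B)) \<omega> \<and> bounded \<omega> \<and>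
        orthogonal_transformation L \<and>
        \<Omega> \<subseteq> (\<lambda>x. L x + x0) ` {y + z | y z. y \<in> span (Basis - B) \<and> z \<in> \<omega>})"

section \<open>Test functions and distributions\<close>

primrec partial_deriv :: "'a::euclidean_space list \<Rightarrow> ('a \<Rightarrow> real) \<Rightarrow> 'a \<Rightarrow> real" where
  "partial_deriv [] f = f"
| "partial_deriv (b # bs) f = (\<lambda>x. frechet_derivative (partial_deriv bs f) (at x) b)"

definition smooth :: "('a::euclidean_space \<Rightarrow> real) \<Rightarrow> bool" where
  "smooth f \<longleftrightarrow> (\<forall>bs\<in>lists Basis. \<forall>x. partial_deriv bs f differentiable (at x))"

definition test_fun :: "'a::euclidean_space set \<Rightarrow> ('a \<Rightarrow> real) set" where
  "test_fun \<Omega> = {\<phi>. smooth \<phi> \<and> compact (closure (support_on UNIV \<phi>)) \<and>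
                    closure (support_on UNIV \<phi>) \<subseteq> \<Omega>}"

text \<open>
  A real distribution is represented by a functional on all functions, of which only the values
  on \<open>test_fun UNIV\<close> are meaningful. Continuity is the usual seminorm estimate on each compact
  set \<open>K\<close>; the bound \<open>M\<close> stands for the maximum of the sup norms of the partial derivatives
  of order at most \<open>N\<close>.
\<close>

definition distribution :: "(('a::euclidean_space \<Rightarrow> real) \<Rightarrow> real) \<Rightarrow> bool" where
  "distribution T \<longleftrightarrow>
     (\<forall>\<phi>\<in>test_fun UNIV. \<forall>\<psi>\<in>test_fun UNIV. T (\<lambda>x. \<phi> x + \<psi> x) = T \<phi> + T \<psi>) \<and>
     (\<forall>c. \<forall>\<phi>\<in>test_fun UNIV. T (\<lambda>x. c * \<phi> x) = c * T \<phi>) \<and>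
     (\<forall>K. compact K \<longrightarrow> (\<exists>C N. \<forall>\<phi>\<in>test_fun K. \<forall>M.
        (\<forall>bs\<in>lists Basis. length bs \<le> N \<longrightarrow> (\<forall>x. \<bar>partial_deriv bs \<phi> x\<bar> \<le> M)) \<longrightarrow>
        \<bar>T \<phi>\<bar> \<le> C * M))"

definition eq_on :: "'a::euclidean_space set \<Rightarrow> (('a \<Rightarrow> real) \<Rightarrow> real) \<Rightarrow>
    (('a \<Rightarrow> real) \<Rightarrow> real) \<Rightarrow> bool" where
  "eq_on \<Omega> S T \<longleftrightarrow> (\<forall>\<phi>\<in>test_fun \<Omega>. S \<phi> = T \<phi>)"

section \<open>Fourier transform on \<open>L\<^sup>2\<close>\<close>

definition L2 :: "('a::euclidean_space \<Rightarrow> 'b::real_normed_vector) set" where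
  "L2 = {f. f \<in> borel_measurable lborel \<and> integrable lborel (\<lambda>x. (norm (f x))\<^sup>2)}"

definition L2_norm :: "('a::euclidean_space \<Rightarrow> 'b::real_normed_vector) \<Rightarrow> real" where
  "L2_norm f = sqrt (LINT x|lborel. (norm (f x))\<^sup>2)"

definition fourier_integral :: "('a::euclidean_space \<Rightarrow> real) \<Rightarrow> 'a \<Rightarrow> complex" where
  "fourier_integral f \<xi> = (LINT x|lborel. complex_of_real (f x) * cis (- (x \<bullet> \<xi>)))"

text \<open>
  \<open>F\<close> is (a representative of) the Fourier transform of \<open>f \<in> L\<^sup>2\<close>: the \<open>L\<^sup>2\<close> limit, as
  \<open>R \<rightarrow> \<infinity>\<close>, of the Fourier integrals of the truncations of \<open>f\<close> to balls of radius \<open>R\<close>.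
\<close>

definition has_fourier :: "('a::euclidean_space \<Rightarrow> real) \<Rightarrow> ('a \<Rightarrow> complex) \<Rightarrow> bool" where
  "has_fourier f F \<longleftrightarrow> f \<in> L2 \<and> F \<in> L2 \<and>
     ((\<lambda>R. \<integral>\<^sup>+ \<xi>. ennreal ((norm (F \<xi> -
          fourier_integral (\<lambda>x. indicator (cball 0 R) x * f x) \<xi>))\<^sup>2) \<partial>lborel) \<longlongrightarrow> 0) at_top"

text \<open>
  \<open>has_multiplier m u g\<close> says that \<open>g = \<F>\<^sup>-\<^sup>1(m \<F>u)\<close> in \<open>L\<^sup>2\<close>. Such a \<open>g\<close> is unique only
  up to a null set, and \<open>fourier_multiplier\<close> picks a representative.
\<close>

definition has_multiplier ::
    "('a::euclidean_space \<Rightarrow> real) \<Rightarrow> ('a \<Rightarrow> real) \<Rightarrow> ('a \<Rightarrow> real) \<Rightarrow> bool" where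
  "has_multiplier m u g \<longleftrightarrow> (\<exists>U G. has_fourier u U \<and> has_fourier g G \<and>
     (AE \<xi> in lborel. G \<xi> = complex_of_real (m \<xi>) * U \<xi>))"

definition fourier_multiplier ::
    "('a::euclidean_space \<Rightarrow> real) \<Rightarrow> ('a \<Rightarrow> real) \<Rightarrow> 'a \<Rightarrow> real" where
  "fourier_multiplier m u = (SOME g. has_multiplier m u g)"

section \<open>Bessel potential spaces and the fractional Laplacian\<close>

text \<open>
  Only orders \<open>s \<ge> 0\<close> are used, for which \<open>H\<^sup>s \<subseteq> L\<^sup>2\<close>; elements are real functions, two of
  which stand for the same element of \<open>H\<^sup>s\<close> if they agree almost everywhere. The Bessel
  potential operator has symbol \<open>(1 + |\<xi>|\<^sup>2)\<^sup>s\<^sup>/\<^sup>2\<close>.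
\<close>

definition bessel_symbol :: "real \<Rightarrow> 'a::euclidean_space \<Rightarrow> real" where
  "bessel_symbol s \<xi> = (1 + (norm \<xi>)\<^sup>2) powr (s / 2)"

definition sobolev :: "real \<Rightarrow> ('a::euclidean_space \<Rightarrow> real) set" where
  "sobolev s = {u \<in> L2. \<exists>g. has_multiplier (bessel_symbol s) u g}"

definition sobolev_norm :: "real \<Rightarrow> ('a::euclidean_space \<Rightarrow> real) \<Rightarrow> real" where
  "sobolev_norm s u = L2_norm (fourier_multiplier (bessel_symbol s) u)"

definition sobolev_tilde :: "real \<Rightarrow> 'a::euclidean_space set \<Rightarrow> ('a \<Rightarrow> real) set" where
  "sobolev_tilde s \<Omega> =
     {u \<in> sobolev s. \<forall>\<epsilon>>0. \<exists>\<phi>\<in>test_fun \<Omega>. sobolev_norm s (\<lambda>x. u x - \<phi> x) < \<epsilon>}"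

definition frac_laplacian :: "real \<Rightarrow> ('a::euclidean_space \<Rightarrow> real) \<Rightarrow> 'a \<Rightarrow> real" where
  "frac_laplacian t u = fourier_multiplier (\<lambda>\<xi>. norm \<xi> powr (2 * t)) u"

section \<open>Sobolev multipliers\<close>

definition multiplier_norm ::
    "real \<Rightarrow> (('a::euclidean_space \<Rightarrow> real) \<Rightarrow> real) \<Rightarrow> ennreal" where
  "multiplier_norm s a =
     (SUP (u, v) \<in> {(u, v). u \<in> test_fun UNIV \<and> v \<in> test_fun UNIV \<and>
                           sobolev_norm s u = 1 \<and> sobolev_norm s v = 1}.
        ennreal \<bar>a (\<lambda>x. u x * v x)\<bar>)"

definition multipliers :: "real \<Rightarrow> (('a::euclidean_space \<Rightarrow> real) \<Rightarrow> real) set" where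
  "multipliers s = {a. distribution a \<and> multiplier_norm s a < \<infinity>}"

definition multipliers_less ::
    "real \<Rightarrow> real \<Rightarrow> (('a::euclidean_space \<Rightarrow> real) \<Rightarrow> real) set" where
  "multipliers_less s C = {a \<in> multipliers s. multiplier_norm s a < ennreal C}"

definition multipliers_nonneg :: "real \<Rightarrow> (('a::euclidean_space \<Rightarrow> real) \<Rightarrow> real) set" where
  "multipliers_nonneg s = {a \<in> multipliers s. \<forall>f\<in>test_fun UNIV. a (\<lambda>x. (f x)\<^sup>2) \<ge> 0}"

text \<open>
  The value at \<open>(u, v)\<close> of the continuous extension of \<open>(\<phi>, \<psi>) \<mapsto> a(\<phi> \<psi>)\<close> from test
  functions to \<open>H\<^sup>s \<times> H\<^sup>s\<close>.
\<close>

definition multiplier_form :: "real \<Rightarrow> (('a::euclidean_space \<Rightarrow> real) \<Rightarrow> real) \<Rightarrow>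
    ('a \<Rightarrow> real) \<Rightarrow> ('a \<Rightarrow> real) \<Rightarrow> real" where
  "multiplier_form s a u v = (THE c. \<forall>\<phi> \<psi>.
     (\<forall>k::nat. \<phi> k \<in> test_fun UNIV \<and> \<psi> k \<in> test_fun UNIV) \<longrightarrow>
     (\<lambda>k. sobolev_norm s (\<lambda>x. \<phi> k x - u x)) \<longlonglongrightarrow> 0 \<longrightarrow>
     (\<lambda>k. sobolev_norm s (\<lambda>x. \<psi> k x - v x)) \<longlonglongrightarrow> 0 \<longrightarrow>
     (\<lambda>k. a (\<lambda>x. \<phi> k x * \<psi> k x)) \<longlonglongrightarrow> c)"

definition poincare_const :: "real \<Rightarrow> 'a::euclidean_space set \<Rightarrow> real" where
  "poincare_const s \<Omega> = Inf {C. 0 \<le> C \<and>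
     (\<forall>u\<in>sobolev_tilde s \<Omega>. L2_norm u \<le> C * L2_norm (frac_laplacian (s / 2) u))}"

definition delta :: "real \<Rightarrow> 'a::euclidean_space set \<Rightarrow> real" where
  "delta s \<Omega> = (2 powr (- s / 2) / (1 + poincare_const s \<Omega>))\<^sup>2"

definition potentials ::
    "real \<Rightarrow> 'a::euclidean_space set \<Rightarrow> (('a \<Rightarrow> real) \<Rightarrow> real) set" where
  "potentials s \<Omega> = {\<lambda>\<phi>. a \<phi> + b \<phi> | a b.
     a \<in> multipliers_less s (delta s \<Omega>) \<and> b \<in> multipliers_nonneg s}"

section \<open>The exterior Dirichlet-to-Neumann map\<close>

definition bilinear_form :: "real \<Rightarrow> (('a::euclidean_space \<Rightarrow> real) \<Rightarrow> real) \<Rightarrow>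
    ('a \<Rightarrow> real) \<Rightarrow> ('a \<Rightarrow> real) \<Rightarrow> real" where
  "bilinear_form s q v w =
     (LINT x|lborel. frac_laplacian (s / 2) v x * frac_laplacian (s / 2) w x)
     + multiplier_form s q v w"

definition is_solution :: "real \<Rightarrow> 'a::euclidean_space set \<Rightarrow> (('a \<Rightarrow> real) \<Rightarrow> real) \<Rightarrow>
    ('a \<Rightarrow> real) \<Rightarrow> ('a \<Rightarrow> real) \<Rightarrow> bool" where
  "is_solution s \<Omega> q f u \<longleftrightarrow> u \<in> sobolev s \<and> (\<lambda>x. u x - f x) \<in> sobolev_tilde s \<Omega> \<and>
     (\<forall>v\<in>sobolev_tilde s \<Omega>. bilinear_form s q u v = 0)"

definition solution :: "real \<Rightarrow> 'a::euclidean_space set \<Rightarrow> (('a \<Rightarrow> real) \<Rightarrow> real) \<Rightarrow>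
    ('a \<Rightarrow> real) \<Rightarrow> 'a \<Rightarrow> real" where
  "solution s \<Omega> q f = (SOME u. is_solution s \<Omega> q f u)"

definition trace_rel ::
    "real \<Rightarrow> 'a::euclidean_space set \<Rightarrow> (('a \<Rightarrow> real) \<times> ('a \<Rightarrow> real)) set" where
  "trace_rel s \<Omega> = {(f, g). f \<in> sobolev s \<and> g \<in> sobolev s \<and>
                            (\<lambda>x. f x - g x) \<in> sobolev_tilde s \<Omega>}"

text \<open>
  Elements of the quotient \<open>X = H\<^sup>s(\<real>\<^sup>n) / H\<^sup>~\<^sup>s(\<Omega>)\<close> are the classes \<open>trace_class s \<Omega> f\<close>, and
  \<open>DN_map s \<Omega> q F\<close> is the functional \<open>\<Lambda>\<^sub>q F\<close> on \<open>X\<close>. The value does not depend on the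
  representatives chosen when \<open>q \<in> potentials s \<Omega>\<close>.
\<close>

definition trace_class ::
    "real \<Rightarrow> 'a::euclidean_space set \<Rightarrow> ('a \<Rightarrow> real) \<Rightarrow> ('a \<Rightarrow> real) set" where
  "trace_class s \<Omega> f = trace_rel s \<Omega> `` {f}"

definition DN_map :: "real \<Rightarrow> 'a::euclidean_space set \<Rightarrow> (('a \<Rightarrow> real) \<Rightarrow> real) \<Rightarrow>
    ('a \<Rightarrow> real) set \<Rightarrow> ('a \<Rightarrow> real) set \<Rightarrow> real" where
  "DN_map s \<Omega> q F G = bilinear_form s q (solution s \<Omega> q (SOME f. f \<in> F)) (SOME g. g \<in> G)"

end

theory Submission
  imports Defs "HOL-Probability.Characteristic_Functions" "HOL-Probability.Sinc_Integral"
begin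

text \<open>
  By Plancherel all spaces are identified with \<open>L\<^sup>2\<close> on the frequency side, where \<open>B\<^sub>q\<close> becomes a
  bounded symmetric form. A Poincare inequality on slabs and the smallness built into
  \<open>\<delta>(\<Omega>)\<close> make it coercive on the closure of the test functions of \<open>\<Omega>\<close>.

  Unique continuation: let \<open>u\<close> vanish on a ball \<open>B\<close> on which \<open>(-\<Delta>)\<^sup>s u\<close> vanishes as well. Subordination of
  \<open>|\<xi>|\<^sup>2\<^sup>s\<close> to the heat semigroup turns this into \<open>\<integral> u(y) |x - y|\<^sup>-\<^sup>n\<^sup>-\<^sup>2\<^sup>s dy = 0\<close> for \<open>x \<in> B\<close>.
  Differentiating in \<open>x\<close> produces all kernels \<open>z\<^sup>\<alpha> |z|\<^sup>-\<^sup>2\<^sup>|\<^sup>\<alpha>\<^sup>| |z|\<^sup>-\<^sup>n\<^sup>-\<^sup>2\<^sup>s\<close> with \<open>z = x - y\<close>, which are monomials in the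
  inversion of \<open>y\<close> about the centre of \<open>B\<close> times a fixed weight. By the Stone-Weierstrass theorem
  \<open>u = 0\<close>.

  Unique continuation and coercivity give the Runge property: the functions \<open>u\<^sub>f - f\<close> with
  \<open>f \<in> C\<^sub>c\<^sup>\<infinity>(W)\<close> are dense. After shrinking \<open>W\<^sub>1\<close> and \<open>W\<^sub>2\<close> to disjoint sets, the equality of
  the exterior data says that \<open>q\<^sub>1 - q\<^sub>2\<close> annihilates all products \<open>(u\<^sub>f - f) (v\<^sub>g - g)\<close>, where \<open>u\<^sub>f\<close>
  solves the equation for \<open>q\<^sub>1\<close> and \<open>v\<^sub>g\<close> the one for \<open>q\<^sub>2\<close>; by density it annihilates \<open>\<phi> \<psi>\<close> for
  all test functions \<open>\<phi>, \<psi>\<close> of \<open>\<Omega>\<close>, and \<open>\<psi> = 1\<close> on the support of \<open>\<phi>\<close> is allowed.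
\<close>

section \<open>The Hilbert space \<open>L\<^sup>2\<close>\<close>

text \<open>For integer s the operator is local and unique continuation fails. A noninteger s lies
  strictly between consecutive integers m and m + 1, and this is what makes the subordination
  integral of the Taylor remainder converge at both ends. The constant \<delta>(\<Omega>) comes from
  (1 + |\<xi>|^2)^s \<le> 2^s (1 + |\<xi>|^(2s)) and the Poincare inequality: on limits of test
  functions of \<Omega>, \<delta>(\<Omega>) times the squared H^s norm is at most the squared L^2
  norm of (-\<Delta>)^(s/2) u. A multiplier of norm below \<delta>(\<Omega>) cannot use up this
  reserve, and a nonnegative one adds to it. A potential is given only on test functions. Its form
  lives on limits of test functions, so membership in \<open>hs_closure s UNIV\<close> accompanies
  every manipulation of it. Density of the differences u_f - f is shown by projecting with the
  energy form itself: the remainder is orthogonal to the exterior test functions because a potential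
  does not couple disjoint supports, whereas the fractional Laplacian does. The inversion serves
  because it sends the unbounded region where u may be nonzero into a compact ball, where uniform
  approximation by polynomials is available.\<close>

lemma L2_realI:
  fixes f :: "'a::euclidean_space \<Rightarrow> real"
  assumes "f \<in> borel_measurable borel" "integrable lborel (\<lambda>x. (f x)\<^sup>2)"
  shows "f \<in> L2"
  using assms by (simp add: L2_def)

lemma L2_realD:
  fixes f :: "'a::euclidean_space \<Rightarrow> real"
  assumes "f \<in> L2"
  shows "f \<in> borel_measurable borel" "integrable lborel (\<lambda>x. (f x)\<^sup>2)"
  using assms by (simp_all add: L2_def)

lemma L2_mult_integrable:
  fixes f g :: "'a::euclidean_space \<Rightarrow> real"
  assumes f: "f \<in> L2" and g: "g \<in> L2"
  shows "integrable lborel (\<lambda>x. f x * g x)"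
proof (rule Bochner_Integration.integrable_bound)
  show "integrable lborel (\<lambda>x. (f x)\<^sup>2 + (g x)\<^sup>2)"
    using L2_realD(2)[OF f] L2_realD(2)[OF g] by simp
  show "(\<lambda>x. f x * g x) \<in> borel_measurable lborel"
    using L2_realD(1)[OF f] L2_realD(1)[OF g] by simp
  have "\<bar>a * b\<bar> \<le> a\<^sup>2 + b\<^sup>2" for a b :: real
  proof -
    have "0 \<le> (\<bar>a\<bar> - \<bar>b\<bar>)\<^sup>2" by simp
    then have "2 * \<bar>a * b\<bar> \<le> a\<^sup>2 + b\<^sup>2" by (simp add: power2_eq_square algebra_simps abs_mult)
    then show ?thesis by (smt (verit) zero_le_power2)
  qed
  then show "AE x in lborel. norm (f x * g x) \<le> norm ((f x)\<^sup>2 + (g x)\<^sup>2)"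
    by (simp add: order_trans[OF _ abs_ge_self])
qed

lemma L2_add: 
  fixes f g :: "'a::euclidean_space \<Rightarrow> real"
  assumes f: "f \<in> L2" and g: "g \<in> L2"
  shows "(\<lambda>x. f x + g x) \<in> L2"
proof (rule L2_realI)
  show "(\<lambda>x. f x + g x) \<in> borel_measurable borel"
    using L2_realD(1)[OF f] L2_realD(1)[OF g] by simp
  show "integrable lborel (\<lambda>x. (f x + g x)\<^sup>2)"
    using L2_realD(2)[OF f] L2_realD(2)[OF g] L2_mult_integrable[OF f g]
    by (simp add: power2_sum mult.assoc)
qed

lemma L2_scale:
  fixes f :: "'a::euclidean_space \<Rightarrow> real"
  assumes f: "f \<in> L2"
  shows "(\<lambda>x. c * f x) \<in> L2"
proof (rule L2_realI)
  show "(\<lambda>x. c * f x) \<in> borel_measurable borel"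
    using L2_realD(1)[OF f] by simp
  show "integrable lborel (\<lambda>x. (c * f x)\<^sup>2)"
    using L2_realD(2)[OF f] by (simp add: power_mult_distrib)
qed

lemma L2_diff: 
  fixes f g :: "'a::euclidean_space \<Rightarrow> real"
  assumes f: "f \<in> L2" and g: "g \<in> L2"
  shows "(\<lambda>x. f x - g x) \<in> L2"
  using L2_add[OF f L2_scale[OF g, of "-1"]] by simp

lemma L2_zero: "(\<lambda>x. 0 :: real) \<in> L2"
  by (rule L2_realI) auto

lemma L2_cong_AE:
  fixes f g :: "'a::euclidean_space \<Rightarrow> real"
  assumes "f \<in> L2" "g \<in> borel_measurable borel" "AE x in lborel. f x = g x"
  shows "g \<in> L2"
proof (rule L2_realI)
  show "integrable lborel (\<lambda>x. (g x)\<^sup>2)"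
    using L2_realD[OF assms(1)] assms
    by (subst integrable_cong_AE[of _ _ "\<lambda>x. (f x)\<^sup>2"]) auto
qed fact

lemma L2_bound:
  fixes f g :: "'a::euclidean_space \<Rightarrow> real"
  assumes g: "g \<in> L2" and f: "f \<in> borel_measurable borel"
    and le: "AE x in lborel. \<bar>f x\<bar> \<le> C * \<bar>g x\<bar>"
  shows "f \<in> L2"
proof (rule L2_realI)
  show "integrable lborel (\<lambda>x. (f x)\<^sup>2)"
  proof (rule Bochner_Integration.integrable_bound)
    show "integrable lborel (\<lambda>x. C\<^sup>2 * (g x)\<^sup>2)" using L2_realD(2)[OF g] by simp
    show "AE x in lborel. norm ((f x)\<^sup>2) \<le> norm (C\<^sup>2 * (g x)\<^sup>2)"
      using le
    proof eventually_elim
      case (elim x)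
      have "\<bar>f x\<bar>\<^sup>2 \<le> (C * \<bar>g x\<bar>)\<^sup>2" using elim by (intro power_mono) auto
      then show ?case by (simp add: power_mult_distrib)
    qed
  qed (use f in simp)
qed fact

\<comment> \<open>The relation is partial: a function outside \<open>L2\<close> is related to
  nothing, so every class has square integrable representatives. The real Hilbert space structure is
  put on the classes, because the norm of a function only sees it up to null sets.\<close>
quotient_type (overloaded) 'a l2 = "'a::euclidean_space \<Rightarrow> real"
  / partial: "\<lambda>f g. f \<in> L2 \<and> g \<in> L2 \<and> (AE x in lborel. f x = g x)"
proof (rule part_equivpI)
  show "\<exists>f :: 'a \<Rightarrow> real. f \<in> L2 \<and> f \<in> L2 \<and> (AE x in lborel. f x = f x)"
    using L2_zero by auto
  show "symp (\<lambda>f g. f \<in> L2 \<and> g \<in> L2 \<and> (AE x in (lborel :: 'a measure). f x = (g x :: real)))"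
    by (auto simp: symp_def elim: AE_mp)
  show "transp (\<lambda>f g. f \<in> L2 \<and> g \<in> L2 \<and> (AE x in (lborel :: 'a measure). f x = (g x :: real)))"
    by (auto simp: transp_def elim: AE_mp)
qed

lemma rep_l2_in [simp]: "rep_l2 X \<in> L2"
  using Quotient3_l2 unfolding Quotient3_def by metis

lemma abs_rep_l2 [simp]: "abs_l2 (rep_l2 X) = X"
  using Quotient3_l2 unfolding Quotient3_def by metis

lemma abs_l2_eq_iff:
  assumes "f \<in> L2" "g \<in> L2"
  shows "abs_l2 f = abs_l2 g \<longleftrightarrow> (AE x in lborel. f x = g x)"
  using Quotient3_rel[OF Quotient3_l2, of f g] assms by auto

lemma rep_abs_l2: "f \<in> L2 \<Longrightarrow> AE x in lborel. rep_l2 (abs_l2 f) x = f x"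
  using abs_l2_eq_iff[of "rep_l2 (abs_l2 f)" f] by simp

lemma rep_l2_measurable [measurable]: "rep_l2 X \<in> borel_measurable borel"
  using L2_realD(1)[OF rep_l2_in] .

instantiation l2 :: (euclidean_space) real_vector
begin

lift_definition zero_l2 :: "'a l2" is "\<lambda>x. 0" by (simp add: L2_zero)
lift_definition plus_l2 :: "'a l2 \<Rightarrow> 'a l2 \<Rightarrow> 'a l2" is "\<lambda>f g x. f x + g x"
  by (auto intro: L2_add)
lift_definition minus_l2 :: "'a l2 \<Rightarrow> 'a l2 \<Rightarrow> 'a l2" is "\<lambda>f g x. f x - g x"
  by (auto intro: L2_diff)
lift_definition uminus_l2 :: "'a l2 \<Rightarrow> 'a l2" is "\<lambda>f x. - f x"
  using L2_scale[of _ "-1"] by auto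
lift_definition scaleR_l2 :: "real \<Rightarrow> 'a l2 \<Rightarrow> 'a l2" is "\<lambda>c f x. c * f x"
  by (auto intro: L2_scale)

instance
proof
  fix X Y Z :: "'a l2" and a b :: real
  show "X + Y + Z = X + (Y + Z)" by transfer (auto intro!: L2_add simp: add.assoc)
  show "X + Y = Y + X" by transfer (auto intro!: L2_add simp: add.commute)
  show "0 + X = X" by transfer auto
  show "- X + X = 0" by transfer (simp add: L2_zero)
  show "X - Y = X + - Y" by transfer (simp add: L2_diff)
  show "a *\<^sub>R (X + Y) = a *\<^sub>R X + a *\<^sub>R Y"
    by transfer (auto intro!: L2_add L2_scale simp: algebra_simps)
  show "(a + b) *\<^sub>R X = a *\<^sub>R X + b *\<^sub>R X"
    by transfer (auto intro!: L2_add L2_scale simp: algebra_simps)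
  show "a *\<^sub>R b *\<^sub>R X = (a * b) *\<^sub>R X"
    by transfer (auto intro!: L2_scale simp: algebra_simps)
  show "1 *\<^sub>R X = X" by transfer auto
qed

end

instantiation l2 :: (euclidean_space) real_inner
begin

lift_definition inner_l2 :: "'a l2 \<Rightarrow> 'a l2 \<Rightarrow> real" is "\<lambda>f g. LINT x|lborel. f x * g x"
  by (rule integral_cong_AE) (auto intro!: borel_measurable_times dest: L2_realD(1))

definition norm_l2 :: "'a l2 \<Rightarrow> real" where "norm_l2 X = sqrt (inner X X)"
definition dist_l2 :: "'a l2 \<Rightarrow> 'a l2 \<Rightarrow> real" where "dist_l2 X Y = norm (X - Y)"
definition sgn_l2 :: "'a l2 \<Rightarrow> 'a l2" where "sgn_l2 X = X /\<^sub>R norm X"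
definition uniformity_l2 :: "('a l2 \<times> 'a l2) filter" where
  "uniformity_l2 = (INF e\<in>{0 <..}. principal {(x, y). dist x y < e})"
definition open_l2 :: "'a l2 set \<Rightarrow> bool" where
  "open_l2 U = (\<forall>x\<in>U. eventually (\<lambda>(x', y). x' = x \<longrightarrow> y \<in> U) uniformity)"

instance
proof
  fix X Y Z :: "'a l2" and a :: real
  show "dist X Y = norm (X - Y)" by (simp add: dist_l2_def)
  show "sgn X = X /\<^sub>R norm X" by (simp add: sgn_l2_def)
  show "uniformity = (INF e\<in>{0 <..}. principal {(x, y). dist (x::'a l2) y < e})"
    by (rule uniformity_l2_def)
  show "open U = (\<forall>x\<in>U. eventually (\<lambda>(x', y). x' = x \<longrightarrow> y \<in> U) uniformity)" for U :: "'a l2 set"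
    by (rule open_l2_def)
  show "inner X Y = inner Y X" by transfer (simp add: mult.commute)
  show "inner (X + Y) Z = inner X Z + inner Y Z"
    by transfer (simp add: distrib_right L2_mult_integrable)
  show "inner (a *\<^sub>R X) Y = a * inner X Y"
    by transfer (simp add: mult.assoc)
  show "0 \<le> inner X X" by transfer simp
  show "inner X X = 0 \<longleftrightarrow> X = 0"
  proof transfer
    fix f :: "'a \<Rightarrow> real" assume f: "f \<in> L2 \<and> f \<in> L2 \<and> (AE x in lborel. f x = f x)"
    then have "(LINT x|lborel. f x * f x) = 0 \<longleftrightarrow> (AE x in lborel. f x * f x = 0)"
      by (intro integral_nonneg_eq_0_iff_AE) (auto simp: L2_mult_integrable)
    then show "(LINT x|lborel. f x * f x) = 0 \<longleftrightarrow> f \<in> L2 \<and> (\<lambda>x. 0::real) \<in> L2 \<and> (AE x in lborel. f x = 0)"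
      using f L2_zero by auto
  qed
  show "norm X = sqrt (inner X X)" by (rule norm_l2_def)
qed

end

lemma inner_abs_l2: 
  "f \<in> L2 \<Longrightarrow> g \<in> L2 \<Longrightarrow> inner (abs_l2 f) (abs_l2 g) = (LINT x|lborel. f x * g x)"
  by (rule inner_l2.abs_eq) auto

lemma abs_l2_add: "f \<in> L2 \<Longrightarrow> g \<in> L2 \<Longrightarrow> abs_l2 (\<lambda>x. f x + g x) = abs_l2 f + abs_l2 g"
  by (rule plus_l2.abs_eq[symmetric]) auto

lemma abs_l2_diff: "f \<in> L2 \<Longrightarrow> g \<in> L2 \<Longrightarrow> abs_l2 (\<lambda>x. f x - g x) = abs_l2 f - abs_l2 g"
  by (rule minus_l2.abs_eq[symmetric]) auto

lemma abs_l2_scale: "f \<in> L2 \<Longrightarrow> abs_l2 (\<lambda>x. c * f x) = c *\<^sub>R abs_l2 f"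
  by (rule scaleR_l2.abs_eq[symmetric]) auto

lemma abs_l2_zero: "abs_l2 (\<lambda>x. 0) = 0"
  by (simp add: zero_l2_def)

lemma norm_abs_l2: "f \<in> L2 \<Longrightarrow> norm (abs_l2 f) = L2_norm f"
  by (simp add: norm_eq_sqrt_inner inner_abs_l2 L2_norm_def power2_eq_square)

lemma norm_abs_l2_sq: "f \<in> L2 \<Longrightarrow> (norm (abs_l2 f))\<^sup>2 = (LINT x|lborel. (f x)\<^sup>2)"
  by (simp add: power2_norm_eq_inner inner_abs_l2) (simp add: power2_eq_square)

lemma nn_integral_L2: "f \<in> L2 \<Longrightarrow> (\<integral>\<^sup>+x. ennreal ((f x)\<^sup>2) \<partial>lborel) = ennreal ((norm (abs_l2 f))\<^sup>2)"
  by (subst nn_integral_eq_integral) (auto simp: norm_abs_l2_sq L2_realD)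

lemma L2I_nn_integral:
  fixes f :: "'a::euclidean_space \<Rightarrow> real"
  assumes [measurable]: "f \<in> borel_measurable borel" and "(\<integral>\<^sup>+x. ennreal ((f x)\<^sup>2) \<partial>lborel) < \<infinity>"
  shows "f \<in> L2"
  by (rule L2_realI) (use assms in \<open>auto intro!: integrableI_nonneg\<close>)

lemma rep_l2_add: "AE x in lborel. rep_l2 (X + Y) x = rep_l2 X x + rep_l2 Y x"
  using rep_abs_l2[OF L2_add[OF rep_l2_in[of X] rep_l2_in[of Y]]]
  by (simp add: abs_l2_add)

lemma rep_l2_scale: "AE x in lborel. rep_l2 (c *\<^sub>R X) x = c * rep_l2 X x"
  using rep_abs_l2[OF L2_scale[OF rep_l2_in[of X], of c]]
  by (simp add: abs_l2_scale)

text \<open>Riesz-Fischer. The increments satisfy |d_k|^2 \<le> 4^(-k) in the mean, so the sum of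
  2^k |d_k|^2 has finite integral and is finite almost everywhere. There |d_k| is eventually below
  2^(-k/2), and the increments are absolutely summable.\<close>

lemma l2_fast_Cauchy_AE:
  fixes X :: "nat \<Rightarrow> 'a::euclidean_space l2"
  assumes X: "\<And>k. norm (X (Suc k) - X k) \<le> (1/2) ^ k"
  shows "AE x in lborel. convergent (\<lambda>k. rep_l2 (X k) x)"
proof -
  define d where "d k x = rep_l2 (X (Suc k)) x - rep_l2 (X k) x" for k x
  have dL: "d k \<in> L2" for k unfolding d_def by (intro L2_diff) auto
  have nd: "norm (abs_l2 (d k)) \<le> (1/2)^k" for k
    unfolding d_def using X by (simp add: abs_l2_diff)
  have [measurable]: "d k \<in> borel_measurable borel" for k using L2_realD(1)[OF dL] .
  have "(\<integral>\<^sup>+x. (\<Sum>k. ennreal (2^k * (d k x)\<^sup>2)) \<partial>lborel) = (\<Sum>k. \<integral>\<^sup>+x. ennreal (2^k * (d k x)\<^sup>2) \<partial>lborel)"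
    by (rule nn_integral_suminf) simp
  also have "\<dots> \<le> (\<Sum>k. ennreal ((1/2)^k))"
  proof (rule suminf_le)
    fix k
    have "(\<integral>\<^sup>+x. ennreal (2^k * (d k x)\<^sup>2) \<partial>lborel) = ennreal (2^k) * ennreal ((norm (abs_l2 (d k)))\<^sup>2)"
      by (simp add: ennreal_mult nn_integral_cmult nn_integral_L2[OF dL])
    also have "\<dots> \<le> ennreal (2^k) * ennreal (((1/2)^k)\<^sup>2)"
      using nd[of k] by (intro mult_left_mono ennreal_leI power_mono) auto
    also have "\<dots> = ennreal (2^k * ((1/2)^k)\<^sup>2)" by (rule ennreal_mult[symmetric]) auto
    also have "2^k * ((1/2)^k)\<^sup>2 = ((1/2)^k :: real)"
      by (simp add: power2_eq_square power_divide)
    finally show "(\<integral>\<^sup>+x. ennreal (2^k * (d k x)\<^sup>2) \<partial>lborel) \<le> ennreal ((1/2)^k)" .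
  qed auto
  also have "\<dots> = ennreal (\<Sum>k. (1/2)^k)"
    by (rule suminf_ennreal2) (auto simp: summable_geometric)
  finally have "(\<integral>\<^sup>+x. (\<Sum>k. ennreal (2^k * (d k x)\<^sup>2)) \<partial>lborel) \<noteq> \<infinity>"
    by (auto simp: top_unique)
  then have "AE x in lborel. (\<Sum>k. ennreal (2^k * (d k x)\<^sup>2)) \<noteq> \<infinity>"
    by (intro nn_integral_PInf_AE) auto
  then show ?thesis
  proof eventually_elim
    case (elim x)
    then have "summable (\<lambda>k. 2^k * (d k x)\<^sup>2)"
      by (intro summable_suminf_not_top) auto
    then have "(\<lambda>k. 2^k * (d k x)\<^sup>2) \<longlonglongrightarrow> 0" by (rule summable_LIMSEQ_zero)
    then have "\<forall>\<^sub>F k in sequentially. 2^k * (d k x)\<^sup>2 < 1"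
      by (rule order_tendstoD) simp
    then obtain K where K: "\<And>k. k \<ge> K \<Longrightarrow> 2^k * (d k x)\<^sup>2 < 1"
      by (auto simp: eventually_sequentially)
    have "\<bar>d k x\<bar> \<le> (sqrt (1/2))^k" if "k \<ge> K" for k
    proof -
      have "(d k x)\<^sup>2 \<le> (1/2)^k" using K[OF that] by (simp add: field_simps)
      then have "sqrt ((d k x)\<^sup>2) \<le> sqrt ((1/2)^k)" by (rule real_sqrt_le_mono)
      then show ?thesis unfolding real_sqrt_abs real_sqrt_power[of "1/2" k] .
    qed
    then have "\<exists>N. \<forall>k\<ge>N. norm (d k x) \<le> (sqrt (1/2))^k" by auto
    then have "summable (\<lambda>k. d k x)"
      by (rule summable_comparison_test) (rule summable_geometric, simp add: real_sqrt_divide)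
    then have "convergent (\<lambda>n. \<Sum>k<n. d k x)" by (simp add: summable_iff_convergent)
    moreover have "(\<Sum>k<n. d k x) = rep_l2 (X n) x - rep_l2 (X 0) x" for n
      unfolding d_def by (rule sum_lessThan_telescope)
    ultimately have "convergent (\<lambda>n. (rep_l2 (X n) x - rep_l2 (X 0) x) + rep_l2 (X 0) x)"
      by (intro convergent_add convergent_const) simp
    then show ?case by simp
  qed
qed

lemma l2_Cauchy_fast_subseq:
  fixes X :: "nat \<Rightarrow> 'a::real_normed_vector"
  assumes "Cauchy X"
  obtains r where "strict_mono r" "\<And>k. norm (X (r (Suc k)) - X (r k)) \<le> (1/2)^k"
proof -
  have "\<exists>M. \<forall>m\<ge>M. \<forall>n\<ge>M. norm (X m - X n) < (1/2)^k" for k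
    using assms by (intro CauchyD) auto
  then obtain M where M: "\<And>k m n. m \<ge> M k \<Longrightarrow> n \<ge> M k \<Longrightarrow> norm (X m - X n) < (1/2)^k" by metis
  \<comment> \<open>A sum of successors is strictly increasing and still dominates each
    \<open>M k\<close>.\<close>
  define r where "r k = (\<Sum>i\<le>k. Suc (M i))" for k
  have "strict_mono r" unfolding r_def by (rule strict_monoI_Suc) simp
  moreover have "M k \<le> r k" for k unfolding r_def by (induction k) auto
  moreover have "r k \<le> r (Suc k)" for k unfolding r_def by simp
  ultimately show ?thesis using M by (intro that[of r]) (meson less_imp_le order_trans)+
qed

text \<open>Fatou's lemma applied to the Cauchy estimate in the second index, with the first index
  fixed, bounds the distance to the pointwise limit.\<close>

lemma l2_AE_limit:
  fixes X :: "nat \<Rightarrow> 'a::euclidean_space l2"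
  assumes C: "Cauchy X" and f[measurable]: "f \<in> borel_measurable borel"
    and lim: "AE x in lborel. (\<lambda>k. rep_l2 (X k) x) \<longlonglongrightarrow> f x"
  shows "f \<in> L2 \<and> X \<longlonglongrightarrow> abs_l2 f"
proof -
  have *: "(\<integral>\<^sup>+x. ennreal ((rep_l2 (X n) x - f x)\<^sup>2) \<partial>lborel) \<le> ennreal (e\<^sup>2)"
    if "\<And>m. m \<ge> M \<Longrightarrow> norm (X n - X m) \<le> e" "e \<ge> 0" for n M e
  proof -
    have "(\<integral>\<^sup>+x. ennreal ((rep_l2 (X n) x - f x)\<^sup>2) \<partial>lborel) 
      = (\<integral>\<^sup>+x. liminf (\<lambda>m. ennreal ((rep_l2 (X n) x - rep_l2 (X m) x)\<^sup>2)) \<partial>lborel)"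
    proof (rule nn_integral_cong_AE, use lim in eventually_elim)
      case (elim x)
      then have "(\<lambda>m. ennreal ((rep_l2 (X n) x - rep_l2 (X m) x)\<^sup>2)) \<longlonglongrightarrow> ennreal ((rep_l2 (X n) x - f x)\<^sup>2)"
        by (intro tendsto_intros)
      then show ?case by (intro lim_imp_Liminf[symmetric]) auto
    qed
    also have "\<dots> \<le> liminf (\<lambda>m. \<integral>\<^sup>+x. ennreal ((rep_l2 (X n) x - rep_l2 (X m) x)\<^sup>2) \<partial>lborel)"
      by (rule nn_integral_liminf) simp
    also have "\<dots> = liminf (\<lambda>m. ennreal ((norm (X n - X m))\<^sup>2))"
      by (subst nn_integral_L2) (auto intro: L2_diff simp: abs_l2_diff)
    also have "\<dots> \<le> liminf (\<lambda>m. ennreal (e\<^sup>2))"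
      using that by (intro Liminf_mono eventually_sequentiallyI[of M]) (auto intro!: ennreal_leI power_mono)
    finally show ?thesis by (simp add: Liminf_const)
  qed
  have C': "\<exists>M. \<forall>n\<ge>M. \<forall>m\<ge>M. norm (X n - X m) < e" if "e > 0" for e
    using CauchyD[OF C that] by simp
  obtain M where M: "\<And>n m. n \<ge> M \<Longrightarrow> m \<ge> M \<Longrightarrow> norm (X n - X m) < 1"
    using C'[of 1] by auto
  have "(\<lambda>x. rep_l2 (X M) x - f x) \<in> L2"
    using *[of M M 1] M[of M] by (intro L2I_nn_integral) (auto simp: less_imp_le less_top[symmetric] top_unique)
  then have fL: "f \<in> L2" using L2_diff[OF rep_l2_in[of "X M"], of "\<lambda>x. rep_l2 (X M) x - f x"] by simp
  moreover have "X \<longlonglongrightarrow> abs_l2 f"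
  proof (rule LIMSEQ_I)
    fix e :: real assume "e > 0"
    then obtain M where M: "\<And>n m. n \<ge> M \<Longrightarrow> m \<ge> M \<Longrightarrow> norm (X n - X m) < e/2"
      using C'[of "e/2"] by auto
    have "norm (X n - abs_l2 f) < e" if "n \<ge> M" for n
    proof -
      have "ennreal ((norm (X n - abs_l2 f))\<^sup>2) \<le> ennreal ((e/2)\<^sup>2)"
      proof -
        have "(\<integral>\<^sup>+x. ennreal ((rep_l2 (X n) x - f x)\<^sup>2) \<partial>lborel) \<le> ennreal ((e/2)\<^sup>2)"
          using \<open>e > 0\<close> by (intro *[of M] less_imp_le[OF M[OF that]]) auto
        then show ?thesis
          by (subst (asm) nn_integral_L2) (auto intro: L2_diff fL simp: abs_l2_diff fL)
      qed
      then have "norm (X n - abs_l2 f) \<le> e/2" using \<open>e > 0\<close>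
        by (simp add: power2_le_iff_abs_le)
      then show ?thesis using \<open>e > 0\<close> by simp
    qed
    then show "\<exists>no. \<forall>n\<ge>no. norm (X n - abs_l2 f) < e" by blast
  qed
  ultimately show ?thesis by simp
qed

lemma l2_fast_limit:
  fixes X :: "nat \<Rightarrow> 'a::euclidean_space l2"
  assumes C: "Cauchy X" 
  obtains f r where "f \<in> L2" "strict_mono r" "X \<longlonglongrightarrow> abs_l2 f" 
    "AE x in lborel. (\<lambda>k. rep_l2 (X (r k)) x) \<longlonglongrightarrow> f x"
proof -
  obtain r where r: "strict_mono r" "\<And>k. norm (X (r (Suc k)) - X (r k)) \<le> (1/2)^k"
    using l2_Cauchy_fast_subseq[OF C] by blast
  define f where "f x = lim (\<lambda>k. rep_l2 (X (r k)) x)" for x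
  have [measurable]: "f \<in> borel_measurable borel" unfolding f_def by measurable
  have lim: "AE x in lborel. (\<lambda>k. rep_l2 (X (r k)) x) \<longlonglongrightarrow> f x"
    using l2_fast_Cauchy_AE[of "\<lambda>k. X (r k)", OF r(2)] unfolding f_def
    by eventually_elim (simp add: convergent_LIMSEQ_iff)
  have "Cauchy (X \<circ> r)" by (rule Cauchy_subseq_Cauchy[OF C r(1)])
  then have "f \<in> L2 \<and> (X \<circ> r) \<longlonglongrightarrow> abs_l2 f"
    using lim by (intro l2_AE_limit) (auto simp: o_def)
  moreover have "X \<longlonglongrightarrow> abs_l2 f"
    using Cauchy_converges_subseq[OF C r(1)] calculation by (auto simp: o_def)
  ultimately show ?thesis using that r(1) lim by blast
qed

instance l2 :: (euclidean_space) complete_space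
proof
  fix X :: "nat \<Rightarrow> 'a l2" assume "Cauchy X"
  then show "convergent X" using l2_fast_limit[of X] by (metis convergentI)
qed

text \<open>Serves to identify an abstract limit in \<open>l2\<close> with a concrete function that
  is known as a pointwise limit.\<close>

lemma l2_limit_AE_unique:
  fixes X :: "nat \<Rightarrow> 'a::euclidean_space l2"
  assumes X: "X \<longlonglongrightarrow> Y" and f: "f \<in> borel_measurable borel"
    and lim: "AE x in lborel. (\<lambda>k. rep_l2 (X k) x) \<longlonglongrightarrow> f x"
  shows "f \<in> L2 \<and> Y = abs_l2 f"
  using l2_AE_limit[OF LIMSEQ_imp_Cauchy[OF X] f lim] LIMSEQ_unique[OF X] by blast

section \<open>Affine changes of variables, and continuity of translation in L^1\<close>

lemma lborel_affine_transfer: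
  fixes f :: "'a::euclidean_space \<Rightarrow> 'b::{banach, second_countable_topology}"
  assumes [measurable]: "f \<in> borel_measurable borel" and c: "c \<noteq> 0"
  shows "integrable lborel (\<lambda>x. f (t + c *\<^sub>R x)) \<longleftrightarrow> integrable lborel f"
    and "(LINT x|lborel. f (t + c *\<^sub>R x)) = (LINT x|lborel. f x) /\<^sub>R \<bar>c\<bar> ^ DIM('a)"
proof -
  let ?D = "distr lborel borel (\<lambda>x. t + c *\<^sub>R x)"
  have eq: "lborel = density ?D (\<lambda>_. ennreal (\<bar>c\<bar> ^ DIM('a)))"
    using lborel_affine[OF c, of t] .
  have "integrable lborel f \<longleftrightarrow> integrable (density ?D (\<lambda>_. ennreal (\<bar>c\<bar> ^ DIM('a)))) f"
    by (subst eq) simp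
  also have "\<dots> \<longleftrightarrow> integrable lborel (\<lambda>x. f (t + c *\<^sub>R x))"
    using c integrable_scaleR_right[of "inverse (\<bar>c\<bar> ^ DIM('a))" lborel "\<lambda>x. \<bar>c\<bar> ^ DIM('a) *\<^sub>R f (t + c *\<^sub>R x)"]
    by (subst integrable_density) (auto simp: integrable_distr_eq)
  finally show "integrable lborel (\<lambda>x. f (t + c *\<^sub>R x)) \<longleftrightarrow> integrable lborel f" by simp
  have "integral\<^sup>L lborel f = integral\<^sup>L (density ?D (\<lambda>_. ennreal (\<bar>c\<bar> ^ DIM('a)))) f"
    by (subst eq) simp
  also have "\<dots> = \<bar>c\<bar> ^ DIM('a) *\<^sub>R (LINT x|lborel. f (t + c *\<^sub>R x))"
    using c by (subst integral_density) (auto simp: integral_distr)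
  finally show "(LINT x|lborel. f (t + c *\<^sub>R x)) = (LINT x|lborel. f x) /\<^sub>R \<bar>c\<bar> ^ DIM('a)"
    using c by simp
qed

lemma lborel_translate:
  fixes f :: "'a::euclidean_space \<Rightarrow> 'b::{banach, second_countable_topology}"
  assumes "f \<in> borel_measurable borel"
  shows "integrable lborel (\<lambda>x. f (x + t)) \<longleftrightarrow> integrable lborel f"
    and "(LINT x|lborel. f (x + t)) = (LINT x|lborel. f x)"
  using lborel_affine_transfer[OF assms, of 1 t] by (simp_all add: add.commute)

lemma AE_lborel_affine:
  fixes P :: "'a::euclidean_space \<Rightarrow> bool"
  assumes c: "c \<noteq> 0" and P: "AE x in lborel. P x"
  shows "AE x in lborel. P (t + c *\<^sub>R x)"
proof -
  from P obtain N where N: "{x. \<not> P x} \<subseteq> N" "N \<in> sets borel" "emeasure lborel N = 0"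
    by (auto elim!: AE_E)
  have "AE x in lborel. x \<notin> N" using N by (intro AE_not_in) (auto simp: null_sets_def)
  then have "AE x in density (distr lborel borel (\<lambda>x. t + c *\<^sub>R x)) (\<lambda>_. ennreal (\<bar>c\<bar> ^ DIM('a))). x \<notin> N"
    by (subst lborel_affine[OF c, of t, symmetric])
  then have "AE x in lborel. t + c *\<^sub>R x \<notin> N"
    using N(2) c by (subst (asm) AE_density) (auto simp: AE_distr_iff)
  then show ?thesis by eventually_elim (use N(1) in blast)
qed

text \<open>Settled for indicators of open sets, then for measurable sets by outer regularity, and
  for all integrable functions by linear combinations and limits. The error of each approximation is
  controlled because translation preserves the L^1 norm.\<close>

lemma L1_translation_continuous:
  fixes f :: "'a::euclidean_space \<Rightarrow> real"
  assumes f: "integrable lborel f" and z: "z \<longlonglongrightarrow> 0"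
  shows "(\<lambda>k. LINT x|lborel. \<bar>f (x + z k) - f x\<bar>) \<longlonglongrightarrow> 0"
proof -
  define T where "T f k = (LINT x|lborel. \<bar>f (x + z k) - f x\<bar>)" for f :: "'a \<Rightarrow> real" and k
  have T0: "T f k \<ge> 0" for f k unfolding T_def by simp
  have int: "integrable lborel (\<lambda>x. f (x + z k))" if "integrable lborel f" for f :: "'a \<Rightarrow> real" and k
    using lborel_translate(1)[of f "z k"] that by auto
  have T_add: "T (\<lambda>x. f x + g x) k \<le> T f k + T g k" 
    if "integrable lborel f" "integrable lborel g" for f g k
  proof -
    have "T (\<lambda>x. f x + g x) k \<le> (LINT x|lborel. \<bar>f (x + z k) - f x\<bar> + \<bar>g (x + z k) - g x\<bar>)"
      unfolding T_def using that int[OF that(1), of k] int[OF that(2), of k] 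
      by (intro integral_mono integrable_abs Bochner_Integration.integrable_add Bochner_Integration.integrable_diff) auto
    also have "\<dots> = T f k + T g k"
      unfolding T_def using that int[OF that(1), of k] int[OF that(2), of k]
      by (intro Bochner_Integration.integral_add integrable_abs Bochner_Integration.integrable_diff)
    finally show ?thesis .
  qed
  have T_le: "T f k \<le> 2 * (LINT x|lborel. \<bar>f x\<bar>)" if f: "integrable lborel f" for f k
  proof -
    have "T f k \<le> (LINT x|lborel. \<bar>f (x + z k)\<bar> + \<bar>f x\<bar>)"
      unfolding T_def using f int[OF f] by (intro integral_mono) auto
    also have "\<dots> = (LINT x|lborel. \<bar>f (x + z k)\<bar>) + (LINT x|lborel. \<bar>f x\<bar>)"
      using f int[OF f] by simp
    also have "(LINT x|lborel. \<bar>f (x + z k)\<bar>) = (LINT x|lborel. \<bar>f x\<bar>)"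
      using lborel_translate(2)[of "\<lambda>x. \<bar>f x\<bar>"] f by auto
    finally show ?thesis by simp
  qed
  have approx: "T f \<longlonglongrightarrow> 0" 
    if f: "integrable lborel f" and *: "\<And>e. e > 0 \<Longrightarrow> \<exists>g. integrable lborel g \<and> T g \<longlonglongrightarrow> 0 \<and> (LINT x|lborel. \<bar>f x - g x\<bar>) < e" for f
  proof (rule LIMSEQ_I)
    fix e :: real assume "e > 0"
    then obtain g where g: "integrable lborel g" "T g \<longlonglongrightarrow> 0" "(LINT x|lborel. \<bar>f x - g x\<bar>) < e/4"
      using *[of "e/4"] by auto
    then obtain K where K: "\<And>k. k \<ge> K \<Longrightarrow> T g k < e/2" 
      using LIMSEQ_D[OF g(2), of "e/2"] \<open>e > 0\<close> T0 by force
    have "norm (T f k - 0) < e" if "k \<ge> K" for k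
    proof -
      have "T f k \<le> T (\<lambda>x. f x - g x) k + T g k"
        using T_add[of "\<lambda>x. f x - g x" g k] f g(1) by simp
      also have "\<dots> < 2 * (e/4) + e/2"
        using T_le[of "\<lambda>x. f x - g x" k] f g K[OF that] by simp
      finally show ?thesis using T0[of f k] by simp
    qed
    then show "\<exists>no. \<forall>n\<ge>no. norm (T f n - 0) < e" by blast
  qed
  have ind: "integrable lborel (\<lambda>x. indicator A x *\<^sub>R c)" 
    if "A \<in> sets borel" "emeasure lborel A < \<infinity>" for A :: "'a set" and c :: real
    using that by simp
  have T_open: "T (\<lambda>x. indicator U x *\<^sub>R c) \<longlonglongrightarrow> 0" 
    if U: "open U" and fin: "emeasure lborel U < \<infinity>" for U :: "'a set" and c :: real
  proof -
    have [measurable]: "U \<in> sets borel" using U by simp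
    have iU: "integrable lborel (indicator U :: 'a \<Rightarrow> real)" using fin by simp
    have iUz: "integrable lborel (\<lambda>x. indicator U (x + z k) :: real)" for k
      using int[OF iU] .
    have iP: "integrable lborel (\<lambda>x. indicator U (x + z k) * indicator U x :: real)" for k
      by (rule Bochner_Integration.integrable_bound[OF iU]) (auto simp: indicator_def)
    \<comment> \<open>The shifted indicator alone need not converge on the boundary of U. Its
      product with the unshifted one does, since points of an open set stay inside under small
      shifts. The L^1 distance of the two indicators is twice the measure of U minus twice the
      integral of this product.\<close>
    have "(\<lambda>k. LINT x|lborel. (indicator U (x + z k) * indicator U x :: real)) \<longlonglongrightarrow> (LINT x|lborel. indicator U x)"
    proof (rule integral_dominated_convergence[where w = "indicator U"])
      show "AE x in lborel. (\<lambda>k. indicator U (x + z k) * indicator U x :: real) \<longlonglongrightarrow> indicator U x"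
      proof (rule AE_I2)
        fix x :: 'a
        have "(\<lambda>k. x + z k) \<longlonglongrightarrow> x + 0" by (intro tendsto_intros z)
        then have "\<forall>\<^sub>F k in sequentially. x \<in> U \<longrightarrow> x + z k \<in> U"
          using U topological_tendstoD[of "\<lambda>k. x + z k" x sequentially U] by (cases "x \<in> U") auto
        then have "\<forall>\<^sub>F k in sequentially. (indicator U (x + z k) * indicator U x :: real) = indicator U x"
          by eventually_elim (auto simp: indicator_def)
        then show "(\<lambda>k. indicator U (x + z k) * indicator U x :: real) \<longlonglongrightarrow> indicator U x"
          by (rule tendsto_eventually)
      qed
    qed (use iU in \<open>auto simp: indicator_def\<close>)
    then have "(\<lambda>k. \<bar>c\<bar> * (2 * (LINT x|lborel. indicator U x) - 2 * (LINT x|lborel. (indicator U (x + z k) * indicator U x :: real))))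
       \<longlonglongrightarrow> \<bar>c\<bar> * (2 * (LINT x|lborel. indicator U x) - 2 * (LINT x|lborel. indicator U x))"
      by (intro tendsto_intros)
    moreover have Teq: "T (\<lambda>x. indicator U x *\<^sub>R c) k = \<bar>c\<bar> * (2 * (LINT x|lborel. indicator U x) - 2 * (LINT x|lborel. (indicator U (x + z k) * indicator U x :: real)))" for k
    proof -
      have "T (\<lambda>x. indicator U x *\<^sub>R c) k = (LINT x|lborel. \<bar>c\<bar> * (indicator U (x + z k) + indicator U x - 2 * (indicator U (x + z k) * indicator U x)))"
        unfolding T_def by (intro Bochner_Integration.integral_cong) (auto simp: indicator_def)
      also have "\<dots> = \<bar>c\<bar> * ((LINT x|lborel. indicator U (x + z k)) + (LINT x|lborel. indicator U x) - 2 * (LINT x|lborel. (indicator U (x + z k) * indicator U x :: real)))"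
        using iU iUz[of k] iP[of k] by simp
      also have "(LINT x|lborel. indicator U (x + z k) :: real) = (LINT x|lborel. indicator U x)"
        by (rule lborel_translate(2)) simp
      finally show ?thesis by simp
    qed
    ultimately have "(\<lambda>k. T (\<lambda>x. indicator U x *\<^sub>R c) k) \<longlonglongrightarrow> 0" unfolding Teq by simp
    then show ?thesis .
  qed
  from f have "T f \<longlonglongrightarrow> 0"
  proof (induction rule: integrable_induct)
    case (base A c)
    then have [measurable]: "A \<in> sets borel" by simp
    show ?case
    proof (rule approx)
      show "integrable lborel (\<lambda>x. indicator A x *\<^sub>R c)" using base by simp
      fix e :: real assume "e > 0"
      define d where "d = e / (\<bar>c\<bar> + 1)"
      have "d > 0" using \<open>e > 0\<close> by (simp add: d_def)
      obtain U where U: "open U" "A \<subseteq> U" "emeasure lborel (U - A) < d"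
        using outer_regular_lborel[of A d] \<open>d > 0\<close> by auto
      have [measurable]: "U \<in> sets borel" using U by simp
      have "emeasure lborel U = emeasure lborel A + emeasure lborel (U - A)"
        using U by (subst plus_emeasure) (auto intro: arg_cong2[where f=emeasure])
      also have "\<dots> < \<infinity>" using base(2) less_trans[OF U(3), of \<infinity>] by simp
      finally have fU: "emeasure lborel U < \<infinity>" .
      have "(LINT x|lborel. \<bar>indicator A x *\<^sub>R c - indicator U x *\<^sub>R c\<bar>) = (LINT x|lborel. \<bar>c\<bar> * indicator (U - A) x)"
        using U(2) by (intro Bochner_Integration.integral_cong) (auto simp: indicator_def)
      also have "\<dots> = \<bar>c\<bar> * measure lborel (U - A)" using U(3) by (simp add: top.not_eq_extremum)
      also have "\<dots> \<le> \<bar>c\<bar> * d"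
      proof (intro mult_left_mono)
        show "measure lborel (U - A) \<le> d" using U(3) \<open>d > 0\<close> 
          by (simp add: measure_def enn2real_leI less_imp_le)
      qed simp
      also have "\<dots> < e" using \<open>e > 0\<close> by (simp add: d_def field_simps)
      finally show "\<exists>g. integrable lborel g \<and> T g \<longlonglongrightarrow> 0 \<and> (LINT x|lborel. \<bar>indicator A x *\<^sub>R c - g x\<bar>) < e"
        using T_open[OF U(1) fU, of c] ind[of U c] fU by (intro exI[of _ "\<lambda>x. indicator U x *\<^sub>R c"]) auto
    qed
  next
    case (add f g)
    have "(\<lambda>k. T f k + T g k) \<longlonglongrightarrow> 0 + 0" using add by (intro tendsto_add) auto
    then show ?case using T_add[OF add(1,2)] T0
      by (intro tendsto_sandwich[of "\<lambda>_. 0" "T (\<lambda>x. f x + g x)" sequentially "\<lambda>k. T f k + T g k" 0]) auto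
  next
    case (lim f s)
    show ?case
    proof (rule approx)
      fix e :: real assume "e > 0"
      have [measurable]: "f \<in> borel_measurable borel" "\<And>i. s i \<in> borel_measurable borel"
        using lim.hyps(1,4) by auto
      have "(\<lambda>i. LINT x|lborel. \<bar>f x - s i x\<bar>) \<longlonglongrightarrow> (LINT x|(lborel :: 'a measure). 0 :: real)"
      proof (rule integral_dominated_convergence[where w = "\<lambda>x. 3 * \<bar>f x\<bar>"])
        show "AE x in lborel. (\<lambda>i. \<bar>f x - s i x\<bar>) \<longlonglongrightarrow> 0"
        proof (rule AE_I2)
          fix x
          have "(\<lambda>i. \<bar>f x - s i x\<bar>) \<longlonglongrightarrow> \<bar>f x - f x\<bar>" by (intro tendsto_intros lim.hyps(2)) simp
          then show "(\<lambda>i. \<bar>f x - s i x\<bar>) \<longlonglongrightarrow> 0" by simp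
        qed
        show "AE x in lborel. norm \<bar>f x - s i x\<bar> \<le> 3 * \<bar>f x\<bar>" for i
        proof (rule AE_I2)
          fix x show "norm \<bar>f x - s i x\<bar> \<le> 3 * \<bar>f x\<bar>" using lim.hyps(3)[of x i] by simp
        qed
      qed (use lim.hyps(4) in auto)
      then have "\<forall>\<^sub>F i in sequentially. (LINT x|lborel. \<bar>f x - s i x\<bar>) < e"
        using \<open>e > 0\<close> by (intro order_tendstoD(2)) auto
      then obtain i where "(LINT x|lborel. \<bar>f x - s i x\<bar>) < e" 
        by (auto simp: eventually_sequentially)
      then show "\<exists>g. integrable lborel g \<and> T g \<longlonglongrightarrow> 0 \<and> (LINT x|lborel. \<bar>f x - g x\<bar>) < e"
        using lim by blast
    qed fact
  qed
  then show ?thesis unfolding T_def .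
qed

section \<open>Gaussian integrals in several variables\<close>

lemma integral_prod_Basis:
  fixes f :: "'a::euclidean_space \<Rightarrow> real \<Rightarrow> complex"
  assumes "\<And>b. b \<in> Basis \<Longrightarrow> integrable lborel (f b)"
  shows "integrable lborel (\<lambda>x::'a. \<Prod>b\<in>Basis. f b (x \<bullet> b))"
    and "(LINT x|lborel. (\<Prod>b\<in>(Basis::'a set). f b (x \<bullet> b))) = (\<Prod>b\<in>Basis. LINT t|lborel. f b t)"
proof -
  interpret product_sigma_finite "\<lambda>_::'a. lborel :: real measure" ..
  have [measurable]: "f b \<in> borel_measurable borel" if "b \<in> Basis" for b
    using assms[OF that] by auto
  have T[measurable]: "(\<lambda>g. \<Sum>b\<in>Basis. g b *\<^sub>R b) \<in> (\<Pi>\<^sub>M b\<in>Basis. lborel) \<rightarrow>\<^sub>M (borel :: 'a measure)"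
    by simp
  have m[measurable]: "(\<lambda>x::'a. \<Prod>b\<in>Basis. f b (x \<bullet> b)) \<in> borel_measurable borel"
    by simp
  have eq: "(\<Prod>b\<in>Basis. f b ((\<Sum>b\<in>Basis. g b *\<^sub>R b) \<bullet> b)) = (\<Prod>b\<in>Basis. f b (g b))" for g :: "'a \<Rightarrow> real"
    by (intro prod.cong) auto
  show "integrable lborel (\<lambda>x::'a. \<Prod>b\<in>Basis. f b (x \<bullet> b))"
    using product_integrable_prod[of "Basis :: 'a set" f] assms
    by (subst lborel_eq) (simp add: integrable_distr_eq eq)
  show "(LINT x|lborel. (\<Prod>b\<in>(Basis::'a set). f b (x \<bullet> b))) = (\<Prod>b\<in>Basis. LINT t|lborel. f b t)"
    using product_integral_prod[of "Basis :: 'a set" f] assms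
    by (subst lborel_eq) (simp add: integral_distr eq)
qed

lemma borel_measurable_cis [measurable]: "cis \<in> borel_measurable borel"
  by (rule borel_measurable_continuous_onI, rule continuous_on_cis, rule continuous_on_id)

text \<open>Density and character both factor over the coordinates, and each factor is the
  characteristic function of the standard normal distribution.\<close>

lemma std_gaussian_Basis:
  fixes z :: "'a::euclidean_space"
  defines "\<gamma> \<equiv> \<lambda>x::'a. exp (- (norm x)\<^sup>2 / 2) / sqrt (2 * pi) ^ DIM('a)"
  shows "integrable lborel (\<lambda>x. complex_of_real (\<gamma> x) * cis (z \<bullet> x))"
    and "(LINT x|lborel. complex_of_real (\<gamma> x) * cis (z \<bullet> x)) = complex_of_real (exp (- (norm z)\<^sup>2 / 2))"
proof -
  define f where "f b t = complex_of_real (std_normal_density t) * cis ((z \<bullet> b) * t)" for b :: 'a and t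
  have nrm: "(norm x)\<^sup>2 = (\<Sum>b\<in>Basis. (x \<bullet> b)\<^sup>2)" for x :: 'a
    unfolding power2_norm_eq_inner by (subst euclidean_inner) (simp add: power2_eq_square)
  have cis_sum: "cis (\<Sum>b\<in>B. g b) = (\<Prod>b\<in>B. cis (g b))" if "finite B" for B and g :: "'a \<Rightarrow> real"
    using that by (induction B) (auto simp flip: cis_mult)
  have eq: "complex_of_real (\<gamma> x) * cis (z \<bullet> x) = (\<Prod>b\<in>Basis. f b (x \<bullet> b))" for x
  proof -
    have "\<gamma> x = (\<Prod>b\<in>(Basis::'a set). std_normal_density (x \<bullet> b))"
      unfolding \<gamma>_def std_normal_density_def
      by (simp add: nrm prod_dividef exp_sum[symmetric] sum_negf sum_divide_distrib prod_constant power_divide)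
    moreover have "cis (z \<bullet> x) = (\<Prod>b\<in>(Basis::'a set). cis ((z \<bullet> b) * (x \<bullet> b)))"
      by (subst euclidean_inner) (simp add: cis_sum)
    ultimately show ?thesis by (simp add: f_def prod.distrib)
  qed
  have int: "integrable lborel (f b)" for b
  proof (rule Bochner_Integration.integrable_bound)
    show "integrable lborel std_normal_density"
      using integrable_std_normal_distribution_moment[of 0] integrable_std_normal_moment[of 0] by simp
    show "f b \<in> borel_measurable lborel" unfolding f_def by simp
  qed (auto simp: f_def norm_mult)
  have val: "(LINT t|lborel. f b t) = complex_of_real (exp (- (z \<bullet> b)\<^sup>2 / 2))" for b
  proof -
    have "char std_normal_distribution (z \<bullet> b) = complex_of_real (exp (- (z \<bullet> b)\<^sup>2 / 2))"
      by (simp add: char_std_normal_distribution)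
    moreover have "cis ((z \<bullet> b) * t) = exp (\<i> * (complex_of_real (z \<bullet> b) * complex_of_real t))" for t
      by (subst cis_conv_exp) (simp only: of_real_mult)
    then have "char std_normal_distribution (z \<bullet> b) = (LINT t|lborel. f b t)"
      unfolding char_def f_def
      by (subst integral_density) (simp_all add: scaleR_conv_of_real)
    ultimately show ?thesis by simp
  qed
  show "integrable lborel (\<lambda>x. complex_of_real (\<gamma> x) * cis (z \<bullet> x))"
    unfolding eq by (rule integral_prod_Basis(1)) (rule int)
  show "(LINT x|lborel. complex_of_real (\<gamma> x) * cis (z \<bullet> x)) = complex_of_real (exp (- (norm z)\<^sup>2 / 2))"
  proof -
    have "(\<Prod>b\<in>(Basis::'a set). complex_of_real (exp (- (z \<bullet> b)\<^sup>2 / 2))) = complex_of_real (exp (- (norm z)\<^sup>2 / 2))"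
      by (simp only: of_real_prod[symmetric] exp_sum[OF finite_Basis, symmetric] nrm sum_negf sum_divide_distrib[symmetric])
    then show ?thesis
      unfolding eq using int by (subst integral_prod_Basis(2)) (simp_all only: val)
  qed
qed

section \<open>The heat kernel and the Hartley transform\<close>

text \<open>The time scale is that of the generator \<Delta>, not \<Delta>/2: the Fourier transform
  is exp (- t |\<xi>|^2) for t > 0.\<close>

definition heat_kernel :: "real \<Rightarrow> 'a::euclidean_space \<Rightarrow> real" where
  "heat_kernel t x = exp (- (norm x)\<^sup>2 / (4 * t)) / sqrt (4 * pi * t) ^ DIM('a)"

lemma heat_kernel_measurable [measurable]:
  "(\<lambda>p. heat_kernel (fst p) (snd p)) \<in> borel_measurable (borel \<Otimes>\<^sub>M borel)"
  "heat_kernel t \<in> borel_measurable borel"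
  unfolding heat_kernel_def[abs_def] by measurable

lemma heat_kernel_nonneg: "t \<ge> 0 \<Longrightarrow> heat_kernel t x \<ge> 0"
  unfolding heat_kernel_def by simp

lemma heat_kernel_fourier:
  fixes z :: "'a::euclidean_space"
  assumes t: "t > 0"
  shows "integrable lborel (heat_kernel t :: 'a \<Rightarrow> real)"
    and "(LINT x|lborel. heat_kernel t x * cos (z \<bullet> x)) = exp (- t * (norm z)\<^sup>2)"
    and "(LINT x|lborel. heat_kernel t x * sin (z \<bullet> x)) = 0"
proof -
  \<comment> \<open>The heat kernel at time t is a Gaussian of variance 2t in each coordinate, so
    the dilation by sqrt (2t) reduces it to the standard one.\<close>
  define c where "c = sqrt (2 * t)"
  have c: "c > 0" "c\<^sup>2 = 2 * t" using t by (simp_all add: c_def)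
  define \<gamma> where "\<gamma> = (\<lambda>x::'a. exp (- (norm x)\<^sup>2 / 2) / sqrt (2 * pi) ^ DIM('a))"
  have h: "heat_kernel t (0 + c *\<^sub>R y) = \<gamma> y / c ^ DIM('a)" for y :: 'a
  proof -
    have "sqrt (4 * pi * t) = sqrt (2 * pi) * c"
      unfolding c_def by (simp add: real_sqrt_mult[symmetric])
    moreover have "(norm (c *\<^sub>R y))\<^sup>2 / (4 * t) = (norm y)\<^sup>2 / 2"
      using t c by (simp add: power_mult_distrib)
    ultimately show ?thesis
      unfolding heat_kernel_def \<gamma>_def by (simp add: power_mult_distrib divide_simps)
  qed
  define F where "F w x = complex_of_real (heat_kernel t x) * cis (w \<bullet> x)" for w x :: 'a
  have [measurable]: "F w \<in> borel_measurable borel" for w unfolding F_def by measurable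
  have eq: "F w (0 + c *\<^sub>R y) = complex_of_real (\<gamma> y) * cis ((c *\<^sub>R w) \<bullet> y) / complex_of_real (c ^ DIM('a))" for w y
    unfolding F_def h by (simp add: inner_simps mult_ac)
  have int: "integrable lborel (F w)" for w
  proof -
    have "integrable lborel (\<lambda>y. F w (0 + c *\<^sub>R y))"
      unfolding eq using std_gaussian_Basis(1)[of "c *\<^sub>R w"] 
      by (intro integrable_divide) (simp add: \<gamma>_def)
    then show ?thesis
      by (rule lborel_affine_transfer(1)[THEN iffD1, rotated 2]) (use c in auto)
  qed
  have val: "(LINT x|lborel. F w x) = complex_of_real (exp (- t * (norm w)\<^sup>2))" for w
  proof -
    have "(LINT x|lborel. F w x) /\<^sub>R \<bar>c\<bar> ^ DIM('a) = (LINT y|lborel. F w (0 + c *\<^sub>R y))"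
      using c by (subst lborel_affine_transfer(2)) auto
    also have "\<dots> = complex_of_real (exp (- (norm (c *\<^sub>R w))\<^sup>2 / 2)) / complex_of_real (c ^ DIM('a))"
    proof -
      have "(LINT x|lborel. complex_of_real (\<gamma> x) * cis ((c *\<^sub>R w) \<bullet> x)) = complex_of_real (exp (- (norm (c *\<^sub>R w))\<^sup>2 / 2))"
        unfolding \<gamma>_def by (rule std_gaussian_Basis(2))
      then show ?thesis unfolding eq by (simp only: integral_divide_zero)
    qed
    also have "- (norm (c *\<^sub>R w))\<^sup>2 / 2 = - t * (norm w)\<^sup>2"
      using c by (simp add: power_mult_distrib)
    finally show ?thesis using c by (simp add: scaleR_conv_of_real field_simps)
  qed
  have "integrable lborel (\<lambda>x. Re (F 0 x))" using int by simp
  then show "integrable lborel (heat_kernel t :: 'a \<Rightarrow> real)" by (simp add: F_def)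
  have "(LINT x|lborel. heat_kernel t x * cos (z \<bullet> x)) = (LINT x|lborel. Re (F z x))"
    by (simp add: F_def)
  also have "\<dots> = exp (- t * (norm z)\<^sup>2)" using int val by simp
  finally show "(LINT x|lborel. heat_kernel t x * cos (z \<bullet> x)) = exp (- t * (norm z)\<^sup>2)" .
  have "(LINT x|lborel. heat_kernel t x * sin (z \<bullet> x)) = (LINT x|lborel. Im (F z x))"
    by (simp add: F_def)
  also have "\<dots> = 0" using int val by simp
  finally show "(LINT x|lborel. heat_kernel t x * sin (z \<bullet> x)) = 0" .
qed

lemma heat_kernel_integral: "t > 0 \<Longrightarrow> (LINT x|lborel. heat_kernel t (x::'a::euclidean_space)) = 1"
  using heat_kernel_fourier(2)[of t "0::'a"] by simp

text \<open>A Gaussian on the frequency side is a multiple of the heat kernel at the dual time 1 /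
  (4t), so its transform can be read off from \<open>heat_kernel_fourier\<close>.\<close>

lemma exp_norm_sq_conv_heat:
  fixes x :: "'a::euclidean_space"
  assumes t: "t > 0"
  shows "exp (- t * (norm x)\<^sup>2) = sqrt (pi / t) ^ DIM('a) * heat_kernel (1 / (4 * t)) x"
proof -
  have "4 * pi * (1 / (4 * t)) = pi / t" using t by simp
  then show ?thesis using t unfolding heat_kernel_def by (simp add: mult.commute)
qed

lemma exp_norm_sq_fourier:
  fixes z :: "'a::euclidean_space"
  assumes t: "t > 0"
  shows "integrable lborel (\<lambda>x::'a. exp (- t * (norm x)\<^sup>2))"
    and "(LINT x|lborel. exp (- t * (norm x)\<^sup>2) * cos (z \<bullet> x)) = (2 * pi) ^ DIM('a) * heat_kernel t z"
    and "(LINT x|lborel. exp (- t * (norm x)\<^sup>2) * sin (z \<bullet> x)) = 0"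
proof -
  have t': "1 / (4 * t) > 0" using t by simp
  show "integrable lborel (\<lambda>x::'a. exp (- t * (norm x)\<^sup>2))"
    unfolding exp_norm_sq_conv_heat[OF t] by (intro integrable_mult_right heat_kernel_fourier(1)[OF t'])
  have sq: "sqrt (pi / t) = 2 * pi / sqrt (4 * pi * t)"
  proof -
    have "2 * pi / sqrt (4 * pi * t) = sqrt ((2 * pi)\<^sup>2 / (4 * pi * t))"
      by (subst real_sqrt_divide) (simp only: real_sqrt_abs abs_of_pos pi_gt_zero zero_less_mult_iff zero_less_numeral simp_thms)
    also have "(2 * pi)\<^sup>2 / (4 * pi * t) = pi / t"
      by (simp add: power2_eq_square field_simps)
    finally show ?thesis by simp
  qed
  have "(LINT x|lborel. exp (- t * (norm x)\<^sup>2) * cos (z \<bullet> x)) 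
    = sqrt (pi / t) ^ DIM('a) * (LINT x|lborel. heat_kernel (1 / (4 * t)) x * cos (z \<bullet> x))"
    unfolding exp_norm_sq_conv_heat[OF t] by (simp add: mult.assoc)
  also have "\<dots> = sqrt (pi / t) ^ DIM('a) * exp (- (norm z)\<^sup>2 / (4 * t))"
    by (subst heat_kernel_fourier(2)[OF t']) simp
  also have "\<dots> = (2 * pi) ^ DIM('a) * heat_kernel t z"
    unfolding heat_kernel_def sq by (simp add: power_divide)
  finally show "(LINT x|lborel. exp (- t * (norm x)\<^sup>2) * cos (z \<bullet> x)) = (2 * pi) ^ DIM('a) * heat_kernel t z" .
  show "(LINT x|lborel. exp (- t * (norm x)\<^sup>2) * sin (z \<bullet> x)) = 0"
    unfolding exp_norm_sq_conv_heat[OF t] using heat_kernel_fourier(3)[OF t', of z] by (simp add: mult.assoc)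
qed

text \<open>
  The Hartley transform is used instead of the Fourier transform because it keeps the Hilbert
  space real; both determine each other through the values at \<open>\<xi>\<close> and \<open>-\<xi>\<close>.
\<close>

definition cas :: "real \<Rightarrow> real" where "cas t = cos t + sin t"

lemma cas_measurable [measurable]: "cas \<in> borel_measurable borel"
  unfolding cas_def[abs_def] by measurable

lemma abs_cas_le: "\<bar>cas t\<bar> \<le> 2"
  unfolding cas_def using abs_cos_le_one[of t] abs_sin_le_one[of t] by linarith

text \<open>Against an even weight the sine term integrates to zero and cos (a - b) remains. In this
  way the kernel \<open>cas\<close>, which is no character, still produces convolutions.\<close>

lemma cas_mult: "cas a * cas b = cos (a - b) + sin (a + b)"
  unfolding cas_def by (simp add: cos_diff sin_add algebra_simps)

definition hart :: "('a::euclidean_space \<Rightarrow> real) \<Rightarrow> 'a \<Rightarrow> real" where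
  "hart f \<xi> = (LINT x|lborel. f x * cas (x \<bullet> \<xi>))"

lemma integrable_bounded_mult:
  fixes f g :: "'a::euclidean_space \<Rightarrow> real"
  assumes f: "integrable lborel f" and g: "g \<in> borel_measurable borel" and b: "\<And>x. \<bar>g x\<bar> \<le> C"
  shows "integrable lborel (\<lambda>x. f x * g x)"
proof (rule Bochner_Integration.integrable_bound)
  show "integrable lborel (\<lambda>x. C * \<bar>f x\<bar>)" using f by simp
  have "0 \<le> C" using b[of 0] by linarith
  then show "AE x in lborel. norm (f x * g x) \<le> norm (C * \<bar>f x\<bar>)"
    using b by (auto simp: abs_mult mult.commute[of C] intro!: mult_left_mono)
  show "(\<lambda>x. f x * g x) \<in> borel_measurable lborel" using f g by auto
qed

lemma hart_integrable: "integrable lborel f \<Longrightarrow> integrable lborel (\<lambda>x. f x * cas (x \<bullet> \<xi>))"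
  by (rule integrable_bounded_mult[where C = 2]) (auto simp: abs_cas_le)

lemma hart_measurable [measurable]:
  assumes [measurable]: "f \<in> borel_measurable borel"
  shows "hart f \<in> borel_measurable borel"
  unfolding hart_def[abs_def] by measurable

lemma hart_add: "integrable lborel f \<Longrightarrow> integrable lborel g \<Longrightarrow> hart (\<lambda>x. f x + g x) \<xi> = hart f \<xi> + hart g \<xi>"
  unfolding hart_def by (simp add: distrib_right hart_integrable)

lemma hart_diff: "integrable lborel f \<Longrightarrow> integrable lborel g \<Longrightarrow> hart (\<lambda>x. f x - g x) \<xi> = hart f \<xi> - hart g \<xi>"
  unfolding hart_def by (simp add: left_diff_distrib hart_integrable)

lemma hart_scale: "hart (\<lambda>x. c * f x) \<xi> = c * hart f \<xi>"
  unfolding hart_def by (simp add: mult.assoc)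

lemma hart_bound: 
  assumes f: "integrable lborel f" shows "\<bar>hart f \<xi>\<bar> \<le> 2 * (LINT x|lborel. \<bar>f x\<bar>)"
proof -
  have "\<bar>hart f \<xi>\<bar> \<le> (LINT x|lborel. \<bar>f x * cas (x \<bullet> \<xi>)\<bar>)"
    unfolding hart_def using integral_norm_bound[of lborel "\<lambda>x. f x * cas (x \<bullet> \<xi>)"] by simp
  also have "\<dots> \<le> (LINT x|lborel. 2 * \<bar>f x\<bar>)"
    using integrable_abs[OF hart_integrable[OF f, of \<xi>]] f
    by (intro integral_mono) (auto simp: abs_mult mult.commute[of 2] intro!: mult_left_mono abs_cas_le)
  finally show ?thesis by simp
qed

lemma integrable_pair_mult:
  fixes f g :: "'a::euclidean_space \<Rightarrow> real"
  assumes f: "integrable lborel f" and g: "integrable lborel g" 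
    and h[measurable]: "(\<lambda>p. h (fst p) (snd p)) \<in> borel_measurable (borel \<Otimes>\<^sub>M borel)" and b: "\<And>x y. \<bar>h x y\<bar> \<le> C"
  shows "integrable (lborel \<Otimes>\<^sub>M lborel) (\<lambda>(x, y). f x * g y * h x y)"
proof -
  have [measurable]: "f \<in> borel_measurable borel" "g \<in> borel_measurable borel" using f g by auto
  have "integrable (lborel \<Otimes>\<^sub>M lborel) (\<lambda>(x, y). f x * g y)"
    by (rule lborel_pair.Fubini_integrable) (use f g in \<open>auto simp: abs_mult\<close>)
  then have "integrable (lborel \<Otimes>\<^sub>M lborel) (\<lambda>p. C * \<bar>f (fst p) * g (snd p)\<bar>)"
    by (auto simp: split_beta')
  then show ?thesis
  proof (rule Bochner_Integration.integrable_bound)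
    have "0 \<le> C" using b[of 0 0] by linarith
    then show "AE p in lborel \<Otimes>\<^sub>M lborel. norm (case p of (x, y) \<Rightarrow> f x * g y * h x y) \<le> norm (C * \<bar>f (fst p) * g (snd p)\<bar>)"
      by (intro AE_I2) (auto simp: abs_mult mult.commute[of C] b split_beta' intro!: mult_left_mono)
  qed (simp add: split_beta')
qed

lemma fubini_pair_mult:
  fixes f g :: "'a::euclidean_space \<Rightarrow> real"
  assumes f: "integrable lborel f" and g: "integrable lborel g" 
    and h: "(\<lambda>p. h (fst p) (snd p)) \<in> borel_measurable (borel \<Otimes>\<^sub>M borel)" and b: "\<And>x y. \<bar>h x y\<bar> \<le> C"
  shows "(LINT x|lborel. f x * (LINT y|lborel. g y * h x y)) = (LINT y|lborel. g y * (LINT x|lborel. f x * h x y))"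
proof -
  have "(LINT y|lborel. LINT x|lborel. f x * g y * h x y) = (LINT x|lborel. LINT y|lborel. f x * g y * h x y)"
    by (rule lborel_pair.Fubini_integral) (use integrable_pair_mult[OF assms] in \<open>simp add: split_beta'\<close>)
  moreover have "(LINT y|lborel. LINT x|lborel. f x * g y * h x y) = (LINT y|lborel. g y * (LINT x|lborel. f x * h x y))"
    unfolding integral_mult_right_zero[symmetric] by (simp add: mult_ac)
  moreover have "(LINT x|lborel. LINT y|lborel. f x * g y * h x y) = (LINT x|lborel. f x * (LINT y|lborel. g y * h x y))"
    by (simp add: mult.assoc)
  ultimately show ?thesis by simp
qed

lemma hart_selfadjoint:
  assumes f: "integrable lborel f" and g: "integrable lborel g"
  shows "(LINT x|lborel. f x * hart g x) = (LINT x|lborel. hart f x * g x)"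
  unfolding hart_def
  using fubini_pair_mult[OF f g, of "\<lambda>x y. cas (x \<bullet> y)" 2]
  by (simp add: abs_cas_le inner_commute mult.commute)

definition heat_op :: "real \<Rightarrow> ('a::euclidean_space \<Rightarrow> real) \<Rightarrow> 'a \<Rightarrow> real" where
  "heat_op t f x = (LINT y|lborel. f y * heat_kernel t (x - y))"

text \<open>Inversion formula regularised by a Gaussian, which makes the double integral absolutely
  convergent. As the Gaussian is even, \<open>cas_mult\<close> leaves its cosine transform, the heat
  kernel at x - y.\<close>

lemma hart_gaussian_hart:
  assumes f: "integrable lborel f" and t: "t > 0"
  shows "hart (\<lambda>\<xi>. exp (- t * (norm \<xi>)\<^sup>2) * hart f \<xi>) (x::'a::euclidean_space) = (2 * pi) ^ DIM('a) * heat_op t f x"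
proof -
  have "hart (\<lambda>\<xi>. exp (- t * (norm \<xi>)\<^sup>2) * hart f \<xi>) x 
    = (LINT \<xi>|lborel. exp (- t * (norm \<xi>)\<^sup>2) * (LINT y|lborel. f y * (cas (y \<bullet> \<xi>) * cas (\<xi> \<bullet> x))))"
    unfolding hart_def by (simp add: mult.assoc flip: integral_mult_left_zero)
  also have "\<dots> = (LINT y|lborel. f y * (LINT \<xi>|lborel. exp (- t * (norm \<xi>)\<^sup>2) * (cas (y \<bullet> \<xi>) * cas (\<xi> \<bullet> x))))"
  proof (rule fubini_pair_mult[where C = 4])
    show "integrable lborel (\<lambda>\<xi>::'a. exp (- t * (norm \<xi>)\<^sup>2))" by (rule exp_norm_sq_fourier(1)[OF t])
    show "\<bar>cas (y \<bullet> \<xi>) * cas (\<xi> \<bullet> x)\<bar> \<le> 4" for y \<xi>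
      using mult_mono[OF abs_cas_le[of "y \<bullet> \<xi>"] abs_cas_le[of "\<xi> \<bullet> x"]] by (simp add: abs_mult)
  qed (use f in auto)
  also have "\<dots> = (LINT y|lborel. f y * ((2 * pi) ^ DIM('a) * heat_kernel t (x - y)))"
  proof (intro Bochner_Integration.integral_cong refl arg_cong2[where f = "(*)"])
    fix y
    have cc: "cas (y \<bullet> \<xi>) * cas (\<xi> \<bullet> x) = cos ((x - y) \<bullet> \<xi>) + sin ((x + y) \<bullet> \<xi>)" for \<xi>
      using cas_mult[of "x \<bullet> \<xi>" "y \<bullet> \<xi>"] by (simp add: inner_simps inner_commute mult.commute)
    have i: "integrable lborel (\<lambda>\<xi>. exp (- t * (norm \<xi>)\<^sup>2) * cos ((x - y) \<bullet> \<xi>))"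
      "integrable lborel (\<lambda>\<xi>. exp (- t * (norm \<xi>)\<^sup>2) * sin ((x + y) \<bullet> \<xi>))"
      by (rule integrable_bounded_mult[where C = 1]; simp add: exp_norm_sq_fourier(1)[OF t, simplified])+
    show "(LINT \<xi>|lborel. exp (- t * (norm \<xi>)\<^sup>2) * (cas (y \<bullet> \<xi>) * cas (\<xi> \<bullet> x))) = (2 * pi) ^ DIM('a) * heat_kernel t (x - y)"
      unfolding cc distrib_left using i
      by (subst Bochner_Integration.integral_add) (simp_all only: exp_norm_sq_fourier(2,3)[OF t] add_0_right)
  qed
  also have "\<dots> = (2 * pi) ^ DIM('a) * heat_op t f x"
    unfolding heat_op_def by (simp only: mult.left_commute[of "f _"] integral_mult_right_zero)
  finally show ?thesis .
qed

lemma hart_regularized: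
  assumes f: "integrable lborel f" and t: "t > 0"
  shows "(LINT \<xi>|lborel. exp (- t * (norm \<xi>)\<^sup>2) * (hart f \<xi>)\<^sup>2) 
    = (2 * pi) ^ DIM('a::euclidean_space) * (LINT x|lborel. f x * heat_op t f (x::'a))"
    and "integrable lborel (\<lambda>\<xi>. exp (- t * (norm \<xi>)\<^sup>2) * (hart f \<xi>)\<^sup>2)"
proof -
  have m: "hart f \<in> borel_measurable borel" using f by auto
  have i: "integrable lborel (\<lambda>\<xi>. exp (- t * (norm \<xi>)\<^sup>2) * hart f \<xi>)"
    by (rule integrable_bounded_mult[OF _ m hart_bound[OF f]]) (rule exp_norm_sq_fourier(1)[OF t])
  show "integrable lborel (\<lambda>\<xi>. exp (- t * (norm \<xi>)\<^sup>2) * (hart f \<xi>)\<^sup>2)"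
    using integrable_bounded_mult[OF i m hart_bound[OF f]] by (simp add: power2_eq_square mult.assoc)
  have "(LINT \<xi>|lborel. exp (- t * (norm \<xi>)\<^sup>2) * (hart f \<xi>)\<^sup>2) = (LINT \<xi>|lborel. hart f \<xi> * (exp (- t * (norm \<xi>)\<^sup>2) * hart f \<xi>))"
    by (simp add: power2_eq_square mult_ac)
  also have "\<dots> = (LINT x|lborel. f x * hart (\<lambda>\<xi>. exp (- t * (norm \<xi>)\<^sup>2) * hart f \<xi>) x)"
    by (rule hart_selfadjoint[OF f i, symmetric])
  also have "\<dots> = (2 * pi) ^ DIM('a) * (LINT x|lborel. f x * heat_op t f x)"
    by (simp only: hart_gaussian_hart[OF f t] mult.left_commute[of "f _"] integral_mult_right_zero)
  finally show "(LINT \<xi>|lborel. exp (- t * (norm \<xi>)\<^sup>2) * (hart f \<xi>)\<^sup>2) 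
    = (2 * pi) ^ DIM('a) * (LINT x|lborel. f x * heat_op t f x)" .
qed

section \<open>Plancherel's identity for bounded integrable functions\<close>

definition bddL1 :: "('a::euclidean_space \<Rightarrow> real) \<Rightarrow> bool" where
  "bddL1 f \<longleftrightarrow> integrable lborel f \<and> (\<exists>M. \<forall>x. \<bar>f x\<bar> \<le> M)"

lemma bddL1_integrable: "bddL1 f \<Longrightarrow> integrable lborel f"
  by (simp add: bddL1_def)

lemma bddL1_L2: 
  assumes "bddL1 f" shows "f \<in> L2"
proof (rule L2_realI)
  obtain M where M: "\<And>x. \<bar>f x\<bar> \<le> M" and f: "integrable lborel f" using assms by (auto simp: bddL1_def)
  show "f \<in> borel_measurable borel" using f by auto
  show "integrable lborel (\<lambda>x. (f x)\<^sup>2)"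
    using integrable_bounded_mult[OF f _ M] f by (auto simp: power2_eq_square)
qed

lemma bddL1_diff: "bddL1 f \<Longrightarrow> bddL1 g \<Longrightarrow> bddL1 (\<lambda>x. f x - g x)"
  unfolding bddL1_def by (auto intro: order_trans[OF abs_triangle_ineq4 add_mono])

lemma bddL1_add: "bddL1 f \<Longrightarrow> bddL1 g \<Longrightarrow> bddL1 (\<lambda>x. f x + g x)"
  unfolding bddL1_def by (auto intro: order_trans[OF abs_triangle_ineq add_mono])

lemma bddL1_scale: 
  assumes "bddL1 f" shows "bddL1 (\<lambda>x. c * f x)"
proof -
  obtain M where "\<And>x. \<bar>f x\<bar> \<le> M" using assms by (auto simp: bddL1_def)
  then have "\<bar>c * f x\<bar> \<le> \<bar>c\<bar> * M" for x by (simp add: abs_mult mult_left_mono)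
  then show ?thesis using assms unfolding bddL1_def by auto
qed

text \<open>All dependence on t moves into the argument of f, so that the limit t \<rightarrow> 0
  can be taken under one fixed integrable weight.\<close>

lemma heat_op_rescale:
  fixes f :: "'a::euclidean_space \<Rightarrow> real"
  assumes [measurable]: "f \<in> borel_measurable borel" and t: "t > 0"
  shows "heat_op t f x = (LINT w|lborel. heat_kernel 1 w * f (x - sqrt t *\<^sub>R w))"
proof -
  have h: "heat_kernel t (sqrt t *\<^sub>R w) = heat_kernel 1 w / sqrt t ^ DIM('a)" for w :: 'a
  proof -
    have "sqrt (4 * pi * t) = sqrt (4 * pi) * sqrt t" by (rule real_sqrt_mult)
    moreover have "(norm (sqrt t *\<^sub>R w))\<^sup>2 / (4 * t) = (norm w)\<^sup>2 / 4"
      using t by (simp add: power_mult_distrib)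
    ultimately show ?thesis unfolding heat_kernel_def by (simp add: power_mult_distrib)
  qed
  have "(LINT w|lborel. f (x + (- sqrt t) *\<^sub>R w) * heat_kernel t (x - (x + (- sqrt t) *\<^sub>R w))) = heat_op t f x /\<^sub>R \<bar>- sqrt t\<bar> ^ DIM('a)"
    unfolding heat_op_def by (rule lborel_affine_transfer(2)) (use t in auto)
  moreover have "f (x + (- sqrt t) *\<^sub>R w) * heat_kernel t (x - (x + (- sqrt t) *\<^sub>R w)) 
      = heat_kernel 1 w * f (x - sqrt t *\<^sub>R w) / sqrt t ^ DIM('a)" for w
    by (simp add: h)
  ultimately have "(LINT w|lborel. heat_kernel 1 w * f (x - sqrt t *\<^sub>R w)) / sqrt t ^ DIM('a) = heat_op t f x / sqrt t ^ DIM('a)"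
    using t by (simp only: integral_divide_zero) (simp add: divide_inverse mult.commute)
  then show ?thesis using t by simp
qed

text \<open>By Fubini the pairing is the average of the autocorrelation \<open>A\<close> of f,
  evaluated at sqrt t times w, against the fixed density \<open>heat_kernel 1\<close>. Since f is
  bounded, \<open>A\<close> is bounded, and it is continuous at 0 by continuity of translation in
  L^1.\<close>

lemma heat_op_approx:
  fixes f :: "'a::euclidean_space \<Rightarrow> real"
  assumes f: "bddL1 f" and t: "\<And>k. t k > 0" "t \<longlonglongrightarrow> 0"
  shows "(\<lambda>k. LINT x|lborel. f x * heat_op (t k) f x) \<longlonglongrightarrow> (LINT x|lborel. (f x)\<^sup>2)"
proof -
  obtain M where M: "\<And>x. \<bar>f x\<bar> \<le> M" and fi: "integrable lborel f" using f by (auto simp: bddL1_def)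
  have M0: "M \<ge> 0" using M[of 0] by linarith
  have [measurable]: "f \<in> borel_measurable borel" using fi by auto
  define A where "A z = (LINT x|lborel. f x * f (x - z))" for z
  have [measurable]: "A \<in> borel_measurable borel" unfolding A_def[abs_def] by measurable
  have iA: "integrable lborel (\<lambda>x. f x * f (x - z))" for z
    by (rule integrable_bounded_mult[OF fi _ M]) measurable
  have A_lim: "(\<lambda>k. A (z k)) \<longlonglongrightarrow> A 0" if "z \<longlonglongrightarrow> 0" for z
  proof -
    have z': "(\<lambda>k. - z k) \<longlonglongrightarrow> 0" using tendsto_minus[OF that] by simp
    have lim: "(\<lambda>k. M * (LINT x|lborel. \<bar>f (x + - z k) - f x\<bar>)) \<longlonglongrightarrow> M * 0"
      by (intro tendsto_intros L1_translation_continuous fi z')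
    have le: "norm (A (z k) - A 0) \<le> M * (LINT x|lborel. \<bar>f (x + - z k) - f x\<bar>)" for k
    proof -
      have i: "integrable lborel (\<lambda>x. f (x + - z k) - f x)"
        using lborel_translate(1)[of f "- z k"] fi by auto
      have "A (z k) - A 0 = (LINT x|lborel. f x * (f (x + - z k) - f x))"
        unfolding A_def using iA[of "z k"] iA[of 0]
        by (subst Bochner_Integration.integral_diff[symmetric]) (auto simp: algebra_simps)
      also have "norm \<dots> \<le> (LINT x|lborel. norm (f x * (f (x + - z k) - f x)))"
        by (rule integral_norm_bound)
      also have "\<dots> \<le> (LINT x|lborel. M * \<bar>f (x + - z k) - f x\<bar>)"
      proof (rule integral_mono)
        show "integrable lborel (\<lambda>x. norm (f x * (f (x + - z k) - f x)))"
          using iA[of "z k"] iA[of 0] by (intro integrable_norm) (simp add: right_diff_distrib)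
      qed (use i M in \<open>auto simp: abs_mult intro!: mult_right_mono\<close>)
      finally show ?thesis by simp
    qed
    have "(\<lambda>k. A (z k) - A 0) \<longlonglongrightarrow> 0"
      by (rule Lim_null_comparison[OF always_eventually lim[unfolded mult_zero_right]]) (use le in auto)
    then show ?thesis by (simp add: LIM_zero_iff)
  qed
  have A_bound: "\<bar>A z\<bar> \<le> M * (LINT x|lborel. \<bar>f x\<bar>)" for z
  proof -
    have "\<bar>A z\<bar> \<le> (LINT x|lborel. \<bar>f x * f (x - z)\<bar>)"
      unfolding A_def using integral_norm_bound[of lborel "\<lambda>x. f x * f (x - z)"] by simp
    also have "\<dots> \<le> (LINT x|lborel. M * \<bar>f x\<bar>)"
      using integrable_abs[OF iA[of z]] fi M by (intro integral_mono) (auto simp: abs_mult mult.commute[of M] intro!: mult_left_mono)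
    finally show ?thesis by simp
  qed
  have eq: "(LINT x|lborel. f x * heat_op (t k) f x) = (LINT w|lborel. heat_kernel 1 w * A (sqrt (t k) *\<^sub>R w))" for k
  proof -
    have "(LINT x|lborel. f x * heat_op (t k) f x) = (LINT x|lborel. f x * (LINT w|lborel. heat_kernel 1 w * f (x - sqrt (t k) *\<^sub>R w)))"
      using t by (simp add: heat_op_rescale)
    also have "\<dots> = (LINT w|lborel. heat_kernel 1 w * (LINT x|lborel. f x * f (x - sqrt (t k) *\<^sub>R w)))"
      by (rule fubini_pair_mult[OF fi heat_kernel_fourier(1) _ M]) auto
    finally show ?thesis unfolding A_def .
  qed
  have hi: "integrable lborel (heat_kernel 1 :: 'a \<Rightarrow> real)" by (rule heat_kernel_fourier(1)) simp
  have "(\<lambda>k. LINT w|lborel. heat_kernel 1 w * A (sqrt (t k) *\<^sub>R w)) \<longlonglongrightarrow> (LINT w|lborel. heat_kernel 1 (w::'a) * A 0)"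
  proof (rule integral_dominated_convergence[where w = "\<lambda>w. (M * (LINT x|lborel. \<bar>f x\<bar>)) * heat_kernel 1 w"])
    show "integrable lborel (\<lambda>w::'a. (M * (LINT x|lborel. \<bar>f x\<bar>)) * heat_kernel 1 w)"
      by (intro integrable_mult_right hi)
    show "AE w in lborel. (\<lambda>k. heat_kernel 1 w * A (sqrt (t k) *\<^sub>R w)) \<longlonglongrightarrow> heat_kernel 1 w * A 0"
    proof (intro AE_I2 tendsto_mult tendsto_const A_lim)
      fix w :: 'a
      have "(\<lambda>k. sqrt (t k) *\<^sub>R w) \<longlonglongrightarrow> sqrt 0 *\<^sub>R w" by (intro tendsto_intros t)
      then show "(\<lambda>k. sqrt (t k) *\<^sub>R w) \<longlonglongrightarrow> 0" by simp
    qed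
    show "AE w in lborel. norm (heat_kernel 1 w * A (sqrt (t k) *\<^sub>R w)) \<le> (M * (LINT x|lborel. \<bar>f x\<bar>)) * heat_kernel 1 w" for k
      using A_bound by (intro AE_I2) (auto simp: abs_mult heat_kernel_nonneg mult.commute[of _ "heat_kernel _ _"] intro!: mult_left_mono)
  qed auto
  then show ?thesis unfolding eq by (simp add: heat_kernel_integral A_def power2_eq_square)
qed

text \<open>Limit t \<rightarrow> 0 in the damped identity \<open>hart_regularized\<close>. The
  damping factor increases to 1, so monotone convergence yields the square integrability of the
  transform together with its norm.\<close>

lemma plancherel_bddL1:
  fixes f :: "'a::euclidean_space \<Rightarrow> real"
  assumes f: "bddL1 f"
  shows "hart f \<in> L2" and "(LINT \<xi>|lborel. (hart f \<xi>)\<^sup>2) = (2 * pi) ^ DIM('a) * (LINT x|lborel. (f x)\<^sup>2)"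
proof -
  have fi: "integrable lborel f" using f by (simp add: bddL1_def)
  have [measurable]: "f \<in> borel_measurable borel" using fi by auto
  define t where "t k = inverse (real (Suc k))" for k
  have t: "\<And>k. t k > 0" "t \<longlonglongrightarrow> 0" unfolding t_def using LIMSEQ_inverse_real_of_nat by auto
  have tm: "t m \<le> t k" if "k \<le> m" for k m using that unfolding t_def by (simp add: le_imp_inverse_le)
  define u where "u k \<xi> = exp (- t k * (norm \<xi>)\<^sup>2) * (hart f \<xi>)\<^sup>2" for k \<xi>
  have ui: "integrable lborel (u k)" for k unfolding u_def by (rule hart_regularized(2)[OF fi t(1)])
  have mono: "AE \<xi> in lborel. mono (\<lambda>k. u k \<xi>)"
    unfolding u_def by (intro AE_I2 monoI mult_right_mono) (auto intro!: mult_right_mono tm)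
  have lim: "AE \<xi> in lborel. (\<lambda>k. u k \<xi>) \<longlonglongrightarrow> (hart f \<xi>)\<^sup>2"
  proof (rule AE_I2)
    fix \<xi> :: 'a
    have "(\<lambda>k. u k \<xi>) \<longlonglongrightarrow> exp (- 0 * (norm \<xi>)\<^sup>2) * (hart f \<xi>)\<^sup>2"
      unfolding u_def by (intro tendsto_intros t(2))
    then show "(\<lambda>k. u k \<xi>) \<longlonglongrightarrow> (hart f \<xi>)\<^sup>2" by simp
  qed
  have ilim: "(\<lambda>k. integral\<^sup>L lborel (u k)) \<longlonglongrightarrow> (2 * pi) ^ DIM('a) * (LINT x|lborel. (f x)\<^sup>2)"
    unfolding u_def hart_regularized(1)[OF fi t(1)] by (intro tendsto_intros heat_op_approx f t)
  have m: "(\<lambda>\<xi>. (hart f \<xi>)\<^sup>2) \<in> borel_measurable lborel" by measurable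
  show "hart f \<in> L2"
    using integrable_monotone_convergence[OF ui mono lim ilim m] by (intro L2_realI) auto
  show "(LINT \<xi>|lborel. (hart f \<xi>)\<^sup>2) = (2 * pi) ^ DIM('a) * (LINT x|lborel. (f x)\<^sup>2)"
    by (rule integral_monotone_convergence[OF ui mono lim ilim m])
qed

lemma norm_hart_bddL1:
  fixes f :: "'a::euclidean_space \<Rightarrow> real"
  assumes f: "bddL1 f"
  shows "norm (abs_l2 (hart f)) = sqrt ((2 * pi) ^ DIM('a)) * norm (abs_l2 f)"
proof -
  have "(norm (abs_l2 (hart f)))\<^sup>2 = (2 * pi) ^ DIM('a) * (norm (abs_l2 f))\<^sup>2"
    using plancherel_bddL1[OF f] bddL1_L2[OF f] by (simp add: norm_abs_l2_sq)
  also have "\<dots> = (sqrt ((2 * pi) ^ DIM('a)) * norm (abs_l2 f))\<^sup>2"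
    by (simp add: power_mult_distrib)
  finally show ?thesis by (rule power2_eq_imp_eq) auto
qed

section \<open>Extension of the Hartley transform to all of L^2\<close>

definition trunc :: "nat \<Rightarrow> ('a::euclidean_space \<Rightarrow> real) \<Rightarrow> 'a \<Rightarrow> real" where
  "trunc k f x = (if norm x \<le> k \<and> \<bar>f x\<bar> \<le> k then f x else 0)"

lemma trunc_measurable [measurable]: 
  assumes [measurable]: "f \<in> borel_measurable borel"
  shows "trunc k f \<in> borel_measurable borel"
  unfolding trunc_def[abs_def] by measurable

lemma trunc_bddL1:
  assumes [measurable]: "f \<in> borel_measurable borel"
  shows "bddL1 (trunc k f)"
  unfolding bddL1_def
proof
  show "integrable lborel (trunc k f)"
  proof (rule Bochner_Integration.integrable_bound)
    show "integrable lborel (\<lambda>x. real k * indicator (cball 0 k) x)"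
      using emeasure_lborel_cball_finite[of 0 "real k"] by (intro integrable_mult_right integrable_real_indicator) auto
  qed (auto simp: trunc_def)
  show "\<exists>M. \<forall>x. \<bar>trunc k f x\<bar> \<le> M" by (rule exI[of _ "real k"]) (auto simp: trunc_def)
qed

lemma trunc_eventually: "\<forall>\<^sub>F k in sequentially. trunc k f x = f x"
proof -
  obtain K :: nat where "norm x \<le> K" "\<bar>f x\<bar> \<le> K"
    using real_arch_simple[of "max (norm x) \<bar>f x\<bar>"] by auto
  then show ?thesis unfolding eventually_sequentially trunc_def by (intro exI[of _ K]) auto
qed

lemma abs_trunc_le: "\<bar>trunc k f x\<bar> \<le> \<bar>f x\<bar>"
  by (simp add: trunc_def)

lemma trunc_tendsto: 
  assumes f: "f \<in> L2"
  shows "(\<lambda>k. abs_l2 (trunc k f)) \<longlonglongrightarrow> abs_l2 f"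
proof -
  have [measurable]: "f \<in> borel_measurable borel" using L2_realD(1)[OF f] .
  have tL: "trunc k f \<in> L2" for k by (intro bddL1_L2 trunc_bddL1) simp
  have "(\<lambda>k. LINT x|lborel. (trunc k f x - f x)\<^sup>2) \<longlonglongrightarrow> (LINT x|(lborel :: 'a measure). 0)"
  proof (rule integral_dominated_convergence[where w = "\<lambda>x. (f x)\<^sup>2"])
    show "AE x in lborel. (\<lambda>k. (trunc k f x - f x)\<^sup>2) \<longlonglongrightarrow> 0"
    proof (intro AE_I2 tendsto_eventually)
      fix x show "\<forall>\<^sub>F k in sequentially. (trunc k f x - f x)\<^sup>2 = 0"
        using trunc_eventually[of f x] by eventually_elim simp
    qed
    show "AE x in lborel. norm ((trunc k f x - f x)\<^sup>2) \<le> (f x)\<^sup>2" for k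
      by (auto simp: trunc_def)
  qed (use L2_realD(2)[OF f] in auto)
  then have "(\<lambda>k. (norm (abs_l2 (trunc k f) - abs_l2 f))\<^sup>2) \<longlonglongrightarrow> 0"
    using tL f L2_diff[OF tL f] by (simp add: norm_abs_l2_sq flip: abs_l2_diff)
  then have "(\<lambda>k. sqrt ((norm (abs_l2 (trunc k f) - abs_l2 f))\<^sup>2)) \<longlonglongrightarrow> sqrt 0"
    by (intro tendsto_real_sqrt)
  then show ?thesis by (simp add: tendsto_norm_zero_iff LIM_zero_iff)
qed

text \<open>Truncating both the argument and the value puts a representative into
  \<open>bddL1\<close>, where the integral converges. By \<open>hartley_tendsto\<close> any other
  approximation by bounded integrable functions gives the same limit.\<close>

definition hartley :: "'a::euclidean_space l2 \<Rightarrow> 'a l2" where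
  "hartley X = lim (\<lambda>k. abs_l2 (hart (trunc k (rep_l2 X))))"

lemma norm_hart_diff:
  fixes f g :: "'a::euclidean_space \<Rightarrow> real"
  assumes f: "bddL1 f" and g: "bddL1 g"
  shows "norm (abs_l2 (hart f) - abs_l2 (hart g)) = sqrt ((2 * pi) ^ DIM('a)) * norm (abs_l2 f - abs_l2 g)"
proof -
  have "abs_l2 (hart f) - abs_l2 (hart g) = abs_l2 (hart (\<lambda>x. f x - g x))"
    using plancherel_bddL1(1)[OF f] plancherel_bddL1(1)[OF g] bddL1_integrable[OF f] bddL1_integrable[OF g]
    by (subst abs_l2_diff[symmetric]) (auto simp: hart_diff intro!: arg_cong[where f = abs_l2])
  also have "norm \<dots> = sqrt ((2 * pi) ^ DIM('a)) * norm (abs_l2 f - abs_l2 g)"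
    using bddL1_L2[OF f] bddL1_L2[OF g] by (subst norm_hart_bddL1[OF bddL1_diff[OF f g]]) (simp add: abs_l2_diff)
  finally show ?thesis .
qed

lemma hartley_tendsto:
  fixes f :: "nat \<Rightarrow> 'a::euclidean_space \<Rightarrow> real"
  assumes f: "\<And>k. bddL1 (f k)" and X: "(\<lambda>k. abs_l2 (f k)) \<longlonglongrightarrow> X"
  shows "(\<lambda>k. abs_l2 (hart (f k))) \<longlonglongrightarrow> hartley X"
proof -
  let ?N = "sqrt ((2 * pi) ^ DIM('a))"
  define g where "g k = trunc k (rep_l2 X)" for k
  have g: "bddL1 (g k)" for k unfolding g_def by (intro trunc_bddL1) simp
  have gX: "(\<lambda>k. abs_l2 (g k)) \<longlonglongrightarrow> X" unfolding g_def using trunc_tendsto[OF rep_l2_in, of X] by simp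
  have "Cauchy (\<lambda>k. abs_l2 (hart (g k)))"
  proof (rule CauchyI)
    fix e :: real assume "e > 0"
    have N: "?N > 0" by simp
    have "e / ?N > 0" using \<open>e > 0\<close> N by simp
    then obtain M where "\<And>m n. m \<ge> M \<Longrightarrow> n \<ge> M \<Longrightarrow> norm (abs_l2 (g m) - abs_l2 (g n)) < e / ?N"
      using CauchyD[OF LIMSEQ_imp_Cauchy[OF gX]] by meson
    then show "\<exists>M. \<forall>m\<ge>M. \<forall>n\<ge>M. norm (abs_l2 (hart (g m)) - abs_l2 (hart (g n))) < e"
      using N by (intro exI[of _ M] allI impI) (simp only: norm_hart_diff[OF g g] pos_less_divide_eq mult.commute)
  qed
  then have h: "(\<lambda>k. abs_l2 (hart (g k))) \<longlonglongrightarrow> hartley X"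
    unfolding hartley_def g_def by (intro convergent_LIMSEQ_iff[THEN iffD1] Cauchy_convergent)
  have "(\<lambda>k. ?N * norm (abs_l2 (f k) - abs_l2 (g k))) \<longlonglongrightarrow> ?N * norm (X - X)"
    by (intro tendsto_intros X gX)
  then have "(\<lambda>k. abs_l2 (hart (f k)) - abs_l2 (hart (g k))) \<longlonglongrightarrow> 0"
    by (subst tendsto_norm_zero_iff[symmetric]) (simp add: norm_hart_diff[OF f g])
  from tendsto_add[OF this h] show ?thesis by simp
qed

lemma l2_bddL1_approx:
  obtains f where "\<And>k::nat. bddL1 (f k)" "(\<lambda>k. abs_l2 (f k)) \<longlonglongrightarrow> X"
proof (rule that)
  show "bddL1 (trunc k (rep_l2 X))" for k by (intro trunc_bddL1) simp
  show "(\<lambda>k. abs_l2 (trunc k (rep_l2 X))) \<longlonglongrightarrow> X" using trunc_tendsto[OF rep_l2_in, of X] by simp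
qed

lemma norm_hartley: "norm (hartley X) = sqrt ((2 * pi) ^ DIM('a)) * norm (X :: 'a::euclidean_space l2)"
proof -
  obtain f where f: "\<And>k::nat. bddL1 (f k)" "(\<lambda>k. abs_l2 (f k)) \<longlonglongrightarrow> X" using l2_bddL1_approx[of X] by metis
  have "(\<lambda>k. norm (abs_l2 (hart (f k)))) \<longlonglongrightarrow> norm (hartley X)"
    by (intro tendsto_norm hartley_tendsto f)
  moreover have "(\<lambda>k. norm (abs_l2 (hart (f k)))) \<longlonglongrightarrow> sqrt ((2 * pi) ^ DIM('a)) * norm X"
    unfolding norm_hart_bddL1[OF f(1)] by (intro tendsto_intros f)
  ultimately show ?thesis by (rule LIMSEQ_unique)
qed

lemma hartley_add: "hartley (X + Y) = hartley X + hartley (Y :: 'a::euclidean_space l2)"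
proof -
  obtain f where f: "\<And>k::nat. bddL1 (f k)" "(\<lambda>k. abs_l2 (f k)) \<longlonglongrightarrow> X" using l2_bddL1_approx[of X] by metis
  obtain g where g: "\<And>k::nat. bddL1 (g k)" "(\<lambda>k. abs_l2 (g k)) \<longlonglongrightarrow> Y" using l2_bddL1_approx[of Y] by metis
  have "(\<lambda>k. abs_l2 (\<lambda>x. f k x + g k x)) \<longlonglongrightarrow> X + Y"
    using tendsto_add[OF f(2) g(2)] by (simp add: abs_l2_add bddL1_L2 f g)
  then have "(\<lambda>k. abs_l2 (hart (\<lambda>x. f k x + g k x))) \<longlonglongrightarrow> hartley (X + Y)"
    by (intro hartley_tendsto bddL1_add f g)
  moreover have "abs_l2 (hart (\<lambda>x. f k x + g k x)) = abs_l2 (hart (f k)) + abs_l2 (hart (g k))" for k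
    by (subst abs_l2_add[symmetric]) (auto simp: plancherel_bddL1 f g hart_add bddL1_integrable intro!: arg_cong[where f = abs_l2])
  ultimately have "(\<lambda>k. abs_l2 (hart (f k)) + abs_l2 (hart (g k))) \<longlonglongrightarrow> hartley (X + Y)" by simp
  moreover have "(\<lambda>k. abs_l2 (hart (f k)) + abs_l2 (hart (g k))) \<longlonglongrightarrow> hartley X + hartley Y"
    by (intro tendsto_intros hartley_tendsto f g)
  ultimately show ?thesis by (rule LIMSEQ_unique)
qed

lemma hartley_scale: "hartley (c *\<^sub>R X) = c *\<^sub>R hartley (X :: 'a::euclidean_space l2)"
proof -
  obtain f where f: "\<And>k::nat. bddL1 (f k)" "(\<lambda>k. abs_l2 (f k)) \<longlonglongrightarrow> X" using l2_bddL1_approx[of X] by metis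
  have "(\<lambda>k. abs_l2 (\<lambda>x. c * f k x)) \<longlonglongrightarrow> c *\<^sub>R X"
    using tendsto_scaleR[OF tendsto_const[of c] f(2)] by (simp add: abs_l2_scale bddL1_L2 f)
  then have "(\<lambda>k. abs_l2 (hart (\<lambda>x. c * f k x))) \<longlonglongrightarrow> hartley (c *\<^sub>R X)"
    by (intro hartley_tendsto bddL1_scale f)
  moreover have "abs_l2 (hart (\<lambda>x. c * f k x)) = c *\<^sub>R abs_l2 (hart (f k))" for k
    by (subst abs_l2_scale[symmetric]) (auto simp: plancherel_bddL1 f hart_scale intro!: arg_cong[where f = abs_l2])
  ultimately have "(\<lambda>k. c *\<^sub>R abs_l2 (hart (f k))) \<longlonglongrightarrow> hartley (c *\<^sub>R X)" by simp
  moreover have "(\<lambda>k. c *\<^sub>R abs_l2 (hart (f k))) \<longlonglongrightarrow> c *\<^sub>R hartley X"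
    by (intro tendsto_intros hartley_tendsto f)
  ultimately show ?thesis by (rule LIMSEQ_unique)
qed

lemma bounded_linear_hartley: "bounded_linear (hartley :: 'a::euclidean_space l2 \<Rightarrow> 'a l2)"
  by (rule bounded_linear_intro[where K = "sqrt ((2 * pi) ^ DIM('a))"])
     (auto simp: hartley_add hartley_scale norm_hartley mult.commute)

lemma hartley_selfadjoint: "inner (hartley X) Y = inner X (hartley (Y :: 'a::euclidean_space l2))"
proof -
  obtain f where f: "\<And>k::nat. bddL1 (f k)" "(\<lambda>k. abs_l2 (f k)) \<longlonglongrightarrow> X" using l2_bddL1_approx[of X] by metis
  obtain g where g: "\<And>k::nat. bddL1 (g k)" "(\<lambda>k. abs_l2 (g k)) \<longlonglongrightarrow> Y" using l2_bddL1_approx[of Y] by metis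
  have "(\<lambda>k. inner (abs_l2 (hart (f k))) (abs_l2 (g k))) \<longlonglongrightarrow> inner (hartley X) Y"
    by (intro tendsto_intros hartley_tendsto f g)
  moreover have "inner (abs_l2 (hart (f k))) (abs_l2 (g k)) = inner (abs_l2 (f k)) (abs_l2 (hart (g k)))" for k
    using hart_selfadjoint[OF bddL1_integrable[OF f(1)] bddL1_integrable[OF g(1)], of k k]
    by (simp add: inner_abs_l2 plancherel_bddL1 f g bddL1_L2)
  ultimately have "(\<lambda>k. inner (abs_l2 (f k)) (abs_l2 (hart (g k)))) \<longlonglongrightarrow> inner (hartley X) Y" by simp
  moreover have "(\<lambda>k. inner (abs_l2 (f k)) (abs_l2 (hart (g k)))) \<longlonglongrightarrow> inner X (hartley Y)"
    by (intro tendsto_intros hartley_tendsto f g)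
  ultimately show ?thesis by (rule LIMSEQ_unique)
qed

text \<open>Follows from being selfadjoint and isometric up to the factor N = (2 \<pi>)^n: with H
  the transform, |H H X - N X|^2 expands to (N^2 - 2 N^2 + N^2) |X|^2 = 0.\<close>

lemma hartley_hartley: "hartley (hartley X) = (2 * pi) ^ DIM('a) *\<^sub>R (X :: 'a::euclidean_space l2)"
proof -
  let ?N = "(2 * pi) ^ DIM('a)"
  have n: "inner (hartley X) (hartley X) = ?N * inner X X" for X :: "'a l2"
    using arg_cong[OF norm_hartley[of X], of "\<lambda>x. x\<^sup>2"] by (simp add: power_mult_distrib power2_norm_eq_inner)
  have "(norm (hartley (hartley X) - ?N *\<^sub>R X))\<^sup>2 
     = inner (hartley (hartley X)) (hartley (hartley X)) - 2 * ?N * inner (hartley (hartley X)) X + ?N\<^sup>2 * inner X X"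
    unfolding power2_norm_eq_inner by (simp add: inner_diff_left inner_diff_right inner_commute power2_eq_square)
  also have "\<dots> = 0"
    by (simp add: n hartley_selfadjoint[of "hartley X"] power2_eq_square)
  finally show ?thesis by simp
qed

lemma inner_hartley: "inner (hartley X) (hartley Y) = (2 * pi) ^ DIM('a) * inner X (Y :: 'a::euclidean_space l2)"
  by (simp add: hartley_selfadjoint hartley_hartley)

text \<open>The transforms of the truncations converge pointwise by dominated convergence and in
  norm by construction, and the two limits coincide.\<close>

lemma hartley_abs_l2:
  fixes f :: "'a::euclidean_space \<Rightarrow> real"
  assumes fi: "integrable lborel f" and fL: "f \<in> L2"
  shows "hart f \<in> L2" "hartley (abs_l2 f) = abs_l2 (hart f)"
proof -
  have [measurable]: "f \<in> borel_measurable borel" using fi by auto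
  have b: "bddL1 (trunc k f)" for k by (intro trunc_bddL1) simp
  have lim: "(\<lambda>k. abs_l2 (hart (trunc k f))) \<longlonglongrightarrow> hartley (abs_l2 f)"
    by (intro hartley_tendsto b trunc_tendsto fL)
  have pw: "(\<lambda>k. hart (trunc k f) \<xi>) \<longlonglongrightarrow> hart f \<xi>" for \<xi>
    unfolding hart_def
  proof (rule integral_dominated_convergence[where w = "\<lambda>x. 2 * \<bar>f x\<bar>"])
    show "AE x in lborel. (\<lambda>k. trunc k f x * cas (x \<bullet> \<xi>)) \<longlonglongrightarrow> f x * cas (x \<bullet> \<xi>)"
    proof (intro AE_I2 tendsto_eventually)
      fix x show "\<forall>\<^sub>F k in sequentially. trunc k f x * cas (x \<bullet> \<xi>) = f x * cas (x \<bullet> \<xi>)"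
        using trunc_eventually[of f x] by eventually_elim simp
    qed
    show "AE x in lborel. norm (trunc k f x * cas (x \<bullet> \<xi>)) \<le> 2 * \<bar>f x\<bar>" for k
      using abs_trunc_le[of k f] abs_cas_le
      by (intro AE_I2) (auto simp: abs_mult mult.commute[of 2] intro!: mult_mono)
  qed (use fi in auto)
  have "AE \<xi> in lborel. \<forall>k. rep_l2 (abs_l2 (hart (trunc k f))) \<xi> = hart (trunc k f) \<xi>"
    unfolding AE_all_countable by (intro allI rep_abs_l2 plancherel_bddL1 b)
  then have "AE \<xi> in lborel. (\<lambda>k. rep_l2 (abs_l2 (hart (trunc k f))) \<xi>) \<longlonglongrightarrow> hart f \<xi>"
    by eventually_elim (simp add: pw)
  then have "hart f \<in> L2 \<and> hartley (abs_l2 f) = abs_l2 (hart f)"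
    by (intro l2_limit_AE_unique[OF lim]) auto
  then show "hart f \<in> L2" "hartley (abs_l2 f) = abs_l2 (hart f)" by auto
qed

section \<open>Fourier multipliers and Sobolev spaces\<close>

definition mulop :: "('a::euclidean_space \<Rightarrow> real) \<Rightarrow> 'a l2 \<Rightarrow> 'a l2" where
  "mulop m X = abs_l2 (\<lambda>\<xi>. m \<xi> * rep_l2 X \<xi>)"

lemma L2_mult_bounded:
  fixes m f :: "'a::euclidean_space \<Rightarrow> real"
  assumes m: "m \<in> borel_measurable borel" "\<And>\<xi>. \<bar>m \<xi>\<bar> \<le> C" and f: "f \<in> L2"
  shows "(\<lambda>\<xi>. m \<xi> * f \<xi>) \<in> L2"
proof (rule L2_bound[OF f])
  show "AE \<xi> in lborel. \<bar>m \<xi> * f \<xi>\<bar> \<le> C * \<bar>f \<xi>\<bar>"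
    by (intro AE_I2) (simp add: abs_mult m mult_right_mono)
qed (use m L2_realD(1)[OF f] in simp)

lemma mulop_abs_l2:
  fixes m f :: "'a::euclidean_space \<Rightarrow> real"
  assumes m: "m \<in> borel_measurable borel" "\<And>\<xi>. \<bar>m \<xi>\<bar> \<le> C" and f: "f \<in> L2"
  shows "mulop m (abs_l2 f) = abs_l2 (\<lambda>\<xi>. m \<xi> * f \<xi>)"
  unfolding mulop_def using rep_abs_l2[OF f]
  by (subst abs_l2_eq_iff) (auto intro!: L2_mult_bounded[OF m] f)

lemma bounded_linear_mulop:
  fixes m :: "'a::euclidean_space \<Rightarrow> real"
  assumes m: "m \<in> borel_measurable borel" "\<And>\<xi>. \<bar>m \<xi>\<bar> \<le> C"
  shows "bounded_linear (mulop m)" and "norm (mulop m X) \<le> C * norm X"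
proof -
  have C0: "C \<ge> 0" using m(2)[of 0] by linarith
  note L = L2_mult_bounded[OF m rep_l2_in]
  show n: "norm (mulop m X) \<le> C * norm X" for X
  proof (rule power2_le_imp_le)
    have "(norm (mulop m X))\<^sup>2 = (LINT \<xi>|lborel. (m \<xi> * rep_l2 X \<xi>)\<^sup>2)"
      unfolding mulop_def by (rule norm_abs_l2_sq[OF L])
    also have "\<dots> \<le> (LINT \<xi>|lborel. C\<^sup>2 * (rep_l2 X \<xi>)\<^sup>2)"
    proof (rule integral_mono)
      show "(m \<xi> * rep_l2 X \<xi>)\<^sup>2 \<le> C\<^sup>2 * (rep_l2 X \<xi>)\<^sup>2" for \<xi>
        using power_mono[OF m(2)[of \<xi>], of 2] by (simp add: power_mult_distrib mult_right_mono)
    qed (use L2_realD(2)[OF L, of X] L2_realD(2)[OF rep_l2_in] in auto)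
    also have "\<dots> = (C * norm X)\<^sup>2"
      using norm_abs_l2_sq[OF rep_l2_in, of X] by (simp add: power_mult_distrib)
    finally show "(norm (mulop m X))\<^sup>2 \<le> (C * norm X)\<^sup>2" .
  qed (use C0 in simp)
  show "bounded_linear (mulop m)"
  proof (rule bounded_linear_intro)
    fix X Y :: "'a l2" and c
    show "mulop m (X + Y) = mulop m X + mulop m Y"
      unfolding mulop_def using rep_l2_add[of X Y]
      by (subst abs_l2_add[symmetric, OF L L], subst abs_l2_eq_iff) (auto intro!: L L2_add simp: algebra_simps)
    show "mulop m (c *\<^sub>R X) = c *\<^sub>R mulop m X"
      unfolding mulop_def using rep_l2_scale[of c X]
      by (subst abs_l2_scale[symmetric, OF L], subst abs_l2_eq_iff) (auto intro!: L L2_scale simp: algebra_simps)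
    show "norm (mulop m X) \<le> norm X * C" using n[of X] by (simp add: mult.commute)
  qed
qed

text \<open>The Fourier transform of a real function in terms of its Hartley transform h: the even
  part of h is the cosine integral and the odd part the sine integral, so the real part is the even
  part and the imaginary part is minus the odd part.\<close>

definition cfourier :: "('a::euclidean_space \<Rightarrow> real) \<Rightarrow> 'a \<Rightarrow> complex" where
  "cfourier h \<xi> = Complex ((h \<xi> + h (- \<xi>)) / 2) ((h (- \<xi>) - h \<xi>) / 2)"

lemma cfourier_inverse: "Re (cfourier h \<xi>) - Im (cfourier h \<xi>) = h \<xi>"
  by (simp add: cfourier_def field_simps)

lemma cfourier_diff: "cfourier g \<xi> - cfourier h \<xi> = cfourier (\<lambda>\<xi>. g \<xi> - h \<xi>) \<xi>"
  by (simp add: cfourier_def complex_eq_iff field_simps)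

lemma norm_cfourier: "(norm (cfourier h \<xi>))\<^sup>2 = ((h \<xi>)\<^sup>2 + (h (- \<xi>))\<^sup>2) / 2"
  unfolding cfourier_def cmod_power2 by (simp add: power2_eq_square field_simps)

lemma cfourier_measurable [measurable]:
  assumes [measurable]: "h \<in> borel_measurable borel"
  shows "cfourier h \<in> borel_measurable borel"
  unfolding cfourier_def[abs_def] Complex_eq by measurable

lemma fourier_integral_hart:
  fixes f :: "'a::euclidean_space \<Rightarrow> real"
  assumes f: "integrable lborel f"
  shows "fourier_integral f = cfourier (hart f)"
proof
  fix \<xi> :: 'a
  have i: "integrable lborel (\<lambda>x. f x * cos (x \<bullet> \<eta>))" "integrable lborel (\<lambda>x. f x * sin (x \<bullet> \<eta>))" for \<eta>
    using f by (auto intro!: integrable_bounded_mult[where C = 1])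
  have ic: "integrable lborel (\<lambda>x. complex_of_real (f x) * cis (- (x \<bullet> \<xi>)))"
  proof (rule Bochner_Integration.integrable_bound)
    show "integrable lborel f" by fact
  qed (use f in \<open>auto simp: norm_mult\<close>)
  have "Re (fourier_integral f \<xi>) = (LINT x|lborel. Re (complex_of_real (f x) * cis (- (x \<bullet> \<xi>))))"
    unfolding fourier_integral_def by (rule integral_Re[OF ic, symmetric])
  also have "\<dots> = (LINT x|lborel. f x * cos (x \<bullet> \<xi>))"
    by (intro Bochner_Integration.integral_cong) auto
  finally have re: "Re (fourier_integral f \<xi>) = (LINT x|lborel. f x * cos (x \<bullet> \<xi>))" .
  have "Im (fourier_integral f \<xi>) = (LINT x|lborel. Im (complex_of_real (f x) * cis (- (x \<bullet> \<xi>))))"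
    unfolding fourier_integral_def by (rule integral_Im[OF ic, symmetric])
  also have "\<dots> = (LINT x|lborel. - (f x * sin (x \<bullet> \<xi>)))"
    by (intro Bochner_Integration.integral_cong) auto
  finally have im: "Im (fourier_integral f \<xi>) = - (LINT x|lborel. f x * sin (x \<bullet> \<xi>))" by simp
  have "hart f \<xi> = (LINT x|lborel. f x * cos (x \<bullet> \<xi>)) + (LINT x|lborel. f x * sin (x \<bullet> \<xi>))"
    "hart f (- \<xi>) = (LINT x|lborel. f x * cos (x \<bullet> \<xi>)) - (LINT x|lborel. f x * sin (x \<bullet> \<xi>))"
    unfolding hart_def cas_def using i[of \<xi>] by (simp_all add: distrib_left right_diff_distrib)
  then show "fourier_integral f \<xi> = cfourier (hart f) \<xi>"
    by (simp add: complex_eq_iff re im cfourier_def)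
qed

lemma lborel_distr_uminus_euclidean: "distr lborel borel uminus = (lborel :: 'a::euclidean_space measure)"
  using lborel_affine[of "-1" "0 :: 'a"] by (simp add: density_1)

text \<open>The squared modulus is the mean of h^2 at \<xi> and -\<xi>, and reflection preserves
  Lebesgue measure.\<close>

lemma nn_integral_cfourier:
  fixes h :: "'a::euclidean_space \<Rightarrow> real"
  assumes [measurable]: "h \<in> borel_measurable borel"
  shows "(\<integral>\<^sup>+ \<xi>. ennreal ((norm (cfourier h \<xi>))\<^sup>2) \<partial>lborel) = (\<integral>\<^sup>+ \<xi>. ennreal ((h \<xi>)\<^sup>2) \<partial>lborel)"
proof -
  have "(\<integral>\<^sup>+ \<xi>. ennreal ((h \<xi>)\<^sup>2) \<partial>lborel) = (\<integral>\<^sup>+ \<xi>. ennreal ((h \<xi>)\<^sup>2) \<partial>distr lborel borel (uminus :: 'a \<Rightarrow> 'a))"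
    by (simp add: lborel_distr_uminus_euclidean)
  also have "\<dots> = (\<integral>\<^sup>+ \<xi>. ennreal ((h (- \<xi>))\<^sup>2) \<partial>lborel)"
    by (subst nn_integral_distr) auto
  finally have r: "(\<integral>\<^sup>+ \<xi>. ennreal ((h (- \<xi>))\<^sup>2) \<partial>lborel) = (\<integral>\<^sup>+ \<xi>. ennreal ((h \<xi>)\<^sup>2) \<partial>lborel)" ..
  have "ennreal ((norm (cfourier h \<xi>))\<^sup>2) = ennreal (1/2) * ennreal ((h \<xi>)\<^sup>2) + ennreal (1/2) * ennreal ((h (- \<xi>))\<^sup>2)" for \<xi>
  proof -
    have e: "ennreal (c * a + c * b) = ennreal c * ennreal a + ennreal c * ennreal b" if "a \<ge> 0" "b \<ge> 0" "c \<ge> 0" for a b c :: real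
      using that by (simp add: ennreal_plus ennreal_mult)
    have "(norm (cfourier h \<xi>))\<^sup>2 = 1/2 * (h \<xi>)\<^sup>2 + 1/2 * (h (- \<xi>))\<^sup>2"
      unfolding norm_cfourier by simp
    then show ?thesis by (simp only: e zero_le_power2)
  qed
  then have "(\<integral>\<^sup>+ \<xi>. ennreal ((norm (cfourier h \<xi>))\<^sup>2) \<partial>lborel) 
     = ennreal (1/2) * (\<integral>\<^sup>+ \<xi>. ennreal ((h \<xi>)\<^sup>2) \<partial>lborel) + ennreal (1/2) * (\<integral>\<^sup>+ \<xi>. ennreal ((h \<xi>)\<^sup>2) \<partial>lborel)"
    by (simp add: nn_integral_add nn_integral_cmult r)
  also have "\<dots> = ennreal (1/2 + 1/2) * (\<integral>\<^sup>+ \<xi>. ennreal ((h \<xi>)\<^sup>2) \<partial>lborel)"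
    by (subst ennreal_plus) (auto simp: distrib_right)
  finally show ?thesis by simp
qed

definition hft :: "('a::euclidean_space \<Rightarrow> real) \<Rightarrow> 'a \<Rightarrow> real" where
  "hft u = rep_l2 (hartley (abs_l2 u))"

lemma hft_L2 [simp]: "hft u \<in> L2" and hft_measurable [measurable]: "hft u \<in> borel_measurable borel"
  by (simp_all add: hft_def)

lemma abs_hft: "abs_l2 (hft u) = hartley (abs_l2 u)"
  by (simp add: hft_def)

lemma ball_truncation:
  fixes f :: "'a::euclidean_space \<Rightarrow> real"
  assumes f: "f \<in> L2"
  shows "(\<lambda>x. indicator (cball 0 R) x * f x) \<in> L2" 
    and "integrable lborel (\<lambda>x. indicator (cball 0 R) x * f x)"
    and "((\<lambda>R. abs_l2 (\<lambda>x. indicator (cball 0 R) x * f x)) \<longlongrightarrow> abs_l2 f) at_top"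
proof -
  have [measurable]: "f \<in> borel_measurable borel" using L2_realD(1)[OF f] .
  show L: "(\<lambda>x. indicator (cball 0 R) x * f x) \<in> L2" for R
    by (rule L2_mult_bounded[OF borel_measurable_indicator _ f, where C = 1]) (auto simp: indicator_def)
  show "integrable lborel (\<lambda>x. indicator (cball 0 R) x * f x)"
  proof (rule Bochner_Integration.integrable_bound)
    show "integrable lborel (\<lambda>x. indicator (cball 0 R) x + (f x)\<^sup>2)"
      using emeasure_lborel_cball_finite[of 0 R] L2_realD(2)[OF f]
      by (intro Bochner_Integration.integrable_add integrable_real_indicator) auto
    have "\<bar>a\<bar> \<le> 1 + a\<^sup>2" for a :: real
      using zero_le_power2[of "\<bar>a\<bar> - 1"] by (simp add: power2_eq_square algebra_simps)
    then show "AE x in lborel. norm (indicator (cball 0 R) x * f x) \<le> norm (indicator (cball 0 R) x + (f x)\<^sup>2)"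
      by (intro AE_I2) (auto simp: indicator_def)
    show "(\<lambda>x. indicator (cball 0 R) x * f x) \<in> borel_measurable lborel" using L2_realD(1)[OF L] by simp
  qed
  have "((\<lambda>R. norm (abs_l2 (\<lambda>x. indicator (cball 0 R) x * f x) - abs_l2 f)) \<longlongrightarrow> 0) at_top"
  proof (rule tendsto_at_topI_sequentially)
    fix R :: "nat \<Rightarrow> real" assume R: "filterlim R at_top sequentially"
    have "(\<lambda>k. LINT x|lborel. (indicator (cball 0 (R k)) x * f x - f x)\<^sup>2) \<longlonglongrightarrow> (LINT x|(lborel :: 'a measure). 0)"
    proof (rule integral_dominated_convergence[where w = "\<lambda>x. (f x)\<^sup>2"])
      show "AE x in lborel. (\<lambda>k. (indicator (cball 0 (R k)) x * f x - f x)\<^sup>2) \<longlonglongrightarrow> 0"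
      proof (intro AE_I2 tendsto_eventually)
        fix x :: 'a
        have "\<forall>\<^sub>F k in sequentially. norm x \<le> R k" using R by (simp add: filterlim_at_top)
        then show "\<forall>\<^sub>F k in sequentially. (indicator (cball 0 (R k)) x * f x - f x)\<^sup>2 = 0"
          by eventually_elim simp
      qed
    qed (use L2_realD(2)[OF f] in \<open>auto simp: indicator_def\<close>)
    then have "(\<lambda>k. (norm (abs_l2 (\<lambda>x. indicator (cball 0 (R k)) x * f x) - abs_l2 f))\<^sup>2) \<longlonglongrightarrow> 0"
      using L f L2_diff[OF L f] by (simp add: norm_abs_l2_sq flip: abs_l2_diff)
    then have "(\<lambda>k. sqrt ((norm (abs_l2 (\<lambda>x. indicator (cball 0 (R k)) x * f x) - abs_l2 f))\<^sup>2)) \<longlonglongrightarrow> sqrt 0"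
      by (intro tendsto_real_sqrt)
    then show "(\<lambda>k. norm (abs_l2 (\<lambda>x. indicator (cball 0 (R k)) x * f x) - abs_l2 f)) \<longlonglongrightarrow> 0" by simp
  qed
  then show "((\<lambda>R. abs_l2 (\<lambda>x. indicator (cball 0 R) x * f x)) \<longlongrightarrow> abs_l2 f) at_top"
    by (simp add: tendsto_norm_zero_iff LIM_zero_iff)
qed

text \<open>On truncations the Fourier integral is \<open>cfourier\<close> of the Hartley integral.
  As \<open>cfourier\<close> preserves L^2 norms, the defining limit reduces to the continuity of
  \<open>hartley\<close>.\<close>

lemma has_fourier_hft:
  fixes f :: "'a::euclidean_space \<Rightarrow> real"
  assumes f: "f \<in> L2"
  shows "has_fourier f (cfourier (hft f))"
proof -
  let ?f = "\<lambda>R x. indicator (cball 0 R) x * f x"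
  note t = ball_truncation[OF f]
  have C: "cfourier (hft f) \<in> L2"
    unfolding L2_def using nn_integral_cfourier[OF hft_measurable[of f]] 
    by (auto intro!: integrableI_nonneg simp: nn_integral_L2)
  have eq: "(\<integral>\<^sup>+ \<xi>. ennreal ((norm (cfourier (hft f) \<xi> - fourier_integral (?f R) \<xi>))\<^sup>2) \<partial>lborel) 
     = ennreal ((norm (hartley (abs_l2 f) - hartley (abs_l2 (?f R))))\<^sup>2)" for R
  proof -
    note h = hartley_abs_l2[OF t(2)[of R] t(1)[of R]]
    have [measurable]: "hart (?f R) \<in> borel_measurable borel" by (rule L2_realD(1)[OF h(1)])
    show ?thesis
      unfolding fourier_integral_hart[OF t(2)] cfourier_diff
      by (subst nn_integral_cfourier) (auto simp: nn_integral_L2 L2_diff h abs_l2_diff abs_hft)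
  qed
  have "((\<lambda>R. (norm (hartley (abs_l2 f) - hartley (abs_l2 (?f R))))\<^sup>2) \<longlongrightarrow> (norm (hartley (abs_l2 f) - hartley (abs_l2 f)))\<^sup>2) at_top"
    by (intro tendsto_intros bounded_linear.tendsto[OF bounded_linear_hartley] t(3))
  then have "((\<lambda>R. ennreal ((norm (hartley (abs_l2 f) - hartley (abs_l2 (?f R))))\<^sup>2)) \<longlongrightarrow> ennreal 0) at_top"
    by (intro tendsto_ennrealI) simp
  then show ?thesis unfolding has_fourier_def eq using f C by simp
qed

lemma has_fourier_unique:
  fixes f :: "'a::euclidean_space \<Rightarrow> real"
  assumes F: "has_fourier f F" and G: "has_fourier f G"
  shows "AE \<xi> in lborel. F \<xi> = G \<xi>"
proof -
  let ?f = "\<lambda>R x. indicator (cball 0 R) x * f x"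
  have f: "f \<in> L2" using F by (simp add: has_fourier_def)
  have [measurable]: "F \<in> borel_measurable borel" "G \<in> borel_measurable borel"
    using F G by (simp_all add: has_fourier_def L2_def)
  have [measurable]: "fourier_integral (?f R) \<in> borel_measurable borel" for R
    unfolding fourier_integral_hart[OF ball_truncation(2)[OF f]]
    using hartley_abs_l2(1)[OF ball_truncation(2,1)[OF f]] L2_realD(1) by (intro cfourier_measurable) blast
  have "((\<lambda>R. 2 * (\<integral>\<^sup>+ \<xi>. ennreal ((norm (F \<xi> - fourier_integral (?f R) \<xi>))\<^sup>2) \<partial>lborel)
     + 2 * (\<integral>\<^sup>+ \<xi>. ennreal ((norm (G \<xi> - fourier_integral (?f R) \<xi>))\<^sup>2) \<partial>lborel)) \<longlongrightarrow> 2 * 0 + 2 * 0) at_top"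
    using F G unfolding has_fourier_def by (intro tendsto_add tendsto_mult_ennreal tendsto_const) auto
  moreover have "(\<integral>\<^sup>+ \<xi>. ennreal ((norm (F \<xi> - G \<xi>))\<^sup>2) \<partial>lborel) \<le> 
      2 * (\<integral>\<^sup>+ \<xi>. ennreal ((norm (F \<xi> - fourier_integral (?f R) \<xi>))\<^sup>2) \<partial>lborel)
     + 2 * (\<integral>\<^sup>+ \<xi>. ennreal ((norm (G \<xi> - fourier_integral (?f R) \<xi>))\<^sup>2) \<partial>lborel)" for R
  proof -
    have "ennreal ((norm (a - b))\<^sup>2) \<le> 2 * ennreal ((norm (a - c))\<^sup>2) + 2 * ennreal ((norm (b - c))\<^sup>2)" for a b c :: complex
    proof -
      have "norm (a - b) \<le> norm (a - c) + norm (b - c)"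
        using norm_triangle_ineq4[of "a - c" "b - c"] by simp
      then have "(norm (a - b))\<^sup>2 \<le> (norm (a - c) + norm (b - c))\<^sup>2" by (intro power_mono) auto
      also have "\<dots> \<le> 2 * (norm (a - c))\<^sup>2 + 2 * (norm (b - c))\<^sup>2"
        using zero_le_power2[of "norm (a - c) - norm (b - c)"] by (simp add: power2_eq_square algebra_simps)
      finally have "ennreal ((norm (a - b))\<^sup>2) \<le> ennreal (2 * (norm (a - c))\<^sup>2 + 2 * (norm (b - c))\<^sup>2)" by (rule ennreal_leI)
      then show ?thesis by (simp add: ennreal_mult)
    qed
    then have "(\<integral>\<^sup>+ \<xi>. ennreal ((norm (F \<xi> - G \<xi>))\<^sup>2) \<partial>lborel) \<le> (\<integral>\<^sup>+ \<xi>. 2 * ennreal ((norm (F \<xi> - fourier_integral (?f R) \<xi>))\<^sup>2) + 2 * ennreal ((norm (G \<xi> - fourier_integral (?f R) \<xi>))\<^sup>2) \<partial>lborel)"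
      by (intro nn_integral_mono)
    also have "\<dots> = 2 * (\<integral>\<^sup>+ \<xi>. ennreal ((norm (F \<xi> - fourier_integral (?f R) \<xi>))\<^sup>2) \<partial>lborel)
     + 2 * (\<integral>\<^sup>+ \<xi>. ennreal ((norm (G \<xi> - fourier_integral (?f R) \<xi>))\<^sup>2) \<partial>lborel)"
      by (subst nn_integral_add) (auto simp: nn_integral_cmult)
    finally show ?thesis .
  qed
  ultimately have "(\<integral>\<^sup>+ \<xi>. ennreal ((norm (F \<xi> - G \<xi>))\<^sup>2) \<partial>lborel) \<le> 2 * 0 + 2 * 0"
    by (intro tendsto_lowerbound[OF _ always_eventually]) auto
  then have "(\<integral>\<^sup>+ \<xi>. ennreal ((norm (F \<xi> - G \<xi>))\<^sup>2) \<partial>lborel) = 0" by simp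
  then have "AE \<xi> in lborel. ennreal ((norm (F \<xi> - G \<xi>))\<^sup>2) = 0"
    by (subst (asm) nn_integral_0_iff_AE) auto
  then show ?thesis by eventually_elim (auto simp: ennreal_eq_0_iff)
qed

text \<open>Evenness of m is essential, because \<open>cfourier\<close> combines the values at \<xi>
  and -\<xi>: multiplication by m has to act in the same way on both.\<close>

lemma has_multiplier_iff:
  fixes m :: "'a::euclidean_space \<Rightarrow> real"
  assumes even: "\<And>\<xi>. m (- \<xi>) = m \<xi>"
  shows "has_multiplier m u g \<longleftrightarrow> u \<in> L2 \<and> g \<in> L2 \<and> (AE \<xi> in lborel. hft g \<xi> = m \<xi> * hft u \<xi>)"
proof safe
  assume "has_multiplier m u g"
  then obtain U G where U: "has_fourier u U" and G: "has_fourier g G" 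
    and GU: "AE \<xi> in lborel. G \<xi> = complex_of_real (m \<xi>) * U \<xi>"
    unfolding has_multiplier_def by blast
  show uL: "u \<in> L2" and gL: "g \<in> L2" using U G by (auto simp: has_fourier_def)
  from has_fourier_unique[OF U has_fourier_hft[OF uL]] has_fourier_unique[OF G has_fourier_hft[OF gL]] GU
  show "AE \<xi> in lborel. hft g \<xi> = m \<xi> * hft u \<xi>"
  proof eventually_elim
    case (elim \<xi>)
    have "hft g \<xi> = Re (cfourier (hft g) \<xi>) - Im (cfourier (hft g) \<xi>)" by (simp only: cfourier_inverse)
    also have "\<dots> = m \<xi> * (Re (cfourier (hft u) \<xi>) - Im (cfourier (hft u) \<xi>))"
    proof -
      have "cfourier (hft g) \<xi> = complex_of_real (m \<xi>) * cfourier (hft u) \<xi>" using elim by simp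
      then show ?thesis by (simp only: Re_complex_of_real Im_complex_of_real times_complex.sel) (simp add: algebra_simps)
    qed
    also have "\<dots> = m \<xi> * hft u \<xi>" by (simp only: cfourier_inverse)
    finally show ?case .
  qed
next
  assume u: "u \<in> L2" and g: "g \<in> L2" and ae: "AE \<xi> in lborel. hft g \<xi> = m \<xi> * hft u \<xi>"
  have ae': "AE \<xi> in lborel. hft g (- \<xi>) = m (- \<xi>) * hft u (- \<xi>)"
    using AE_lborel_affine[OF _ ae, of "-1" 0] by simp
  have "AE \<xi> in lborel. cfourier (hft g) \<xi> = complex_of_real (m \<xi>) * cfourier (hft u) \<xi>"
    using ae ae' by eventually_elim (simp add: cfourier_def even complex_eq_iff algebra_simps)
  then show "has_multiplier m u g"
    unfolding has_multiplier_def using has_fourier_hft[OF u] has_fourier_hft[OF g] by blast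
qed

lemma fourier_multiplier_l2:
  fixes m :: "'a::euclidean_space \<Rightarrow> real"
  assumes even: "\<And>\<xi>. m (- \<xi>) = m \<xi>" and u: "u \<in> L2" and mu: "(\<lambda>\<xi>. m \<xi> * hft u \<xi>) \<in> L2"
  shows "has_multiplier m u (fourier_multiplier m u)"
    and "fourier_multiplier m u \<in> L2"
    and "abs_l2 (fourier_multiplier m u) = (1 / (2 * pi) ^ DIM('a)) *\<^sub>R hartley (abs_l2 (\<lambda>\<xi>. m \<xi> * hft u \<xi>))"
proof -
  let ?N = "(2 * pi) ^ DIM('a)"
  define g where "g = rep_l2 ((1 / ?N) *\<^sub>R hartley (abs_l2 (\<lambda>\<xi>. m \<xi> * hft u \<xi>)))"
  have "hartley (abs_l2 g) = abs_l2 (\<lambda>\<xi>. m \<xi> * hft u \<xi>)"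
    by (simp add: g_def hartley_scale hartley_hartley)
  then have "AE \<xi> in lborel. hft g \<xi> = m \<xi> * hft u \<xi>"
    using rep_abs_l2[OF mu] by (simp add: hft_def)
  then have "has_multiplier m u g"
    unfolding has_multiplier_iff[of m, OF even] using u by (simp add: g_def)
  then show M: "has_multiplier m u (fourier_multiplier m u)"
    unfolding fourier_multiplier_def by (rule someI[of "has_multiplier m u"])
  then have "AE \<xi> in lborel. hft (fourier_multiplier m u) \<xi> = m \<xi> * hft u \<xi>" 
    and L: "fourier_multiplier m u \<in> L2"
    unfolding has_multiplier_iff[of m, OF even] by auto
  then have h: "hartley (abs_l2 (fourier_multiplier m u)) = abs_l2 (\<lambda>\<xi>. m \<xi> * hft u \<xi>)"
    by (subst abs_hft[symmetric]) (auto simp: abs_l2_eq_iff mu)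
  then show "abs_l2 (fourier_multiplier m u) = (1 / ?N) *\<^sub>R hartley (abs_l2 (\<lambda>\<xi>. m \<xi> * hft u \<xi>))"
    by (simp add: hartley_hartley flip: h)
  show "fourier_multiplier m u \<in> L2" by fact
qed

section \<open>Bessel potential spaces on the frequency side\<close>

lemma bessel_symbol_measurable [measurable]: "bessel_symbol s \<in> borel_measurable borel"
  unfolding bessel_symbol_def[abs_def] by measurable

lemma bessel_symbol_even: "bessel_symbol s (- \<xi>) = bessel_symbol s \<xi>"
  by (simp add: bessel_symbol_def)

lemma one_plus_norm_sq: "1 + (norm \<xi>)\<^sup>2 > 0" "1 + (norm \<xi>)\<^sup>2 \<noteq> 0"
  using zero_le_power2[of "norm \<xi>"] by linarith+

lemma bessel_symbol_pos: "bessel_symbol s \<xi> > 0"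
  unfolding bessel_symbol_def by (simp add: one_plus_norm_sq)

lemma bessel_symbol_add: "bessel_symbol (s + t) \<xi> = bessel_symbol s \<xi> * bessel_symbol t \<xi>"
  unfolding bessel_symbol_def by (simp add: powr_add add_divide_distrib)

lemma bessel_symbol_minus: "bessel_symbol s \<xi> * bessel_symbol (- s) \<xi> = 1" 
  using bessel_symbol_add[of s "- s" \<xi>] by (simp add: bessel_symbol_def one_plus_norm_sq)

lemma bessel_symbol_neg_le: "s \<ge> 0 \<Longrightarrow> \<bar>bessel_symbol (- s) \<xi>\<bar> \<le> 1"
  using powr_mono[of "- s / 2" 0 "1 + (norm \<xi>)\<^sup>2"] by (simp add: bessel_symbol_def one_plus_norm_sq)

lemma sobolev_iff: "u \<in> sobolev s \<longleftrightarrow> u \<in> L2 \<and> (\<lambda>\<xi>. bessel_symbol s \<xi> * hft u \<xi>) \<in> L2"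
proof safe
  assume "u \<in> sobolev s"
  then obtain g where u: "u \<in> L2" and g: "has_multiplier (bessel_symbol s) u g" by (auto simp: sobolev_def)
  show "u \<in> L2" by fact
  show "(\<lambda>\<xi>. bessel_symbol s \<xi> * hft u \<xi>) \<in> L2"
    using g unfolding has_multiplier_iff[of "bessel_symbol s", OF bessel_symbol_even]
    by (intro L2_cong_AE[OF hft_L2[of g]]) auto
next
  assume "u \<in> L2" "(\<lambda>\<xi>. bessel_symbol s \<xi> * hft u \<xi>) \<in> L2"
  then show "u \<in> sobolev s"
    unfolding sobolev_def using fourier_multiplier_l2(1)[of "bessel_symbol s", OF bessel_symbol_even] by blast
qed

text \<open>Normalised to be isometric: the factor compensates for \<open>hartley\<close> scaling
  norms by sqrt ((2 \<pi>)^n). It identifies H^s with \<open>l2\<close>, so that limits, closures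
  and the variational argument take place in one complete space.\<close>

definition sob :: "real \<Rightarrow> ('a::euclidean_space \<Rightarrow> real) \<Rightarrow> 'a l2" where
  "sob s u = (1 / sqrt ((2 * pi) ^ DIM('a))) *\<^sub>R abs_l2 (\<lambda>\<xi>. bessel_symbol s \<xi> * hft u \<xi>)"

lemma sobolev_norm_sob: 
  fixes u :: "'a::euclidean_space \<Rightarrow> real"
  assumes "u \<in> sobolev s" shows "sobolev_norm s u = norm (sob s u)"
proof -
  note u = assms[unfolded sobolev_iff]
  note f = fourier_multiplier_l2[of "bessel_symbol s", OF bessel_symbol_even conjunct1[OF u] conjunct2[OF u]]
  define c where "c = sqrt ((2 * pi) ^ DIM('a))"
  have c: "c > 0" "c * c = (2 * pi) ^ DIM('a)" by (simp_all add: c_def)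
  show ?thesis
    unfolding sobolev_norm_def sob_def norm_abs_l2[OF f(2), symmetric] f(3) norm_scaleR norm_hartley c(2)[symmetric]
    using c(1) by simp
qed

lemma hft_add: "u \<in> L2 \<Longrightarrow> v \<in> L2 \<Longrightarrow> AE \<xi> in lborel. hft (\<lambda>x. u x + v x) \<xi> = hft u \<xi> + hft v \<xi>"
  unfolding hft_def abs_l2_add hartley_add by (rule rep_l2_add)

lemma hft_scale: "u \<in> L2 \<Longrightarrow> AE \<xi> in lborel. hft (\<lambda>x. c * u x) \<xi> = c * hft u \<xi>"
  unfolding hft_def abs_l2_scale hartley_scale by (rule rep_l2_scale)

lemma sob_add:
  assumes u: "u \<in> sobolev s" and v: "v \<in> sobolev s"
  shows "(\<lambda>x. u x + v x) \<in> sobolev s" "sob s (\<lambda>x. u x + v x) = sob s u + sob s v"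
proof -
  note u = u[unfolded sobolev_iff] and v = v[unfolded sobolev_iff]
  have ae: "AE \<xi> in lborel. bessel_symbol s \<xi> * hft u \<xi> + bessel_symbol s \<xi> * hft v \<xi> = bessel_symbol s \<xi> * hft (\<lambda>x. u x + v x) \<xi>"
    using hft_add[of u v] u v by (auto elim!: AE_mp simp: algebra_simps)
  then have L: "(\<lambda>\<xi>. bessel_symbol s \<xi> * hft (\<lambda>x. u x + v x) \<xi>) \<in> L2"
    by (rule L2_cong_AE[rotated 2]) (use u v in \<open>auto intro: L2_add\<close>)
  then show "(\<lambda>x. u x + v x) \<in> sobolev s" unfolding sobolev_iff using u v by (auto intro: L2_add)
  have "abs_l2 (\<lambda>\<xi>. bessel_symbol s \<xi> * hft (\<lambda>x. u x + v x) \<xi>) = abs_l2 (\<lambda>\<xi>. bessel_symbol s \<xi> * hft u \<xi> + bessel_symbol s \<xi> * hft v \<xi>)"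
    using L ae u v by (subst abs_l2_eq_iff) (auto intro: L2_add)
  then show "sob s (\<lambda>x. u x + v x) = sob s u + sob s v"
    unfolding sob_def using u v by (simp add: abs_l2_add scaleR_add_right)
qed

lemma sob_scale:
  assumes u: "u \<in> sobolev s"
  shows "(\<lambda>x. c * u x) \<in> sobolev s" "sob s (\<lambda>x. c * u x) = c *\<^sub>R sob s u"
proof -
  note u = u[unfolded sobolev_iff]
  have ae: "AE \<xi> in lborel. c * (bessel_symbol s \<xi> * hft u \<xi>) = bessel_symbol s \<xi> * hft (\<lambda>x. c * u x) \<xi>"
    using hft_scale[of u c] u by (auto elim!: AE_mp)
  then have L: "(\<lambda>\<xi>. bessel_symbol s \<xi> * hft (\<lambda>x. c * u x) \<xi>) \<in> L2"
    by (rule L2_cong_AE[rotated 2]) (use u in \<open>auto intro: L2_scale\<close>)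
  then show "(\<lambda>x. c * u x) \<in> sobolev s" unfolding sobolev_iff using u by (auto intro: L2_scale)
  have "abs_l2 (\<lambda>\<xi>. bessel_symbol s \<xi> * hft (\<lambda>x. c * u x) \<xi>) = abs_l2 (\<lambda>\<xi>. c * (bessel_symbol s \<xi> * hft u \<xi>))"
    using L ae u by (subst abs_l2_eq_iff) (auto intro: L2_scale)
  then show "sob s (\<lambda>x. c * u x) = c *\<^sub>R sob s u"
    unfolding sob_def using u by (simp add: abs_l2_scale)
qed

lemma sob_diff:
  assumes u: "u \<in> sobolev s" and v: "v \<in> sobolev s"
  shows "(\<lambda>x. u x - v x) \<in> sobolev s" "sob s (\<lambda>x. u x - v x) = sob s u - sob s v"
  using sob_add[OF u sob_scale(1)[OF v, of "-1"]] sob_scale(2)[OF v, of "-1"] by simp_all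

text \<open>A bounded operator recovers u from \<open>sob s u\<close>, hence convergence under
  \<open>sob s\<close> implies convergence in L^2.\<close>

lemma sob_inverse:
  fixes u :: "'a::euclidean_space \<Rightarrow> real"
  assumes u: "u \<in> sobolev s" and s: "s \<ge> 0"
  shows "abs_l2 u = (1 / sqrt ((2 * pi) ^ DIM('a))) *\<^sub>R hartley (mulop (bessel_symbol (- s)) (sob s u))"
proof -
  define c where "c = sqrt ((2 * pi) ^ DIM('a))"
  have c: "c > 0" "c * c = (2 * pi) ^ DIM('a)" by (simp_all add: c_def)
  note u = u[unfolded sobolev_iff]
  have "mulop (bessel_symbol (- s)) (sob s u) = (1 / sqrt ((2 * pi) ^ DIM('a))) *\<^sub>R mulop (bessel_symbol (- s)) (abs_l2 (\<lambda>\<xi>. bessel_symbol s \<xi> * hft u \<xi>))"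
    unfolding sob_def by (rule linear_scale[OF bounded_linear.linear[OF bounded_linear_mulop(1)[OF bessel_symbol_measurable bessel_symbol_neg_le[OF s]]]])
  also have "mulop (bessel_symbol (- s)) (abs_l2 (\<lambda>\<xi>. bessel_symbol s \<xi> * hft u \<xi>)) = abs_l2 (\<lambda>\<xi>. (bessel_symbol s \<xi> * bessel_symbol (- s) \<xi>) * hft u \<xi>)"
    using u by (subst mulop_abs_l2[OF bessel_symbol_measurable bessel_symbol_neg_le[OF s]]) (auto simp: mult_ac)
  also have "\<dots> = hartley (abs_l2 u)" by (simp add: bessel_symbol_minus abs_hft)
  finally have m: "mulop (bessel_symbol (- s)) (sob s u) = (1 / c) *\<^sub>R hartley (abs_l2 u)"
    by (simp add: c_def)
  show ?thesis 
    unfolding m hartley_scale hartley_hartley c_def[symmetric] c(2)[symmetric] using c(1) by simp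
qed

lemma sob_norm_L2: 
  fixes u :: "'a::euclidean_space \<Rightarrow> real"
  assumes u: "u \<in> sobolev s" and s: "s \<ge> 0"
  shows "L2_norm u = norm (mulop (bessel_symbol (- s)) (sob s u))"
  using sob_inverse[OF assms] u by (simp add: norm_hartley norm_abs_l2[symmetric] sobolev_iff)

text \<open>Makes statements about all functions in H^s and statements about all vectors of
  \<open>l2\<close> interchangeable.\<close>

lemma sob_surj:
  fixes X :: "'a::euclidean_space l2"
  assumes s: "s \<ge> 0"
  obtains u where "u \<in> sobolev s" "sob s u = X"
proof
  define c where "c = sqrt ((2 * pi) ^ DIM('a))"
  have c: "c > 0" "c * c = (2 * pi) ^ DIM('a)" by (simp_all add: c_def)
  define u where "u = rep_l2 ((1 / c) *\<^sub>R hartley (mulop (bessel_symbol (- s)) X))"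
  have uL: "u \<in> L2" by (simp add: u_def)
  have Lm: "(\<lambda>\<xi>. bessel_symbol (- s) \<xi> * rep_l2 X \<xi>) \<in> L2"
    by (rule L2_mult_bounded[OF bessel_symbol_measurable bessel_symbol_neg_le[OF s] rep_l2_in])
  have "hartley (abs_l2 u) = c *\<^sub>R mulop (bessel_symbol (- s)) X"
    unfolding u_def abs_rep_l2 hartley_scale hartley_hartley c(2)[symmetric] using c(1) by simp
  also have "\<dots> = abs_l2 (\<lambda>\<xi>. c * (bessel_symbol (- s) \<xi> * rep_l2 X \<xi>))"
    unfolding mulop_def using Lm by (simp add: abs_l2_scale)
  finally have "AE \<xi> in lborel. hft u \<xi> = c * (bessel_symbol (- s) \<xi> * rep_l2 X \<xi>)"
    unfolding hft_def using rep_abs_l2[OF L2_scale[OF Lm]] by simp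
  then have ae: "AE \<xi> in lborel. c * rep_l2 X \<xi> = bessel_symbol s \<xi> * hft u \<xi>"
  proof eventually_elim
    case (elim \<xi>)
    then have "bessel_symbol s \<xi> * hft u \<xi> = (bessel_symbol s \<xi> * bessel_symbol (- s) \<xi>) * (c * rep_l2 X \<xi>)"
      by (simp only: mult_ac)
    then show ?case by (simp add: bessel_symbol_minus)
  qed
  then have L: "(\<lambda>\<xi>. bessel_symbol s \<xi> * hft u \<xi>) \<in> L2"
    by (rule L2_cong_AE[rotated 2]) (auto intro: L2_scale)
  then show "u \<in> sobolev s" using uL by (simp add: sobolev_iff)
  have "abs_l2 (\<lambda>\<xi>. bessel_symbol s \<xi> * hft u \<xi>) = abs_l2 (\<lambda>\<xi>. c * rep_l2 X \<xi>)"
    using ae by (subst abs_l2_eq_iff) (auto intro: L2_scale L)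
  then show "sob s u = X" unfolding sob_def c_def[symmetric] using c by (simp add: abs_l2_scale)
qed

text \<open>
  The symbol \<open>|\<xi>|\<^sup>s\<close> of \<open>(-\<Delta>)\<^sup>s\<^sup>/\<^sup>2\<close>, divided by the Bessel symbol that is already contained in \<open>sob s u\<close>.
\<close>

definition fracw :: "real \<Rightarrow> 'a::euclidean_space \<Rightarrow> real" where
  "fracw s \<xi> = norm \<xi> powr s * bessel_symbol (- s) \<xi>"

lemma fracw_measurable [measurable]: "fracw s \<in> borel_measurable borel"
  unfolding fracw_def[abs_def] by measurable

lemma fracw_le: 
  assumes "s \<ge> 0" shows "\<bar>fracw s \<xi>\<bar> \<le> 1"
proof -
  have "norm \<xi> powr s \<le> sqrt (1 + (norm \<xi>)\<^sup>2) powr s"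
    using assms real_sqrt_le_mono[of "(norm \<xi>)\<^sup>2" "1 + (norm \<xi>)\<^sup>2"] by (intro powr_mono2) auto
  also have "\<dots> = bessel_symbol s \<xi>"
    unfolding bessel_symbol_def by (simp add: powr_half_sqrt[symmetric] powr_powr add_nonneg_nonneg)
  finally have "norm \<xi> powr s * bessel_symbol (- s) \<xi> \<le> bessel_symbol s \<xi> * bessel_symbol (- s) \<xi>"
    using bessel_symbol_pos[of "- s" \<xi>] by (intro mult_right_mono) auto
  then show ?thesis unfolding fracw_def using bessel_symbol_pos[of "- s" \<xi>] by (simp add: bessel_symbol_minus abs_mult)
qed

lemma mulop_fracw_sob:
  fixes u :: "'a::euclidean_space \<Rightarrow> real"
  assumes u: "u \<in> sobolev s" and s: "s \<ge> 0"
  shows "(\<lambda>\<xi>. norm \<xi> powr s * hft u \<xi>) \<in> L2"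
    and "mulop (fracw s) (sob s u) = (1 / sqrt ((2 * pi) ^ DIM('a))) *\<^sub>R abs_l2 (\<lambda>\<xi>. norm \<xi> powr s * hft u \<xi>)"
proof -
  note u = u[unfolded sobolev_iff]
  have eq: "norm \<xi> powr s * hft u \<xi> = fracw s \<xi> * (bessel_symbol s \<xi> * hft u \<xi>)" for \<xi>
    using bessel_symbol_minus[of s \<xi>] by (simp add: fracw_def mult_ac)
  show "(\<lambda>\<xi>. norm \<xi> powr s * hft u \<xi>) \<in> L2"
    unfolding eq using u by (intro L2_mult_bounded[OF fracw_measurable fracw_le[OF s]]) auto
  have "mulop (fracw s) (sob s u) = (1 / sqrt ((2 * pi) ^ DIM('a))) *\<^sub>R mulop (fracw s) (abs_l2 (\<lambda>\<xi>. bessel_symbol s \<xi> * hft u \<xi>))"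
    unfolding sob_def by (rule linear_scale[OF bounded_linear.linear[OF bounded_linear_mulop(1)[OF fracw_measurable fracw_le[OF s]]]])
  also have "mulop (fracw s) (abs_l2 (\<lambda>\<xi>. bessel_symbol s \<xi> * hft u \<xi>)) = abs_l2 (\<lambda>\<xi>. norm \<xi> powr s * hft u \<xi>)"
    unfolding eq using u by (intro mulop_abs_l2[OF fracw_measurable fracw_le[OF s]]) auto
  finally show "mulop (fracw s) (sob s u) = (1 / sqrt ((2 * pi) ^ DIM('a))) *\<^sub>R abs_l2 (\<lambda>\<xi>. norm \<xi> powr s * hft u \<xi>)" .
qed

lemma frac_laplacian_sob:
  fixes u :: "'a::euclidean_space \<Rightarrow> real"
  assumes u: "u \<in> sobolev s" and s: "s \<ge> 0"
  shows "frac_laplacian (s / 2) u \<in> L2"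
    and "abs_l2 (frac_laplacian (s / 2) u) = (1 / sqrt ((2 * pi) ^ DIM('a))) *\<^sub>R hartley (mulop (fracw s) (sob s u))"
proof -
  define c where "c = sqrt ((2 * pi) ^ DIM('a))"
  have c: "c > 0" "c * c = (2 * pi) ^ DIM('a)" by (simp_all add: c_def)
  note L = mulop_fracw_sob[OF u s]
  have u: "u \<in> L2" using u by (simp add: sobolev_iff)
  note f = fourier_multiplier_l2[of "\<lambda>\<xi>. norm \<xi> powr s", OF _ u L(1)]
  have d: "frac_laplacian (s / 2) u = fourier_multiplier (\<lambda>\<xi>. norm \<xi> powr s) u"
    by (simp add: frac_laplacian_def)
  show "frac_laplacian (s / 2) u \<in> L2" unfolding d using f(2) by simp
  show "abs_l2 (frac_laplacian (s / 2) u) = (1 / sqrt ((2 * pi) ^ DIM('a))) *\<^sub>R hartley (mulop (fracw s) (sob s u))"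
    unfolding d f(3)[OF norm_minus_cancel[THEN arg_cong[where f = "\<lambda>r. r powr s"]]] L(2) hartley_scale c_def[symmetric] c(2)[symmetric] using c(1) by simp
qed

lemma frac_laplacian_inner:
  fixes u v :: "'a::euclidean_space \<Rightarrow> real"
  assumes u: "u \<in> sobolev s" and v: "v \<in> sobolev s" and s: "s \<ge> 0"
  shows "(LINT x|lborel. frac_laplacian (s / 2) u x * frac_laplacian (s / 2) v x) 
    = inner (mulop (fracw s) (sob s u)) (mulop (fracw s) (sob s v))"
  using frac_laplacian_sob[OF u s] frac_laplacian_sob[OF v s]
  by (simp add: inner_abs_l2[symmetric] inner_hartley)

lemma frac_laplacian_norm:
  fixes u :: "'a::euclidean_space \<Rightarrow> real"
  assumes u: "u \<in> sobolev s" and s: "s \<ge> 0"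
  shows "L2_norm (frac_laplacian (s / 2) u) = norm (mulop (fracw s) (sob s u))"
  using frac_laplacian_sob[OF u s] by (simp add: norm_abs_l2[symmetric] norm_hartley)

section \<open>Test functions\<close>

abbreviation pd :: "'a::euclidean_space \<Rightarrow> ('a \<Rightarrow> real) \<Rightarrow> 'a \<Rightarrow> real" where
  "pd b f \<equiv> \<lambda>x. frechet_derivative f (at x) b"

lemma smooth_coinduct:
  assumes f: "f \<in> S" 
    and S: "\<And>f. f \<in> S \<Longrightarrow> (\<forall>x. f differentiable (at x)) \<and> (\<forall>b\<in>Basis. pd b f \<in> S)"
  shows "smooth f"
proof -
  have "partial_deriv bs f \<in> S" if "bs \<in> lists Basis" for bs
    using that by (induction bs) (auto simp: f dest: S)
  then show ?thesis unfolding smooth_def using S by blast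
qed

lemma smooth_differentiable: "smooth f \<Longrightarrow> f differentiable (at x)"
  unfolding smooth_def by (drule bspec[of _ _ "[]"]) auto

lemma partial_deriv_append: "partial_deriv (bs @ cs) f = partial_deriv bs (partial_deriv cs f)"
  by (induction bs) auto

lemma smooth_pd: 
  assumes "smooth f" "b \<in> Basis" shows "smooth (pd b f)"
  unfolding smooth_def
proof (intro ballI allI)
  fix bs :: "'a list" and x assume "bs \<in> lists Basis"
  then have "bs @ [b] \<in> lists Basis" using assms(2) by simp
  then have "partial_deriv (bs @ [b]) f differentiable (at x)" using assms(1) unfolding smooth_def by blast
  then show "partial_deriv bs (pd b f) differentiable (at x)" by (simp only: partial_deriv_append partial_deriv.simps)
qed

lemma smooth_has_derivative: "smooth f \<Longrightarrow> (f has_derivative frechet_derivative f (at x)) (at x)"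
  using smooth_differentiable frechet_derivative_works by blast

text \<open>The polynomial factor makes this family of flat functions closed under differentiation.\<close>

definition flat_exp :: "real poly \<Rightarrow> real \<Rightarrow> real" where
  "flat_exp p x = (if x > 0 then poly p (inverse x) * exp (- inverse x) else 0)"

lemma poly_exp_tendsto_0: "((\<lambda>y::real. poly q y * exp (- y)) \<longlongrightarrow> 0) at_top"
proof -
  have "((\<lambda>y. \<Sum>i\<le>degree q. coeff q i * (y ^ i / exp y)) \<longlongrightarrow> (\<Sum>i\<le>degree q. coeff q i * 0)) at_top"
    by (intro tendsto_sum tendsto_mult tendsto_const tendsto_power_div_exp_0)
  moreover have "(\<lambda>y. \<Sum>i\<le>degree q. coeff q i * (y ^ i / exp y)) = (\<lambda>y. poly q y * exp (- y))"
    by (auto simp: poly_altdef sum_distrib_right exp_minus divide_inverse mult.assoc)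
  ultimately show ?thesis by simp
qed

text \<open>With y = 1/x, the derivative of p(y) exp (-y) in x is y^2 (p - p')(y) exp (-y), and
  \<open>[:0, 0, 1:]\<close> is the polynomial y^2.\<close>

lemma flat_exp_deriv: "(flat_exp p has_real_derivative flat_exp ([:0, 0, 1:] * (p - pderiv p)) x) (at x)"
proof -
  consider "x > 0" | "x < 0" | "x = 0" by linarith
  then show ?thesis
  proof cases
    case 1
    have "((\<lambda>x. poly p (inverse x) * exp (- inverse x)) has_real_derivative 
       flat_exp ([:0, 0, 1:] * (p - pderiv p)) x) (at x)"
      unfolding flat_exp_def using 1
      by (auto intro!: derivative_eq_intros simp: power2_eq_square algebra_simps)
    then show ?thesis
      by (rule has_field_derivative_transform_within_open[of _ _ _ "{0<..}"]) (use 1 in \<open>auto simp: flat_exp_def\<close>)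
  next
    case 2
    have "((\<lambda>x. 0) has_real_derivative 0) (at x)" by simp
    then have "(flat_exp p has_real_derivative 0) (at x)"
      by (rule has_field_derivative_transform_within_open[of _ _ _ "{..<0}"]) (use 2 in \<open>auto simp: flat_exp_def\<close>)
    then show ?thesis using 2 by (simp add: flat_exp_def)
  next
    case 3
    have "((\<lambda>h. (flat_exp p (0 + h) - flat_exp p 0) / h) \<longlongrightarrow> 0) (at 0)"
    proof (rule filterlim_split_at)
      show "((\<lambda>h. (flat_exp p (0 + h) - flat_exp p 0) / h) \<longlongrightarrow> 0) (at_left 0)"
        by (rule tendsto_eventually) (auto simp: eventually_at_filter flat_exp_def)
      \<comment> \<open>Dividing by h multiplies the polynomial in 1/h by its variable, which is
        \<open>pCons 0 p\<close>.\<close>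
      have "((\<lambda>h. poly (pCons 0 p) (inverse h) * exp (- inverse h)) \<longlongrightarrow> 0) (at_right 0)"
        by (rule filterlim_compose[OF poly_exp_tendsto_0 filterlim_inverse_at_top_right])
      then show "((\<lambda>h. (flat_exp p (0 + h) - flat_exp p 0) / h) \<longlongrightarrow> 0) (at_right 0)"
        by (rule Lim_transform_eventually) (auto simp: eventually_at_filter flat_exp_def divide_inverse)
    qed
    then show ?thesis unfolding 3 DERIV_def by (simp add: flat_exp_def)
  qed
qed

text \<open>Every constructor has a derivative that is again expressible by the constructors, so
  smoothness of compound expressions comes from \<open>smooth_coinduct\<close> and first derivatives
  alone. Negation is written as multiplication by the constant -1.\<close>

inductive_set smooth_closure :: "('a::euclidean_space \<Rightarrow> real) set" where
  base: "smooth f \<Longrightarrow> f \<in> smooth_closure"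
| const: "(\<lambda>x. c) \<in> smooth_closure"
| inner: "(\<lambda>x. x \<bullet> v) \<in> smooth_closure"
| add: "f \<in> smooth_closure \<Longrightarrow> g \<in> smooth_closure \<Longrightarrow> (\<lambda>x. f x + g x) \<in> smooth_closure"
| mult: "f \<in> smooth_closure \<Longrightarrow> g \<in> smooth_closure \<Longrightarrow> (\<lambda>x. f x * g x) \<in> smooth_closure"
| inverse: "f \<in> smooth_closure \<Longrightarrow> (\<And>x. f x \<noteq> 0) \<Longrightarrow> (\<lambda>x. inverse (f x)) \<in> smooth_closure"
| sin: "f \<in> smooth_closure \<Longrightarrow> (\<lambda>x. sin (f x)) \<in> smooth_closure"
| cos: "f \<in> smooth_closure \<Longrightarrow> (\<lambda>x. cos (f x)) \<in> smooth_closure"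
| flat: "f \<in> smooth_closure \<Longrightarrow> (\<lambda>x. flat_exp p (f x)) \<in> smooth_closure"

lemmas smooth_closure_rules = smooth_closure.const smooth_closure.inner smooth_closure.add smooth_closure.mult
  smooth_closure.sin smooth_closure.cos

lemma smooth_closure_derivative:
  fixes f :: "'a::euclidean_space \<Rightarrow> real"
  assumes "f \<in> smooth_closure"
  shows "\<exists>D. (\<forall>x. (f has_derivative D x) (at x)) \<and> (\<forall>b\<in>Basis. (\<lambda>x. D x b) \<in> smooth_closure)"
  using assms
proof induction
  case (base f)
  then show ?case
    by (intro exI[of _ "\<lambda>x. frechet_derivative f (at x)"])
       (auto intro: smooth_closure.base smooth_pd smooth_has_derivative)
next
  case (const c)
  then show ?case by (intro exI[of _ "\<lambda>x h. 0"]) (auto intro: smooth_closure.const)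
next
  case (inner v)
  then show ?case by (intro exI[of _ "\<lambda>x h. h \<bullet> v"]) (auto intro!: smooth_closure.const derivative_eq_intros)
next
  case (add f g)
  then obtain Df Dg where "\<And>x. (f has_derivative Df x) (at x)" "\<And>b. b \<in> Basis \<Longrightarrow> (\<lambda>x. Df x b) \<in> smooth_closure"
    "\<And>x. (g has_derivative Dg x) (at x)" "\<And>b. b \<in> Basis \<Longrightarrow> (\<lambda>x. Dg x b) \<in> smooth_closure" by blast
  then show ?case by (intro exI[of _ "\<lambda>x h. Df x h + Dg x h"]) (auto intro!: has_derivative_add smooth_closure.add)
next
  case (mult f g)
  then obtain Df Dg where "\<And>x. (f has_derivative Df x) (at x)" "\<And>b. b \<in> Basis \<Longrightarrow> (\<lambda>x. Df x b) \<in> smooth_closure"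
    "\<And>x. (g has_derivative Dg x) (at x)" "\<And>b. b \<in> Basis \<Longrightarrow> (\<lambda>x. Dg x b) \<in> smooth_closure" by blast
  then show ?case using mult by (intro exI[of _ "\<lambda>x h. f x * Dg x h + Df x h * g x"]) (auto intro!: has_derivative_mult smooth_closure.add smooth_closure.mult)
next
  case (inverse f)
  then obtain Df where "\<And>x. (f has_derivative Df x) (at x)" "\<And>b. b \<in> Basis \<Longrightarrow> (\<lambda>x. Df x b) \<in> smooth_closure" by blast
  then show ?case using inverse 
    by (intro exI[of _ "\<lambda>x h. (- 1) * (inverse (f x) * Df x h * inverse (f x))"]) 
       (auto intro!: derivative_eq_intros smooth_closure.mult[OF smooth_closure.const[of "-1"], simplified] smooth_closure.mult smooth_closure.inverse)
next
  case (sin f)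
  then obtain Df where "\<And>x. (f has_derivative Df x) (at x)" "\<And>b. b \<in> Basis \<Longrightarrow> (\<lambda>x. Df x b) \<in> smooth_closure" by blast
  then show ?case using sin 
    by (intro exI[of _ "\<lambda>x h. Df x h * cos (f x)"]) (auto intro!: has_derivative_sin smooth_closure.mult smooth_closure.cos)
next
  case (cos f)
  then obtain Df where "\<And>x. (f has_derivative Df x) (at x)" "\<And>b. b \<in> Basis \<Longrightarrow> (\<lambda>x. Df x b) \<in> smooth_closure" by blast
  note D = this
  show ?case
  proof (intro exI[of _ "\<lambda>x h. Df x h * ((-1) * sin (f x))"] conjI allI ballI)
    fix x show "((\<lambda>x. cos (f x)) has_derivative (\<lambda>h. Df x h * ((-1) * sin (f x)))) (at x)"
      using has_derivative_cos[OF D(1)[of x]] by simp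
    fix b :: 'a assume "b \<in> Basis"
    then show "(\<lambda>x. Df x b * ((-1) * sin (f x))) \<in> smooth_closure"
      by (intro smooth_closure.mult smooth_closure.const smooth_closure.sin cos.hyps D)
  qed
next
  case (flat f p)
  then obtain Df where "\<And>x. (f has_derivative Df x) (at x)" "\<And>b. b \<in> Basis \<Longrightarrow> (\<lambda>x. Df x b) \<in> smooth_closure" by blast
  note D = this
  show ?case
    by (intro exI[of _ "\<lambda>x h. Df x h * flat_exp ([:0, 0, 1:] * (p - pderiv p)) (f x)"] conjI allI ballI
          DERIV_compose_FDERIV[OF flat_exp_deriv] smooth_closure.mult smooth_closure.flat flat.hyps D)
qed

lemma smooth_closure_smooth: 
  assumes "f \<in> smooth_closure" shows "smooth f"
proof (rule smooth_coinduct[OF assms])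
  fix f :: "'a \<Rightarrow> real" assume "f \<in> smooth_closure"
  then obtain D where D: "\<And>x. (f has_derivative D x) (at x)" "\<And>b. b \<in> Basis \<Longrightarrow> (\<lambda>x. D x b) \<in> smooth_closure"
    using smooth_closure_derivative by blast
  have "frechet_derivative f (at x) = D x" for x using frechet_derivative_at[OF D(1)] by simp
  then show "(\<forall>x. f differentiable (at x)) \<and> (\<forall>b\<in>Basis. pd b f \<in> smooth_closure)"
    using D by (auto simp: differentiable_def)
qed

section \<open>Algebra of test functions\<close>

lemma smooth_add: "smooth f \<Longrightarrow> smooth g \<Longrightarrow> smooth (\<lambda>x. f x + g x)"
  and smooth_mult: "smooth f \<Longrightarrow> smooth g \<Longrightarrow> smooth (\<lambda>x. f x * g x)"
  and smooth_const: "smooth (\<lambda>x. c)"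
  by (rule smooth_closure_smooth, (intro smooth_closure.add smooth_closure.mult smooth_closure.const smooth_closure.base; assumption)?)+

lemma pd_mult: 
  assumes f: "smooth f" and g: "smooth g" 
  shows "pd b (\<lambda>x. f x * g x) = (\<lambda>x. f x * pd b g x + pd b f x * g x)"
proof
  fix x show "pd b (\<lambda>x. f x * g x) x = f x * pd b g x + pd b f x * g x"
    using frechet_derivative_at[OF has_derivative_mult[OF smooth_has_derivative[OF f] smooth_has_derivative[OF g]], of x] by metis
qed

lemma smooth_continuous: "smooth f \<Longrightarrow> continuous_on A f"
  by (meson continuous_at_imp_continuous_on differentiable_imp_continuous_within smooth_differentiable)

abbreviation supp :: "('a::euclidean_space \<Rightarrow> real) \<Rightarrow> 'a set" where
  "supp \<phi> \<equiv> closure (support_on UNIV \<phi>)"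

lemma not_supp: "x \<notin> supp \<phi> \<Longrightarrow> \<phi> x = 0"
  using closure_subset[of "support_on UNIV \<phi>"] by (auto simp: support_on_def)

lemma supp_subset_closed: "closed C \<Longrightarrow> (\<And>x. x \<notin> C \<Longrightarrow> \<phi> x = 0) \<Longrightarrow> supp \<phi> \<subseteq> C"
  by (rule closure_minimal) (auto simp: support_on_def)

lemma test_funI:
  assumes "smooth \<phi>" "compact C" "C \<subseteq> A" "\<And>x. x \<notin> C \<Longrightarrow> \<phi> x = 0"
  shows "\<phi> \<in> test_fun A"
proof -
  have "supp \<phi> \<subseteq> C" using assms by (intro supp_subset_closed compact_imp_closed)
  moreover from this have "compact (supp \<phi>)"
    using compact_Int_closed[OF assms(2) closed_closure[of "support_on UNIV \<phi>"]] by (simp add: Int_absorb1)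
  ultimately show ?thesis unfolding test_fun_def using assms by auto
qed

lemma test_funD:
  assumes "\<phi> \<in> test_fun A" shows "smooth \<phi>" "compact (supp \<phi>)" "supp \<phi> \<subseteq> A"
  using assms by (auto simp: test_fun_def)

lemma test_fun_mono: "\<phi> \<in> test_fun A \<Longrightarrow> A \<subseteq> B \<Longrightarrow> \<phi> \<in> test_fun B"
  by (auto simp: test_fun_def)

lemma test_fun_UNIV: "\<phi> \<in> test_fun A \<Longrightarrow> \<phi> \<in> test_fun UNIV"
  by (auto simp: test_fun_def)

lemma test_fun_zero: "(\<lambda>x. 0) \<in> test_fun A"
  by (rule test_funI[of _ "{}"]) (auto intro: smooth_const)

lemma test_fun_add: 
  assumes "\<phi> \<in> test_fun A" "\<psi> \<in> test_fun A" shows "(\<lambda>x. \<phi> x + \<psi> x) \<in> test_fun A"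
  by (rule test_funI[of _ "supp \<phi> \<union> supp \<psi>"]) (use test_funD[OF assms(1)] test_funD[OF assms(2)] in \<open>auto intro: smooth_add simp: not_supp\<close>)

lemma test_fun_mult_smooth: 
  assumes "\<phi> \<in> test_fun A" "smooth \<psi>" shows "(\<lambda>x. \<phi> x * \<psi> x) \<in> test_fun A"
  by (rule test_funI[of _ "supp \<phi>"]) (use test_funD[OF assms(1)] assms(2) in \<open>auto intro: smooth_mult simp: not_supp\<close>)

lemma test_fun_mult: 
  assumes "\<phi> \<in> test_fun A" "\<psi> \<in> test_fun B" shows "(\<lambda>x. \<phi> x * \<psi> x) \<in> test_fun A"
  by (rule test_fun_mult_smooth[OF assms(1) test_funD(1)[OF assms(2)]])

lemma test_fun_scale: 
  assumes "\<phi> \<in> test_fun A" shows "(\<lambda>x. c * \<phi> x) \<in> test_fun A"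
  using test_fun_mult_smooth[OF assms smooth_const[of c]] by (simp add: mult.commute)

lemma test_fun_diff: 
  assumes "\<phi> \<in> test_fun A" "\<psi> \<in> test_fun A" shows "(\<lambda>x. \<phi> x - \<psi> x) \<in> test_fun A"
  using test_fun_add[OF assms(1) test_fun_scale[OF assms(2), of "-1"]] by simp

lemma test_fun_sum:
  "finite I \<Longrightarrow> (\<And>i. i \<in> I \<Longrightarrow> \<phi> i \<in> test_fun A) \<Longrightarrow> (\<lambda>x. \<Sum>i\<in>I. \<phi> i x) \<in> test_fun A"
  by (induction I rule: finite_induct) (auto intro: test_fun_zero test_fun_add)

lemma test_fun_pd: 
  fixes \<phi> :: "'a::euclidean_space \<Rightarrow> real"
  assumes "\<phi> \<in> test_fun A" "b \<in> Basis" shows "pd b \<phi> \<in> test_fun A"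
proof (rule test_funI[of _ "supp \<phi>"])
  note t = test_funD[OF assms(1)]
  show "smooth (pd b \<phi>)" using t assms(2) by (intro smooth_pd)
  fix x assume x: "x \<notin> supp \<phi>"
  have "(\<phi> has_derivative (\<lambda>h. 0)) (at x)"
  proof (rule has_derivative_transform_within_open[of "\<lambda>x. 0" _ _ _ "- supp \<phi>"])
    show "((\<lambda>x. 0::real) has_derivative (\<lambda>h. 0)) (at x)" by simp
  qed (use x in \<open>auto simp: not_supp\<close>)
  then show "pd b \<phi> x = 0" using frechet_derivative_at by metis
qed (use test_funD[OF assms(1)] in auto)

lemma test_fun_bounded: 
  assumes "\<phi> \<in> test_fun A" obtains M where "\<And>x. \<bar>\<phi> x\<bar> \<le> M" "M \<ge> 0"
proof -
  note t = test_funD[OF assms]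
  have "compact (\<phi> ` supp \<phi>)" by (intro compact_continuous_image smooth_continuous t)
  then obtain M where M: "\<And>y. y \<in> \<phi> ` supp \<phi> \<Longrightarrow> \<bar>y\<bar> \<le> M" 
    using compact_imp_bounded bounded_iff by (metis real_norm_def)
  have "\<bar>\<phi> x\<bar> \<le> max M 0" for x using M[of "\<phi> x"] not_supp[of x \<phi>] by (cases "x \<in> supp \<phi>") auto
  then show ?thesis by (intro that[of "max M 0"]) auto
qed

lemma test_fun_measurable: "\<phi> \<in> test_fun A \<Longrightarrow> \<phi> \<in> borel_measurable borel"
  by (intro borel_measurable_continuous_onI smooth_continuous test_funD(1))

lemma test_fun_bddL1: 
  assumes "\<phi> \<in> test_fun A" shows "bddL1 \<phi>"
proof -
  obtain M where M: "\<And>x. \<bar>\<phi> x\<bar> \<le> M" "M \<ge> 0" using test_fun_bounded[OF assms] by metis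
  have "integrable lborel \<phi>"
  proof (rule Bochner_Integration.integrable_bound)
    show "integrable lborel (\<lambda>x. M * indicator (supp \<phi>) x)"
      using emeasure_compact_finite[OF test_funD(2)[OF assms]]
      by (intro integrable_mult_right integrable_real_indicator) (auto simp: emeasure_lborel_countable less_top)
    show "AE x in lborel. norm (\<phi> x) \<le> norm (M * indicator (supp \<phi>) x)"
      using M not_supp[of _ \<phi>] by (intro AE_I2) (auto simp: indicator_def)
  qed (use test_fun_measurable[OF assms] in simp)
  then show ?thesis using M unfolding bddL1_def by blast
qed

section \<open>Integration by parts and decay of the transform\<close>

lemma smooth_directional_deriv:
  assumes "smooth \<phi>"
  shows "((\<lambda>t. \<phi> (x + t *\<^sub>R b)) has_real_derivative pd b \<phi> (x + t *\<^sub>R b)) (at t)"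
proof -
  have l: "bounded_linear (frechet_derivative \<phi> (at (x + t *\<^sub>R b)))" 
    using smooth_has_derivative[OF assms] has_derivative_bounded_linear by blast
  have "((\<lambda>t. x + t *\<^sub>R b) has_derivative (\<lambda>h. h *\<^sub>R b)) (at t)" by (auto intro!: derivative_eq_intros)
  from has_derivative_compose[OF this smooth_has_derivative[OF assms]]
  have "((\<lambda>t. \<phi> (x + t *\<^sub>R b)) has_derivative (\<lambda>h. frechet_derivative \<phi> (at (x + t *\<^sub>R b)) (h *\<^sub>R b))) (at t)" .
  moreover have "(\<lambda>h. frechet_derivative \<phi> (at (x + t *\<^sub>R b)) (h *\<^sub>R b)) = (*) (pd b \<phi> (x + t *\<^sub>R b))"
    by (auto simp: linear_scale[OF bounded_linear.linear[OF l]])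
  ultimately show ?thesis by (simp add: has_field_derivative_def)
qed

text \<open>Difference quotients integrate to zero by translation invariance, and they converge to
  the partial derivative under the domination supplied by the mean value theorem.\<close>

lemma integral_pd_test_fun:
  fixes \<phi> :: "'a::euclidean_space \<Rightarrow> real"
  assumes \<phi>: "\<phi> \<in> test_fun UNIV" and b: "b \<in> Basis"
  shows "(LINT x|lborel. pd b \<phi> x) = 0"
proof -
  note t = test_funD[OF \<phi>]
  have p: "pd b \<phi> \<in> test_fun UNIV" by (rule test_fun_pd[OF \<phi> b])
  obtain M where M: "\<And>x. \<bar>pd b \<phi> x\<bar> \<le> M" "M \<ge> 0" using test_fun_bounded[OF p] by auto
  obtain R where R: "\<And>x. x \<in> supp \<phi> \<Longrightarrow> norm x \<le> R" using compact_imp_bounded[OF t(2)] by (auto simp: bounded_iff)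
  define h where "h k = inverse (real (Suc k))" for k
  have h: "h k > 0" "h k \<le> 1" for k by (auto simp: h_def divide_simps)
  have hlim: "h \<longlonglongrightarrow> 0" unfolding h_def by (rule LIMSEQ_inverse_real_of_nat)
  define q where "q k x = (\<phi> (x + h k *\<^sub>R b) - \<phi> x) / h k" for k x
  have [measurable]: "\<phi> \<in> borel_measurable borel" by (rule test_fun_measurable[OF \<phi>])
  have i: "integrable lborel \<phi>" by (rule bddL1_integrable[OF test_fun_bddL1[OF \<phi>]])
  have qi: "(LINT x|lborel. q k x) = 0" for k
    unfolding q_def using lborel_translate[of \<phi> "h k *\<^sub>R b"] i by simp
  have "(\<lambda>k. LINT x|lborel. q k x) \<longlonglongrightarrow> (LINT x|lborel. pd b \<phi> x)"
  \<comment> \<open>The steps \<open>h k\<close> are at most 1, so all difference quotients vanish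
    outside the ball of radius R + 1.\<close>
  proof (rule integral_dominated_convergence[where w = "\<lambda>x. M * indicator (cball 0 (R + 1)) x"])
    show "integrable lborel (\<lambda>x::'a. M * indicator (cball 0 (R + 1)) x)"
      using emeasure_lborel_cball_finite[of "0::'a" "R + 1"] by (intro integrable_mult_right integrable_real_indicator) auto
    show "AE x in lborel. (\<lambda>k. q k x) \<longlonglongrightarrow> pd b \<phi> x"
    proof (rule AE_I2)
      fix x
      have "(\<lambda>h. (\<phi> (x + (0 + h) *\<^sub>R b) - \<phi> (x + 0 *\<^sub>R b)) / h) \<midarrow>0\<rightarrow> pd b \<phi> (x + 0 *\<^sub>R b)"
        using smooth_directional_deriv[OF t(1), of x b 0] by (simp add: DERIV_def)
      then have "(\<lambda>h. (\<phi> (x + h *\<^sub>R b) - \<phi> x) / h) \<midarrow>0\<rightarrow> pd b \<phi> x" by simp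
      moreover have "filterlim h (at 0) sequentially"
        using hlim h(1) by (auto simp: filterlim_at intro!: always_eventually) (metis less_irrefl)
      ultimately show "(\<lambda>k. q k x) \<longlonglongrightarrow> pd b \<phi> x"
        unfolding q_def by (rule filterlim_compose)
    qed
    show "AE x in lborel. norm (q k x) \<le> M * indicator (cball 0 (R + 1)) x" for k
    proof (rule AE_I2)
      fix x
      show "norm (q k x) \<le> M * indicator (cball 0 (R + 1)) x"
      proof (cases "norm x \<le> R + 1")
        case True
        obtain z where "\<phi> (x + h k *\<^sub>R b) - \<phi> (x + 0 *\<^sub>R b) = (h k - 0) * pd b \<phi> (x + z *\<^sub>R b)"
          using MVT2[OF h(1)[of k], of "\<lambda>t. \<phi> (x + t *\<^sub>R b)" "\<lambda>t. pd b \<phi> (x + t *\<^sub>R b)"] smooth_directional_deriv[OF t(1)] by blast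
        then have "q k x = pd b \<phi> (x + z *\<^sub>R b)" using h(1)[of k] by (simp add: q_def)
        then show ?thesis using M True by simp
      next
        case False
        have "norm x \<le> norm (x + h k *\<^sub>R b) + norm (h k *\<^sub>R b)"
          using norm_triangle_ineq4[of "x + h k *\<^sub>R b" "h k *\<^sub>R b"] by simp
        moreover have "norm (h k *\<^sub>R b) \<le> 1" using h[of k] b by simp
        ultimately have "norm (x + h k *\<^sub>R b) > R" "norm x > R" using False by linarith+
        then have "\<phi> (x + h k *\<^sub>R b) = 0" "\<phi> x = 0"
          using R by (metis not_less not_supp)+
        then show ?thesis using M by (simp add: q_def indicator_def)
      qed
    qed
  qed (use test_fun_measurable[OF p] in \<open>auto simp: q_def\<close>)
  then show ?thesis unfolding qi using LIMSEQ_unique tendsto_const by metis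
qed

lemma smooth_cas: "smooth (\<lambda>x. cas (x \<bullet> \<xi>))"
  unfolding cas_def by (intro smooth_closure_smooth smooth_closure_rules)

lemma pd_cas: "pd b (\<lambda>x. cas (x \<bullet> \<xi>)) = (\<lambda>x. (b \<bullet> \<xi>) * (cos (x \<bullet> \<xi>) - sin (x \<bullet> \<xi>)))"
proof
  fix x
  have "((\<lambda>x. cas (x \<bullet> \<xi>)) has_derivative (\<lambda>h. (h \<bullet> \<xi>) * (cos (x \<bullet> \<xi>) - sin (x \<bullet> \<xi>)))) (at x)"
    unfolding cas_def by (auto intro!: derivative_eq_intros simp: algebra_simps)
  then show "pd b (\<lambda>x. cas (x \<bullet> \<xi>)) x = (b \<bullet> \<xi>) * (cos (x \<bullet> \<xi>) - sin (x \<bullet> \<xi>))"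
    using frechet_derivative_at by metis
qed

lemma pd_pd_cas: "pd b (pd b (\<lambda>x. cas (x \<bullet> \<xi>))) = (\<lambda>x. - (b \<bullet> \<xi>)\<^sup>2 * cas (x \<bullet> \<xi>))"
proof
  fix x
  have "((\<lambda>x. (b \<bullet> \<xi>) * (cos (x \<bullet> \<xi>) - sin (x \<bullet> \<xi>))) has_derivative (\<lambda>h. - (b \<bullet> \<xi>) * (h \<bullet> \<xi>) * cas (x \<bullet> \<xi>))) (at x)"
    unfolding cas_def by (auto intro!: derivative_eq_intros simp: algebra_simps)
  then show "pd b (pd b (\<lambda>x. cas (x \<bullet> \<xi>))) x = - (b \<bullet> \<xi>)\<^sup>2 * cas (x \<bullet> \<xi>)"
    unfolding pd_cas using frechet_derivative_at by (metis (no_types, lifting) power2_eq_square mult_minus_left)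
qed

text \<open>Two derivatives are moved together: a single one turns \<open>cas\<close> into cos -
  sin, while the second returns a multiple of \<open>cas\<close>.\<close>

lemma hart_pd_pd:
  fixes \<phi> :: "'a::euclidean_space \<Rightarrow> real"
  assumes \<phi>: "\<phi> \<in> test_fun UNIV" and b: "b \<in> Basis"
  shows "hart (pd b (pd b \<phi>)) \<xi> = - (b \<bullet> \<xi>)\<^sup>2 * hart \<phi> \<xi>"
proof -
  define c where "c = (\<lambda>x. cas (x \<bullet> \<xi>))"
  have c: "smooth c" "smooth (pd b c)" using smooth_pd[OF smooth_cas b] by (auto simp: c_def smooth_cas)
  have p: "pd b \<phi> \<in> test_fun UNIV" "pd b (pd b \<phi>) \<in> test_fun UNIV" by (intro test_fun_pd \<phi> b)+
  note s = test_funD(1)[OF \<phi>] test_funD(1)[OF p(1)]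
  note i = bddL1_integrable[OF test_fun_bddL1]
  have t: "(\<lambda>x. pd b \<phi> x * c x) \<in> test_fun UNIV" "(\<lambda>x. \<phi> x * pd b c x) \<in> test_fun UNIV"
    "(\<lambda>x. pd b \<phi> x * pd b c x) \<in> test_fun UNIV" "(\<lambda>x. pd b (pd b \<phi>) x * c x) \<in> test_fun UNIV"
    "(\<lambda>x. \<phi> x * pd b (pd b c) x) \<in> test_fun UNIV"
    by (intro test_fun_mult_smooth \<phi> p c smooth_pd b)+
  have "(LINT x|lborel. pd b \<phi> x * pd b c x + pd b (pd b \<phi>) x * c x) = 0"
    using integral_pd_test_fun[OF t(1) b] pd_mult[OF s(2) c(1), of b] by simp
  moreover have "(LINT x|lborel. \<phi> x * pd b (pd b c) x + pd b \<phi> x * pd b c x) = 0"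
    using integral_pd_test_fun[OF t(2) b] pd_mult[OF s(1) c(2), of b] by simp
  ultimately have "(LINT x|lborel. pd b (pd b \<phi>) x * c x) = (LINT x|lborel. \<phi> x * pd b (pd b c) x)"
    using i[OF t(3)] i[OF t(4)] i[OF t(5)] by simp
  also have "\<dots> = (LINT x|lborel. - (b \<bullet> \<xi>)\<^sup>2 * (\<phi> x * cas (x \<bullet> \<xi>)))"
    unfolding c_def fun_cong[OF pd_pd_cas] by (simp add: mult_ac)
  finally show ?thesis unfolding hart_def c_def by simp
qed

definition neg_laplacian :: "('a::euclidean_space \<Rightarrow> real) \<Rightarrow> 'a \<Rightarrow> real" where
  "neg_laplacian \<phi> x = (\<Sum>b\<in>Basis. - pd b (pd b \<phi>) x)"

lemma test_fun_neg_laplacian: "\<phi> \<in> test_fun A \<Longrightarrow> neg_laplacian \<phi> \<in> test_fun A"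
  unfolding neg_laplacian_def[abs_def]
  using test_fun_scale[of _ A "-1"] by (intro test_fun_sum) (auto intro: test_fun_pd)

lemma hart_neg_laplacian:
  fixes \<phi> :: "'a::euclidean_space \<Rightarrow> real"
  assumes \<phi>: "\<phi> \<in> test_fun UNIV"
  shows "hart (neg_laplacian \<phi>) \<xi> = (norm \<xi>)\<^sup>2 * hart \<phi> \<xi>"
proof -
  have i: "integrable lborel (\<lambda>x. - pd b (pd b \<phi>) x * cas (x \<bullet> \<xi>))" if "b \<in> Basis" for b
    using hart_integrable[OF bddL1_integrable[OF test_fun_bddL1[OF test_fun_pd[OF test_fun_pd[OF \<phi> that] that]]], of \<xi>] by simp
  have "hart (neg_laplacian \<phi>) \<xi> = (\<Sum>b\<in>Basis. - hart (pd b (pd b \<phi>)) \<xi>)"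
    unfolding hart_def neg_laplacian_def sum_distrib_right using i by simp
  also have "\<dots> = (\<Sum>b\<in>Basis. (b \<bullet> \<xi>)\<^sup>2) * hart \<phi> \<xi>"
    by (simp add: hart_pd_pd[OF \<phi>] sum_distrib_right)
  also have "(\<Sum>b\<in>Basis. (b \<bullet> \<xi>)\<^sup>2) = (norm \<xi>)\<^sup>2"
    unfolding power2_norm_eq_inner by (subst euclidean_inner) (simp add: power2_eq_square inner_commute)
  finally show ?thesis .
qed

text \<open>Even powers of |\<xi>| are symbols of local operators. This gives the decay of
  \<open>hart \<phi>\<close>, and it is what makes the Taylor terms of the subordination formula
  invisible to a function vanishing on the support.\<close>

lemma hart_iter_neg_laplacian:
  fixes \<phi> :: "'a::euclidean_space \<Rightarrow> real"
  assumes \<phi>: "\<phi> \<in> test_fun A"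
  shows "(neg_laplacian ^^ k) \<phi> \<in> test_fun A" and "hart ((neg_laplacian ^^ k) \<phi>) \<xi> = (norm \<xi>) ^ (2 * k) * hart \<phi> \<xi>"
proof -
  show t: "(neg_laplacian ^^ k) \<phi> \<in> test_fun A" for k
    by (induction k) (auto intro: \<phi> test_fun_neg_laplacian)
  show "hart ((neg_laplacian ^^ k) \<phi>) \<xi> = (norm \<xi>) ^ (2 * k) * hart \<phi> \<xi>"
    by (induction k) (auto simp: hart_neg_laplacian[OF test_fun_UNIV[OF t]] power2_eq_square)
qed

lemma test_fun_hart_L2:
  assumes \<phi>: "\<phi> \<in> test_fun A"
  shows "\<phi> \<in> L2" "hart \<phi> \<in> L2" "AE \<xi> in lborel. hft \<phi> \<xi> = hart \<phi> \<xi>"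
proof -
  show L: "\<phi> \<in> L2" by (rule bddL1_L2[OF test_fun_bddL1[OF \<phi>]])
  note h = hartley_abs_l2[OF bddL1_integrable[OF test_fun_bddL1[OF \<phi>]] L]
  show "hart \<phi> \<in> L2" "AE \<xi> in lborel. hft \<phi> \<xi> = hart \<phi> \<xi>"
    unfolding hft_def h(2) using h(1) by (auto intro: rep_abs_l2)
qed

text \<open>Both the transform and its product with |\<xi>|^(2k), the transform of an iterated
  Laplacian, are square integrable, and together they dominate any weight of polynomial
  growth.\<close>

lemma test_fun_hart_weight_L2:
  fixes \<phi> :: "'a::euclidean_space \<Rightarrow> real"
  assumes \<phi>: "\<phi> \<in> test_fun A" and m[measurable]: "m \<in> borel_measurable borel" 
    and le: "\<And>\<xi>. \<bar>m \<xi>\<bar> \<le> C * (1 + (norm \<xi>) ^ (2 * k))" 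
  shows "(\<lambda>\<xi>. m \<xi> * hart \<phi> \<xi>) \<in> L2"
proof -
  have [measurable]: "hart \<phi> \<in> borel_measurable borel" using test_fun_hart_L2(2)[OF \<phi>] by (rule L2_realD)
  have C0: "C \<ge> 0" using le[of 0] by (cases k) (auto intro: order_trans[OF abs_ge_zero] simp: zero_le_mult_iff dest: order_trans[OF abs_ge_zero])
  have L: "(\<lambda>\<xi>. C * (hart \<phi> \<xi> + (norm \<xi>) ^ (2 * k) * hart \<phi> \<xi>)) \<in> L2"
    using test_fun_hart_L2(2)[OF hart_iter_neg_laplacian(1)[OF \<phi>], of k] test_fun_hart_L2(2)[OF \<phi>]
    by (intro L2_scale L2_add) (simp_all add: hart_iter_neg_laplacian(2)[OF \<phi>, abs_def])
  show ?thesis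
  proof (rule L2_bound[OF L, where C = 1])
    show "AE \<xi> in lborel. \<bar>m \<xi> * hart \<phi> \<xi>\<bar> \<le> 1 * \<bar>C * (hart \<phi> \<xi> + (norm \<xi>) ^ (2 * k) * hart \<phi> \<xi>)\<bar>"
    proof (rule AE_I2)
      fix \<xi>
      have "\<bar>m \<xi>\<bar> * \<bar>hart \<phi> \<xi>\<bar> \<le> (C * (1 + (norm \<xi>) ^ (2 * k))) * \<bar>hart \<phi> \<xi>\<bar>"
        by (rule mult_right_mono[OF le]) simp
      also have "\<dots> = \<bar>(C * (1 + (norm \<xi>) ^ (2 * k))) * hart \<phi> \<xi>\<bar>" using C0 by (simp add: abs_mult)
      finally show "\<bar>m \<xi> * hart \<phi> \<xi>\<bar> \<le> 1 * \<bar>C * (hart \<phi> \<xi> + (norm \<xi>) ^ (2 * k) * hart \<phi> \<xi>)\<bar>"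
        by (simp add: abs_mult[symmetric] algebra_simps)
    qed
  qed simp
qed

lemma test_fun_sobolev:
  fixes \<phi> :: "'a::euclidean_space \<Rightarrow> real"
  assumes \<phi>: "\<phi> \<in> test_fun A" and s: "s \<ge> 0"
  shows "\<phi> \<in> sobolev s"
proof -
  obtain k :: nat where k: "s / 2 \<le> real k" using real_arch_simple by blast
  have "\<bar>bessel_symbol s \<xi>\<bar> \<le> 2 ^ k * (1 + (norm \<xi>) ^ (2 * k))" for \<xi> :: 'a
  proof -
    have "\<bar>bessel_symbol s \<xi>\<bar> \<le> (1 + (norm \<xi>)\<^sup>2) powr real k"
      unfolding bessel_symbol_def using k powr_mono[of "s/2" "real k" "1 + (norm \<xi>)\<^sup>2"] by simp
    also have "\<dots> = (1 + (norm \<xi>)\<^sup>2) ^ k" by (rule powr_realpow[OF one_plus_norm_sq(1)])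
    also have "\<dots> \<le> (2 * max 1 ((norm \<xi>)\<^sup>2)) ^ k" by (intro power_mono) auto
    also have "\<dots> = 2 ^ k * (max 1 ((norm \<xi>)\<^sup>2)) ^ k" by (rule power_mult_distrib)
    also have "(max 1 ((norm \<xi>)\<^sup>2)) ^ k \<le> 1 + ((norm \<xi>)\<^sup>2) ^ k" by (auto simp: max_def)
    finally show ?thesis by (simp add: power_mult)
  qed
  from test_fun_hart_weight_L2[OF \<phi> bessel_symbol_measurable this]
  have L: "(\<lambda>\<xi>. bessel_symbol s \<xi> * hart \<phi> \<xi>) \<in> L2" .
  have "(\<lambda>\<xi>. bessel_symbol s \<xi> * hft \<phi> \<xi>) \<in> L2"
    by (rule L2_cong_AE[OF L]) (use test_fun_hart_L2(3)[OF \<phi>] in \<open>auto elim!: AE_mp\<close>)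
  then show ?thesis unfolding sobolev_iff using test_fun_hart_L2(1)[OF \<phi>] by simp
qed

text \<open>The quotient u / (u + v) of two flat exponentials in the squared distance: u is positive
  exactly inside radius R and v exactly outside radius r. Since r < R, the denominator never
  vanishes.\<close>

lemma smooth_ball_cutoff:
  fixes c :: "'a::euclidean_space"
  assumes "0 < r" "r < R"
  obtains \<psi> where "smooth \<psi>" "\<And>x. x \<in> cball c r \<Longrightarrow> \<psi> x = 1" "\<And>x. x \<notin> cball c R \<Longrightarrow> \<psi> x = 0" "\<And>x. 0 \<le> \<psi> x \<and> \<psi> x \<le> 1"
proof -
  define e where "e = flat_exp 1"
  have e: "e t > 0 \<longleftrightarrow> t > 0" "e t \<ge> 0" "t \<le> 0 \<Longrightarrow> e t = 0" for t by (auto simp: e_def flat_exp_def)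
  define d where "d x = (\<Sum>b\<in>Basis. ((x \<bullet> b) + (- c \<bullet> b)) * ((x \<bullet> b) + (- c \<bullet> b)))" for x
  have dd: "d x = (dist c x)\<^sup>2" for x
    unfolding d_def dist_norm norm_minus_commute[of c] power2_norm_eq_inner
    by (subst euclidean_inner) (simp add: inner_simps)
  have sum_SM: "(\<lambda>x. \<Sum>b\<in>B. g b x) \<in> smooth_closure" if "finite B" "\<And>b. b \<in> B \<Longrightarrow> g b \<in> smooth_closure" for g :: "'a \<Rightarrow> 'a \<Rightarrow> real" and B :: "'a set"
    using that by (induction B rule: finite_induct) (auto intro: smooth_closure.const smooth_closure.add)
  have dS: "d \<in> smooth_closure" unfolding d_def[abs_def] by (intro sum_SM finite_Basis smooth_closure_rules)
  define u where "u x = e (R\<^sup>2 + (-1) * d x)" for x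
  define v where "v x = e (d x + (- (r\<^sup>2)))" for x
  have uv: "u \<in> smooth_closure" "v \<in> smooth_closure"
    unfolding u_def[abs_def] v_def[abs_def] e_def by (intro smooth_closure.flat smooth_closure.add smooth_closure.mult smooth_closure.const dS)+
  have rR: "r\<^sup>2 < R\<^sup>2" using assms by (intro power_strict_mono) auto
  have pos: "u x + v x > 0" for x
  proof (cases "d x < R\<^sup>2")
    case True then have "u x > 0" by (simp add: u_def e) then show ?thesis using e(2) by (simp add: v_def add_pos_nonneg)
  next
    case False then have "v x > 0" using rR by (simp add: v_def e) then show ?thesis using e(2) by (simp add: u_def add_nonneg_pos)
  qed
  define \<psi> where "\<psi> x = u x * inverse (u x + v x)" for x
  show ?thesis
  proof
    have "u x + v x \<noteq> 0" for x using pos[of x] by simp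
    then show "smooth \<psi>"
      unfolding \<psi>_def[abs_def] by (intro smooth_closure_smooth smooth_closure.mult smooth_closure.inverse smooth_closure.add uv)
    fix x
    show "\<psi> x = 1" if "x \<in> cball c r"
    proof -
      have "d x \<le> r\<^sup>2" unfolding dd using that by (intro power_mono) auto
      then have "v x = 0" by (simp add: v_def e)
      then show ?thesis using pos[of x] by (simp add: \<psi>_def)
    qed
    show "\<psi> x = 0" if "x \<notin> cball c R"
    proof -
      have "d x \<ge> R\<^sup>2" unfolding dd using that assms by (intro power_mono) auto
      then have "u x = 0" by (simp add: u_def e)
      then show ?thesis by (simp add: \<psi>_def)
    qed
    have "u x \<ge> 0" "v x \<ge> 0" using e(2) by (auto simp: u_def v_def)
    then show "0 \<le> \<psi> x \<and> \<psi> x \<le> 1"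
      using pos[of x] by (auto simp: \<psi>_def field_simps)
  qed
qed

text \<open>Take 1 minus the product of the factors 1 - \<psi>_x over a finite subcover: the product
  vanishes as soon as one \<psi>_x equals 1, and it is 1 outside all the balls.\<close>

lemma test_fun_cutoff:
  fixes K :: "'a::euclidean_space set"
  assumes K: "compact K" and A: "open A" "K \<subseteq> A"
  obtains \<psi> where "\<psi> \<in> test_fun A" "\<And>x. x \<in> K \<Longrightarrow> \<psi> x = 1" "\<And>x. 0 \<le> \<psi> x \<and> \<psi> x \<le> 1"
proof -
  have "\<exists>R>0. cball x R \<subseteq> A" if "x \<in> K" for x using that A open_contains_cball by blast
  then obtain R where R: "\<And>x. x \<in> K \<Longrightarrow> R x > 0" "\<And>x. x \<in> K \<Longrightarrow> cball x (R x) \<subseteq> A" by metis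
  have "K \<subseteq> (\<Union>x\<in>K. ball x (R x / 2))" using R by force
  then obtain F where F: "F \<subseteq> K" "finite F" "K \<subseteq> (\<Union>x\<in>F. ball x (R x / 2))"
    using compactE_image[OF K, of K "\<lambda>x. ball x (R x / 2)"] by auto
  have "\<exists>\<psi>. smooth \<psi> \<and> (\<forall>y\<in>cball x (R x / 2). \<psi> y = 1) \<and> (\<forall>y. y \<notin> cball x (R x) \<longrightarrow> \<psi> y = 0) \<and> (\<forall>y. 0 \<le> \<psi> y \<and> \<psi> y \<le> 1)" if "x \<in> F" for x
  proof -
    have "0 < R x / 2" "R x / 2 < R x" using R(1)[of x] F(1) that by auto
    then obtain \<psi> where "smooth \<psi>" "\<And>y. y \<in> cball x (R x / 2) \<Longrightarrow> \<psi> y = 1" "\<And>y. y \<notin> cball x (R x) \<Longrightarrow> \<psi> y = 0" "\<And>y. 0 \<le> \<psi> y \<and> \<psi> y \<le> 1"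
      by (rule smooth_ball_cutoff[where c = x]) blast
    then show ?thesis by blast
  qed
  then obtain \<psi> where \<psi>: "\<And>x. x \<in> F \<Longrightarrow> smooth (\<psi> x)" "\<And>x y. x \<in> F \<Longrightarrow> y \<in> cball x (R x / 2) \<Longrightarrow> \<psi> x y = 1"
    "\<And>x y. x \<in> F \<Longrightarrow> y \<notin> cball x (R x) \<Longrightarrow> \<psi> x y = 0" "\<And>x y. x \<in> F \<Longrightarrow> 0 \<le> \<psi> x y \<and> \<psi> x y \<le> 1"
    by metis
  define P where "P y = (\<Prod>x\<in>F. 1 + (-1) * \<psi> x y)" for y
  have "(\<lambda>y. \<Prod>x\<in>G. 1 + (-1) * \<psi> x y) \<in> smooth_closure" if "finite G" "G \<subseteq> F" for G
    using that
  proof (induction G rule: finite_induct)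
    case empty
    show ?case by (simp add: smooth_closure.const)
  next
    case (insert x G)
    have a: "(\<lambda>y. \<Prod>x\<in>G. 1 + (-1) * \<psi> x y) \<in> smooth_closure" by (rule insert.IH) (use insert.prems in auto)
    have p: "\<psi> x \<in> smooth_closure" by (rule smooth_closure.base[OF \<psi>(1)]) (use insert.prems in auto)
    have "(\<lambda>y. (1 + (-1) * \<psi> x y) * (\<Prod>x\<in>G. 1 + (-1) * \<psi> x y)) \<in> smooth_closure"
      by (intro smooth_closure.mult smooth_closure.add smooth_closure.const a p)
    then show ?case by (simp only: prod.insert[OF insert.hyps(1,2)])
  qed
  then have PS: "P \<in> smooth_closure" unfolding P_def[abs_def] using F by auto
  show ?thesis
  proof
    show "(\<lambda>y. 1 + (-1) * P y) \<in> test_fun A"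
    proof (rule test_funI[of _ "\<Union>x\<in>F. cball x (R x)"])
      show "smooth (\<lambda>y. 1 + (-1) * P y)" by (intro smooth_closure_smooth smooth_closure_rules PS)
      show "compact (\<Union>x\<in>F. cball x (R x))" using F by (intro compact_UN) auto
      show "(\<Union>x\<in>F. cball x (R x)) \<subseteq> A" using R F by blast
      fix y assume "y \<notin> (\<Union>x\<in>F. cball x (R x))"
      then have "P y = 1" unfolding P_def using \<psi>(3) by (intro prod.neutral) auto
      then show "1 + (-1) * P y = 0" by simp
    qed
    fix y
    show "1 + (-1) * P y = 1" if yK: "y \<in> K"
    proof -
      obtain x where x: "x \<in> F" "y \<in> ball x (R x / 2)" using F(3) yK by blast
      then have "1 + (-1) * \<psi> x y = 0" using \<psi>(2)[of x y] by auto
      then have "P y = 0" unfolding P_def using F(2) x(1) by (intro prod_zero) auto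
      then show ?thesis by simp
    qed
    have "0 \<le> P y" "P y \<le> 1" unfolding P_def using \<psi>(4) by (auto intro!: prod_nonneg prod_le_1)
    then show "0 \<le> 1 + (-1) * P y \<and> 1 + (-1) * P y \<le> 1" by simp
  qed
qed

section \<open>Sobolev multipliers\<close>

text \<open>The image of \<open>sobolev_tilde s A\<close> under the isometry \<open>sob s\<close>.
  For A = UNIV it is the space on which multipliers define forms.\<close>

definition hs_closure :: "real \<Rightarrow> 'a::euclidean_space set \<Rightarrow> 'a l2 set" where
  "hs_closure s A = closure (sob s ` test_fun A)"

lemma hs_closureE:
  assumes "X \<in> hs_closure s A"
  obtains \<phi> where "\<And>k::nat. \<phi> k \<in> test_fun A" "(\<lambda>k. sob s (\<phi> k)) \<longlonglongrightarrow> X"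
proof -
  obtain x where x: "\<And>n. x n \<in> sob s ` test_fun A" "x \<longlonglongrightarrow> X"
    using assms unfolding hs_closure_def closure_sequential by blast
  have "\<forall>n. \<exists>\<phi>. \<phi> \<in> test_fun A \<and> x n = sob s \<phi>" using x(1) by blast
  then obtain \<phi> where \<phi>: "\<And>n. \<phi> n \<in> test_fun A" "\<And>n. x n = sob s (\<phi> n)" by metis
  have "x = (\<lambda>n. sob s (\<phi> n))" using \<phi>(2) by auto
  then show ?thesis using x(2) that[of \<phi>] \<phi>(1) by simp
qed

lemma hs_closureI: 
  assumes "\<And>k::nat. \<phi> k \<in> test_fun A" "(\<lambda>k. sob s (\<phi> k)) \<longlonglongrightarrow> X"
  shows "X \<in> hs_closure s A"
  unfolding hs_closure_def closure_sequential using assms by (intro exI[of _ "\<lambda>k. sob s (\<phi> k)"]) auto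

lemma sob_test_in: "\<phi> \<in> test_fun A \<Longrightarrow> sob s \<phi> \<in> hs_closure s A"
  unfolding hs_closure_def using closure_subset by fast

lemma hs_closure_mono: "A \<subseteq> B \<Longrightarrow> hs_closure s A \<subseteq> hs_closure s B"
  unfolding hs_closure_def by (intro closure_mono image_mono) (auto intro: test_fun_mono)

lemma closed_hs_closure: "closed (hs_closure s A)"
  by (simp add: hs_closure_def)

lemma subspace_hs_closure:
  assumes s: "s \<ge> 0" shows "subspace (hs_closure s (A :: 'a::euclidean_space set))"
proof (rule subspaceI)
  note T = test_fun_sobolev[OF _ s]
  have "sob s (\<lambda>x::'a. 0 * 0) = 0 *\<^sub>R sob s (\<lambda>x::'a. 0 :: real)" by (rule sob_scale(2)[OF T[OF test_fun_zero]])
  then show "0 \<in> hs_closure s A" using sob_test_in[OF test_fun_zero, of s A] by simp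
  fix X Y c assume X: "X \<in> hs_closure s A"
  obtain f where f: "\<And>k::nat. f k \<in> test_fun A" "(\<lambda>k. sob s (f k)) \<longlonglongrightarrow> X" using hs_closureE[OF X] by metis
  have "(\<lambda>k. sob s (\<lambda>x. c * f k x)) \<longlonglongrightarrow> c *\<^sub>R X"
    unfolding sob_scale(2)[OF T[OF f(1)]] by (intro tendsto_intros f)
  then show "c *\<^sub>R X \<in> hs_closure s A" by (rule hs_closureI[rotated]) (intro test_fun_scale f)
  assume Y: "Y \<in> hs_closure s A"
  obtain g where g: "\<And>k::nat. g k \<in> test_fun A" "(\<lambda>k. sob s (g k)) \<longlonglongrightarrow> Y" using hs_closureE[OF Y] by metis
  have "(\<lambda>k. sob s (\<lambda>x. f k x + g k x)) \<longlonglongrightarrow> X + Y"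
    unfolding sob_add(2)[OF T[OF f(1)] T[OF g(1)]] by (intro tendsto_intros f g)
  then show "X + Y \<in> hs_closure s A" by (rule hs_closureI[rotated]) (intro test_fun_add f g)
qed

lemma sobolev_tilde_iff:
  assumes s: "s \<ge> 0" 
  shows "u \<in> sobolev_tilde s A \<longleftrightarrow> u \<in> sobolev s \<and> sob s u \<in> hs_closure s A"
proof -
  have "sobolev_norm s (\<lambda>x. u x - \<phi> x) = dist (sob s \<phi>) (sob s u)" if "u \<in> sobolev s" "\<phi> \<in> test_fun A" for \<phi>
    using sob_diff[OF that(1) test_fun_sobolev[OF that(2) s]] by (simp add: sobolev_norm_sob dist_norm norm_minus_commute)
  then show ?thesis
    unfolding sobolev_tilde_def hs_closure_def closure_approachable by auto
qed

text \<open>Contains what the extension by continuity is built on. The bound is homogeneous, whereas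
  \<open>multiplier_norm\<close> tests normalised pairs.\<close>

definition bdd_multiplier :: "real \<Rightarrow> real \<Rightarrow> (('a::euclidean_space \<Rightarrow> real) \<Rightarrow> real) \<Rightarrow> bool" where
  "bdd_multiplier s K q \<longleftrightarrow>
     (\<forall>\<phi>\<in>test_fun UNIV. \<forall>\<psi>\<in>test_fun UNIV. q (\<lambda>x. \<phi> x + \<psi> x) = q \<phi> + q \<psi>) \<and>
     (\<forall>c. \<forall>\<phi>\<in>test_fun UNIV. q (\<lambda>x. c * \<phi> x) = c * q \<phi>) \<and>
     (\<forall>\<phi>\<in>test_fun UNIV. \<forall>\<psi>\<in>test_fun UNIV. \<bar>q (\<lambda>x. \<phi> x * \<psi> x)\<bar> \<le> K * norm (sob s \<phi>) * norm (sob s \<psi>))"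

lemma test_fun_AE_zero:
  fixes \<phi> :: "'a::euclidean_space \<Rightarrow> real"
  assumes \<phi>: "\<phi> \<in> test_fun A" and z: "AE x in lborel. \<phi> x = 0"
  shows "\<phi> = (\<lambda>x. 0)"
proof (rule ccontr)
  assume "\<phi> \<noteq> (\<lambda>x. 0)"
  then obtain y where y: "\<phi> y \<noteq> 0" by auto
  have "open {x. \<phi> x \<noteq> 0}"
    using smooth_continuous[OF test_funD(1)[OF \<phi>], of UNIV] by (intro open_Collect_neq continuous_on_const) 
  moreover have "{x. \<phi> x \<noteq> 0} \<in> null_sets lborel"
    using z calculation by (subst (asm) AE_iff_null) (auto simp: test_fun_measurable[OF \<phi>])
  then have "negligible {x. \<phi> x \<noteq> 0}" 
    by (simp add: negligible_iff_null_sets null_sets_completionI)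
  ultimately show False using y open_not_negligible by blast
qed

lemma sob_test_fun_zero:
  fixes \<phi> :: "'a::euclidean_space \<Rightarrow> real"
  assumes \<phi>: "\<phi> \<in> test_fun A" and s: "s \<ge> 0" and z: "sob s \<phi> = 0"
  shows "\<phi> = (\<lambda>x. 0)"
proof (rule test_fun_AE_zero[OF \<phi>])
  have S: "\<phi> \<in> sobolev s" by (rule test_fun_sobolev[OF \<phi> s])
  have "abs_l2 \<phi> = 0"
    unfolding sob_inverse[OF S s] z
    by (simp add: linear_0[OF bounded_linear.linear[OF bounded_linear_mulop(1)[OF bessel_symbol_measurable bessel_symbol_neg_le[OF s]]]] 
        linear_0[OF bounded_linear.linear[OF bounded_linear_hartley]])
  then show "AE x in lborel. \<phi> x = 0"
    using abs_l2_eq_iff[OF test_fun_hart_L2(1)[OF \<phi>] L2_zero] by (simp add: abs_l2_zero)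
qed

lemma multipliers_bdd:
  fixes a :: "('a::euclidean_space \<Rightarrow> real) \<Rightarrow> real"
  assumes a: "a \<in> multipliers s" and s: "s \<ge> 0"
  shows "bdd_multiplier s (enn2real (multiplier_norm s a)) a"
proof -
  have lin: "\<And>\<phi> \<psi>. \<phi> \<in> test_fun UNIV \<Longrightarrow> \<psi> \<in> test_fun UNIV \<Longrightarrow> a (\<lambda>x. \<phi> x + \<psi> x) = a \<phi> + a \<psi>"
    "\<And>c \<phi>. \<phi> \<in> test_fun UNIV \<Longrightarrow> a (\<lambda>x. c * \<phi> x) = c * a \<phi>"
    and fin: "multiplier_norm s a < \<infinity>"
    using a by (auto simp: multipliers_def distribution_def)
  have bound: "\<bar>a (\<lambda>x. \<phi> x * \<psi> x)\<bar> \<le> enn2real (multiplier_norm s a) * norm (sob s \<phi>) * norm (sob s \<psi>)" 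
    if \<phi>: "\<phi> \<in> test_fun UNIV" and \<psi>: "\<psi> \<in> test_fun UNIV" for \<phi> \<psi>
  \<comment> \<open>The general case divides by both norms. If one of them is zero, that test
    function vanishes identically, and so does the product.\<close>
  proof (cases "sob s \<phi> = 0 \<or> sob s \<psi> = 0")
    case True
    then have "(\<lambda>x. \<phi> x * \<psi> x) = (\<lambda>x. 0)"
      using sob_test_fun_zero[OF \<phi> s] sob_test_fun_zero[OF \<psi> s] by auto
    moreover have "a (\<lambda>x. 0) = 0" using lin(2)[OF test_fun_zero, of 0] by simp
    ultimately show ?thesis by simp
  next
    case False
    define c d where "c = norm (sob s \<phi>)" and "d = norm (sob s \<psi>)"
    have cd: "c > 0" "d > 0" using False by (auto simp: c_def d_def)
    define u v where "u = (\<lambda>x. (1 / c) * \<phi> x)" and "v = (\<lambda>x. (1 / d) * \<psi> x)"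
    have uv: "u \<in> test_fun UNIV" "v \<in> test_fun UNIV" unfolding u_def v_def by (intro test_fun_scale \<phi> \<psi>)+
    have "sobolev_norm s u = 1" "sobolev_norm s v = 1"
      unfolding sobolev_norm_sob[OF test_fun_sobolev[OF uv(1) s]] sobolev_norm_sob[OF test_fun_sobolev[OF uv(2) s]]
      unfolding u_def v_def sob_scale(2)[OF test_fun_sobolev[OF \<phi> s]] sob_scale(2)[OF test_fun_sobolev[OF \<psi> s]] norm_scaleR c_def[symmetric] d_def[symmetric]
      using cd by auto
    then have "ennreal \<bar>a (\<lambda>x. u x * v x)\<bar> \<le> multiplier_norm s a"
      unfolding multiplier_norm_def using uv by (intro SUP_upper2[of "(u, v)"]) auto
    then have "\<bar>a (\<lambda>x. u x * v x)\<bar> \<le> enn2real (multiplier_norm s a)"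
      using enn2real_mono[of "ennreal \<bar>a (\<lambda>x. u x * v x)\<bar>" "multiplier_norm s a"] fin by simp
    moreover have "a (\<lambda>x. u x * v x) = 1 / (c * d) * a (\<lambda>x. \<phi> x * \<psi> x)"
      using lin(2)[OF test_fun_mult[OF \<phi> \<psi>], of "1 / (c * d)"] by (simp add: u_def v_def)
    ultimately show ?thesis using cd by (simp add: abs_mult c_def[symmetric] d_def[symmetric] divide_simps mult.assoc)
  qed
  show ?thesis unfolding bdd_multiplier_def using lin bound by blast
qed

lemma bdd_multiplier_add:
  assumes "bdd_multiplier s K a" "bdd_multiplier s L b" 
  shows "bdd_multiplier s (K + L) (\<lambda>\<phi>. a \<phi> + b \<phi>)"
proof -
  have "\<bar>a (\<lambda>x. \<phi> x * \<psi> x) + b (\<lambda>x. \<phi> x * \<psi> x)\<bar> \<le> (K + L) * norm (sob s \<phi>) * norm (sob s \<psi>)" 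
    if "\<phi> \<in> test_fun UNIV" "\<psi> \<in> test_fun UNIV" for \<phi> \<psi>
  proof -
    have "\<bar>a (\<lambda>x. \<phi> x * \<psi> x)\<bar> \<le> K * norm (sob s \<phi>) * norm (sob s \<psi>)" 
      "\<bar>b (\<lambda>x. \<phi> x * \<psi> x)\<bar> \<le> L * norm (sob s \<phi>) * norm (sob s \<psi>)"
      using assms that unfolding bdd_multiplier_def by blast+
    then show ?thesis unfolding distrib_right by linarith
  qed
  then show ?thesis using assms unfolding bdd_multiplier_def by (simp add: distrib_left)
qed

locale bdd_mult =
  fixes s K :: real and q :: "('a::euclidean_space \<Rightarrow> real) \<Rightarrow> real"
  assumes s: "s \<ge> 0" and q: "bdd_multiplier s K q"
begin

lemma q_add: "\<phi> \<in> test_fun UNIV \<Longrightarrow> \<psi> \<in> test_fun UNIV \<Longrightarrow> q (\<lambda>x. \<phi> x + \<psi> x) = q \<phi> + q \<psi>"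
  and q_scale: "\<phi> \<in> test_fun UNIV \<Longrightarrow> q (\<lambda>x. c * \<phi> x) = c * q \<phi>"
  and q_bound: "\<phi> \<in> test_fun UNIV \<Longrightarrow> \<psi> \<in> test_fun UNIV \<Longrightarrow> \<bar>q (\<lambda>x. \<phi> x * \<psi> x)\<bar> \<le> K * norm (sob s \<phi>) * norm (sob s \<psi>)"
  using q unfolding bdd_multiplier_def by blast+

lemma q_zero: "q (\<lambda>x. 0) = 0"
  using q_scale[OF test_fun_zero, of 0] by simp

lemma q_diff: "\<phi> \<in> test_fun UNIV \<Longrightarrow> \<psi> \<in> test_fun UNIV \<Longrightarrow> q (\<lambda>x. \<phi> x - \<psi> x) = q \<phi> - q \<psi>"
  using q_add[of \<phi> "\<lambda>x. (-1) * \<psi> x"] q_scale[of \<psi> "-1"] test_fun_scale[of \<psi> UNIV "-1"] by simp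

lemma q_diff_bound:
  assumes "\<phi> \<in> test_fun UNIV" "\<psi> \<in> test_fun UNIV" "\<phi>' \<in> test_fun UNIV" "\<psi>' \<in> test_fun UNIV"
  shows "\<bar>q (\<lambda>x. \<phi> x * \<psi> x) - q (\<lambda>x. \<phi>' x * \<psi>' x)\<bar> 
     \<le> K * norm (sob s \<phi> - sob s \<phi>') * norm (sob s \<psi>) + K * norm (sob s \<phi>') * norm (sob s \<psi> - sob s \<psi>')"
proof -
  note T = test_fun_sobolev[OF _ s]
  have "q (\<lambda>x. \<phi> x * \<psi> x) - q (\<lambda>x. \<phi>' x * \<psi> x) = q (\<lambda>x. (\<phi> x - \<phi>' x) * \<psi> x)"
    using q_diff[OF test_fun_mult[OF assms(1,2)] test_fun_mult[OF assms(3,2)]] by (simp add: algebra_simps)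
  moreover have "q (\<lambda>x. \<phi>' x * \<psi> x) - q (\<lambda>x. \<phi>' x * \<psi>' x) = q (\<lambda>x. \<phi>' x * (\<psi> x - \<psi>' x))"
    using q_diff[OF test_fun_mult[OF assms(3,2)] test_fun_mult[OF assms(3,4)]] by (simp add: algebra_simps)
  moreover have "\<bar>q (\<lambda>x. (\<phi> x - \<phi>' x) * \<psi> x)\<bar> \<le> K * norm (sob s \<phi> - sob s \<phi>') * norm (sob s \<psi>)"
    using q_bound[OF test_fun_diff[OF assms(1,3)] assms(2)] sob_diff(2)[OF T[OF assms(1)] T[OF assms(3)]] by simp
  moreover have "\<bar>q (\<lambda>x. \<phi>' x * (\<psi> x - \<psi>' x))\<bar> \<le> K * norm (sob s \<phi>') * norm (sob s \<psi> - sob s \<psi>')"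
    using q_bound[OF assms(3) test_fun_diff[OF assms(2,4)]] sob_diff(2)[OF T[OF assms(2)] T[OF assms(4)]] by simp
  ultimately show ?thesis by linarith
qed

text \<open>The form \<open>multiplier_form\<close> transported to \<open>l2\<close>. It is
  determined on \<open>hs_closure s UNIV\<close>, where approximating sequences exist.\<close>

definition qform :: "'a l2 \<Rightarrow> 'a l2 \<Rightarrow> real" where
  "qform X Y = (THE c. \<forall>\<phi> \<psi>. (\<forall>k::nat. \<phi> k \<in> test_fun UNIV \<and> \<psi> k \<in> test_fun UNIV) \<longrightarrow>
     (\<lambda>k. sob s (\<phi> k)) \<longlonglongrightarrow> X \<longrightarrow> (\<lambda>k. sob s (\<psi> k)) \<longlonglongrightarrow> Y \<longrightarrow> (\<lambda>k. q (\<lambda>x. \<phi> k x * \<psi> k x)) \<longlonglongrightarrow> c)"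

text \<open>Any two pairs of approximating sequences have asymptotically equal values
  (\<open>close\<close>), which gives the independence of the limit and, applied to two
  subsequences, its existence.\<close>

lemma qform_exists:
  assumes "X \<in> hs_closure s UNIV" "Y \<in> hs_closure s UNIV"
  shows "\<exists>!c. \<forall>\<phi> \<psi>. (\<forall>k::nat. \<phi> k \<in> test_fun UNIV \<and> \<psi> k \<in> test_fun UNIV) \<longrightarrow>
     (\<lambda>k. sob s (\<phi> k)) \<longlonglongrightarrow> X \<longrightarrow> (\<lambda>k. sob s (\<psi> k)) \<longlonglongrightarrow> Y \<longrightarrow> (\<lambda>k. q (\<lambda>x. \<phi> k x * \<psi> k x)) \<longlonglongrightarrow> c"
proof -
  obtain f where f: "\<And>k::nat. f k \<in> test_fun UNIV" "(\<lambda>k. sob s (f k)) \<longlonglongrightarrow> X" using hs_closureE[OF assms(1)] by metis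
  obtain g where g: "\<And>k::nat. g k \<in> test_fun UNIV" "(\<lambda>k. sob s (g k)) \<longlonglongrightarrow> Y" using hs_closureE[OF assms(2)] by metis
  have close: "(\<lambda>k. q (\<lambda>x. \<phi> k x * \<psi> k x) - q (\<lambda>x. \<phi>' k x * \<psi>' k x)) \<longlonglongrightarrow> 0"
    if "\<And>k::nat. \<phi> k \<in> test_fun UNIV" "\<And>k. \<psi> k \<in> test_fun UNIV" "\<And>k::nat. \<phi>' k \<in> test_fun UNIV" "\<And>k. \<psi>' k \<in> test_fun UNIV"
      "(\<lambda>k. sob s (\<phi> k)) \<longlonglongrightarrow> X" "(\<lambda>k. sob s (\<psi> k)) \<longlonglongrightarrow> Y" "(\<lambda>k. sob s (\<phi>' k)) \<longlonglongrightarrow> X" "(\<lambda>k. sob s (\<psi>' k)) \<longlonglongrightarrow> Y" for \<phi> \<psi> \<phi>' \<psi>'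
  proof (rule Lim_null_comparison)
    show "\<forall>\<^sub>F k in sequentially. norm (q (\<lambda>x. \<phi> k x * \<psi> k x) - q (\<lambda>x. \<phi>' k x * \<psi>' k x))
       \<le> K * norm (sob s (\<phi> k) - sob s (\<phi>' k)) * norm (sob s (\<psi> k)) + K * norm (sob s (\<phi>' k)) * norm (sob s (\<psi> k) - sob s (\<psi>' k))"
      using q_diff_bound that by (intro always_eventually) auto
    have "(\<lambda>k. K * norm (sob s (\<phi> k) - sob s (\<phi>' k)) * norm (sob s (\<psi> k)) + K * norm (sob s (\<phi>' k)) * norm (sob s (\<psi> k) - sob s (\<psi>' k)))
      \<longlonglongrightarrow> K * norm (X - X) * norm Y + K * norm X * norm (Y - Y)"
      by (intro tendsto_intros that)
    then show "(\<lambda>k. K * norm (sob s (\<phi> k) - sob s (\<phi>' k)) * norm (sob s (\<psi> k)) + K * norm (sob s (\<phi>' k)) * norm (sob s (\<psi> k) - sob s (\<psi>' k))) \<longlonglongrightarrow> 0"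
      by simp
  qed
  have "Cauchy (\<lambda>k. q (\<lambda>x. f k x * g k x))"
  proof (rule ccontr)
    assume "\<not> Cauchy (\<lambda>k. q (\<lambda>x. f k x * g k x))"
    then obtain e where e: "e > 0" "\<And>M. \<exists>m\<ge>M. \<exists>n\<ge>M. \<not> norm (q (\<lambda>x. f m x * g m x) - q (\<lambda>x. f n x * g n x)) < e"
      unfolding Cauchy_iff by blast
    \<comment> \<open>If the values were not Cauchy, these indices would select two subsequences of
      the same approximants whose values stay e apart, against \<open>close\<close>.\<close>
    then obtain m n where mn: "\<And>M. m M \<ge> M \<and> n M \<ge> M \<and> \<not> norm (q (\<lambda>x. f (m M) x * g (m M) x) - q (\<lambda>x. f (n M) x * g (n M) x)) < e"
      by metis
    have "filterlim m at_top sequentially" "filterlim n at_top sequentially"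
      using mn by (auto intro!: filterlim_at_top_mono[OF filterlim_ident] always_eventually)
    note comp = filterlim_compose[OF f(2)] filterlim_compose[OF g(2)]
    have "(\<lambda>k. q (\<lambda>x. f (m k) x * g (m k) x) - q (\<lambda>x. f (n k) x * g (n k) x)) \<longlonglongrightarrow> 0"
      by (rule close) (use f g comp \<open>filterlim m at_top sequentially\<close> \<open>filterlim n at_top sequentially\<close> in auto)
    then have "\<forall>\<^sub>F k in sequentially. norm (q (\<lambda>x. f (m k) x * g (m k) x) - q (\<lambda>x. f (n k) x * g (n k) x)) < e"
      using e(1) by (auto dest!: tendstoD simp: dist_norm)
    then show False using mn by (auto simp: eventually_sequentially)
  qed
  then obtain c where c: "(\<lambda>k. q (\<lambda>x. f k x * g k x)) \<longlonglongrightarrow> c" using Cauchy_convergent convergent_def by blast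
  show ?thesis
  proof (rule ex1I[of _ c])
    show "\<forall>\<phi> \<psi>. (\<forall>k::nat. \<phi> k \<in> test_fun UNIV \<and> \<psi> k \<in> test_fun UNIV) \<longrightarrow>
     (\<lambda>k. sob s (\<phi> k)) \<longlonglongrightarrow> X \<longrightarrow> (\<lambda>k. sob s (\<psi> k)) \<longlonglongrightarrow> Y \<longrightarrow> (\<lambda>k. q (\<lambda>x. \<phi> k x * \<psi> k x)) \<longlonglongrightarrow> c"
    proof (intro allI impI)
      fix \<phi> \<psi> :: "nat \<Rightarrow> 'a \<Rightarrow> real"
      assume a: "\<forall>k. \<phi> k \<in> test_fun UNIV \<and> \<psi> k \<in> test_fun UNIV" "(\<lambda>k. sob s (\<phi> k)) \<longlonglongrightarrow> X" "(\<lambda>k. sob s (\<psi> k)) \<longlonglongrightarrow> Y"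
      have "(\<lambda>k. q (\<lambda>x. \<phi> k x * \<psi> k x) - q (\<lambda>x. f k x * g k x)) \<longlonglongrightarrow> 0"
        by (rule close) (use a f g in auto)
      from tendsto_add[OF this c] show "(\<lambda>k. q (\<lambda>x. \<phi> k x * \<psi> k x)) \<longlonglongrightarrow> c" by simp
    qed
    fix d assume "\<forall>\<phi> \<psi>. (\<forall>k::nat. \<phi> k \<in> test_fun UNIV \<and> \<psi> k \<in> test_fun UNIV) \<longrightarrow>
     (\<lambda>k. sob s (\<phi> k)) \<longlonglongrightarrow> X \<longrightarrow> (\<lambda>k. sob s (\<psi> k)) \<longlonglongrightarrow> Y \<longrightarrow> (\<lambda>k. q (\<lambda>x. \<phi> k x * \<psi> k x)) \<longlonglongrightarrow> d"
    then have "(\<lambda>k. q (\<lambda>x. f k x * g k x)) \<longlonglongrightarrow> d" using f g by blast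
    then show "d = c" using c LIMSEQ_unique by blast
  qed
qed

lemma qform_tendsto:
  assumes "\<And>k::nat. \<phi> k \<in> test_fun UNIV" "\<And>k. \<psi> k \<in> test_fun UNIV" "(\<lambda>k. sob s (\<phi> k)) \<longlonglongrightarrow> X" "(\<lambda>k. sob s (\<psi> k)) \<longlonglongrightarrow> Y"
  shows "(\<lambda>k. q (\<lambda>x. \<phi> k x * \<psi> k x)) \<longlonglongrightarrow> qform X Y"
  using theI'[OF qform_exists[of X Y]] assms hs_closureI[of \<phi> UNIV s X] hs_closureI[of \<psi> UNIV s Y] unfolding qform_def by blast

text \<open>The predicates under the two definite descriptions are equivalent, so their values agree
  for all u and v in H^s.\<close>

lemma multiplier_form_eq:
  assumes u: "u \<in> sobolev s" and v: "v \<in> sobolev s"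
  shows "multiplier_form s q u v = qform (sob s u) (sob s v)"
proof -
  have *: "(\<lambda>k. sobolev_norm s (\<lambda>x. \<phi> k x - u x)) \<longlonglongrightarrow> 0 \<longleftrightarrow> (\<lambda>k. sob s (\<phi> k)) \<longlonglongrightarrow> sob s u"
    if "\<And>k::nat. \<phi> k \<in> test_fun UNIV" "u \<in> sobolev s" for \<phi> u
  proof -
    have "sobolev_norm s (\<lambda>x. \<phi> k x - u x) = norm (sob s (\<phi> k) - sob s u)" for k
      using sob_diff[OF test_fun_sobolev[OF that(1) s] that(2)] by (simp add: sobolev_norm_sob)
    then show ?thesis by (simp add: tendsto_norm_zero_iff LIM_zero_iff)
  qed
  show ?thesis unfolding multiplier_form_def qform_def
    by (rule arg_cong[where f = The], intro ext all_cong1 imp_cong refl) (use * u v in auto)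
qed

lemma qform_add:
  assumes "X \<in> hs_closure s UNIV" "Y \<in> hs_closure s UNIV" "Z \<in> hs_closure s UNIV"
  shows "qform (X + Y) Z = qform X Z + qform Y Z"
proof -
  note T = test_fun_sobolev[OF _ s]
  obtain f where f: "\<And>k::nat. f k \<in> test_fun UNIV" "(\<lambda>k. sob s (f k)) \<longlonglongrightarrow> X" using hs_closureE[OF assms(1)] by metis
  obtain g where g: "\<And>k::nat. g k \<in> test_fun UNIV" "(\<lambda>k. sob s (g k)) \<longlonglongrightarrow> Y" using hs_closureE[OF assms(2)] by metis
  obtain h where h: "\<And>k::nat. h k \<in> test_fun UNIV" "(\<lambda>k. sob s (h k)) \<longlonglongrightarrow> Z" using hs_closureE[OF assms(3)] by metis
  have "(\<lambda>k. sob s (\<lambda>x. f k x + g k x)) \<longlonglongrightarrow> X + Y"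
    unfolding sob_add(2)[OF T[OF f(1)] T[OF g(1)]] by (intro tendsto_intros f g)
  then have "(\<lambda>k. q (\<lambda>x. (f k x + g k x) * h k x)) \<longlonglongrightarrow> qform (X + Y) Z"
    by (intro qform_tendsto test_fun_add f g h)
  moreover have "q (\<lambda>x. (f k x + g k x) * h k x) = q (\<lambda>x. f k x * h k x) + q (\<lambda>x. g k x * h k x)" for k
    using q_add[OF test_fun_mult[OF f(1) h(1)] test_fun_mult[OF g(1) h(1)], of k k k k] by (simp add: distrib_right)
  moreover have "(\<lambda>k. q (\<lambda>x. f k x * h k x) + q (\<lambda>x. g k x * h k x)) \<longlonglongrightarrow> qform X Z + qform Y Z"
    by (intro tendsto_add qform_tendsto f g h)
  ultimately show ?thesis using LIMSEQ_unique by force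
qed

lemma qform_scale:
  assumes "X \<in> hs_closure s UNIV" "Z \<in> hs_closure s UNIV"
  shows "qform (c *\<^sub>R X) Z = c * qform X Z"
proof -
  note T = test_fun_sobolev[OF _ s]
  obtain f where f: "\<And>k::nat. f k \<in> test_fun UNIV" "(\<lambda>k. sob s (f k)) \<longlonglongrightarrow> X" using hs_closureE[OF assms(1)] by metis
  obtain h where h: "\<And>k::nat. h k \<in> test_fun UNIV" "(\<lambda>k. sob s (h k)) \<longlonglongrightarrow> Z" using hs_closureE[OF assms(2)] by metis
  have "(\<lambda>k. sob s (\<lambda>x. c * f k x)) \<longlonglongrightarrow> c *\<^sub>R X"
    unfolding sob_scale(2)[OF T[OF f(1)]] by (intro tendsto_intros f)
  then have "(\<lambda>k. q (\<lambda>x. (c * f k x) * h k x)) \<longlonglongrightarrow> qform (c *\<^sub>R X) Z"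
    by (intro qform_tendsto test_fun_scale f h)
  moreover have "q (\<lambda>x. (c * f k x) * h k x) = c * q (\<lambda>x. f k x * h k x)" for k
    using q_scale[OF test_fun_mult[OF f(1) h(1)], of c k k] by (simp add: mult.assoc)
  moreover have "(\<lambda>k. c * q (\<lambda>x. f k x * h k x)) \<longlonglongrightarrow> c * qform X Z"
    by (intro tendsto_mult tendsto_const qform_tendsto f h)
  ultimately show ?thesis using LIMSEQ_unique by force
qed

lemma qform_sym:
  assumes "X \<in> hs_closure s UNIV" "Z \<in> hs_closure s UNIV"
  shows "qform X Z = qform Z X"
proof -
  obtain f where f: "\<And>k::nat. f k \<in> test_fun UNIV" "(\<lambda>k. sob s (f k)) \<longlonglongrightarrow> X" using hs_closureE[OF assms(1)] by metis
  obtain h where h: "\<And>k::nat. h k \<in> test_fun UNIV" "(\<lambda>k. sob s (h k)) \<longlonglongrightarrow> Z" using hs_closureE[OF assms(2)] by metis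
  have "(\<lambda>k. q (\<lambda>x. f k x * h k x)) \<longlonglongrightarrow> qform X Z" "(\<lambda>k. q (\<lambda>x. h k x * f k x)) \<longlonglongrightarrow> qform Z X"
    by (intro qform_tendsto f h)+
  then show ?thesis by (simp add: mult.commute LIMSEQ_unique)
qed

lemma qform_bound:
  assumes "X \<in> hs_closure s UNIV" "Z \<in> hs_closure s UNIV"
  shows "\<bar>qform X Z\<bar> \<le> K * norm X * norm Z"
proof -
  obtain f where f: "\<And>k::nat. f k \<in> test_fun UNIV" "(\<lambda>k. sob s (f k)) \<longlonglongrightarrow> X" using hs_closureE[OF assms(1)] by metis
  obtain h where h: "\<And>k::nat. h k \<in> test_fun UNIV" "(\<lambda>k. sob s (h k)) \<longlonglongrightarrow> Z" using hs_closureE[OF assms(2)] by metis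
  have "(\<lambda>k. \<bar>q (\<lambda>x. f k x * h k x)\<bar>) \<longlonglongrightarrow> \<bar>qform X Z\<bar>"
    by (intro tendsto_rabs qform_tendsto f h)
  moreover have "(\<lambda>k. K * norm (sob s (f k)) * norm (sob s (h k))) \<longlonglongrightarrow> K * norm X * norm Z"
    by (intro tendsto_intros f h)
  ultimately show ?thesis by (rule LIMSEQ_le) (use q_bound f h in auto)
qed

lemma qform_test: "\<phi> \<in> test_fun UNIV \<Longrightarrow> \<psi> \<in> test_fun UNIV \<Longrightarrow> qform (sob s \<phi>) (sob s \<psi>) = q (\<lambda>x. \<phi> x * \<psi> x)"
  using qform_tendsto[of "\<lambda>k. \<phi>" "\<lambda>k. \<psi>", OF _ _ tendsto_const tendsto_const] by (simp add: LIMSEQ_const_iff)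

text \<open>Locality of a potential: products of test functions with disjoint supports are zero, and
  this survives the limit.\<close>

lemma qform_disjoint:
  assumes X: "X \<in> hs_closure s A" and Z: "Z \<in> hs_closure s C" and AC: "A \<inter> C = {}"
  shows "qform X Z = 0"
proof -
  obtain f where f: "\<And>k::nat. f k \<in> test_fun A" "(\<lambda>k. sob s (f k)) \<longlonglongrightarrow> X" using hs_closureE[OF X] by metis
  obtain h where h: "\<And>k::nat. h k \<in> test_fun C" "(\<lambda>k. sob s (h k)) \<longlonglongrightarrow> Z" using hs_closureE[OF Z] by metis
  have "f k x * h k x = 0" for k x
    using AC test_funD(3)[OF f(1)[of k]] test_funD(3)[OF h(1)[of k]] not_supp[of x "f k"] not_supp[of x "h k"] by (metis disjoint_iff mult_eq_0_iff subsetD)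
  then have z: "(\<lambda>x. f k x * h k x) = (\<lambda>x. 0)" for k by blast
  have "(\<lambda>k. q (\<lambda>x. f k x * h k x)) \<longlonglongrightarrow> qform X Z"
    by (intro qform_tendsto test_fun_UNIV[OF f(1)] test_fun_UNIV[OF h(1)] f h)
  then show ?thesis unfolding z by (simp add: q_zero LIMSEQ_const_iff)
qed

lemma qform_lower:
  assumes X: "X \<in> hs_closure s UNIV" and l: "\<And>\<phi>. \<phi> \<in> test_fun UNIV \<Longrightarrow> q (\<lambda>x. \<phi> x * \<phi> x) \<ge> - L * (norm (sob s \<phi>))\<^sup>2"
  shows "qform X X \<ge> - L * (norm X)\<^sup>2"
proof -
  obtain f where f: "\<And>k::nat. f k \<in> test_fun UNIV" "(\<lambda>k. sob s (f k)) \<longlonglongrightarrow> X" using hs_closureE[OF X] by metis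
  have a: "(\<lambda>k. q (\<lambda>x. f k x * f k x)) \<longlonglongrightarrow> qform X X" by (intro qform_tendsto f)
  have b: "(\<lambda>k. - L * (norm (sob s (f k)))\<^sup>2) \<longlonglongrightarrow> - L * (norm X)\<^sup>2" by (intro tendsto_intros f)
  show ?thesis by (rule LIMSEQ_le[OF b a]) (use l f in auto)
qed

definition bform :: "'a l2 \<Rightarrow> 'a l2 \<Rightarrow> real" where
  "bform X Y = inner (mulop (fracw s) X) (mulop (fracw s) Y) + qform X Y"

lemma bilinear_form_eq:
  assumes u: "u \<in> sobolev s" and v: "v \<in> sobolev s"
  shows "bilinear_form s q u v = bform (sob s u) (sob s v)"
  unfolding bilinear_form_def bform_def multiplier_form_eq[OF assms] frac_laplacian_inner[OF u v s] ..

end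

section \<open>Coercivity\<close>

text \<open>Direct method: the energy \<open>J V = B (F + V) (F + V)\<close> is minimised over S.
  Coercivity bounds it from below and makes minimising sequences Cauchy, and minimality along lines
  gives the equation. S is an arbitrary subspace and the minimiser lies in its closure, because the
  result is applied to \<open>corrections W\<close> as well as to a closed space.\<close>

lemma variational_solution:
  fixes B :: "'h::{real_inner, complete_space} \<Rightarrow> 'h \<Rightarrow> real"
  assumes W: "subspace W" and S: "subspace S" and SW: "closure S \<subseteq> W" and F: "F \<in> W"
    and add: "\<And>X Y Z. X \<in> W \<Longrightarrow> Y \<in> W \<Longrightarrow> Z \<in> W \<Longrightarrow> B (X + Y) Z = B X Z + B Y Z"
    and scale: "\<And>c X Z. X \<in> W \<Longrightarrow> Z \<in> W \<Longrightarrow> B (c *\<^sub>R X) Z = c * B X Z"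
    and sym: "\<And>X Z. X \<in> W \<Longrightarrow> Z \<in> W \<Longrightarrow> B X Z = B Z X"
    and bound: "\<And>X Z. X \<in> W \<Longrightarrow> Z \<in> W \<Longrightarrow> \<bar>B X Z\<bar> \<le> M * norm X * norm Z"
    and coercive: "\<And>X. X \<in> S \<Longrightarrow> B X X \<ge> \<kappa> * (norm X)\<^sup>2" and \<kappa>: "\<kappa> > 0"
  shows "\<exists>V\<in>closure S. \<forall>Y\<in>S. B (F + V) Y = 0"
proof -
  have SW': "X \<in> W" if "X \<in> S" for X using that SW closure_subset by blast
  note Wa = subspace_add[OF W] and Ws = subspace_scale[OF W] and Wd = subspace_diff[OF W]
  have add': "B Z (X + Y) = B Z X + B Z Y" if "X \<in> W" "Y \<in> W" "Z \<in> W" for X Y Z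
    using that by (simp add: sym[of Z] Wa add)
  have scale': "B Z (c *\<^sub>R X) = c * B Z X" if "X \<in> W" "Z \<in> W" for X Z c
    using that by (simp add: sym[of Z] Ws scale)
  have sq: "B (P + Q) (P + Q) = B P P + 2 * B P Q + B Q Q" if "P \<in> W" "Q \<in> W" for P Q
    using add[OF that Wa[OF that]] add'[OF that that(1)] add'[OF that that(2)] sym[OF that(2,1)] by simp
  define J where "J V = B (F + V) (F + V)" for V
  have quad: "J (V + t *\<^sub>R Y) = J V + 2 * t * B (F + V) Y + t\<^sup>2 * B Y Y" if "V \<in> S" "Y \<in> S" for V Y t
  proof -
    have W1: "F + V \<in> W" "Y \<in> W" "t *\<^sub>R Y \<in> W" using that SW' F by (auto intro: Wa Ws)
    have "J (V + t *\<^sub>R Y) = B ((F + V) + t *\<^sub>R Y) ((F + V) + t *\<^sub>R Y)" by (simp add: J_def add.assoc)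
    also have "\<dots> = J V + 2 * t * B (F + V) Y + t\<^sup>2 * B Y Y"
      unfolding sq[OF W1(1,3)] scale'[OF W1(2,1)] scale[OF W1(2,3)] scale'[OF W1(2,2)] by (simp add: J_def power2_eq_square)
    finally show ?thesis .
  qed
  have lower: "J V \<ge> B F F - M\<^sup>2 * (norm F)\<^sup>2 / \<kappa>" if V: "V \<in> S" for V
  proof -
    have V': "V \<in> W" by (rule SW'[OF V])
    have "J V = B F F + 2 * B F V + B V V"
      unfolding J_def by (rule sq[OF F V'])
    moreover have "- (M * norm F * norm V) \<le> B F V" using bound[OF F V'] by linarith
    moreover have "B V V \<ge> \<kappa> * (norm V)\<^sup>2" by (rule coercive[OF V])
    moreover have "\<kappa> * (norm V)\<^sup>2 - 2 * (M * norm F * norm V) + M\<^sup>2 * (norm F)\<^sup>2 / \<kappa> = (\<kappa> * norm V - M * norm F)\<^sup>2 / \<kappa>"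
      using \<kappa> by (simp add: power2_eq_square field_simps)
    moreover have "(\<kappa> * norm V - M * norm F)\<^sup>2 / \<kappa> \<ge> 0" using \<kappa> by simp
    ultimately show ?thesis by linarith
  qed
  define m where "m = Inf (J ` S)"
  have bdd: "bdd_below (J ` S)" using lower by (intro bdd_belowI2)
  have m_le: "m \<le> J V" if "V \<in> S" for V unfolding m_def using bdd that by (intro cInf_lower) auto
  have S0: "S \<noteq> {}" using subspace_0[OF S] by auto
  have "\<exists>V\<in>S. J V < m + inverse (real (Suc k))" for k
    using cInf_lessD[of "J ` S" "m + inverse (real (Suc k))"] S0 unfolding m_def by auto
  then obtain v where v: "\<And>k. v k \<in> S" "\<And>k. J (v k) < m + inverse (real (Suc k))" by metis
  \<comment> \<open>Parallelogram identity: the midpoint of X and Y has energy at least m, so two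
    nearly minimal vectors are close to each other.\<close>
  have par: "\<kappa> / 2 * (norm (X - Y))\<^sup>2 \<le> (J X - m) + (J Y - m)" if X: "X \<in> S" and Y: "Y \<in> S" for X Y
  proof -
    have D: "X - Y \<in> S" using X Y by (rule subspace_diff[OF S])
    have Z: "Y + (1/2) *\<^sub>R (X - Y) \<in> S" using Y D by (intro subspace_add[OF S] subspace_scale[OF S])
    have "J X = J Y + 2 * B (F + Y) (X - Y) + B (X - Y) (X - Y)" using quad[OF Y D, of 1] by simp
    moreover have "J (Y + (1/2) *\<^sub>R (X - Y)) = J Y + B (F + Y) (X - Y) + 1/4 * B (X - Y) (X - Y)"
      using quad[OF Y D, of "1/2"] by (simp add: power2_eq_square)
    moreover have "m \<le> J (Y + (1/2) *\<^sub>R (X - Y))" by (rule m_le[OF Z])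
    moreover have "\<kappa> * (norm (X - Y))\<^sup>2 \<le> B (X - Y) (X - Y)" by (rule coercive[OF D])
    ultimately show ?thesis by simp
  qed
  have "Cauchy v"
  proof (rule CauchyI)
    fix e :: real assume e: "e > 0"
    have "\<kappa> / 4 * e\<^sup>2 > 0" using \<kappa> e by simp
    then obtain N where N: "inverse (real (Suc N)) < \<kappa> / 4 * e\<^sup>2" using reals_Archimedean by blast
    have "norm (v i - v j) < e" if "i \<ge> N" "j \<ge> N" for i j
    proof -
      have le: "inverse (real (Suc k)) \<le> inverse (real (Suc N))" if "k \<ge> N" for k
        using that by (intro le_imp_inverse_le) auto
      have "\<kappa> / 2 * (norm (v i - v j))\<^sup>2 < \<kappa> / 4 * e\<^sup>2 + \<kappa> / 4 * e\<^sup>2"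
        using par[OF v(1) v(1), of i j] v(2)[of i] v(2)[of j] le[OF that(1)] le[OF that(2)] N by linarith
      then have "(norm (v i - v j))\<^sup>2 < e\<^sup>2" using \<kappa> by (simp add: field_simps)
      then show ?thesis using e by (simp add: power2_less_imp_less)
    qed
    then show "\<exists>M. \<forall>m\<ge>M. \<forall>n\<ge>M. norm (v m - v n) < e" by blast
  qed
  then obtain V where V: "v \<longlonglongrightarrow> V" using Cauchy_convergent convergent_def by blast
  have VS: "V \<in> closure S" using V v(1) closure_sequential by blast
  then have VW: "V \<in> W" using SW by blast
  have "B (F + V) Y = 0" if Y: "Y \<in> S" for Y
  proof -
    have YW: "Y \<in> W" by (rule SW'[OF Y])
    have "(\<lambda>k. B (F + v k) Y - B (F + V) Y) \<longlonglongrightarrow> 0"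
    proof (rule Lim_null_comparison)
      have "B (F + v k) Y - B (F + V) Y = B (v k - V) Y" for k
      proof -
        have vW: "v k \<in> W" by (rule SW'[OF v(1)])
        have "B ((F + V) + (v k - V)) Y = B (F + V) Y + B (v k - V) Y"
          using vW VW F YW by (intro add Wa Wd)
        then show ?thesis by (simp add: algebra_simps)
      qed
      then show "\<forall>\<^sub>F k in sequentially. norm (B (F + v k) Y - B (F + V) Y) \<le> M * norm (v k - V) * norm Y"
        using bound[OF Wd[OF SW'[OF v(1)] VW] YW] by simp
      have "(\<lambda>k. M * norm (v k - V) * norm Y) \<longlonglongrightarrow> M * norm (V - V) * norm Y" by (intro tendsto_intros V)
      then show "(\<lambda>k. M * norm (v k - V) * norm Y) \<longlonglongrightarrow> 0" by simp
    qed
    then have lim: "(\<lambda>k. B (F + v k) Y) \<longlonglongrightarrow> B (F + V) Y" by (simp add: LIM_zero_iff)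
    have nonneg: "0 \<le> 2 * t * B (F + V) Y + t\<^sup>2 * B Y Y" for t
    proof -
      have "(\<lambda>k. inverse (real (Suc k)) + 2 * t * B (F + v k) Y + t\<^sup>2 * B Y Y) \<longlonglongrightarrow> 0 + 2 * t * B (F + V) Y + t\<^sup>2 * B Y Y"
        by (intro tendsto_intros lim LIMSEQ_inverse_real_of_nat)
      moreover have "0 \<le> inverse (real (Suc k)) + 2 * t * B (F + v k) Y + t\<^sup>2 * B Y Y" for k
        using m_le[of "v k + t *\<^sub>R Y"] quad[OF v(1) Y, of k t] v(2)[of k] subspace_add[OF S v(1) subspace_scale[OF S Y]] by simp
      ultimately have "0 \<le> 0 + 2 * t * B (F + V) Y + t\<^sup>2 * B Y Y" by (intro LIMSEQ_le_const) auto
      then show ?thesis by simp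
    qed
    \<comment> \<open>The nonnegative quadratic polynomial is tested at t = - b / c, where it is at
      most - b^2 / c. The summand 1 keeps c positive even if B Y Y = 0.\<close>
    define b c where "b = B (F + V) Y" and "c = \<bar>B Y Y\<bar> + 1"
    have c: "c > 0" "B Y Y \<le> c" by (auto simp: c_def)
    have "0 \<le> 2 * (- b / c) * b + (- b / c)\<^sup>2 * B Y Y" using nonneg[of "- b / c"] by (simp add: b_def)
    also have "\<dots> \<le> 2 * (- b / c) * b + (- b / c)\<^sup>2 * c" using c by (intro add_left_mono mult_left_mono) auto
    also have "\<dots> = - (b\<^sup>2 / c)" using c by (simp add: power2_eq_square field_simps)
    finally show ?thesis using c unfolding b_def[symmetric] by (auto simp: divide_le_0_iff)
  qed
  then show ?thesis using VS by blast
qed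

section \<open>The Poincare inequality on slabs\<close>

lemma bounded_in_one_direction_slab:
  fixes \<Omega> :: "'a::euclidean_space set"
  assumes "bounded_in_one_direction \<Omega>"
  obtains e :: 'a and x0 R where "norm e = 1" "\<And>x. x \<in> \<Omega> \<Longrightarrow> \<bar>(x - x0) \<bullet> e\<bar> \<le> R"
proof -
  obtain B :: "'a set" and \<omega> L x0 where B: "B \<subseteq> Basis" "B \<noteq> {}" and \<omega>: "\<omega> \<subseteq> span B" "openin (top_of_set (span B)) \<omega>" "bounded \<omega>" 
    and L: "orthogonal_transformation L" and \<Omega>: "\<Omega> \<subseteq> (\<lambda>x. L x + x0) ` {y + z | y z. y \<in> span (Basis - B) \<and> z \<in> \<omega>}"
    using assms unfolding bounded_in_one_direction_def by blast
  \<comment> \<open>One bounded coordinate suffices: the component along \<open>L b\<close> is blind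
    to the unbounded factor and sees only the bounded one.\<close>
  obtain b where b: "b \<in> B" using B by blast
  then have bB: "b \<in> Basis" using B by blast
  obtain R where R: "\<And>z. z \<in> \<omega> \<Longrightarrow> norm z \<le> R" using \<omega>(3) by (auto simp: bounded_iff)
  show ?thesis
  proof (rule that[of "L b" x0 R])
    show "norm (L b) = 1" using L bB by (simp add: orthogonal_transformation_norm)
    fix x assume "x \<in> \<Omega>"
    then obtain y z where yz: "y \<in> span (Basis - B)" "z \<in> \<omega>" "x = L (y + z) + x0" using \<Omega> by blast
    have "orthogonal b y"
      by (rule orthogonal_to_span[OF yz(1)]) (use bB b in \<open>auto simp: orthogonal_def intro!: inner_not_same_Basis\<close>)
    then have yb: "y \<bullet> b = 0" by (simp add: orthogonal_def inner_commute)
    have "(x - x0) \<bullet> L b = (y + z) \<bullet> b" using L by (simp add: yz(3) orthogonal_transformation_def)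
    also have "\<dots> = z \<bullet> b" using yb by (simp add: inner_add_left)
    finally show "\<bar>(x - x0) \<bullet> L b\<bar> \<le> R"
      using Cauchy_Schwarz_ineq2[of z b] bB R[OF yz(2)] by simp
  qed
qed

text \<open>For |t| \<le> 1 the left side is at most t^2 / 2 \<le> 1/2, and otherwise |t|^(2s) \<ge>
  1. The constant has to stay below 1 so that it can be absorbed in the Poincare inequality.\<close>

lemma one_minus_cos_le: "1 - cos t \<le> 1/2 + 2 * \<bar>t\<bar> powr (2 * s)" if "s \<ge> 0" for t s :: real
proof (cases "\<bar>t\<bar> \<le> 1")
  case True
  have "1 - cos t = 2 * (sin (t / 2))\<^sup>2" using cos_double_sin[of "t / 2"] by simp
  also have "(sin (t / 2))\<^sup>2 \<le> (t / 2)\<^sup>2"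
    using abs_sin_x_le_abs_x[of "t / 2"] by (simp only: abs_le_square_iff)
  also have "2 * (t / 2)\<^sup>2 \<le> 1/2" using True abs_square_le_1[of t] by (simp add: power2_eq_square)
  finally show ?thesis by (smt (verit) powr_ge_zero)
next
  case False
  then have "\<bar>t\<bar> powr (2 * s) \<ge> 1" using that by (intro ge_one_powr_ge_zero) auto
  then show ?thesis using cos_ge_minus_one[of t] by linarith
qed

lemma powr_sq: "(r powr s)\<^sup>2 = r powr (2 * s)" for r s :: real
  unfolding power2_eq_square mult_2 by (rule powr_add[symmetric])

text \<open>A single translate mixes the Hartley transform at \<xi> and -\<xi>. The symmetric pair
  acts as multiplication by the even symbol 2 cos (h \<bullet> \<xi>).\<close>

lemma hart_symmetric_translate:
  fixes \<phi> :: "'a::euclidean_space \<Rightarrow> real"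
  assumes i: "integrable lborel \<phi>"
  shows "hart (\<lambda>x. \<phi> (x + h) + \<phi> (x - h)) \<xi> = 2 * cos (h \<bullet> \<xi>) * hart \<phi> \<xi>"
proof -
  have [measurable]: "\<phi> \<in> borel_measurable borel" using i by auto
  have tr: "integrable lborel (\<lambda>x. \<phi> (x + a) * cas (x \<bullet> \<xi>))" "(LINT x|lborel. \<phi> (x + a) * cas (x \<bullet> \<xi>)) = (LINT x|lborel. \<phi> x * cas ((x - a) \<bullet> \<xi>))" for a
    using lborel_translate[of "\<lambda>x. \<phi> x * cas ((x - a) \<bullet> \<xi>)" a] integrable_bounded_mult[OF i, of "\<lambda>x. cas ((x - a) \<bullet> \<xi>)" 2]
    by (simp_all add: abs_cas_le)
  have j: "integrable lborel (\<lambda>x. \<phi> x * cas ((x - a) \<bullet> \<xi>))" for a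
    by (rule integrable_bounded_mult[OF i, where C = 2]) (simp_all add: abs_cas_le)
  have "hart (\<lambda>x. \<phi> (x + h) + \<phi> (x - h)) \<xi> = (LINT x|lborel. \<phi> x * cas ((x - h) \<bullet> \<xi>)) + (LINT x|lborel. \<phi> x * cas ((x + h) \<bullet> \<xi>))"
    unfolding hart_def distrib_right using tr[of h] tr[of "- h"] by simp
  also have "\<dots> = (LINT x|lborel. \<phi> x * cas ((x - h) \<bullet> \<xi>) + \<phi> x * cas ((x + h) \<bullet> \<xi>))"
    using j[of h] j[of "- h"] by simp
  also have "\<dots> = (LINT x|lborel. 2 * cos (h \<bullet> \<xi>) * (\<phi> x * cas (x \<bullet> \<xi>)))"
  proof (rule Bochner_Integration.integral_cong[OF refl])
    fix x
    have "cas ((x - h) \<bullet> \<xi>) + cas ((x + h) \<bullet> \<xi>) = 2 * cos (h \<bullet> \<xi>) * cas (x \<bullet> \<xi>)"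
      by (simp add: cas_def inner_simps cos_diff sin_diff cos_add sin_add algebra_simps)
    from arg_cong[OF this, of "(*) (\<phi> x)"]
    show "\<phi> x * cas ((x - h) \<bullet> \<xi>) + \<phi> x * cas ((x + h) \<bullet> \<xi>) = 2 * cos (h \<bullet> \<xi>) * (\<phi> x * cas (x \<bullet> \<xi>))"
      by (simp only: distrib_left mult_ac)
  qed
  finally show ?thesis by (simp add: hart_def)
qed

text \<open>
  If \<open>h\<close> is longer than the width of the slab, then \<open>u\<close> is orthogonal to its translates by \<open>\<plusminus>h\<close>, so
  \<open>\<integral> cos (h \<bullet> \<xi>) |\<F>u|\<^sup>2 = 0\<close> and \<open>\<integral> |\<F>u|\<^sup>2 = \<integral> (1 - cos (h \<bullet> \<xi>)) |\<F>u|\<^sup>2\<close>, where \<open>1 - cos t \<le> 1/2 + 2 |t|\<^sup>2\<^sup>s\<close>.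
\<close>

lemma poincare_test_fun:
  fixes \<phi> :: "'a::euclidean_space \<Rightarrow> real"
  assumes \<phi>: "\<phi> \<in> test_fun \<Omega>" and s: "s \<ge> 0" and h: "\<And>x. x \<in> \<Omega> \<Longrightarrow> x + h \<notin> \<Omega>"
  shows "norm (mulop (bessel_symbol (- s)) (sob s \<phi>)) \<le> (2 * norm h powr s) * norm (mulop (fracw s) (sob s \<phi>))"
proof -
  let ?F = "hart \<phi>" and ?N = "(2 * pi) ^ DIM('a)"
  note b = test_fun_bddL1[OF \<phi>]
  note i = bddL1_integrable[OF b] and FL = test_fun_hart_L2(2)[OF \<phi>]
  note S = test_fun_sobolev[OF \<phi> s]
  have [measurable]: "\<phi> \<in> borel_measurable borel" by (rule test_fun_measurable[OF \<phi>])
  define g where "g x = \<phi> (x + h) + \<phi> (x - h)" for x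
  have gb: "bddL1 g"
  proof -
    have "bddL1 (\<lambda>x. \<phi> (x + a))" for a
      using b lborel_translate(1)[of \<phi> a] unfolding bddL1_def by auto
    from bddL1_add[OF this[of h] this[of "- h"]] show ?thesis by (simp add: g_def[abs_def])
  qed
  have hg: "hart g \<xi> = 2 * cos (h \<bullet> \<xi>) * ?F \<xi>" for \<xi>
    unfolding g_def[abs_def] by (rule hart_symmetric_translate[OF i])
  have disj: "\<phi> x * g x = 0" for x
  proof (cases "x \<in> \<Omega>")
    case True
    then have "x + h \<notin> \<Omega>" "x - h \<notin> \<Omega>" using h[of x] h[of "x - h"] by auto
    then have "\<phi> (x + h) = 0" "\<phi> (x - h) = 0" using test_funD(3)[OF \<phi>] not_supp[of _ \<phi>] by blast+
    then show ?thesis by (simp add: g_def)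
  next
    case False
    then have "\<phi> x = 0" using test_funD(3)[OF \<phi>] not_supp[of _ \<phi>] by blast
    then show ?thesis by simp
  qed
  have "0 = inner (abs_l2 \<phi>) (abs_l2 g)"
    by (simp add: inner_abs_l2 bddL1_L2 b gb disj)
  then have "0 = inner (abs_l2 ?F) (abs_l2 (hart g))"
    using inner_hartley[of "abs_l2 \<phi>" "abs_l2 g"] hartley_abs_l2(2)[OF i bddL1_L2[OF b]] hartley_abs_l2(2)[OF bddL1_integrable[OF gb] bddL1_L2[OF gb]] by simp
  also have "\<dots> = (LINT \<xi>|lborel. ?F \<xi> * hart g \<xi>)"
    by (rule inner_abs_l2[OF FL plancherel_bddL1(1)[OF gb]])
  also have "\<dots> = (LINT \<xi>|lborel. 2 * (cos (h \<bullet> \<xi>) * (?F \<xi>)\<^sup>2))"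
    by (simp add: hg power2_eq_square mult_ac)
  finally have cos0: "(LINT \<xi>|lborel. cos (h \<bullet> \<xi>) * (?F \<xi>)\<^sup>2) = 0" by simp
  have iF: "integrable lborel (\<lambda>\<xi>. (?F \<xi>)\<^sup>2)" using L2_realD(2)[OF FL] .
  have icF: "integrable lborel (\<lambda>\<xi>. cos (h \<bullet> \<xi>) * (?F \<xi>)\<^sup>2)"
    using integrable_bounded_mult[OF iF, of "\<lambda>\<xi>. cos (h \<bullet> \<xi>)" 1] by (simp add: mult.commute)
  have ae: "AE \<xi> in lborel. norm \<xi> powr s * hft \<phi> \<xi> = norm \<xi> powr s * ?F \<xi>"
    using test_fun_hart_L2(3)[OF \<phi>] by (auto elim!: AE_mp)
  have [measurable]: "hart \<phi> \<in> borel_measurable borel" using FL by (rule L2_realD)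
  have wL: "(\<lambda>\<xi>. norm \<xi> powr s * ?F \<xi>) \<in> L2"
    by (rule L2_cong_AE[OF mulop_fracw_sob(1)[OF S s] _ ae]) simp
  have iwF: "integrable lborel (\<lambda>\<xi>. norm \<xi> powr (2 * s) * (?F \<xi>)\<^sup>2)"
    using L2_realD(2)[OF wL] by (simp add: power_mult_distrib powr_sq mult.commute)
  define A D where "A = (LINT \<xi>|lborel. (?F \<xi>)\<^sup>2)" and "D = (LINT \<xi>|lborel. norm \<xi> powr (2 * s) * (?F \<xi>)\<^sup>2)"
  have "A = (LINT \<xi>|lborel. (1 - cos (h \<bullet> \<xi>)) * (?F \<xi>)\<^sup>2)"
    using iF icF cos0 by (simp add: A_def left_diff_distrib)
  also have "\<dots> \<le> (LINT \<xi>|lborel. 1/2 * (?F \<xi>)\<^sup>2 + 2 * norm h powr (2 * s) * (norm \<xi> powr (2 * s) * (?F \<xi>)\<^sup>2))"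
  proof (rule integral_mono)
    show "integrable lborel (\<lambda>\<xi>. (1 - cos (h \<bullet> \<xi>)) * (?F \<xi>)\<^sup>2)" using iF icF by (simp add: left_diff_distrib)
    show "integrable lborel (\<lambda>\<xi>. 1/2 * (?F \<xi>)\<^sup>2 + 2 * norm h powr (2 * s) * (norm \<xi> powr (2 * s) * (?F \<xi>)\<^sup>2))"
      using iF iwF by (intro Bochner_Integration.integrable_add integrable_mult_right)
    fix \<xi>
    have "\<bar>h \<bullet> \<xi>\<bar> powr (2 * s) \<le> (norm h * norm \<xi>) powr (2 * s)"
      using s by (intro powr_mono2 Cauchy_Schwarz_ineq2) auto
    then have "1 - cos (h \<bullet> \<xi>) \<le> 1/2 + 2 * (norm h * norm \<xi>) powr (2 * s)"
      using one_minus_cos_le[OF s, of "h \<bullet> \<xi>"] by linarith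
    then have "(1 - cos (h \<bullet> \<xi>)) * (?F \<xi>)\<^sup>2 \<le> (1/2 + 2 * (norm h * norm \<xi>) powr (2 * s)) * (?F \<xi>)\<^sup>2"
      by (intro mult_right_mono) auto
    then show "(1 - cos (h \<bullet> \<xi>)) * (?F \<xi>)\<^sup>2 \<le> 1/2 * (?F \<xi>)\<^sup>2 + 2 * norm h powr (2 * s) * (norm \<xi> powr (2 * s) * (?F \<xi>)\<^sup>2)"
      by (simp add: powr_mult distrib_right mult.assoc)
  qed
  also have "\<dots> = 1/2 * A + 2 * norm h powr (2 * s) * D"
    unfolding A_def D_def using iF iwF by (subst Bochner_Integration.integral_add) (auto intro: integrable_mult_right)
  \<comment> \<open>The term A/2 is absorbed on the left. The factor 4 becomes the constant 2 |h|^s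
    after taking square roots.\<close>
  finally have AD: "A \<le> 4 * norm h powr (2 * s) * D" by simp
  have nA: "(norm (mulop (bessel_symbol (- s)) (sob s \<phi>)))\<^sup>2 = A / ?N"
  proof -
    have "norm (mulop (bessel_symbol (- s)) (sob s \<phi>)) = norm (abs_l2 \<phi>)"
      using sob_norm_L2[OF S s] norm_abs_l2[OF bddL1_L2[OF b]] by simp
    moreover have "A = ?N * (norm (abs_l2 \<phi>))\<^sup>2"
      unfolding A_def plancherel_bddL1(2)[OF b] norm_abs_l2_sq[OF bddL1_L2[OF b]] ..
    ultimately show ?thesis by simp
  qed
  have nD: "(norm (mulop (fracw s) (sob s \<phi>)))\<^sup>2 = D / ?N"
  proof -
    have "abs_l2 (\<lambda>\<xi>. norm \<xi> powr s * hft \<phi> \<xi>) = abs_l2 (\<lambda>\<xi>. norm \<xi> powr s * ?F \<xi>)"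
      using ae by (subst abs_l2_eq_iff[OF mulop_fracw_sob(1)[OF S s] wL])
    then have "(norm (mulop (fracw s) (sob s \<phi>)))\<^sup>2 = (1 / sqrt ?N)\<^sup>2 * (norm (abs_l2 (\<lambda>\<xi>. norm \<xi> powr s * ?F \<xi>)))\<^sup>2"
      unfolding mulop_fracw_sob(2)[OF S s] norm_scaleR by (simp only: power_mult_distrib power2_abs)
    also have "(1 / sqrt ?N)\<^sup>2 = 1 / ?N" by (simp only: power_divide real_sqrt_pow2_iff one_power2) simp
    also have "(norm (abs_l2 (\<lambda>\<xi>. norm \<xi> powr s * ?F \<xi>)))\<^sup>2 = D"
      unfolding norm_abs_l2_sq[OF wL] D_def by (simp add: power_mult_distrib powr_sq mult.commute)
    finally show ?thesis by simp
  qed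
  have hp: "(2 * norm h powr s)\<^sup>2 = 4 * norm h powr (2 * s)"
    by (simp add: power_mult_distrib powr_sq mult.commute)
  show ?thesis
  proof (rule power2_le_imp_le)
    have "A / ?N \<le> 4 * norm h powr (2 * s) * D / ?N" using AD by (intro divide_right_mono) auto
    then show "(norm (mulop (bessel_symbol (- s)) (sob s \<phi>)))\<^sup>2 \<le> ((2 * norm h powr s) * norm (mulop (fracw s) (sob s \<phi>)))\<^sup>2"
      unfolding power_mult_distrib[of "2 * norm h powr s"] hp nA nD by simp
  qed simp
qed

lemma poincare_hs_closure:
  fixes \<Omega> :: "'a::euclidean_space set"
  assumes \<Omega>: "bounded_in_one_direction \<Omega>" and s: "s \<ge> 0"
  obtains C where "C \<ge> 0" "\<And>X. X \<in> hs_closure s \<Omega> \<Longrightarrow> norm (mulop (bessel_symbol (- s)) X) \<le> C * norm (mulop (fracw s) X)"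
proof -
  obtain e :: 'a and x0 R where e: "norm e = 1" and R: "\<And>x. x \<in> \<Omega> \<Longrightarrow> \<bar>(x - x0) \<bullet> e\<bar> \<le> R"
    using bounded_in_one_direction_slab[OF \<Omega>] by metis
  \<comment> \<open>Longer than the width 2R of the slab. The absolute value covers a negative R,
    which can occur when \<Omega> is empty.\<close>
  define h where "h = (2 * \<bar>R\<bar> + 1) *\<^sub>R e"
  have h: "x + h \<notin> \<Omega>" if "x \<in> \<Omega>" for x
  proof
    assume "x + h \<in> \<Omega>"
    then have "\<bar>(x + h - x0) \<bullet> e\<bar> \<le> R" by (rule R)
    moreover have "(x + h - x0) \<bullet> e = (x - x0) \<bullet> e + (2 * \<bar>R\<bar> + 1)"
      using e by (simp add: h_def inner_simps power2_norm_eq_inner[symmetric])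
    ultimately show False using R[OF that] by linarith
  qed
  show ?thesis
  proof (rule that[of "2 * norm h powr s"])
    note l1 = bounded_linear_mulop(1)[OF bessel_symbol_measurable bessel_symbol_neg_le[OF s]]
      and l2 = bounded_linear_mulop(1)[OF fracw_measurable fracw_le[OF s]]
    have "closed {X. norm (mulop (bessel_symbol (- s)) X) \<le> (2 * norm h powr s) * norm (mulop (fracw s) (X :: 'a l2))}"
      by (intro closed_Collect_le continuous_intros bounded_linear.continuous_on[OF l1] bounded_linear.continuous_on[OF l2])
    moreover have "sob s ` test_fun \<Omega> \<subseteq> {X. norm (mulop (bessel_symbol (- s)) X) \<le> (2 * norm h powr s) * norm (mulop (fracw s) X)}"
      using poincare_test_fun[OF _ s h] by blast
    ultimately have "hs_closure s \<Omega> \<subseteq> {X. norm (mulop (bessel_symbol (- s)) X) \<le> (2 * norm h powr s) * norm (mulop (fracw s) X)}"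
      unfolding hs_closure_def by (rule closure_minimal[rotated])
    then show "norm (mulop (bessel_symbol (- s)) X) \<le> (2 * norm h powr s) * norm (mulop (fracw s) X)" if "X \<in> hs_closure s \<Omega>" for X
      using that by blast
  qed simp
qed

lemma poincare_const:
  fixes \<Omega> :: "'a::euclidean_space set"
  assumes \<Omega>: "bounded_in_one_direction \<Omega>" and s: "s \<ge> 0"
  shows "poincare_const s \<Omega> \<ge> 0" 
    and "X \<in> hs_closure s \<Omega> \<Longrightarrow> norm (mulop (bessel_symbol (- s)) X) \<le> poincare_const s \<Omega> * norm (mulop (fracw s) X)"
proof -
  define CS where "CS = {C. 0 \<le> C \<and> (\<forall>u\<in>sobolev_tilde s \<Omega>. L2_norm u \<le> C * L2_norm (frac_laplacian (s / 2) u))}"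
  have P: "poincare_const s \<Omega> = Inf CS" by (simp add: poincare_const_def CS_def)
  have eq: "L2_norm u = norm (mulop (bessel_symbol (- s)) (sob s u))" "L2_norm (frac_laplacian (s / 2) u) = norm (mulop (fracw s) (sob s u))"
    if "u \<in> sobolev s" for u :: "'a \<Rightarrow> real"
    using sob_norm_L2[OF that s] frac_laplacian_norm[OF that s] .
  obtain C where "C \<ge> 0" "\<And>X. X \<in> hs_closure s \<Omega> \<Longrightarrow> norm (mulop (bessel_symbol (- s)) X) \<le> C * norm (mulop (fracw s) X)"
    using poincare_hs_closure[OF \<Omega> s] by metis
  then have "C \<in> CS" unfolding CS_def using eq by (auto simp: sobolev_tilde_iff[OF s])
  then have ne: "CS \<noteq> {}" by auto
  show "poincare_const s \<Omega> \<ge> 0" unfolding P by (rule cInf_greatest[OF ne]) (simp add: CS_def)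
  assume X: "X \<in> hs_closure s \<Omega>"
  obtain u where u: "u \<in> sobolev s" "sob s u = X" using sob_surj[OF s] by metis
  have ut: "u \<in> sobolev_tilde s \<Omega>" using u X by (simp add: sobolev_tilde_iff[OF s])
  have le: "norm (mulop (bessel_symbol (- s)) X) \<le> C * norm (mulop (fracw s) X)" if "C \<in> CS" for C
    using that ut eq[OF u(1)] by (auto simp: CS_def u(2))
  show "norm (mulop (bessel_symbol (- s)) X) \<le> poincare_const s \<Omega> * norm (mulop (fracw s) X)"
  \<comment> \<open>If the right-hand norm is zero, any admissible constant forces the left-hand
    norm to be zero. Otherwise one may divide by it and pass to the infimum.\<close>
  proof (cases "norm (mulop (fracw s) X) = 0")
    case True
    then show ?thesis using le[OF \<open>C \<in> CS\<close>] by simp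
  next
    case False
    then have pos: "norm (mulop (fracw s) X) > 0" by simp
    have "norm (mulop (bessel_symbol (- s)) X) / norm (mulop (fracw s) X) \<le> Inf CS"
      by (rule cInf_greatest[OF ne]) (use le pos in \<open>simp add: divide_le_eq\<close>)
    then show ?thesis using pos by (simp add: P divide_le_eq)
  qed
qed

text \<open>Pointwise (1 + |\<xi>|^2)^s \<le> 2^s max(1, |\<xi>|^2)^s \<le> 2^s (1 + |\<xi>|^(2s)),
  divided by the left side. This is the origin of the power of 2 in \<open>delta\<close>.\<close>

lemma norm_split:
  fixes X :: "'a::euclidean_space l2"
  assumes s: "s \<ge> 0"
  shows "(norm X)\<^sup>2 \<le> 2 powr s * ((norm (mulop (bessel_symbol (- s)) X))\<^sup>2 + (norm (mulop (fracw s) X))\<^sup>2)"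
proof -
  let ?r = "rep_l2 X"
  note L1 = L2_mult_bounded[OF bessel_symbol_measurable bessel_symbol_neg_le[OF s] rep_l2_in[of X]]
    and L2 = L2_mult_bounded[OF fracw_measurable fracw_le[OF s] rep_l2_in[of X]]
  have pw: "1 \<le> 2 powr s * ((bessel_symbol (- s) \<xi>)\<^sup>2 + (fracw s \<xi>)\<^sup>2)" for \<xi> :: 'a
  proof -
    define b where "b = (1 + (norm \<xi>)\<^sup>2) powr s"
    have b: "b > 0" using one_plus_norm_sq[of \<xi>] by (simp add: b_def)
    have bs: "(bessel_symbol (- s) \<xi>)\<^sup>2 = 1 / b"
    proof -
      have "(bessel_symbol (- s) \<xi>)\<^sup>2 = (1 + (norm \<xi>)\<^sup>2) powr - s"
        unfolding bessel_symbol_def powr_sq by simp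
      then show ?thesis by (simp add: b_def powr_minus_divide)
    qed
    have "b \<le> (2 * max 1 ((norm \<xi>)\<^sup>2)) powr s" unfolding b_def using s by (intro powr_mono2) auto
    also have "\<dots> = 2 powr s * (max 1 ((norm \<xi>)\<^sup>2)) powr s" by (rule powr_mult)
    also have "(max 1 ((norm \<xi>)\<^sup>2)) powr s \<le> 1 + ((norm \<xi>)\<^sup>2) powr s" by (auto simp: max_def)
    also have "((norm \<xi>)\<^sup>2) powr s = (norm \<xi> powr s)\<^sup>2" by (simp add: power2_eq_square powr_mult)
    finally have "b \<le> 2 powr s * (1 + (norm \<xi> powr s)\<^sup>2)" by simp
    then show ?thesis unfolding fracw_def power_mult_distrib bs using b by (simp add: field_simps)
  qed
  have "(norm X)\<^sup>2 = (LINT \<xi>|lborel. (?r \<xi>)\<^sup>2)" using norm_abs_l2_sq[OF rep_l2_in[of X]] by simp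
  also have "\<dots> \<le> (LINT \<xi>|lborel. 2 powr s * ((bessel_symbol (- s) \<xi> * ?r \<xi>)\<^sup>2 + (fracw s \<xi> * ?r \<xi>)\<^sup>2))"
  proof (rule integral_mono)
    fix \<xi>
    show "(?r \<xi>)\<^sup>2 \<le> 2 powr s * ((bessel_symbol (- s) \<xi> * ?r \<xi>)\<^sup>2 + (fracw s \<xi> * ?r \<xi>)\<^sup>2)"
      using mult_right_mono[OF pw[of \<xi>], of "(?r \<xi>)\<^sup>2"] by (simp add: power_mult_distrib algebra_simps)
  qed (use L2_realD(2)[OF rep_l2_in[of X]] L2_realD(2)[OF L1] L2_realD(2)[OF L2] in auto)
  also have "\<dots> = 2 powr s * ((norm (mulop (bessel_symbol (- s)) X))\<^sup>2 + (norm (mulop (fracw s) X))\<^sup>2)"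
    unfolding mulop_def norm_abs_l2_sq[OF L1] norm_abs_l2_sq[OF L2] using L2_realD(2)[OF L1] L2_realD(2)[OF L2] by simp
  finally show ?thesis .
qed

text \<open>With P the Poincare constant and D the norm of the fractional part, |X|^2 \<le> 2^s (P^2
  + 1) D^2 \<le> 2^s (1 + P)^2 D^2, and \<open>delta\<close> is the reciprocal of the last
  constant.\<close>

lemma delta_bound:
  fixes \<Omega> :: "'a::euclidean_space set"
  assumes \<Omega>: "bounded_in_one_direction \<Omega>" and s: "s \<ge> 0" and X: "X \<in> hs_closure s \<Omega>"
  shows "delta s \<Omega> * (norm X)\<^sup>2 \<le> (norm (mulop (fracw s) X))\<^sup>2" "delta s \<Omega> > 0"
proof -
  define P where "P = poincare_const s \<Omega>"
  have P0: "P \<ge> 0" unfolding P_def by (rule poincare_const(1)[OF \<Omega> s])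
  define D where "D = norm (mulop (fracw s) X)"
  have "(norm (mulop (bessel_symbol (- s)) X))\<^sup>2 \<le> (P * D)\<^sup>2"
    unfolding P_def D_def by (intro power_mono poincare_const(2)[OF \<Omega> s X]) simp
  then have "(norm (mulop (bessel_symbol (- s)) X))\<^sup>2 + D\<^sup>2 \<le> (P\<^sup>2 + 1) * D\<^sup>2" by (simp add: power_mult_distrib algebra_simps)
  also have "\<dots> \<le> (1 + P)\<^sup>2 * D\<^sup>2" using P0 by (intro mult_right_mono) (auto simp: power2_eq_square algebra_simps)
  finally have "2 powr s * ((norm (mulop (bessel_symbol (- s)) X))\<^sup>2 + D\<^sup>2) \<le> 2 powr s * ((1 + P)\<^sup>2 * D\<^sup>2)" by simp
  with norm_split[OF s, of X] have n: "(norm X)\<^sup>2 \<le> 2 powr s * ((1 + P)\<^sup>2 * D\<^sup>2)" unfolding D_def by linarith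
  have d: "delta s \<Omega> = 1 / (2 powr s * (1 + P)\<^sup>2)"
    unfolding delta_def P_def[symmetric] power_divide powr_sq by (simp add: powr_minus_divide)
  show "delta s \<Omega> > 0" unfolding d using P0 by simp
  show "delta s \<Omega> * (norm X)\<^sup>2 \<le> (norm (mulop (fracw s) X))\<^sup>2"
    unfolding d D_def[symmetric] using n P0 by (simp add: divide_le_eq mult.commute mult.left_commute)
qed

text \<open>The lower bound uses the small summand through its norm, which becomes L, and the
  nonnegative summand through its sign, while both norms enter K.\<close>

lemma potentials_bdd:
  fixes \<Omega> :: "'a::euclidean_space set"
  assumes q: "q \<in> potentials s \<Omega>" and \<Omega>: "bounded_in_one_direction \<Omega>" and s: "s \<ge> 0"
  obtains K L where "bdd_multiplier s K q" "L < delta s \<Omega>"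
    "\<And>\<phi>. \<phi> \<in> test_fun UNIV \<Longrightarrow> q (\<lambda>x. \<phi> x * \<phi> x) \<ge> - L * (norm (sob s \<phi>))\<^sup>2"
proof -
  obtain a b where ab: "q = (\<lambda>\<phi>. a \<phi> + b \<phi>)" "a \<in> multipliers_less s (delta s \<Omega>)" "b \<in> multipliers_nonneg s"
    using q unfolding potentials_def by blast
  have a: "a \<in> multipliers s" "multiplier_norm s a < ennreal (delta s \<Omega>)" using ab(2) by (auto simp: multipliers_less_def)
  have b: "b \<in> multipliers s" "\<And>f. f \<in> test_fun UNIV \<Longrightarrow> b (\<lambda>x. (f x)\<^sup>2) \<ge> 0" using ab(3) by (auto simp: multipliers_nonneg_def)
  note ma = multipliers_bdd[OF a(1) s] and mb = multipliers_bdd[OF b(1) s]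
  have "delta s \<Omega> \<ge> 0" by (simp add: delta_def)
  then have less: "enn2real (multiplier_norm s a) < delta s \<Omega>"
    using a(2) by (subst enn2real_less_iff) (auto simp: less_top[symmetric] intro: less_imp_neq order.strict_trans)
  show ?thesis
  proof (rule that[OF _ less])
    show "bdd_multiplier s (enn2real (multiplier_norm s a) + enn2real (multiplier_norm s b)) q"
      unfolding ab(1) by (rule bdd_multiplier_add[OF ma mb])
    fix \<phi> :: "'a \<Rightarrow> real" assume \<phi>: "\<phi> \<in> test_fun UNIV"
    have "\<bar>a (\<lambda>x. \<phi> x * \<phi> x)\<bar> \<le> enn2real (multiplier_norm s a) * norm (sob s \<phi>) * norm (sob s \<phi>)"
      using ma \<phi> unfolding bdd_multiplier_def by blast
    moreover have "b (\<lambda>x. \<phi> x * \<phi> x) \<ge> 0" using b(2)[OF \<phi>] by (simp add: power2_eq_square)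
    ultimately show "q (\<lambda>x. \<phi> x * \<phi> x) \<ge> - enn2real (multiplier_norm s a) * (norm (sob s \<phi>))\<^sup>2"
      unfolding ab(1) power2_eq_square by (simp add: mult.assoc)
  qed
qed

section \<open>The exterior value problem\<close>

text \<open>Coercivity concerns the closure of the test functions of \<Omega>. On the larger space
  of exterior data the form is merely bounded.\<close>

locale calderon = bdd_mult s K q for s K and q :: "('a::euclidean_space \<Rightarrow> real) \<Rightarrow> real" +
  fixes \<Omega> :: "'a set" and \<kappa> :: real
  assumes \<kappa>: "\<kappa> > 0" and coercive: "X \<in> hs_closure s \<Omega> \<Longrightarrow> bform X X \<ge> \<kappa> * (norm X)\<^sup>2"
begin

abbreviation "E \<equiv> hs_closure s \<Omega>"
abbreviation "H \<equiv> hs_closure s UNIV"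

lemma EH: "X \<in> E \<Longrightarrow> X \<in> H"
  using hs_closure_mono[of \<Omega> UNIV s] by auto

lemma testH: "\<phi> \<in> test_fun A \<Longrightarrow> sob s \<phi> \<in> H"
  by (rule sob_test_in[OF test_fun_UNIV])

lemmas H_add = subspace_add[OF subspace_hs_closure[OF s, of UNIV]]
  and H_diff = subspace_diff[OF subspace_hs_closure[OF s, of UNIV]]
  and E_add = subspace_add[OF subspace_hs_closure[OF s, of \<Omega>]]
  and E_diff = subspace_diff[OF subspace_hs_closure[OF s, of \<Omega>]]
  and E_scale = subspace_scale[OF subspace_hs_closure[OF s, of \<Omega>]]

lemmas lin_fracw = bounded_linear.linear[OF bounded_linear_mulop(1)[OF fracw_measurable fracw_le[OF s]]]

lemma bform_add: "X \<in> H \<Longrightarrow> Y \<in> H \<Longrightarrow> Z \<in> H \<Longrightarrow> bform (X + Y) Z = bform X Z + bform Y Z"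
  unfolding bform_def by (simp add: linear_add[OF lin_fracw] inner_add_left qform_add)

lemma bform_scale: "X \<in> H \<Longrightarrow> Z \<in> H \<Longrightarrow> bform (c *\<^sub>R X) Z = c * bform X Z"
  unfolding bform_def by (simp add: linear_scale[OF lin_fracw] qform_scale distrib_left)

lemma bform_sym: "X \<in> H \<Longrightarrow> Z \<in> H \<Longrightarrow> bform X Z = bform Z X"
  unfolding bform_def by (simp add: inner_commute qform_sym)

lemma bform_bound: 
  assumes "X \<in> H" "Z \<in> H" shows "\<bar>bform X Z\<bar> \<le> (1 + K) * norm X * norm Z"
proof -
  have n: "norm (mulop (fracw s) X) \<le> norm X" for X :: "'a l2"
    using bounded_linear_mulop(2)[OF fracw_measurable fracw_le[OF s], of X] by simp
  have "\<bar>inner (mulop (fracw s) X) (mulop (fracw s) Z)\<bar> \<le> norm X * norm Z"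
    using Cauchy_Schwarz_ineq2[of "mulop (fracw s) X" "mulop (fracw s) Z"] mult_mono[OF n[of X] n[of Z]] by simp
  then show ?thesis unfolding bform_def using qform_bound[OF assms] by (simp add: distrib_right)
qed

lemma bform_add_right: "X \<in> H \<Longrightarrow> Y \<in> H \<Longrightarrow> Z \<in> H \<Longrightarrow> bform Z (X + Y) = bform Z X + bform Z Y"
  by (simp add: bform_sym[of Z] H_add bform_add)

lemma variational:
  assumes S: "subspace S" "closure S \<subseteq> E" and F: "F \<in> H"
  shows "\<exists>V\<in>closure S. \<forall>Y\<in>S. bform (F + V) Y = 0"
proof (rule variational_solution[OF subspace_hs_closure[OF s] S(1)])
  show "closure S \<subseteq> H" using S(2) EH by blast
  show "bform X X \<ge> \<kappa> * (norm X)\<^sup>2" if "X \<in> S" for X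
    using that S(2) closure_subset by (intro coercive) blast
qed (use F \<kappa> bform_add bform_scale bform_sym bform_bound in auto)

definition solves :: "'a l2 \<Rightarrow> 'a l2 \<Rightarrow> bool" where
  "solves F U \<longleftrightarrow> U - F \<in> E \<and> (\<forall>Y\<in>E. bform U Y = 0)"

lemma solves_exists:
  assumes F: "F \<in> H" shows "\<exists>U. solves F U"
proof -
  have "closure E = E" using closed_hs_closure by (rule closure_closed)
  then obtain V where "V \<in> E" "\<forall>Y\<in>E. bform (F + V) Y = 0"
    using variational[OF subspace_hs_closure[OF s] _ F, of \<Omega>] by auto
  then show ?thesis unfolding solves_def by (intro exI[of _ "F + V"]) simp
qed

lemma solves_H: "F \<in> H \<Longrightarrow> solves F U \<Longrightarrow> U \<in> H"
  using H_add[of F "U - F"] EH by (simp add: solves_def)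

text \<open>Data that agree modulo \<open>E\<close> have the same solution, by coercivity applied to
  the difference. This makes the solution operator well defined on the quotient.\<close>

lemma solves_unique:
  assumes F: "F \<in> H" "F' \<in> H" "F - F' \<in> E" and U: "solves F U" and V: "solves F' V"
  shows "U = V"
proof -
  note UH = solves_H[OF F(1) U] and VH = solves_H[OF F(2) V]
  have "U - V = (U - F) - (V - F') + (F - F')" by simp
  then have D: "U - V \<in> E" using U V F(3) unfolding solves_def by (metis E_add E_diff)
  have "bform (U - V) (U - V) = 0"
    using bform_add[of "U - V" V "U - V"] UH VH D U V EH[OF D] unfolding solves_def by simp
  then have "\<kappa> * (norm (U - V))\<^sup>2 \<le> 0" using coercive[OF D] by simp
  then show ?thesis using \<kappa> by (simp add: mult_le_0_iff)
qed

lemma is_solution_iff: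
  assumes f: "f \<in> sobolev s" "sob s f \<in> H"
  shows "is_solution s \<Omega> q f u \<longleftrightarrow> u \<in> sobolev s \<and> solves (sob s f) (sob s u)"
proof -
  have "(\<lambda>x. u x - f x) \<in> sobolev_tilde s \<Omega> \<longleftrightarrow> sob s u - sob s f \<in> E" if "u \<in> sobolev s"
    using sob_diff[OF that f(1)] by (simp add: sobolev_tilde_iff[OF s])
  moreover have "(\<forall>v\<in>sobolev_tilde s \<Omega>. bilinear_form s q u v = 0) \<longleftrightarrow> (\<forall>Y\<in>E. bform (sob s u) Y = 0)" if "u \<in> sobolev s"
  proof
    assume *: "\<forall>v\<in>sobolev_tilde s \<Omega>. bilinear_form s q u v = 0"
    show "\<forall>Y\<in>E. bform (sob s u) Y = 0"
    proof
      fix Y assume Y: "Y \<in> E"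
      obtain v where v: "v \<in> sobolev s" "sob s v = Y" using sob_surj[OF s] by metis
      then show "bform (sob s u) Y = 0" using * Y bilinear_form_eq[OF that v(1)] by (auto simp: sobolev_tilde_iff[OF s])
    qed
  next
    assume "\<forall>Y\<in>E. bform (sob s u) Y = 0"
    then show "\<forall>v\<in>sobolev_tilde s \<Omega>. bilinear_form s q u v = 0"
      using bilinear_form_eq[OF that] by (auto simp: sobolev_tilde_iff[OF s])
  qed
  ultimately show ?thesis unfolding is_solution_def solves_def by blast
qed

text \<open>The representative chosen from a class may fail to be a test function, but it differs
  from one by an element of \<open>E\<close> and therefore stays in \<open>H\<close>.\<close>

lemma trace_class_some:
  assumes f: "f \<in> test_fun UNIV"
  defines "g \<equiv> SOME g. g \<in> trace_class s \<Omega> f"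
  shows "g \<in> sobolev s" "sob s g \<in> H" "sob s f - sob s g \<in> E"
proof -
  have fS: "f \<in> sobolev s" by (rule test_fun_sobolev[OF f s])
  have iff: "g \<in> trace_class s \<Omega> f \<longleftrightarrow> g \<in> sobolev s \<and> sob s f - sob s g \<in> E" for g
    using sob_diff[OF fS] fS by (auto simp: trace_class_def trace_rel_def sobolev_tilde_iff[OF s])
  have "f \<in> trace_class s \<Omega> f" 
    unfolding iff using fS subspace_0[OF subspace_hs_closure[OF s]] by simp
  then have "g \<in> trace_class s \<Omega> f" unfolding g_def by (rule someI[of "\<lambda>g. g \<in> trace_class s \<Omega> f"])
  then show g: "g \<in> sobolev s" "sob s f - sob s g \<in> E" unfolding iff by auto
  show "sob s g \<in> H" using H_diff[OF testH[OF f] EH[OF g(2)]] by simp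
qed

text \<open>Both choices of representatives are harmless: changing f within its class leaves the
  solution unchanged, and changing g adds an element of \<open>E\<close>, which is orthogonal to a
  solution.\<close>

lemma DN_map_eq:
  assumes f: "f \<in> test_fun UNIV" and g: "g \<in> test_fun UNIV" and U: "solves (sob s f) U"
  shows "DN_map s \<Omega> q (trace_class s \<Omega> f) (trace_class s \<Omega> g) = bform U (sob s g)"
proof -
  define f' where "f' = (SOME f'. f' \<in> trace_class s \<Omega> f)"
  define g' where "g' = (SOME g'. g' \<in> trace_class s \<Omega> g)"
  note f' = trace_class_some[OF f, folded f'_def] and g' = trace_class_some[OF g, folded g'_def]
  obtain V where V: "solves (sob s f') V" using solves_exists[OF f'(2)] by blast
  obtain v where v: "v \<in> sobolev s" "sob s v = V" using sob_surj[OF s] by metis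
  have "is_solution s \<Omega> q f' v" unfolding is_solution_iff[OF f'(1,2)] using v V by simp
  then have "is_solution s \<Omega> q f' (solution s \<Omega> q f')" unfolding solution_def by (rule someI[of "is_solution s \<Omega> q f'"])
  then have w: "solution s \<Omega> q f' \<in> sobolev s" "solves (sob s f') (sob s (solution s \<Omega> q f'))"
    unfolding is_solution_iff[OF f'(1,2)] by auto
  have eq: "U = sob s (solution s \<Omega> q f')"
    by (rule solves_unique[OF testH[OF f] f'(2) f'(3) U w(2)])
  have UH: "U \<in> H" by (rule solves_H[OF testH[OF f] U])
  have "bform U (sob s g) = bform U (sob s g') + bform U (sob s g - sob s g')"
    using bform_add_right[OF g'(2) EH[OF g'(3)] UH] by simp
  also have "bform U (sob s g - sob s g') = 0" using U g'(3) by (simp add: solves_def)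
  finally show ?thesis
    unfolding DN_map_def f'_def[symmetric] g'_def[symmetric] bilinear_form_eq[OF w(1) g'(1)] eq by simp
qed

section \<open>Runge approximation\<close>

definition corrections :: "'a set \<Rightarrow> 'a l2 set" where
  "corrections W = {V \<in> E. \<exists>f\<in>test_fun W. solves (sob s f) (sob s f + V)}"

lemma subspace_corrections: "subspace (corrections W)"
proof (rule subspaceI)
  have "solves (sob s (\<lambda>x. 0)) (sob s (\<lambda>x. 0) + 0)"
  proof -
    have z: "sob s (\<lambda>x. 0) = (0 :: 'a l2)"
      using sob_scale(2)[OF test_fun_sobolev[OF test_fun_zero s], of 0] by simp
    have "bform 0 Y = 0" if "Y \<in> H" for Y
      using bform_scale[OF that that, of 0] by simp
    then show ?thesis unfolding z solves_def using EH subspace_0[OF subspace_hs_closure[OF s]] by simp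
  qed
  then show "0 \<in> corrections W"
    unfolding corrections_def using test_fun_zero subspace_0[OF subspace_hs_closure[OF s]] by blast
  fix X Y c assume X: "X \<in> corrections W"
  then obtain f where f: "f \<in> test_fun W" "X \<in> E" "\<And>Z. Z \<in> E \<Longrightarrow> bform (sob s f + X) Z = 0"
    unfolding corrections_def solves_def by auto
  have "bform (sob s (\<lambda>x. c * f x) + c *\<^sub>R X) Z = 0" if "Z \<in> E" for Z
    using bform_scale[OF H_add[OF testH[OF f(1)] EH[OF f(2)]] EH[OF that], of c] f(3)[OF that]
    by (simp add: sob_scale(2)[OF test_fun_sobolev[OF f(1) s]] scaleR_add_right)
  then show "c *\<^sub>R X \<in> corrections W"
    unfolding corrections_def solves_def using E_scale[OF f(2), of c] test_fun_scale[OF f(1), of c] by auto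
  assume Y: "Y \<in> corrections W"
  then obtain g where g: "g \<in> test_fun W" "Y \<in> E" "\<And>Z. Z \<in> E \<Longrightarrow> bform (sob s g + Y) Z = 0"
    unfolding corrections_def solves_def by auto
  have "bform (sob s (\<lambda>x. f x + g x) + (X + Y)) Z = 0" if "Z \<in> E" for Z
    using bform_add[OF H_add[OF testH[OF f(1)] EH[OF f(2)]] H_add[OF testH[OF g(1)] EH[OF g(2)]] EH[OF that]] f(3)[OF that] g(3)[OF that]
    by (simp add: sob_add(2)[OF test_fun_sobolev[OF f(1) s] test_fun_sobolev[OF g(1) s]] algebra_simps)
  then show "X + Y \<in> corrections W"
    unfolding corrections_def solves_def using E_add[OF f(2) g(2)] test_fun_add[OF f(1) g(1)] by auto
qed

text \<open>Choose V in the closure of the corrections such that X = F + V is orthogonal to all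
  corrections with respect to the form. For a solution U with datum f, X is orthogonal to U because
  X lies in \<open>E\<close>, and to U - f by choice, hence to f. The potential does not couple X
  and f, so the fractional part vanishes as well. Unique continuation gives X = 0, and F = -V is a
  limit of corrections.\<close>

lemma runge:
  assumes W: "W \<inter> \<Omega> = {}"
    and ucp: "\<And>X. X \<in> E \<Longrightarrow> (\<And>f. f \<in> test_fun W \<Longrightarrow> inner (mulop (fracw s) X) (mulop (fracw s) (sob s f)) = 0) \<Longrightarrow> X = 0"
  shows "E \<subseteq> closure (corrections W)"
proof
  fix F assume F: "F \<in> E"
  have cE: "closure (corrections W) \<subseteq> E"
    by (rule closure_minimal[OF _ closed_hs_closure]) (auto simp: corrections_def)
  obtain V where V: "V \<in> closure (corrections W)" "\<And>Y. Y \<in> corrections W \<Longrightarrow> bform (F + V) Y = 0"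
    using variational[OF subspace_corrections cE EH[OF F]] by blast
  have X: "F + V \<in> E" using E_add[OF F] V(1) cE by blast
  have "F + V = 0"
  proof (rule ucp[OF X])
    fix f assume f: "f \<in> test_fun W"
    obtain U where U: "solves (sob s f) U" using solves_exists[OF testH[OF f]] by blast
    then have UE: "U - sob s f \<in> E" by (simp add: solves_def)
    have "U - sob s f \<in> corrections W" unfolding corrections_def using f U UE by (intro CollectI conjI bexI[of _ f]) auto
    then have "bform (F + V) (U - sob s f) = 0" by (rule V(2))
    moreover have "bform (F + V) U = 0"
      using U X bform_sym[OF EH[OF X] solves_H[OF testH[OF f] U]] by (simp add: solves_def)
    moreover have "bform (F + V) (sob s f + (U - sob s f)) = bform (F + V) (sob s f) + bform (F + V) (U - sob s f)"
      by (rule bform_add_right[OF testH[OF f] EH[OF UE] EH[OF X]])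
    ultimately have "bform (F + V) (sob s f) = 0" by simp
    moreover have "qform (F + V) (sob s f) = 0"
      by (rule qform_disjoint[OF X sob_test_in[OF f]]) (use W in auto)
    ultimately show "inner (mulop (fracw s) (F + V)) (mulop (fracw s) (sob s f)) = 0"
      by (simp add: bform_def)
  qed
  then have "F = (-1) *\<^sub>R V" by (simp add: eq_neg_iff_add_eq_0)
  moreover have "(-1) *\<^sub>R V \<in> closure (corrections W)"
  proof -
    have "(-1) *\<^sub>R V \<in> (*\<^sub>R) (-1) ` closure (corrections W)" using V(1) by blast
    also have "\<dots> = closure ((*\<^sub>R) (-1) ` corrections W)" by (rule closure_scaleR)
    also have "(*\<^sub>R) (-1) ` corrections W \<subseteq> corrections W" using subspace_scale[OF subspace_corrections, of _ W "-1"] by auto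
    then have "closure ((*\<^sub>R) (-1) ` corrections W) \<subseteq> closure (corrections W)" by (rule closure_mono)
    finally show ?thesis .
  qed
  ultimately show "F \<in> closure (corrections W)" by simp
qed

lemma qform_cont:
  assumes X: "\<And>k::nat. X k \<in> H" "X \<longlonglongrightarrow> X0" and Y: "Y \<in> H"
  shows "(\<lambda>k. qform (X k) Y) \<longlonglongrightarrow> qform X0 Y"
proof -
  have X0: "X0 \<in> H" using closed_sequentially[OF closed_hs_closure] X by blast
  have "(\<lambda>k. qform (X k) Y - qform X0 Y) \<longlonglongrightarrow> 0"
  proof (rule Lim_null_comparison)
    have "qform (X k) Y - qform X0 Y = qform (X k - X0) Y" for k
      using qform_add[OF H_diff[OF X(1) X0] X0 Y, of k] by simp
    then show "\<forall>\<^sub>F k in sequentially. norm (qform (X k) Y - qform X0 Y) \<le> K * norm (X k - X0) * norm Y"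
      using qform_bound[OF H_diff[OF X(1) X0] Y] by simp
    have "(\<lambda>k. K * norm (X k - X0) * norm Y) \<longlonglongrightarrow> K * norm (X0 - X0) * norm Y" by (intro tendsto_intros X)
    then show "(\<lambda>k. K * norm (X k - X0) * norm Y) \<longlonglongrightarrow> 0" by simp
  qed
  then show ?thesis by (simp add: LIM_zero_iff)
qed

end

lemma potentials_calderon:
  fixes \<Omega> :: "'a::euclidean_space set"
  assumes q: "q \<in> potentials s \<Omega>" and \<Omega>: "bounded_in_one_direction \<Omega>" and s: "s \<ge> 0"
  obtains K \<kappa> where "calderon s K q \<Omega> \<kappa>"
proof -
  obtain K L where K: "bdd_multiplier s K q" and L: "L < delta s \<Omega>"
    "\<And>\<phi>. \<phi> \<in> test_fun UNIV \<Longrightarrow> q (\<lambda>x. \<phi> x * \<phi> x) \<ge> - L * (norm (sob s \<phi>))\<^sup>2"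
    using potentials_bdd[OF assms] by metis
  interpret bdd_mult s K q by unfold_locales (use s K in auto)
  have "calderon s K q \<Omega> (delta s \<Omega> - L)"
  proof
    show "0 < delta s \<Omega> - L" using L by simp
    fix X assume X: "X \<in> hs_closure s \<Omega>"
    have "X \<in> hs_closure s UNIV" using X hs_closure_mono[of \<Omega> UNIV s] by auto
    then have "qform X X \<ge> - L * (norm X)\<^sup>2" by (rule qform_lower[OF _ L(2)])
    moreover have "delta s \<Omega> * (norm X)\<^sup>2 \<le> (norm (mulop (fracw s) X))\<^sup>2" by (rule delta_bound[OF \<Omega> s X])
    ultimately show "(delta s \<Omega> - L) * (norm X)\<^sup>2 \<le> bform X X"
      unfolding bform_def by (simp add: power2_norm_eq_inner[symmetric] left_diff_distrib)
  qed
  then show ?thesis by (rule that)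
qed

section \<open>Subordination to the heat semigroup\<close>

text \<open>
  Removing the Taylor polynomial of order \<open>m = \<lfloor>s\<rfloor>\<close> makes \<open>\<integral> t\<^sup>-\<^sup>s\<^sup>-\<^sup>1 exp_tail m (t x) dt\<close> converge at \<open>0\<close>; it is
  a multiple of \<open>x\<^sup>s\<close>, and a nonzero one because \<open>exp_tail m\<close> has constant sign.
\<close>

definition exp_tail :: "nat \<Rightarrow> real \<Rightarrow> real" where
  "exp_tail m x = exp (- x) - (\<Sum>j\<le>m. (- x) ^ j / fact j)"

lemma exp_tail_measurable [measurable]: "exp_tail m \<in> borel_measurable borel"
  unfolding exp_tail_def[abs_def] by measurable

text \<open>The Lagrange form of the remainder exhibits its sign and its size at once.\<close>

lemma exp_tail_lagrange:
  assumes x: "x > 0"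
  obtains t where "0 < t" "t < x" "exp_tail m x = exp (- t) / fact (Suc m) * (- x) ^ Suc m"
proof -
  define d where "d k t = (- 1) ^ k * exp (- t)" for k :: nat and t :: real
  have "\<exists>t>0. t < x \<and> exp (- x) = (\<Sum>k<Suc m. d k 0 / fact k * x ^ k) + d (Suc m) t / fact (Suc m) * x ^ Suc m"
  proof (rule Maclaurin[OF x])
    show "d 0 = (\<lambda>x. exp (- x))" by (auto simp: d_def)
    show "\<forall>k t. k < Suc m \<and> 0 \<le> t \<and> t \<le> x \<longrightarrow> (d k has_real_derivative d (Suc k) t) (at t)"
      unfolding d_def by (auto intro!: derivative_eq_intros)
  qed simp
  then obtain t where t: "t > 0" "t < x" "exp (- x) = (\<Sum>k<Suc m. d k 0 / fact k * x ^ k) + d (Suc m) t / fact (Suc m) * x ^ Suc m" by blast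
  have p: "(- x) ^ k = (- 1) ^ k * x ^ k" for k by (rule power_minus)
  have "(\<Sum>k<Suc m. d k 0 / fact k * x ^ k) = (\<Sum>k\<le>m. (- x) ^ k / fact k)"
    unfolding lessThan_Suc_atMost p d_def by simp
  moreover have "d (Suc m) t / fact (Suc m) * x ^ Suc m = exp (- t) / fact (Suc m) * (- x) ^ Suc m"
    unfolding p d_def by simp
  ultimately have "exp_tail m x = exp (- t) / fact (Suc m) * (- x) ^ Suc m"
    using t(3) by (simp add: exp_tail_def del: power_Suc fact_Suc)
  then show ?thesis using that t by blast
qed

text \<open>The power x^(m+1) governs convergence at 0 and x^m convergence at infinity.\<close>

lemma exp_tail_bounds:
  assumes x: "x > 0"
  shows "(- 1) ^ Suc m * exp_tail m x > 0" "\<bar>exp_tail m x\<bar> \<le> x ^ Suc m" "\<bar>exp_tail m x\<bar> \<le> 2 * x ^ m"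
proof -
  have sgn: "(- 1) ^ Suc m * exp_tail m x > 0" and b: "\<bar>exp_tail m x\<bar> \<le> x ^ Suc m" for m
  proof -
    obtain t where t: "0 < t" "t < x" "exp_tail m x = exp (- t) / fact (Suc m) * (- x) ^ Suc m"
      using exp_tail_lagrange[OF x] by metis
    have "(- 1) ^ Suc m * exp_tail m x = exp (- t) / fact (Suc m) * ((- 1) ^ Suc m * (- x) ^ Suc m)"
      unfolding t(3) by (simp only: mult_ac)
    also have "(- 1) ^ Suc m * (- x) ^ Suc m = x ^ Suc m" by (subst power_mult_distrib[symmetric]) simp
    finally show "(- 1) ^ Suc m * exp_tail m x > 0" using x by (simp del: power_Suc fact_Suc)
    have "exp (- t) / fact (Suc m) \<le> 1 / 1" 
      using t(1) by (intro frac_le fact_ge_1) auto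
    then have "exp (- t) / fact (Suc m) \<le> 1" by simp
    then have "exp (- t) / fact (Suc m) * x ^ Suc m \<le> 1 * x ^ Suc m" using x by (intro mult_right_mono) auto
    moreover have "\<bar>exp_tail m x\<bar> = exp (- t) / fact (Suc m) * x ^ Suc m"
      unfolding t(3) using x by (simp add: abs_mult power_abs del: power_Suc fact_Suc)
    ultimately show "\<bar>exp_tail m x\<bar> \<le> x ^ Suc m" by simp
  qed
  show "(- 1) ^ Suc m * exp_tail m x > 0" "\<bar>exp_tail m x\<bar> \<le> x ^ Suc m" by (rule sgn, rule b)
  show "\<bar>exp_tail m x\<bar> \<le> 2 * x ^ m"
  proof (cases m)
    case 0
    have "0 < exp (- x)" "exp (- x) \<le> 1" using x by simp_all
    moreover have "exp_tail m x = exp (- x) - 1" by (simp add: 0 exp_tail_def)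
    moreover have "2 * x ^ m = 2" by (simp add: 0)
    ultimately show ?thesis by linarith
  next
    \<comment> \<open>The remainders of orders m - 1 and m differ by one Taylor term, and both this
      term and the remainder of order m - 1 are bounded by x^m.\<close>
    case (Suc k)
    have "\<bar>(- x) ^ m / fact m\<bar> \<le> x ^ m"
      using x fact_ge_1[of m, where 'a=real] by (simp add: power_abs divide_le_eq mult_le_cancel_left1)
    moreover have "exp_tail m x = exp_tail k x - (- x) ^ m / fact m"
      by (simp add: exp_tail_def Suc del: power_Suc fact_Suc)
    ultimately show ?thesis using b[of k] unfolding Suc by linarith
  qed
qed

lemma integrable_half_line:
  fixes F :: "real \<Rightarrow> real"
  assumes [measurable]: "F \<in> borel_measurable borel" and a: "a > -1" and b: "b < -1"
    and F0: "\<And>t. 0 < t \<Longrightarrow> t \<le> 1 \<Longrightarrow> \<bar>F t\<bar> \<le> A * t powr a" and F1: "\<And>t. 1 \<le> t \<Longrightarrow> \<bar>F t\<bar> \<le> C * t powr b"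
  shows "integrable lborel (\<lambda>t. indicator {0<..} t * F t)"
proof (rule Bochner_Integration.integrable_bound)
  have i: "integrable lborel (\<lambda>t. indicator S t * t powr p)" if "((\<lambda>t. t powr p) has_integral I) S" "S \<in> sets borel" for S I and p :: real
  proof (rule integrableI_nonneg)
    have "(\<integral>\<^sup>+t. ennreal (indicator S t * t powr p) \<partial>lborel) = (\<integral>\<^sup>+t. indicator S t * ennreal (t powr p) \<partial>lborel)"
      by (intro nn_integral_cong) (auto simp: indicator_def)
    also have "\<dots> = ennreal I"
      using nn_integral_has_integral_lebesgue[OF _ that(1)] by (simp add: ennreal_mult' ennreal_indicator)
    finally show "(\<integral>\<^sup>+t. ennreal (indicator S t * t powr p) \<partial>lborel) < \<infinity>" by simp
  qed (use that(2) in auto)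
  show "integrable lborel (\<lambda>t. A * (indicator {0..1} t * t powr a) + C * (indicator {1..} t * t powr b))"
    by (intro Bochner_Integration.integrable_add integrable_mult_right i[OF has_integral_powr_from_0[OF a]] i[OF has_integral_powr_to_inf[OF b]]) auto
  have A0: "A \<ge> 0" using F0[of 1] by simp
  have C0: "C \<ge> 0" using F1[of 1] by simp
  show "AE t in lborel. norm (indicator {0<..} t * F t) \<le> norm (A * (indicator {0..1} t * t powr a) + C * (indicator {1..} t * t powr b))"
  proof (rule AE_I2)
    fix t :: real
    have nn: "A * (indicator {0..1} t * t powr a) \<ge> 0" "C * (indicator {1..} t * t powr b) \<ge> 0" using A0 C0 by auto
    have "\<bar>indicator {0<..} t * F t\<bar> \<le> A * (indicator {0..1} t * t powr a) + C * (indicator {1..} t * t powr b)"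
    proof (cases "0 < t")
      case True
      show ?thesis
      proof (cases "t \<le> 1")
        case t1: True
        then have "\<bar>indicator {0<..} t * F t\<bar> \<le> A * (indicator {0..1} t * t powr a)" using True F0[of t] by simp
        then show ?thesis using nn by linarith
      next
        case False
        then have "\<bar>indicator {0<..} t * F t\<bar> \<le> C * (indicator {1..} t * t powr b)" using True F1[of t] by simp
        then show ?thesis using nn by linarith
      qed
    next
      case False then show ?thesis using nn by simp
    qed
    then show "norm (indicator {0<..} t * F t) \<le> norm (A * (indicator {0..1} t * t powr a) + C * (indicator {1..} t * t powr b))" using nn by simp
  qed
qed simp

text \<open>The Mellin weight of the subordination formulas, extended by zero to the whole line so
  that Fubini applies to \<open>lborel\<close>.\<close>

definition sweight :: "real \<Rightarrow> real \<Rightarrow> real" where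
  "sweight s t = indicator {0<..} t * t powr (- s - 1)"

lemma sweight_measurable [measurable]: "sweight s \<in> borel_measurable borel"
  unfolding sweight_def[abs_def] by measurable

lemma sweight_scale: "r > 0 \<Longrightarrow> sweight s (r * t) = r powr (- s - 1) * sweight s t"
  by (auto simp: sweight_def powr_mult indicator_def zero_less_mult_iff)

lemma sweight_nonneg: "sweight s t \<ge> 0"
  by (simp add: sweight_def)

lemma integral_pos_half_line:
  fixes F :: "real \<Rightarrow> real"
  assumes F: "integrable lborel (\<lambda>t. indicator {0<..} t * F t)" and pos: "\<And>t. t > 0 \<Longrightarrow> F t > 0"
  shows "(LINT t|lborel. indicator {0<..} t * F t) > 0"
proof (rule ccontr)
  assume "\<not> (LINT t|lborel. indicator {0<..} t * F t) > 0"
  moreover have nn: "AE t in lborel. 0 \<le> indicator {0<..} t * F t" using pos by (auto simp: indicator_def less_imp_le)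
  ultimately have "(LINT t|lborel. indicator {0<..} t * F t) = 0" using integral_nonneg_AE[OF nn] by simp
  then have "AE t in lborel. indicator {0<..} t * F t = 0" using integral_nonneg_eq_0_iff_AE[OF F nn] by simp
  then have "AE t in lborel. t \<notin> {0<..<1::real}"
    by eventually_elim (use pos in \<open>fastforce simp: indicator_def\<close>)
  then have "{0<..<1::real} \<in> null_sets lborel" by (subst AE_iff_null_sets) auto
  then have "emeasure lborel {0<..<1::real} = 0" by (rule null_setsD1)
  moreover have "emeasure lborel {0<..<1::real} = ennreal (1 - 0)" by (rule emeasure_lborel_Ioo) simp
  ultimately show False by (metis diff_zero ennreal_1 zero_neq_one)
qed

lemma power_over_fact_le_exp:
  fixes x :: real assumes "x \<ge> 0" shows "x ^ k / fact k \<le> exp x"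
proof -
  have "(\<Sum>n\<in>{k}. x ^ n /\<^sub>R fact n) \<le> (\<Sum>n. x ^ n /\<^sub>R fact n)"
    using assms by (intro sum_le_suminf summable_exp_generic) auto
  then show ?thesis by (simp add: exp_def divide_inverse mult.commute)
qed

text \<open>The substitution t l \<rightarrow> t extracts l^s. The remaining integrand is O(t^(m-s))
  at 0 and O(t^(m-s-1)) at infinity, so the two hypotheses on m are precisely the two convergence
  conditions. The integral of the modulus is recorded for a later use of Fubini.\<close>

lemma exp_tail_subordination:
  fixes s :: real
  assumes m: "real m < s" "s < real m + 1"
  obtains c where "c \<noteq> 0" 
    "\<And>l. l \<ge> 0 \<Longrightarrow> integrable lborel (\<lambda>t. sweight s t * exp_tail m (t * l))"
    "\<And>l. l \<ge> 0 \<Longrightarrow> (LINT t|lborel. sweight s t * exp_tail m (t * l)) = c * l powr s"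
    "\<And>l. l \<ge> 0 \<Longrightarrow> (LINT t|lborel. \<bar>sweight s t * exp_tail m (t * l)\<bar>) = \<bar>c\<bar> * l powr s"
proof -
  define F where "F t = t powr (- s - 1) * exp_tail m t" for t
  have Fw: "sweight s t * exp_tail m t = indicator {0<..} t * F t" for t by (simp add: sweight_def F_def)
  have i: "integrable lborel (\<lambda>t. indicator {0<..} t * F t)"
  proof (rule integrable_half_line[where a = "real m - s" and b = "real m - s - 1" and A = 1 and C = 2])
    show "F \<in> borel_measurable borel" unfolding F_def[abs_def] by measurable
    fix t :: real
    show "\<bar>F t\<bar> \<le> 1 * t powr (real m - s)" if "0 < t" "t \<le> 1"
    proof -
      have "\<bar>F t\<bar> \<le> t powr (- s - 1) * t ^ Suc m"
        unfolding F_def abs_mult using exp_tail_bounds(2)[OF that(1), of m] by (simp add: mult_left_mono del: power_Suc)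
      also have "\<dots> = t powr (- s - 1) * t powr real (Suc m)" using that by (simp only: powr_realpow)
      also have "\<dots> = t powr (real m - s)" by (simp add: powr_add[symmetric] algebra_simps)
      finally show ?thesis by simp
    qed
    show "\<bar>F t\<bar> \<le> 2 * t powr (real m - s - 1)" if "1 \<le> t"
    proof -
      have t0: "t > 0" using that by simp
      have "\<bar>F t\<bar> \<le> t powr (- s - 1) * (2 * t ^ m)"
        unfolding F_def abs_mult using exp_tail_bounds(3)[OF t0, of m] by (simp add: mult_left_mono)
      also have "\<dots> = 2 * (t powr (- s - 1) * t powr real m)" using t0 by (simp add: powr_realpow)
      also have "\<dots> = 2 * t powr (real m - s - 1)" by (simp add: powr_add[symmetric] algebra_simps)
      finally show ?thesis .
    qed
  qed (use m in auto)
  define c where "c = (LINT t|lborel. indicator {0<..} t * F t)"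
  \<comment> \<open>The sign of the remainder. It shows that c is nonzero and turns the integral of
    the modulus into a signed one.\<close>
  define \<sigma> where "\<sigma> = (- 1 :: real) ^ Suc m"
  have \<sigma>: "\<bar>\<sigma>\<bar> = 1" by (simp add: \<sigma>_def power_abs)
  have sg: "\<sigma> * F t > 0" if "t > 0" for t
  proof -
    have "t powr (- s - 1) * (\<sigma> * exp_tail m t) > 0"
      unfolding \<sigma>_def by (rule mult_pos_pos[OF _ exp_tail_bounds(1)[OF that]]) (use that in simp)
    then show ?thesis by (simp add: F_def mult_ac)
  qed
  have "integrable lborel (\<lambda>t. indicator {0<..} t * (\<sigma> * F t))"
    using integrable_mult_right[OF i, of \<sigma>] by (simp add: mult_ac)
  then have "(LINT t|lborel. indicator {0<..} t * (\<sigma> * F t)) > 0"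
    by (rule integral_pos_half_line) (rule sg)
  also have "(LINT t|lborel. indicator {0<..} t * (\<sigma> * F t)) = (LINT t|lborel. \<sigma> * (indicator {0<..} t * F t))"
    by (simp add: mult_ac)
  finally have cpos: "\<sigma> * c > 0" unfolding c_def by simp
  have c0: "c \<noteq> 0" using cpos by auto
  have sc: "sweight s t * exp_tail m (t * l) = l powr (s + 1) * (indicator {0<..} (0 + l * t) * F (0 + l * t))" if "l > 0" for l t
  proof -
    have "l powr (s + 1) * l powr (- s - 1) = 1" using that by (simp add: powr_add[symmetric])
    then show ?thesis using that unfolding Fw[symmetric] by (simp add: sweight_scale mult.commute)
  qed
  have z: "exp_tail m 0 = 0" 
  proof -
    have "(\<Sum>j\<le>m. (- 0) ^ j / fact j :: real) = (\<Sum>j\<in>{0}. (- 0) ^ j / fact j)"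
      by (rule sum.mono_neutral_right) (auto simp: power_0_left)
    then show ?thesis by (simp add: exp_tail_def)
  qed
  have I: "integrable lborel (\<lambda>t. sweight s t * exp_tail m (t * l))" and V: "(LINT t|lborel. sweight s t * exp_tail m (t * l)) = c * l powr s" if "l \<ge> 0" for l
  proof -
    show "integrable lborel (\<lambda>t. sweight s t * exp_tail m (t * l))"
    proof (cases "l = 0")
      case False
      then have l: "l > 0" using that by simp
      show ?thesis unfolding sc[OF l] by (intro integrable_mult_right lborel_integrable_real_affine[OF i]) (use l in auto)
    qed (simp add: z)
    show "(LINT t|lborel. sweight s t * exp_tail m (t * l)) = c * l powr s"
    proof (cases "l = 0")
      case False
      then have l: "l > 0" using that by simp
      have "(LINT t|lborel. sweight s t * exp_tail m (t * l)) = l powr (s + 1) * (LINT t|lborel. indicator {0<..} (0 + l * t) * F (0 + l * t))"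
        unfolding sc[OF l] by (rule integral_mult_right_zero)
      moreover have "c = l * (LINT t|lborel. indicator {0<..} (0 + l * t) * F (0 + l * t))"
        unfolding c_def using lborel_integral_real_affine[of l "\<lambda>t. indicator {0<..} t * F t" 0] l by simp
      ultimately show ?thesis using l by (simp add: powr_add field_simps)
    qed (use m in \<open>simp add: z\<close>)
  qed
  have "(LINT t|lborel. \<bar>sweight s t * exp_tail m (t * l)\<bar>) = \<bar>c\<bar> * l powr s" if "l \<ge> 0" for l
  proof -
    have "\<bar>sweight s t * exp_tail m (t * l)\<bar> = \<sigma> * (sweight s t * exp_tail m (t * l))" for t
    proof (cases "t > 0 \<and> l > 0")
      case True
      then have "\<sigma> * exp_tail m (t * l) > 0" unfolding \<sigma>_def by (intro exp_tail_bounds) simp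
      then have "sweight s t * (\<sigma> * exp_tail m (t * l)) \<ge> 0"
        by (intro mult_nonneg_nonneg[OF sweight_nonneg] less_imp_le)
      then have p: "\<sigma> * (sweight s t * exp_tail m (t * l)) \<ge> 0" by (simp add: mult_ac)
      have "\<bar>sweight s t * exp_tail m (t * l)\<bar> = \<bar>\<sigma> * (sweight s t * exp_tail m (t * l))\<bar>"
        by (simp add: abs_mult \<sigma>)
      then show ?thesis using p by simp
    next
      case False
      then have "sweight s t * exp_tail m (t * l) = 0" using that by (cases "l = 0") (auto simp: sweight_def z)
      then show ?thesis by (simp only: abs_zero mult_zero_right)
    qed
    then have "(LINT t|lborel. \<bar>sweight s t * exp_tail m (t * l)\<bar>) = \<sigma> * c * l powr s"
      using V[OF that] by simp
    also have "\<sigma> * c = \<bar>\<sigma> * c\<bar>" using cpos by simp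
    also have "\<dots> = \<bar>c\<bar>" by (simp add: abs_mult \<sigma>)
    finally show ?thesis .
  qed
  then show ?thesis using that[OF c0 I V] by blast
qed

text \<open>Scaling time by |z|^2 collects the powers |z|^(-n) from the kernel, |z|^(-2s-2) from the
  weight and |z|^2 from the measure, in total |z|^(-n-2s).\<close>

lemma heat_kernel_subordination:
  fixes s :: real
  assumes s: "s > 0"
  obtains C where "C > 0" 
    "\<And>z::'a::euclidean_space. z \<noteq> 0 \<Longrightarrow> integrable lborel (\<lambda>t. sweight s t * heat_kernel t z)"
    "\<And>z::'a. z \<noteq> 0 \<Longrightarrow> (LINT t|lborel. sweight s t * heat_kernel t z) = C * norm z powr (- (real DIM('a) + 2 * s))"
proof -
  let ?n = "DIM('a)"
  define h where "h t = exp (- 1 / (4 * t)) / sqrt (4 * pi * t) ^ ?n" for t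
  define F where "F t = t powr (- s - 1) * h t" for t
  have Fw: "sweight s t * h t = indicator {0<..} t * F t" for t by (simp add: sweight_def F_def)
  have i: "integrable lborel (\<lambda>t. indicator {0<..} t * F t)"
  proof -
    \<comment> \<open>The bound exp (-1/(4t)) \<le> k! (4t)^k with this k compensates the
      singularity t^(-s-1-n) that the weight and the normalisation of the kernel have at most at
      0.\<close>
    obtain k :: nat where k: "real k \<ge> s + 1 + ?n" using real_arch_simple by blast
    show ?thesis
    proof (rule integrable_half_line[where a = 0 and b = "- s - 1" and A = "fact k * 4 ^ k" and C = 1])
      show "F \<in> borel_measurable borel" unfolding F_def[abs_def] h_def[abs_def] by measurable
      fix t :: real
      show "\<bar>F t\<bar> \<le> (fact k * 4 ^ k) * t powr 0" if t: "0 < t" "t \<le> 1"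
      proof -
        have "(1 / (4 * t)) ^ k / fact k \<le> exp (1 / (4 * t))"
          using t by (intro power_over_fact_le_exp) auto
        then have e: "exp (- 1 / (4 * t)) \<le> fact k * (4 * t) ^ k"
          using t by (simp add: exp_minus field_simps power_divide)
        have "t \<le> sqrt t" using t by (simp add: real_le_rsqrt power2_eq_square mult_le_one)
        also have "sqrt t \<le> sqrt (4 * pi * t)" using t pi_ge_two by (intro real_sqrt_le_mono) (simp add: mult_le_cancel_right1)
        finally have "t ^ ?n \<le> sqrt (4 * pi * t) ^ ?n" using t by (intro power_mono) auto
        then have "h t \<le> fact k * (4 * t) ^ k / t ^ ?n"
          unfolding h_def using e t by (intro frac_le) auto
        then have "F t \<le> t powr (- s - 1) * (fact k * (4 * t) ^ k / t ^ ?n)"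
          unfolding F_def by (intro mult_left_mono) auto
        also have "\<dots> = (fact k * 4 ^ k) * (t powr (- s - 1) * t powr real k / t powr real ?n)"
          using t by (simp add: powr_realpow power_mult_distrib)
        also have "t powr (- s - 1) * t powr real k / t powr real ?n = t powr (real k - s - 1 - ?n)"
          by (simp add: powr_add[symmetric] powr_diff[symmetric] algebra_simps)
        also have "\<dots> \<le> 1" using t k by (intro powr_le1) auto
        finally have "F t \<le> fact k * 4 ^ k" by simp
        moreover have "F t \<ge> 0" using t by (simp add: F_def h_def)
        ultimately show ?thesis using t by simp
      qed
      show "\<bar>F t\<bar> \<le> 1 * t powr (- s - 1)" if t: "1 \<le> t"
      proof -
        have "1 \<le> 4 * pi * t" using t pi_ge_two mult_mono[of 1 "4 * pi" 1 t] by simp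
        then have "1 \<le> sqrt (4 * pi * t) ^ ?n" by (intro one_le_power) simp
        moreover have "exp (- 1 / (4 * t)) \<le> 1" using t by simp
        ultimately have "h t \<le> 1 / 1" unfolding h_def by (intro frac_le) auto
        moreover have "h t \<ge> 0" unfolding h_def using t by simp
        ultimately have "h t \<le> 1" "h t \<ge> 0" by simp_all
        then show ?thesis unfolding F_def by (simp add: abs_mult mult_left_le)
      qed
    qed (use s in auto)
  qed
  define C where "C = (LINT t|lborel. indicator {0<..} t * F t)"
  have "C > 0" unfolding C_def by (rule integral_pos_half_line[OF i]) (simp add: F_def h_def)
  have sc: "sweight s (0 + (norm z)\<^sup>2 * t) * heat_kernel (0 + (norm z)\<^sup>2 * t) z = norm z powr (- (2 * s + 2 + ?n)) * (indicator {0<..} t * F t)" if z: "z \<noteq> 0" for z :: 'a and t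
  proof (cases "t > 0")
    case True
    define r where "r = norm z"
    have r: "r > 0" using z by (simp add: r_def)
    have "sqrt (4 * pi * (r\<^sup>2 * t)) = sqrt (4 * pi * t) * r"
      using r by (simp add: real_sqrt_mult)
    moreover have "- r\<^sup>2 / (4 * (r\<^sup>2 * t)) = - 1 / (4 * t)" using r True by simp
    ultimately have hk: "heat_kernel (r\<^sup>2 * t) z = h t / r ^ ?n"
      unfolding heat_kernel_def h_def r_def[symmetric] by (simp add: power_mult_distrib)
    have w: "sweight s (r\<^sup>2 * t) = r powr (2 * (- s - 1)) * sweight s t"
    proof -
      have "r\<^sup>2 = r powr 2" using r by simp
      then have "(r\<^sup>2) powr (- s - 1) = r powr (2 * (- s - 1))" by (simp only: powr_powr)
      then show ?thesis using r by (subst sweight_scale) simp_all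
    qed
    have e: "r powr (2 * (- s - 1)) / r ^ ?n = r powr (- (2 * s + 2 + ?n))"
    proof -
      have "2 * (- s - 1) - real ?n = - (2 * s + 2 + ?n)" by simp
      then show ?thesis by (simp only: powr_realpow[OF r, symmetric] powr_diff[symmetric])
    qed
    have "sweight s (0 + r\<^sup>2 * t) * heat_kernel (0 + r\<^sup>2 * t) z = (r powr (2 * (- s - 1)) * sweight s t) * (h t / r ^ ?n)"
      by (simp only: add_0 hk w)
    also have "\<dots> = (r powr (2 * (- s - 1)) / r ^ ?n) * (sweight s t * h t)" by simp
    finally show ?thesis unfolding Fw[symmetric] r_def[symmetric] e .
  next
    case False
    then have "(norm z)\<^sup>2 * t \<le> 0" by (simp add: mult_nonneg_nonpos)
    then show ?thesis using False by (simp add: sweight_def)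
  qed
  show ?thesis
  proof (rule that[OF \<open>C > 0\<close>])
    fix z :: 'a assume z: "z \<noteq> 0"
    have r: "(norm z)\<^sup>2 > 0" "norm z > 0" using z by simp_all
    have "integrable lborel (\<lambda>t. sweight s (0 + (norm z)\<^sup>2 * t) * heat_kernel (0 + (norm z)\<^sup>2 * t) z)"
      unfolding sc[OF z] by (intro integrable_mult_right i)
    then show "integrable lborel (\<lambda>t. sweight s t * heat_kernel t z)"
      by (subst (asm) lborel_integrable_real_affine_iff) (use r in auto)
    have "(LINT t|lborel. sweight s t * heat_kernel t z) = (norm z)\<^sup>2 * (LINT t|lborel. sweight s (0 + (norm z)\<^sup>2 * t) * heat_kernel (0 + (norm z)\<^sup>2 * t) z)"
      using lborel_integral_real_affine[of "(norm z)\<^sup>2" "\<lambda>t. sweight s t * heat_kernel t z" 0] r by simp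
    also have "\<dots> = ((norm z)\<^sup>2 * norm z powr (- (2 * s + 2 + ?n))) * C"
      unfolding sc[OF z] C_def by simp
    also have "(norm z)\<^sup>2 * norm z powr (- (2 * s + 2 + ?n)) = norm z powr (- (real ?n + 2 * s))"
    proof -
      have "2 + - (2 * s + 2 + real ?n) = - (real ?n + 2 * s)" by simp
      moreover have "(norm z)\<^sup>2 = norm z powr 2" using r by simp
      ultimately show ?thesis by (simp only: powr_add[symmetric])
    qed
    finally show "(LINT t|lborel. sweight s t * heat_kernel t z) = C * norm z powr (- (real ?n + 2 * s))" by simp
  qed
qed

lemma hft_pairing:
  assumes \<phi>: "\<phi> \<in> L2" and gi: "integrable lborel g" and gL: "g \<in> L2"
  shows "(LINT \<xi>|lborel. hft \<phi> \<xi> * g \<xi>) = (LINT x|lborel. \<phi> x * hart g x)"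
proof -
  note h = hartley_abs_l2[OF gi gL]
  have "(LINT \<xi>|lborel. hft \<phi> \<xi> * g \<xi>) = inner (hartley (abs_l2 \<phi>)) (abs_l2 g)"
    by (simp add: inner_abs_l2[symmetric] gL abs_hft)
  also have "\<dots> = inner (abs_l2 \<phi>) (abs_l2 (hart g))" by (simp add: hartley_selfadjoint h)
  also have "\<dots> = (LINT x|lborel. \<phi> x * hart g x)" by (rule inner_abs_l2[OF \<phi> h(1)])
  finally show ?thesis .
qed

lemma heat_pairing:
  fixes \<phi> f :: "'a::euclidean_space \<Rightarrow> real"
  assumes \<phi>: "\<phi> \<in> L2" and f: "bddL1 f" and t: "t > 0"
  shows "(LINT \<xi>|lborel. hft \<phi> \<xi> * (exp (- t * (norm \<xi>)\<^sup>2) * hart f \<xi>)) = (2 * pi) ^ DIM('a) * (LINT x|lborel. \<phi> x * heat_op t f x)"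
    and "integrable lborel (\<lambda>\<xi>. hft \<phi> \<xi> * (exp (- t * (norm \<xi>)\<^sup>2) * hart f \<xi>))"
proof -
  note fi = bddL1_integrable[OF f]
  have m: "hart f \<in> borel_measurable borel" using fi by auto
  have gi: "integrable lborel (\<lambda>\<xi>. exp (- t * (norm \<xi>)\<^sup>2) * hart f \<xi>)"
    by (rule integrable_bounded_mult[OF exp_norm_sq_fourier(1)[OF t] m hart_bound[OF fi]])
  have gL: "(\<lambda>\<xi>. exp (- t * (norm \<xi>)\<^sup>2) * hart f \<xi>) \<in> L2"
    by (rule L2_mult_bounded[where C = 1]) (use t plancherel_bddL1(1)[OF f] in auto)
  show "integrable lborel (\<lambda>\<xi>. hft \<phi> \<xi> * (exp (- t * (norm \<xi>)\<^sup>2) * hart f \<xi>))"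
    by (rule L2_mult_integrable[OF hft_L2 gL])
  show "(LINT \<xi>|lborel. hft \<phi> \<xi> * (exp (- t * (norm \<xi>)\<^sup>2) * hart f \<xi>)) = (2 * pi) ^ DIM('a) * (LINT x|lborel. \<phi> x * heat_op t f x)"
    unfolding hft_pairing[OF \<phi> gi gL] hart_gaussian_hart[OF fi t] mult.left_commute[of "\<phi> _"] by (rule integral_mult_right_zero)
qed

lemma exp_tail_pairing:
  fixes \<phi> f :: "'a::euclidean_space \<Rightarrow> real"
  assumes \<phi>: "\<phi> \<in> L2" and f: "f \<in> test_fun W" and z: "\<And>x. x \<in> W \<Longrightarrow> \<phi> x = 0" and t: "t > 0"
  shows "(LINT \<xi>|lborel. exp_tail m (t * (norm \<xi>)\<^sup>2) * (hft \<phi> \<xi> * hart f \<xi>)) = (2 * pi) ^ DIM('a) * (LINT x|lborel. \<phi> x * heat_op t f x)"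
proof -
  let ?g = "\<lambda>j. (neg_laplacian ^^ j) f"
  note g = hart_iter_neg_laplacian[OF f]
  note gL = test_fun_hart_L2[OF g(1)]
  have poly: "(LINT \<xi>|lborel. hft \<phi> \<xi> * hart (?g j) \<xi>) = 0" for j
  proof -
    have "(LINT \<xi>|lborel. hft \<phi> \<xi> * hart (?g j) \<xi>) = inner (hartley (abs_l2 \<phi>)) (abs_l2 (hart (?g j)))"
      by (simp add: inner_abs_l2[symmetric] gL(2) abs_hft)
    also have "abs_l2 (hart (?g j)) = hartley (abs_l2 (?g j))"
      by (rule hartley_abs_l2(2)[OF bddL1_integrable[OF test_fun_bddL1[OF g(1)]] gL(1), symmetric])
    also have "inner (hartley (abs_l2 \<phi>)) (hartley (abs_l2 (?g j))) = (2 * pi) ^ DIM('a) * (LINT x|lborel. \<phi> x * ?g j x)"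
      by (simp add: inner_hartley inner_abs_l2 \<phi> gL(1))
    also have "(\<lambda>x. \<phi> x * ?g j x) = (\<lambda>x. 0)"
    proof
      fix x show "\<phi> x * ?g j x = 0"
        using z[of x] not_supp[of x "?g j"] test_funD(3)[OF g(1)[of j]] by (cases "x \<in> W") auto
    qed
    finally show ?thesis by simp
  qed
  have i1: "integrable lborel (\<lambda>\<xi>. hft \<phi> \<xi> * hart (?g j) \<xi>)" for j
    by (rule L2_mult_integrable[OF hft_L2 gL(2)])
  note hp = heat_pairing[OF \<phi> test_fun_bddL1[OF f] t]
  have "exp_tail m (t * (norm \<xi>)\<^sup>2) * (hft \<phi> \<xi> * hart f \<xi>) = hft \<phi> \<xi> * (exp (- t * (norm \<xi>)\<^sup>2) * hart f \<xi>) - (\<Sum>j\<le>m. ((- t) ^ j / fact j) * (hft \<phi> \<xi> * hart (?g j) \<xi>))" for \<xi>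
  proof -
    have p: "(- (t * (norm \<xi>)\<^sup>2)) ^ j = (- t) ^ j * norm \<xi> ^ (2 * j)" for j
      unfolding mult_minus_left[symmetric] by (simp only: power_mult_distrib power_mult)
    have "(\<Sum>j\<le>m. (- (t * (norm \<xi>)\<^sup>2)) ^ j / fact j) * (hft \<phi> \<xi> * hart f \<xi>) = (\<Sum>j\<le>m. ((- t) ^ j / fact j) * (hft \<phi> \<xi> * hart (?g j) \<xi>))"
      unfolding sum_distrib_right by (intro sum.cong refl) (simp only: p g(2), simp)
    then show ?thesis unfolding exp_tail_def left_diff_distrib by (simp only: mult_minus_left mult.left_commute)
  qed
  then have "(LINT \<xi>|lborel. exp_tail m (t * (norm \<xi>)\<^sup>2) * (hft \<phi> \<xi> * hart f \<xi>)) 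
     = (LINT \<xi>|lborel. hft \<phi> \<xi> * (exp (- t * (norm \<xi>)\<^sup>2) * hart f \<xi>)) - (LINT \<xi>|lborel. (\<Sum>j\<le>m. ((- t) ^ j / fact j) * (hft \<phi> \<xi> * hart (?g j) \<xi>)))"
    using hp(2) i1 by (simp only:) (intro Bochner_Integration.integral_diff integrable_sum integrable_mult_right; simp)
  also have "(LINT \<xi>|lborel. (\<Sum>j\<le>m. ((- t) ^ j / fact j) * (hft \<phi> \<xi> * hart (?g j) \<xi>))) = 0"
    using i1 by (subst Bochner_Integration.integral_sum) (simp_all only: integral_mult_right_zero poly mult_zero_right sum.neutral_const, auto)
  finally show ?thesis using hp(1) by simp
qed

text \<open>
  The Taylor polynomial inside \<open>exp_tail\<close> does not contribute: it pairs \<open>\<phi>\<close> with \<open>(-\<Delta>)\<^sup>j f\<close>, whose support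
  lies in \<open>W\<close>.
\<close>

lemma heat_integral_zero:
  fixes \<phi> f :: "'a::euclidean_space \<Rightarrow> real"
  assumes s: "s > 0" "s \<notin> \<int>" and \<phi>: "\<phi> \<in> L2" and f: "f \<in> test_fun W" and z: "\<And>x. x \<in> W \<Longrightarrow> \<phi> x = 0"
    and 0: "(LINT \<xi>|lborel. norm \<xi> powr (2 * s) * (hft \<phi> \<xi> * hart f \<xi>)) = 0"
  shows "(LINT t|lborel. sweight s t * (LINT x|lborel. \<phi> x * heat_op t f x)) = 0"
proof -
  define m where "m = nat \<lfloor>s\<rfloor>"
  have "real m = of_int \<lfloor>s\<rfloor>" using s by (simp add: m_def)
  moreover have "of_int \<lfloor>s\<rfloor> \<noteq> s" using s(2) by (metis Ints_of_int)
  \<comment> \<open>The first inequality is strict because s is not an integer. It makes the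
    exponent m - s - 1 at infinity smaller than -1.\<close>
  ultimately have m: "real m < s" "s < real m + 1" by linarith+
  obtain c where c: "c \<noteq> 0"
    "\<And>l. l \<ge> 0 \<Longrightarrow> integrable lborel (\<lambda>t. sweight s t * exp_tail m (t * l))"
    "\<And>l. l \<ge> 0 \<Longrightarrow> (LINT t|lborel. sweight s t * exp_tail m (t * l)) = c * l powr s"
    "\<And>l. l \<ge> 0 \<Longrightarrow> (LINT t|lborel. \<bar>sweight s t * exp_tail m (t * l)\<bar>) = \<bar>c\<bar> * l powr s"
    using exp_tail_subordination[OF m] by blast
  define g where "g \<xi> = hft \<phi> \<xi> * hart f \<xi>" for \<xi>
  have [measurable]: "hart f \<in> borel_measurable borel" using test_fun_hart_L2(2)[OF f] by (rule L2_realD)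
  have [measurable]: "g \<in> borel_measurable borel" unfolding g_def[abs_def] by measurable
  have pw: "((norm \<xi>)\<^sup>2) powr s = norm \<xi> powr (2 * s)" for \<xi> :: 'a
    by (simp add: powr_sq[symmetric] power2_eq_square powr_mult)
  define P where "P \<xi> t = (sweight s t * exp_tail m (t * (norm \<xi>)\<^sup>2)) * g \<xi>" for \<xi> :: 'a and t
  have iw: "integrable lborel (\<lambda>\<xi>. norm \<xi> powr (2 * s) * g \<xi>)"
  proof -
    obtain k :: nat where k: "s \<le> real k" using real_arch_simple by blast
    have "\<bar>norm \<xi> powr (2 * s)\<bar> \<le> 1 * (1 + norm \<xi> ^ (2 * k))" for \<xi> :: 'a
    proof (cases "norm \<xi> \<le> 1")
      case True
      then have "norm \<xi> powr (2 * s) \<le> 1" using s by (intro powr_le1) auto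
      then show ?thesis by (simp add: add_increasing2)
    next
      case False
      then have "norm \<xi> powr (2 * s) \<le> norm \<xi> powr real (2 * k)" using k by (intro powr_mono) auto
      also have "\<dots> = norm \<xi> ^ (2 * k)" using False by (intro powr_realpow) auto
      finally show ?thesis by simp
    qed
    from test_fun_hart_weight_L2[OF f _ this] have "(\<lambda>\<xi>. norm \<xi> powr (2 * s) * hart f \<xi>) \<in> L2" by simp
    from L2_mult_integrable[OF hft_L2[of \<phi>] this] show ?thesis by (simp add: g_def mult_ac)
  qed
  \<comment> \<open>Integrating the modulus over t first gives |c| |\<xi>|^(2s) |g|, which is
    integrable by the decay of \<open>hart f\<close>.\<close>
  have iP: "integrable (lborel \<Otimes>\<^sub>M lborel) (\<lambda>(\<xi>, t). P \<xi> t)"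
  proof (rule lborel_pair.Fubini_integrable)
    show "(\<lambda>(\<xi>, t). P \<xi> t) \<in> borel_measurable (lborel \<Otimes>\<^sub>M lborel)" unfolding P_def by measurable
    show "AE \<xi> in lborel. integrable lborel (\<lambda>t. case (\<xi>, t) of (\<xi>, t) \<Rightarrow> P \<xi> t)"
      unfolding P_def prod.case by (intro AE_I2 integrable_mult_left c(2)) simp
    have "(LINT t|lborel. norm (P \<xi> t)) = \<bar>c\<bar> * \<bar>norm \<xi> powr (2 * s) * g \<xi>\<bar>" for \<xi>
      unfolding P_def real_norm_def abs_mult[of _ "g \<xi>"] integral_mult_left_zero using c(4)[of "(norm \<xi>)\<^sup>2"] 
      by (simp add: pw abs_mult)
    then show "integrable lborel (\<lambda>\<xi>. LINT t|lborel. norm (case (\<xi>, t) of (\<xi>, t) \<Rightarrow> P \<xi> t))"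
      using iw by simp
  qed
  have "(LINT t|lborel. LINT \<xi>|lborel. P \<xi> t) = (LINT \<xi>|lborel. LINT t|lborel. P \<xi> t)"
    by (rule lborel_pair.Fubini_integral[OF iP])
  also have "\<dots> = (LINT \<xi>|lborel. c * (norm \<xi> powr (2 * s) * g \<xi>))"
    unfolding P_def integral_mult_left_zero by (simp add: c(3) pw mult_ac)
  also have "\<dots> = 0" using 0 by (simp add: g_def)
  finally have "(LINT t|lborel. LINT \<xi>|lborel. P \<xi> t) = 0" .
  moreover have "(LINT \<xi>|lborel. P \<xi> t) = (2 * pi) ^ DIM('a) * (sweight s t * (LINT x|lborel. \<phi> x * heat_op t f x))" for t
  proof (cases "t > 0")
    case True
    have "(LINT \<xi>|lborel. P \<xi> t) = sweight s t * (LINT \<xi>|lborel. exp_tail m (t * (norm \<xi>)\<^sup>2) * g \<xi>)"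
      unfolding P_def mult.assoc by (rule integral_mult_right_zero)
    also have "(LINT \<xi>|lborel. exp_tail m (t * (norm \<xi>)\<^sup>2) * g \<xi>) = (2 * pi) ^ DIM('a) * (LINT x|lborel. \<phi> x * heat_op t f x)"
      unfolding g_def by (rule exp_tail_pairing[OF \<phi> f z True])
    finally show ?thesis by (simp only: mult.left_commute)
  qed (simp add: P_def sweight_def)
  ultimately have "(2 * pi) ^ DIM('a) * (LINT t|lborel. sweight s t * (LINT x|lborel. \<phi> x * heat_op t f x)) = 0"
    by (simp only: integral_mult_right_zero)
  then show ?thesis by simp
qed

text \<open>Each 1 + (z \<bullet> b)^2 is at most 1 + |z|^2, so the n-th power is dominated by a
  product of n integrable functions of one variable.\<close>

lemma integrable_inverse_one_plus_norm:
  "integrable lborel (\<lambda>z::'a::euclidean_space. inverse ((1 + (norm z)\<^sup>2) ^ DIM('a)))"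
proof (rule Bochner_Integration.integrable_bound)
  have "integrable lborel (\<lambda>x::real. inverse (1 + x\<^sup>2))"
    using integrable_inverse_1_plus_square by (simp add: set_integrable_def)
  then have "integrable lborel (\<lambda>x::real. complex_of_real (inverse (1 + x\<^sup>2)))"
    by (rule integrable_of_real)
  then have "integrable lborel (\<lambda>z::'a. \<Prod>b\<in>Basis. complex_of_real (inverse (1 + (z \<bullet> b)\<^sup>2)))"
    by (intro integral_prod_Basis(1))
  then show "integrable lborel (\<lambda>z::'a. \<Prod>b\<in>Basis. complex_of_real (inverse (1 + (z \<bullet> b)\<^sup>2)))" .
  show "AE z in lborel. norm (inverse ((1 + (norm z)\<^sup>2) ^ DIM('a))) \<le> norm (\<Prod>b\<in>(Basis::'a set). complex_of_real (inverse (1 + (z \<bullet> b)\<^sup>2)))"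
  proof (rule AE_I2)
    fix z :: 'a
    have "inverse ((1 + (norm z)\<^sup>2) ^ DIM('a)) = (\<Prod>b\<in>(Basis::'a set). inverse (1 + (norm z)\<^sup>2))"
      by (simp add: power_inverse)
    also have "\<dots> \<le> (\<Prod>b\<in>(Basis::'a set). inverse (1 + (z \<bullet> b)\<^sup>2))"
    proof (intro prod_mono conjI le_imp_inverse_le)
      fix b :: 'a assume "b \<in> Basis"
      then have "\<bar>z \<bullet> b\<bar> \<le> norm z" by (rule Basis_le_norm)
      then show "1 + (z \<bullet> b)\<^sup>2 \<le> 1 + (norm z)\<^sup>2" by (simp add: abs_le_square_iff[symmetric])
    qed (auto simp: add_pos_nonneg add_nonneg_nonneg)
    also have "\<dots> = norm (\<Prod>b\<in>(Basis::'a set). complex_of_real (inverse (1 + (z \<bullet> b)\<^sup>2)))"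
      unfolding of_real_prod[symmetric] norm_of_real by (intro abs_of_nonneg[symmetric] prod_nonneg) (auto simp: add_nonneg_nonneg)
    finally show "norm (inverse ((1 + (norm z)\<^sup>2) ^ DIM('a))) \<le> norm (\<Prod>b\<in>(Basis::'a set). complex_of_real (inverse (1 + (z \<bullet> b)\<^sup>2)))"
      by (simp add: add_nonneg_nonneg)
  qed
qed simp

definition tail_weight :: "real \<Rightarrow> real \<Rightarrow> 'a::euclidean_space \<Rightarrow> real" where
  "tail_weight a \<rho> z = (if norm z \<ge> \<rho> then norm z powr (- a) else 0)"

lemma tail_weight_measurable [measurable]: "tail_weight a \<rho> \<in> borel_measurable borel"
  unfolding tail_weight_def[abs_def] by measurable

text \<open>For |z| \<ge> \<rho> the square |z|^(-2a) is compared with (1 + |z|^2)^(-n): the excess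
  power |z|^(-2(a-n)) is estimated by its value at \<rho>, and 1 + |z|^2 \<le> (1 + 1/\<rho>^2)
  |z|^2.\<close>

lemma tail_weight_L2:
  assumes \<rho>: "\<rho> > 0" and a: "a \<ge> real DIM('a)"
  shows "(\<lambda>y. tail_weight a \<rho> (y - x0 :: 'a::euclidean_space)) \<in> L2"
proof (rule L2_realI)
  let ?n = "DIM('a)"
  have t: "integrable lborel (\<lambda>z::'a. (tail_weight a \<rho> z)\<^sup>2)"
  proof (rule Bochner_Integration.integrable_bound)
    define C where "C = \<rho> powr (- 2 * (a - ?n)) * (1 + 1 / \<rho>\<^sup>2) ^ ?n"
    show "integrable lborel (\<lambda>z::'a. C * inverse ((1 + (norm z)\<^sup>2) ^ ?n))"
      by (intro integrable_mult_right integrable_inverse_one_plus_norm)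
    have C0: "C \<ge> 0" by (simp add: C_def)
    show "AE z in lborel. norm ((tail_weight a \<rho> (z::'a))\<^sup>2) \<le> norm (C * inverse ((1 + (norm z)\<^sup>2) ^ ?n))"
    proof (rule AE_I2)
      fix z :: 'a
      have nn: "C * inverse ((1 + (norm z)\<^sup>2) ^ ?n) \<ge> 0" using C0 one_plus_norm_sq[of z] by simp
      have "(tail_weight a \<rho> z)\<^sup>2 \<le> C * inverse ((1 + (norm z)\<^sup>2) ^ ?n)"
      proof (cases "norm z \<ge> \<rho>")
        case True
        define r where "r = norm z"
        have r: "r \<ge> \<rho>" "r > 0" using True \<rho> by (auto simp: r_def)
        have "(tail_weight a \<rho> z)\<^sup>2 = r powr (- 2 * a)" using True by (simp add: tail_weight_def r_def powr_sq)
        also have "\<dots> = r powr (- 2 * (a - ?n)) * r powr (- real (2 * ?n))" by (simp add: powr_add[symmetric] algebra_simps)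
        also have "r powr (- real (2 * ?n)) = inverse ((r\<^sup>2) ^ ?n)"
          by (simp only: powr_minus powr_realpow[OF r(2)] power_mult)
        also have "r powr (- 2 * (a - ?n)) * inverse ((r\<^sup>2) ^ ?n) \<le> \<rho> powr (- 2 * (a - ?n)) * inverse ((r\<^sup>2) ^ ?n)"
          using r \<rho> a by (intro mult_right_mono powr_mono2') auto
        also have "inverse ((r\<^sup>2) ^ ?n) \<le> (1 + 1 / \<rho>\<^sup>2) ^ ?n * inverse ((1 + r\<^sup>2) ^ ?n)"
        proof -
          have "\<rho>\<^sup>2 \<le> r\<^sup>2" using r \<rho> by (intro power_mono) auto
          then have "1 + r\<^sup>2 \<le> (1 + 1 / \<rho>\<^sup>2) * r\<^sup>2" using \<rho> by (simp add: distrib_right divide_simps)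
          then have "(1 + r\<^sup>2) ^ ?n \<le> ((1 + 1 / \<rho>\<^sup>2) * r\<^sup>2) ^ ?n" by (intro power_mono) auto
          moreover have "(1 + r\<^sup>2) ^ ?n > 0" "(r\<^sup>2) ^ ?n > 0" using r by (auto simp: add_pos_nonneg)
          moreover have "inverse B \<le> D * inverse A" if "A \<le> D * B" "A > 0" "B > 0" for A B D :: real
            using that by (simp add: field_simps)
          ultimately show ?thesis unfolding power_mult_distrib by blast
        qed
        finally show ?thesis unfolding C_def r_def using \<rho> by (simp add: mult_left_mono mult.assoc)
      qed (use nn in \<open>simp add: tail_weight_def\<close>)
      then show "norm ((tail_weight a \<rho> z)\<^sup>2) \<le> norm (C * inverse ((1 + (norm z)\<^sup>2) ^ ?n))" using nn by simp
    qed
  qed simp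
  then show "integrable lborel (\<lambda>y. (tail_weight a \<rho> (y - x0))\<^sup>2)"
    using lborel_translate(1)[of "\<lambda>z::'a. (tail_weight a \<rho> z)\<^sup>2" "- x0"] by simp
qed simp

section \<open>Unique continuation\<close>

text \<open>The source vanishes within 2r of the centre, while potentials are evaluated within r.
  The distances |x - y| that matter therefore exceed r and are at least |y - x0| / 2.\<close>

locale exterior_source =
  fixes s r :: real and x0 :: "'a::euclidean_space" and \<phi> :: "'a \<Rightarrow> real"
  assumes s: "s > 0" and r: "r > 0" and \<phi>: "\<phi> \<in> L2" and \<phi>0: "norm (y - x0) < 2 * r \<Longrightarrow> \<phi> y = 0"
begin

definition a :: real where "a = real DIM('a) + 2 * s"

text \<open>
  \<open>\<phi>\<close> need not be integrable, but \<open>\<psi>\<close> is, and \<open>\<phi> y |x - y|\<^sup>-\<^sup>a = \<psi> y * \<kappa> x y\<close> with \<open>\<kappa>\<close> bounded.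
\<close>

definition \<psi> :: "'a \<Rightarrow> real" where "\<psi> y = \<phi> y * tail_weight a (2 * r) (y - x0)"

lemma a_pos: "a > 0" using s by (simp add: a_def add_nonneg_pos)

lemma \<phi>_measurable [measurable]: "\<phi> \<in> borel_measurable borel"
  by (rule L2_realD(1)[OF \<phi>])

lemma \<psi>_integrable: "integrable lborel \<psi>"
  unfolding \<psi>_def[abs_def] using s r by (intro L2_mult_integrable \<phi> tail_weight_L2) (auto simp: a_def)

lemma \<psi>_measurable [measurable]: "\<psi> \<in> borel_measurable borel"
  using \<psi>_integrable by auto

lemma norm_ge:
  assumes "norm (x - x0) < r" "norm (y - x0) \<ge> 2 * r"
  shows "norm (x - y) \<ge> norm (y - x0) / 2" "norm (x - y) > r"
proof -
  have "norm (y - x0) \<le> norm (x - y) + norm (x - x0)"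
    using norm_triangle_ineq4[of "x - x0" "x - y"] by (simp add: norm_minus_commute)
  then show "norm (x - y) \<ge> norm (y - x0) / 2" "norm (x - y) > r" using assms by linarith+
qed

lemma powr_le_\<psi>:
  assumes "norm (x - x0) < r"
  shows "\<bar>\<phi> y\<bar> * norm (x - y) powr (- a) \<le> 2 powr a * \<bar>\<psi> y\<bar>"
proof (cases "norm (y - x0) \<ge> 2 * r")
  case True
  have "norm (x - y) powr (- a) \<le> (norm (y - x0) / 2) powr (- a)"
    using norm_ge(1)[OF assms True] True r a_pos by (intro powr_mono2') auto
  also have "\<dots> = 2 powr a * norm (y - x0) powr (- a)"
    by (simp add: powr_divide powr_minus_divide)
  finally have "\<bar>\<phi> y\<bar> * norm (x - y) powr (- a) \<le> \<bar>\<phi> y\<bar> * (2 powr a * norm (y - x0) powr (- a))"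
    by (intro mult_left_mono) auto
  then show ?thesis using True by (simp add: \<psi>_def tail_weight_def abs_mult mult_ac)
qed (simp add: \<phi>0)

lemma potential_integrable:
  assumes K: "(\<lambda>y. K (x - y)) \<in> borel_measurable borel" and x: "norm (x - x0) < r"
    and b: "\<And>z. norm z \<ge> r \<Longrightarrow> \<bar>K z\<bar> \<le> A * norm z powr (- a)"
  shows "integrable lborel (\<lambda>y. \<phi> y * K (x - y))" and "\<bar>\<phi> y * K (x - y)\<bar> \<le> A * 2 powr a * \<bar>\<psi> y\<bar>"
proof -
  \<comment> \<open>Evaluating the bound at some vector of length r shows A \<ge> 0.\<close>
  obtain e :: 'a where e: "norm e = r" using vector_choose_size[of r] r by auto
  have "0 \<le> \<bar>K e\<bar>" by simp
  also have "\<bar>K e\<bar> \<le> A * r powr (- a)" using b[of e] e by simp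
  finally have A0: "A \<ge> 0" using r by (simp add: zero_le_mult_iff)
  show *: "\<bar>\<phi> y * K (x - y)\<bar> \<le> A * 2 powr a * \<bar>\<psi> y\<bar>" for y
  proof (cases "norm (y - x0) \<ge> 2 * r")
    case True
    have "\<bar>\<phi> y * K (x - y)\<bar> \<le> \<bar>\<phi> y\<bar> * (A * norm (x - y) powr (- a))"
      unfolding abs_mult using norm_ge(2)[OF x True] by (intro mult_left_mono b) auto
    also have "\<dots> = A * (\<bar>\<phi> y\<bar> * norm (x - y) powr (- a))" by simp
    also have "\<dots> \<le> A * (2 powr a * \<bar>\<psi> y\<bar>)" by (intro mult_left_mono powr_le_\<psi> x A0)
    finally show ?thesis by simp
  qed (use A0 in \<open>simp add: \<phi>0\<close>)
  show "integrable lborel (\<lambda>y. \<phi> y * K (x - y))"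
  proof (rule Bochner_Integration.integrable_bound)
    show "integrable lborel (\<lambda>y. A * 2 powr a * \<bar>\<psi> y\<bar>)"
      using \<psi>_integrable by (intro integrable_mult_right) simp
    show "AE y in lborel. norm (\<phi> y * K (x - y)) \<le> norm (A * 2 powr a * \<bar>\<psi> y\<bar>)"
      using * A0 by (intro AE_I2) simp
  qed (use K in simp)
qed

text \<open>The kernel |x - y|^(-a) relative to its value at x = x0. Setting it to zero elsewhere
  makes its bound and joint measurability global.\<close>

definition \<kappa> :: "'a \<Rightarrow> 'a \<Rightarrow> real" where
  "\<kappa> x y = (if norm (x - x0) < r \<and> norm (y - x0) \<ge> 2 * r then (norm (y - x) / norm (y - x0)) powr (- a) else 0)"

lemma \<kappa>_measurable: "(\<lambda>p. \<kappa> (fst p) (snd p)) \<in> borel_measurable (borel \<Otimes>\<^sub>M borel)"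
  unfolding \<kappa>_def by measurable

lemma \<kappa>_measurable' [measurable]: "\<kappa> x \<in> borel_measurable borel"
  unfolding \<kappa>_def[abs_def] by measurable

lemma \<kappa>_bound: "\<bar>\<kappa> x y\<bar> \<le> 2 powr a"
proof (cases "norm (x - x0) < r \<and> norm (y - x0) \<ge> 2 * r")
  case True
  then have "norm (y - x0) > 0" using r by linarith
  then have "1 / 2 \<le> norm (y - x) / norm (y - x0)"
    using norm_ge(1)[of x y] True by (simp add: field_simps norm_minus_commute)
  then have "(norm (y - x) / norm (y - x0)) powr (- a) \<le> (1 / 2) powr (- a)"
    using a_pos by (intro powr_mono2') auto
  also have "\<dots> = 2 powr a" by (simp add: powr_divide powr_minus_divide)
  finally show ?thesis using True by (simp add: \<kappa>_def)
qed (auto simp: \<kappa>_def)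

lemma \<psi>_\<kappa>:
  assumes "norm (x - x0) < r" shows "\<psi> y * \<kappa> x y = \<phi> y * norm (x - y) powr (- a)"
proof (cases "norm (y - x0) \<ge> 2 * r")
  case True
  then have "norm (y - x0) > 0" using r by linarith
  then show ?thesis using True assms by (simp add: \<psi>_def \<kappa>_def tail_weight_def powr_divide norm_minus_commute[of y x])
qed (simp add: \<phi>0 \<psi>_def)

definition \<Phi> :: "'a \<Rightarrow> real" where "\<Phi> x = (LINT y|lborel. \<psi> y * \<kappa> x y)"

lemma \<Phi>_measurable [measurable]: "\<Phi> \<in> borel_measurable borel"
proof -
  have "(\<lambda>p. \<psi> (snd p) * \<kappa> (fst p) (snd p)) \<in> borel_measurable (borel \<Otimes>\<^sub>M borel)"
    using \<kappa>_measurable by measurable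
  then have "(\<lambda>(x, y). \<psi> y * \<kappa> x y) \<in> borel_measurable (borel \<Otimes>\<^sub>M lborel)"
    by (simp add: split_beta' cong: measurable_cong_sets)
  from lborel.borel_measurable_lebesgue_integral[OF this] show ?thesis unfolding \<Phi>_def[abs_def] .
qed

lemma \<psi>_\<kappa>_integrable: "integrable lborel (\<lambda>y. \<psi> y * \<kappa> x y)"
  by (rule integrable_bounded_mult[OF \<psi>_integrable _ \<kappa>_bound]) measurable

lemma \<Phi>_bound: "\<bar>\<Phi> x\<bar> \<le> 2 powr a * (LINT y|lborel. \<bar>\<psi> y\<bar>)"
proof -
  have "\<bar>\<Phi> x\<bar> \<le> (LINT y|lborel. \<bar>\<psi> y * \<kappa> x y\<bar>)"
    unfolding \<Phi>_def using integral_norm_bound[of lborel "\<lambda>y. \<psi> y * \<kappa> x y"] by simp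
  also have "\<dots> \<le> (LINT y|lborel. 2 powr a * \<bar>\<psi> y\<bar>)"
    using \<psi>_integrable \<psi>_\<kappa>_integrable[of x] 
    by (intro integral_mono integrable_abs) (auto simp: abs_mult mult.commute[of "2 powr a"] intro!: mult_left_mono \<kappa>_bound)
  finally show ?thesis by simp
qed

lemma \<Phi>_continuous: "continuous_on (ball x0 r) \<Phi>"
  unfolding continuous_on_sequentially
proof (intro allI ballI impI, elim conjE)
  fix u x assume x: "x \<in> ball x0 r" and u: "\<forall>n. u n \<in> ball x0 r" "u \<longlonglongrightarrow> x"
  have "(\<lambda>n. LINT y|lborel. \<psi> y * \<kappa> (u n) y) \<longlonglongrightarrow> (LINT y|lborel. \<psi> y * \<kappa> x y)"
  proof (rule integral_dominated_convergence[where w = "\<lambda>y. 2 powr a * \<bar>\<psi> y\<bar>"])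
    show "AE y in lborel. (\<lambda>n. \<psi> y * \<kappa> (u n) y) \<longlonglongrightarrow> \<psi> y * \<kappa> x y"
    proof (intro AE_I2 tendsto_mult tendsto_const)
      fix y
      show "(\<lambda>n. \<kappa> (u n) y) \<longlonglongrightarrow> \<kappa> x y"
      proof (cases "norm (y - x0) \<ge> 2 * r")
        case True
        have n: "norm (u n - x0) < r" "norm (x - x0) < r" for n using u(1) x by (auto simp: dist_norm norm_minus_commute)
        have "norm (y - x) > 0" "norm (y - x0) > 0" using norm_ge(2)[OF n(2) True] r True by (auto simp: norm_minus_commute)
        then have "(\<lambda>n. (norm (y - u n) / norm (y - x0)) powr (- a)) \<longlonglongrightarrow> (norm (y - x) / norm (y - x0)) powr (- a)"
          by (intro tendsto_intros u(2)) auto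
        then show ?thesis using n True by (simp add: \<kappa>_def)
      qed (simp add: \<kappa>_def)
    qed
    show "AE y in lborel. norm (\<psi> y * \<kappa> (u n) y) \<le> 2 powr a * \<bar>\<psi> y\<bar>" for n
      by (intro AE_I2) (auto simp: abs_mult mult.commute[of "2 powr a"] intro!: mult_left_mono \<kappa>_bound)
  qed (use \<psi>_integrable in auto)
  then show "(\<Phi> \<circ> u) \<longlonglongrightarrow> \<Phi> x" by (simp add: \<Phi>_def o_def)
qed

text \<open>Fubini between space and time: integrating the heat kernel against the Mellin weight
  first leaves C |x - y|^(-a), which is \<Phi> after integration over y.\<close>

lemma kernel_pairing_zero:
  assumes f: "f \<in> test_fun (ball x0 r)"
    and 0: "(LINT t|lborel. sweight s t * (LINT y|lborel. \<phi> y * heat_op t f y)) = 0"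
  shows "(LINT x|lborel. f x * \<Phi> x) = 0"
proof -
  obtain C where C: "C > 0" 
    "\<And>z::'a. z \<noteq> 0 \<Longrightarrow> integrable lborel (\<lambda>t. sweight s t * heat_kernel t z)"
    "\<And>z::'a. z \<noteq> 0 \<Longrightarrow> (LINT t|lborel. sweight s t * heat_kernel t z) = C * norm z powr (- (real DIM('a) + 2 * s))"
    using heat_kernel_subordination[OF s] by blast
  have [measurable]: "f \<in> borel_measurable borel" by (rule test_fun_measurable[OF f])
  have fi: "integrable lborel f" by (rule bddL1_integrable[OF test_fun_bddL1[OF f]])
  have f0: "norm (x - x0) < r" if "f x \<noteq> 0" for x
  proof -
    have "x \<in> ball x0 r" using that test_funD(3)[OF f] not_supp[of x f] by blast
    then show ?thesis by (simp add: dist_norm norm_minus_commute)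
  qed
  \<comment> \<open>Both space variables are packed into one pair p, so that the two-factor form of
    Fubini separates p from t.\<close>
  define Q where "Q p t = f (fst p) * \<phi> (snd p) * (sweight s t * heat_kernel t (snd p - fst p))" for p :: "'a \<times> 'a" and t
  \<comment> \<open>The supports of f and \<phi> are separated, so the subordination formula is
    never evaluated at z = 0.\<close>
  have ne: "snd p - fst p \<noteq> 0" if "f (fst p) * \<phi> (snd p) \<noteq> 0" for p
  proof -
    have "norm (fst p - x0) < r" "\<not> norm (snd p - x0) < 2 * r" using that f0[of "fst p"] \<phi>0[of "snd p"] by auto
    then show ?thesis using r by (metis eq_iff_diff_eq_0 less_trans mult_2 less_add_same_cancel1)
  qed
  have [measurable]: "(fst :: 'a \<times> 'a \<Rightarrow> 'a) \<in> borel \<rightarrow>\<^sub>M borel" "(snd :: 'a \<times> 'a \<Rightarrow> 'a) \<in> borel \<rightarrow>\<^sub>M borel"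
    by (intro borel_measurable_continuous_onI continuous_intros)+
  have Qi: "integrable lborel (Q p)" for p
  proof (cases "f (fst p) * \<phi> (snd p) = 0")
    case False
    show ?thesis unfolding Q_def by (intro integrable_mult_right C(2) ne False)
  next
    case True
    then have "Q p = (\<lambda>t. 0)" by (auto simp: Q_def)
    then show ?thesis by simp
  qed
  have Qv: "(LINT t|lborel. Q p t) = C * (f (fst p) * \<psi> (snd p) * \<kappa> (fst p) (snd p))" 
    and Qn: "(LINT t|lborel. norm (Q p t)) = C * \<bar>f (fst p) * \<psi> (snd p) * \<kappa> (fst p) (snd p)\<bar>" for p
  proof -
    have k: "f (fst p) * \<phi> (snd p) * norm (snd p - fst p) powr (- a) = f (fst p) * \<psi> (snd p) * \<kappa> (fst p) (snd p)"
      using \<psi>_\<kappa>[OF f0, of "fst p" "snd p"] by (cases "f (fst p) = 0") (simp_all add: norm_minus_commute)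
    have v: "f (fst p) * \<phi> (snd p) * (LINT t|lborel. sweight s t * heat_kernel t (snd p - fst p)) = C * (f (fst p) * \<phi> (snd p) * norm (snd p - fst p) powr (- a))"
      using C(3)[OF ne] by (cases "f (fst p) * \<phi> (snd p) = 0") (auto simp: a_def)
    show "(LINT t|lborel. Q p t) = C * (f (fst p) * \<psi> (snd p) * \<kappa> (fst p) (snd p))"
      unfolding Q_def integral_mult_right_zero v k ..
    have nn: "sweight s t * heat_kernel t (snd p - fst p) \<ge> 0" for t
      by (cases "t > 0") (auto simp: sweight_def heat_kernel_nonneg)
    have "(LINT t|lborel. norm (Q p t)) = \<bar>f (fst p) * \<phi> (snd p)\<bar> * (LINT t|lborel. sweight s t * heat_kernel t (snd p - fst p))"
      unfolding Q_def real_norm_def abs_mult[of "f (fst p) * \<phi> (snd p)"] using nn by simp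
    also have "\<dots> = \<bar>f (fst p) * \<phi> (snd p) * (LINT t|lborel. sweight s t * heat_kernel t (snd p - fst p))\<bar>"
      using nn by (simp add: abs_mult integral_nonneg_AE)
    finally show "(LINT t|lborel. norm (Q p t)) = C * \<bar>f (fst p) * \<psi> (snd p) * \<kappa> (fst p) (snd p)\<bar>"
      unfolding v k using C(1) by (simp add: abs_mult)
  qed
  have ik: "integrable (lborel \<Otimes>\<^sub>M lborel) (\<lambda>(x, y). f x * \<psi> y * \<kappa> x y)"
    by (rule integrable_pair_mult[OF fi \<psi>_integrable \<kappa>_measurable \<kappa>_bound])
  then have ik': "integrable lborel (\<lambda>p. f (fst p) * \<psi> (snd p) * \<kappa> (fst p) (snd p))"
    unfolding lborel_prod by (simp add: split_beta')
  have iQ: "integrable (lborel \<Otimes>\<^sub>M lborel) (\<lambda>(p, t). Q p t)"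
  proof (rule lborel_pair.Fubini_integrable)
    show "(\<lambda>(p, t). Q p t) \<in> borel_measurable (lborel \<Otimes>\<^sub>M lborel)" 
      unfolding Q_def heat_kernel_def split_beta' by measurable
    show "integrable lborel (\<lambda>p. LINT t|lborel. norm (case (p, t) of (p, t) \<Rightarrow> Q p t))"
      unfolding prod.case Qn using ik' by (intro integrable_mult_right integrable_abs)
    show "AE p in lborel. integrable lborel (\<lambda>t. case (p, t) of (p, t) \<Rightarrow> Q p t)"
      using Qi by simp
  qed
  have "(LINT t|lborel. LINT p|lborel. Q p t) = (LINT p|lborel. LINT t|lborel. Q p t)"
    by (rule lborel_pair.Fubini_integral[OF iQ])
  also have "\<dots> = C * (LINT p|lborel. f (fst p) * \<psi> (snd p) * \<kappa> (fst p) (snd p))"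
    unfolding Qv by (rule integral_mult_right_zero)
  also have "(LINT p|lborel. f (fst p) * \<psi> (snd p) * \<kappa> (fst p) (snd p)) = (LINT x|lborel. LINT y|lborel. f x * \<psi> y * \<kappa> x y)"
    using lborel_pair.integral_fst[OF ik] unfolding lborel_prod by (simp add: split_beta')
  also have "\<dots> = (LINT x|lborel. f x * \<Phi> x)"
    unfolding \<Phi>_def by (simp add: mult.assoc)
  finally have eq1: "(LINT t|lborel. LINT p|lborel. Q p t) = C * (LINT x|lborel. f x * \<Phi> x)" .
  have "(LINT t|lborel. LINT p|lborel. Q p t) = (LINT t|lborel. sweight s t * (LINT y|lborel. \<phi> y * heat_op t f y))"
  proof (rule integral_cong_AE)
    show "(\<lambda>t. LINT p|lborel. Q p t) \<in> borel_measurable lborel"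
      using lborel_pair.integrable_snd[OF iQ] by simp
    have "(\<lambda>(t, y). \<phi> y * heat_op t f y) \<in> borel_measurable (borel \<Otimes>\<^sub>M lborel)"
      unfolding heat_op_def heat_kernel_def by measurable
    from lborel.borel_measurable_lebesgue_integral[OF this]
    show "(\<lambda>t. sweight s t * (LINT y|lborel. \<phi> y * heat_op t f y)) \<in> borel_measurable lborel"
      by simp
    show "AE t in lborel. (LINT p|lborel. Q p t) = sweight s t * (LINT y|lborel. \<phi> y * heat_op t f y)"
      using lborel_pair.AE_integrable_snd[OF iQ]
    proof eventually_elim
      case (elim t)
      have "integrable (lborel \<Otimes>\<^sub>M lborel) (\<lambda>(x, y). f x * \<phi> y * (sweight s t * heat_kernel t (y - x)))"
        using elim unfolding lborel_prod by (simp add: Q_def split_beta')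
      from lborel_pair.integral_snd[OF this]
      have "(LINT p|lborel. Q p t) = (LINT y|lborel. LINT x|lborel. f x * \<phi> y * (sweight s t * heat_kernel t (y - x)))"
        unfolding lborel_prod by (simp add: Q_def split_beta')
      also have "\<dots> = (LINT y|lborel. LINT x|lborel. sweight s t * (\<phi> y * (f x * heat_kernel t (y - x))))"
        by (simp only: mult_ac)
      finally show ?case by (simp add: heat_op_def)
    qed
  qed
  then show ?thesis using eq1 0 C(1) by simp
qed

text \<open>Fundamental lemma of the calculus of variations: if \<Phi> x were nonzero, a cutoff
  function living where \<Phi> keeps its sign would have a nonzero pairing with it.\<close>

lemma \<Phi>_zero:
  assumes 0: "\<And>f. f \<in> test_fun (ball x0 r) \<Longrightarrow> (LINT t|lborel. sweight s t * (LINT y|lborel. \<phi> y * heat_op t f y)) = 0"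
    and x: "norm (x - x0) < r"
  shows "(LINT y|lborel. \<phi> y * norm (x - y) powr (- a)) = 0"
proof -
  have xb: "x \<in> ball x0 r" using x by (simp add: dist_norm norm_minus_commute)
  have "\<Phi> x = 0"
  proof (rule ccontr)
    assume nz: "\<Phi> x \<noteq> 0"
    define \<sigma> where "\<sigma> = sgn (\<Phi> x)"
    have \<sigma>: "\<sigma> * \<Phi> x > 0" using nz by (auto simp: \<sigma>_def sgn_if)
    have "continuous_on (ball x0 r) (\<lambda>y. \<sigma> * \<Phi> y)" by (intro continuous_intros \<Phi>_continuous)
    then have U: "open (ball x0 r \<inter> (\<lambda>y. \<sigma> * \<Phi> y) -` {0<..})" by (intro continuous_open_preimage) auto
    have xU: "{x} \<subseteq> ball x0 r \<inter> (\<lambda>y. \<sigma> * \<Phi> y) -` {0<..}" using xb \<sigma> by simp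
    obtain f where f: "f \<in> test_fun (ball x0 r \<inter> (\<lambda>y. \<sigma> * \<Phi> y) -` {0<..})" "f x = 1" "\<And>y. 0 \<le> f y"
      by (rule test_fun_cutoff[OF _ U xU]) auto
    have fb: "f \<in> test_fun (ball x0 r)" by (rule test_fun_mono[OF f(1)]) auto
    have fi: "integrable lborel f" by (rule bddL1_integrable[OF test_fun_bddL1[OF fb]])
    have pos: "\<sigma> * \<Phi> y > 0" if "f y \<noteq> 0" for y
      using that not_supp[of y f] test_funD(3)[OF f(1)] by blast
    have i: "integrable lborel (\<lambda>y. \<sigma> * (f y * \<Phi> y))"
      by (intro integrable_mult_right integrable_bounded_mult[OF fi _ \<Phi>_bound]) measurable
    have nn: "0 \<le> \<sigma> * (f y * \<Phi> y)" for y
    proof (cases "f y = 0")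
      case False
      have "0 \<le> f y * (\<sigma> * \<Phi> y)" using f(3)[of y] less_imp_le[OF pos[OF False]] by (rule mult_nonneg_nonneg)
      then show ?thesis by (simp only: mult.left_commute)
    qed simp
    have "(LINT y|lborel. \<sigma> * (f y * \<Phi> y)) = 0"
      unfolding integral_mult_right_zero kernel_pairing_zero[OF fb 0[OF fb]] by simp
    then have "AE y in lborel. \<sigma> * (f y * \<Phi> y) = 0"
      using integral_nonneg_eq_0_iff_AE[OF i] nn by simp
    then have "AE y in lborel. f y = 0"
      by eventually_elim (use pos in force)
    then have "f = (\<lambda>y. 0)" by (rule test_fun_AE_zero[OF fb])
    then show False using f(2) by simp
  qed
  then show ?thesis unfolding \<Phi>_def \<psi>_\<kappa>[OF x] .
qed

end

section \<open>Derivatives of the kernel and monomials in the inversion\<close>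

definition invc :: "'a::euclidean_space \<Rightarrow> 'a \<Rightarrow> real" where
  "invc b z = (z \<bullet> b) / (z \<bullet> z)"

text \<open>A monomial in the coordinates of z / |z|^2. Its multi-index is a list of basis vectors:
  differentiating in the direction b either prepends b or removes one occurrence of it.\<close>

definition invm :: "'a::euclidean_space list \<Rightarrow> 'a \<Rightarrow> real" where
  "invm l z = (\<Prod>b\<leftarrow>l. invc b z)"

lemma invm_simps [simp]: "invm [] z = 1" "invm (b # l) z = invc b z * invm l z"
  by (simp_all add: invm_def)

lemma invm_remove1: "b \<in> set l \<Longrightarrow> invc b z * invm (remove1 b l) z = invm l z"
  by (induction l) (auto simp: mult.left_commute)

lemma invm_measurable [measurable]: "invm l \<in> borel_measurable borel"
  by (induction l) (auto simp: invc_def[abs_def] invm_def[abs_def])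

lemma abs_invm_le:
  assumes "l \<in> lists Basis" "r > 0" "norm z \<ge> r"
  shows "\<bar>invm l z\<bar> \<le> (1 / r) ^ length l"
  using assms(1)
proof (induction l)
  case (Cons b l)
  have z: "norm z > 0" using assms by linarith
  have "\<bar>invc b z\<bar> \<le> norm z / (norm z)\<^sup>2"
    unfolding invc_def abs_divide power2_norm_eq_inner[symmetric] abs_power2 using Basis_le_norm[of b z] Cons by (intro divide_right_mono) auto
  also have "\<dots> = 1 / norm z" using z by (simp add: power2_eq_square)
  also have "\<dots> \<le> 1 / r" using assms z by (intro divide_left_mono mult_pos_pos) auto
  finally have c: "\<bar>invc b z\<bar> \<le> 1 / r" .
  have "\<bar>invc b z\<bar> * \<bar>invm l z\<bar> \<le> 1 / r * (1 / r) ^ length l"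
    using assms(2) by (intro mult_mono c Cons.IH) auto
  then show ?case by (simp add: abs_mult)
qed simp

lemma inner_line_deriv: "((\<lambda>t. (z + t *\<^sub>R b) \<bullet> c) has_real_derivative b \<bullet> c) (at t)"
  by (auto intro!: derivative_eq_intros simp: has_field_derivative_def inner_simps)

lemma sq_line_deriv: "((\<lambda>t. (z + t *\<^sub>R b) \<bullet> (z + t *\<^sub>R b)) has_real_derivative 2 * ((z + t *\<^sub>R b) \<bullet> b)) (at t)"
  by (auto intro!: derivative_eq_intros simp: has_field_derivative_def inner_simps inner_commute algebra_simps)

lemma invc_line_deriv:
  fixes z b c :: "'a::euclidean_space"
  assumes "z + t *\<^sub>R b \<noteq> 0" "b \<in> Basis" "c \<in> Basis"
  defines "w \<equiv> z + t *\<^sub>R b"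
  shows "((\<lambda>t. invc c (z + t *\<^sub>R b)) has_real_derivative ((if c = b then 1 else 0) / (w \<bullet> w) - 2 * invc c w * invc b w)) (at t)"
proof -
  have nz: "w \<bullet> w \<noteq> 0" using assms by simp
  have "((\<lambda>t. invc c (z + t *\<^sub>R b)) has_real_derivative ((b \<bullet> c) * (w \<bullet> w) - (w \<bullet> c) * (2 * (w \<bullet> b))) / ((w \<bullet> w) * (w \<bullet> w))) (at t)"
    unfolding invc_def w_def using nz by (intro DERIV_divide inner_line_deriv sq_line_deriv) (simp add: w_def)
  moreover have "b \<bullet> c = (if c = b then 1 else 0)" using assms by (simp add: inner_Basis)
  ultimately show ?thesis using nz by (simp add: invc_def diff_divide_distrib mult_ac split: if_splits)
qed

text \<open>Product rule: every factor contributes -2 \<open>invc b w\<close>, and each of the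
  \<open>count_list l b\<close> factors belonging to b contributes in addition 1 / |w|^2 in place of
  itself.\<close>

lemma invm_line_deriv:
  fixes z b :: "'a::euclidean_space"
  assumes nz: "z + t *\<^sub>R b \<noteq> 0" and b: "b \<in> Basis" and l: "l \<in> lists Basis"
  defines "w \<equiv> z + t *\<^sub>R b"
  shows "((\<lambda>t. invm l (z + t *\<^sub>R b)) has_real_derivative 
     (count_list l b / (w \<bullet> w) * invm (remove1 b l) w - 2 * real (length l) * invm (b # l) w)) (at t)"
  using l
proof (induction l)
  case (Cons c l)
  then have c: "c \<in> Basis" and l: "l \<in> lists Basis" by auto
  have d: "((\<lambda>t. invc c (z + t *\<^sub>R b) * invm l (z + t *\<^sub>R b)) has_real_derivative
     ((if c = b then 1 else 0) / (w \<bullet> w) - 2 * invc c w * invc b w) * invm l w + 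
     (count_list l b / (w \<bullet> w) * invm (remove1 b l) w - 2 * real (length l) * invm (b # l) w) * invc c w) (at t)"
    using DERIV_mult[OF invc_line_deriv[OF nz b c] Cons.IH] by (simp add: w_def)
  have "((if c = b then 1 else 0) / (w \<bullet> w) - 2 * invc c w * invc b w) * invm l w + 
     (count_list l b / (w \<bullet> w) * invm (remove1 b l) w - 2 * real (length l) * invm (b # l) w) * invc c w
     = count_list (c # l) b / (w \<bullet> w) * invm (remove1 b (c # l)) w - 2 * real (length (c # l)) * invm (b # c # l) w"
  proof (cases "c = b")
    case True
    have "real (count_list l b) * (invc b w * invm (remove1 b l) w) = real (count_list l b) * invm l w"
      using invm_remove1[of b l w] by (cases "b \<in> set l") (auto simp: count_list_0_iff)
    then have "count_list l b / (w \<bullet> w) * invm (remove1 b l) w * invc b w = count_list l b / (w \<bullet> w) * invm l w"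
      by (simp add: mult_ac)
    then show ?thesis using True by (simp add: algebra_simps add_divide_distrib)
  next
    case False
    then show ?thesis by (simp add: algebra_simps)
  qed
  with d show ?case by (simp only: invm_simps)
qed (simp add: invm_def)

lemma norm_powr_line_deriv:
  fixes z b :: "'a::euclidean_space"
  assumes nz: "z + t *\<^sub>R b \<noteq> 0"
  defines "w \<equiv> z + t *\<^sub>R b"
  shows "((\<lambda>t. norm (z + t *\<^sub>R b) powr (- \<beta>)) has_real_derivative - \<beta> * invc b w * norm w powr (- \<beta>)) (at t)"
proof -
  have n: "norm y powr (- \<beta>) = (y \<bullet> y) powr (- \<beta> / 2)" for y :: 'a
    unfolding norm_eq_sqrt_inner by (simp add: powr_half_sqrt[symmetric] powr_powr)
  have pos: "w \<bullet> w > 0" using nz by (simp add: w_def)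
  have "((\<lambda>t. ((z + t *\<^sub>R b) \<bullet> (z + t *\<^sub>R b)) powr (- \<beta> / 2)) has_real_derivative 
      (- \<beta> / 2) * (w \<bullet> w) powr (- \<beta> / 2 - 1) * (2 * (w \<bullet> b))) (at t)"
    using DERIV_fun_powr[OF sq_line_deriv[of z b t], of "- \<beta> / 2"] pos by (simp add: w_def)
  moreover have "(- \<beta> / 2) * (w \<bullet> w) powr (- \<beta> / 2 - 1) * (2 * (w \<bullet> b)) = - \<beta> * invc b w * (w \<bullet> w) powr (- \<beta> / 2)"
    using pos by (simp add: powr_diff invc_def)
  ultimately show ?thesis unfolding n by (simp only:)
qed

context exterior_source
begin

text \<open>The index k absorbs the factors 1 / |z|^2 produced by differentiating the monomial, so
  the family is closed under differentiation up to linear combinations. It starts from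
  \<open>kern [] 0\<close>, the kernel |z|^(-a).\<close>

definition kern :: "'a list \<Rightarrow> nat \<Rightarrow> 'a \<Rightarrow> real" where
  "kern l k z = invm l z * norm z powr (- (a + 2 * real k))"

lemma kern_measurable [measurable]: "kern l k \<in> borel_measurable borel"
  unfolding kern_def[abs_def] by measurable

lemma kern_bound:
  assumes l: "l \<in> lists Basis" and z: "norm z \<ge> r"
  shows "\<bar>kern l k z\<bar> \<le> ((1 / r) ^ length l * r powr (- (2 * real k))) * norm z powr (- a)"
proof -
  have "norm z powr (- (a + 2 * real k)) = norm z powr (- (2 * real k)) * norm z powr (- a)"
  proof -
    have "- (a + 2 * real k) = - (2 * real k) + - a" by simp
    then show ?thesis by (simp only: powr_add)
  qed
  also have "\<dots> \<le> r powr (- (2 * real k)) * norm z powr (- a)"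
    using r z by (intro mult_right_mono powr_mono2') auto
  finally have "\<bar>invm l z\<bar> * norm z powr (- (a + 2 * real k)) \<le> (1 / r) ^ length l * (r powr (- (2 * real k)) * norm z powr (- a))"
    using abs_invm_le[OF l r z] r by (intro mult_mono) auto
  then show ?thesis by (simp add: kern_def abs_mult mult.assoc)
qed

text \<open>The second coefficient adds a + 2k from the power of the norm and 2 for every factor of
  the monomial. It is positive, so the term with \<open>b # l\<close> can be solved for.\<close>

definition dkern :: "'a \<Rightarrow> 'a list \<Rightarrow> nat \<Rightarrow> 'a \<Rightarrow> real" where
  "dkern b l k z = count_list l b * kern (remove1 b l) (Suc k) z - (a + 2 * real k + 2 * real (length l)) * kern (b # l) k z"

lemma kern_line_deriv:
  assumes nz: "z + t *\<^sub>R b \<noteq> 0" and b: "b \<in> Basis" and l: "l \<in> lists Basis"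
  shows "((\<lambda>t. kern l k (z + t *\<^sub>R b)) has_real_derivative dkern b l k (z + t *\<^sub>R b)) (at t)"
proof -
  define w where "w = z + t *\<^sub>R b"
  define P where "P = norm w powr (- (a + 2 * real k))"
  have w: "norm w > 0" using nz by (simp add: w_def)
  have P': "norm w powr (- (a + 2 * real (Suc k))) = P / (w \<bullet> w)"
  proof -
    have "norm w powr (- (a + 2 * real (Suc k))) = P * norm w powr (- 2)"
      unfolding P_def powr_add[symmetric] by (simp add: algebra_simps)
    also have "norm w powr (- 2) = 1 / (w \<bullet> w)"
      using w by (simp add: powr_minus_divide power2_norm_eq_inner)
    finally show ?thesis by simp
  qed
  have "((\<lambda>t. kern l k (z + t *\<^sub>R b)) has_real_derivative
     (count_list l b / (w \<bullet> w) * invm (remove1 b l) w - 2 * real (length l) * invm (b # l) w) * P + (- (a + 2 * real k) * invc b w * P) * invm l w) (at t)"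
    unfolding kern_def P_def w_def
    using DERIV_mult[OF invm_line_deriv[OF nz b l] norm_powr_line_deriv[OF nz, of "a + 2 * real k"]] by simp
  moreover have "(count_list l b / (w \<bullet> w) * invm (remove1 b l) w - 2 * real (length l) * invm (b # l) w) * P + (- (a + 2 * real k) * invc b w * P) * invm l w
     = dkern b l k w"
    unfolding dkern_def kern_def P' P_def[symmetric] by (simp add: algebra_simps)
  ultimately show ?thesis by (simp add: w_def)
qed

lemma kern_integrable:
  assumes "l \<in> lists Basis" "norm (x - x0) < r"
  shows "integrable lborel (\<lambda>y. \<phi> y * kern l k (x - y))"
  by (rule potential_integrable(1)[OF _ assms(2) kern_bound[OF assms(1)]]) measurable

definition annihilates :: "('a \<Rightarrow> real) \<Rightarrow> bool" where
  "annihilates K \<longleftrightarrow> (\<forall>x. norm (x - x0) < r \<longrightarrow> (LINT y|lborel. \<phi> y * K (x - y)) = 0)"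

text \<open>Differentiation under the integral: the difference quotients of a function vanishing on
  the ball are zero, and the mean value theorem together with the decay of \<open>dkern\<close>
  dominates the integrands.\<close>

lemma annihilates_dkern:
  assumes an: "annihilates (kern l k)" and b: "b \<in> Basis" and l: "l \<in> lists Basis"
  shows "annihilates (dkern b l k)"
  unfolding annihilates_def
proof (intro allI impI)
  fix x assume x: "norm (x - x0) < r"
  \<comment> \<open>Half of the remaining distance to the boundary keeps the segment from x in the
    direction b inside the ball.\<close>
  define \<delta> where "\<delta> = (r - norm (x - x0)) / 2"
  have \<delta>: "\<delta> > 0" "norm (x - x0) + \<delta> < r" using x by (auto simp: \<delta>_def field_simps)
  define h where "h j = \<delta> * inverse (real (Suc j))" for j
  have "h \<longlonglongrightarrow> \<delta> * 0" unfolding h_def by (intro tendsto_mult tendsto_const LIMSEQ_inverse_real_of_nat)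
  then have hlim: "h \<longlonglongrightarrow> 0" by simp
  have h: "h j > 0" "h j \<le> \<delta>" for j using \<delta>(1) by (auto simp: h_def mult_le_cancel_left2 inverse_le_1_iff)
  have seg: "norm (x + t *\<^sub>R b - x0) < r" if "0 \<le> t" "t \<le> \<delta>" for t
  proof -
    have "norm (x + t *\<^sub>R b - x0) \<le> norm (x - x0) + norm (t *\<^sub>R b)" using norm_triangle_ineq[of "x - x0" "t *\<^sub>R b"] by (simp add: algebra_simps)
    then show ?thesis using that b \<delta>(2) by simp
  qed
  define q where "q j y = (\<phi> y * kern l k (x + h j *\<^sub>R b - y) - \<phi> y * kern l k (x - y)) / h j" for j y
  have q0: "(LINT y|lborel. q j y) = 0" for j
  proof -
    have n: "norm (x + h j *\<^sub>R b - x0) < r" using seg[of "h j"] h[of j] by simp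
    then show ?thesis
      using kern_integrable[OF l n, of k] kern_integrable[OF l x, of k] an x unfolding q_def annihilates_def by simp
  qed
  have line: "x + t *\<^sub>R b - y = (x - y) + t *\<^sub>R b" for t y by simp
  have bl: "b # l \<in> lists Basis" "remove1 b l \<in> lists Basis" using b l set_remove1_subset[of b l] by (auto simp: in_lists_conv_set)
  obtain A where A: "\<And>z. norm z \<ge> r \<Longrightarrow> \<bar>dkern b l k z\<bar> \<le> A * norm z powr (- a)"
  proof
    fix z :: 'a assume z: "norm z \<ge> r"
    have "\<bar>dkern b l k z\<bar> \<le> \<bar>real (count_list l b)\<bar> * \<bar>kern (remove1 b l) (Suc k) z\<bar> + \<bar>a + 2 * real k + 2 * real (length l)\<bar> * \<bar>kern (b # l) k z\<bar>"
      unfolding dkern_def abs_mult[symmetric] by (rule abs_triangle_ineq4)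
    also have "\<dots> \<le> \<bar>real (count_list l b)\<bar> * (((1 / r) ^ length (remove1 b l) * r powr (- (2 * real (Suc k)))) * norm z powr (- a)) 
       + \<bar>a + 2 * real k + 2 * real (length l)\<bar> * (((1 / r) ^ length (b # l) * r powr (- (2 * real k))) * norm z powr (- a))"
      by (intro add_mono mult_left_mono kern_bound bl z) auto
    finally show "\<bar>dkern b l k z\<bar> \<le> (\<bar>real (count_list l b)\<bar> * ((1 / r) ^ length (remove1 b l) * r powr (- (2 * real (Suc k)))) 
       + \<bar>a + 2 * real k + 2 * real (length l)\<bar> * ((1 / r) ^ length (b # l) * r powr (- (2 * real k)))) * norm z powr (- a)"
      by (simp only: distrib_right mult.assoc)
  qed
  have dm [measurable]: "dkern b l k \<in> borel_measurable borel" unfolding dkern_def[abs_def] by measurable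
  have "(\<lambda>j. LINT y|lborel. q j y) \<longlonglongrightarrow> (LINT y|lborel. \<phi> y * dkern b l k (x - y))"
  proof (rule integral_dominated_convergence[where w = "\<lambda>y. A * 2 powr a * \<bar>\<psi> y\<bar>"])
    show "integrable lborel (\<lambda>y. A * 2 powr a * \<bar>\<psi> y\<bar>)" using \<psi>_integrable by (intro integrable_mult_right) simp
    show "AE y in lborel. (\<lambda>j. q j y) \<longlonglongrightarrow> \<phi> y * dkern b l k (x - y)"
    proof (rule AE_I2)
      fix y
      show "(\<lambda>j. q j y) \<longlonglongrightarrow> \<phi> y * dkern b l k (x - y)"
      proof (cases "norm (y - x0) \<ge> 2 * r")
        case True
        then have "x - y \<noteq> 0" using norm_ge(2)[OF x True] r by auto
        then have "((\<lambda>t. kern l k ((x - y) + t *\<^sub>R b)) has_real_derivative dkern b l k (x - y)) (at 0)"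
          using kern_line_deriv[of "x - y" 0 b l k] b l by simp
        then have "(\<lambda>t. (kern l k ((x - y) + t *\<^sub>R b) - kern l k (x - y)) / t) \<midarrow>0\<rightarrow> dkern b l k (x - y)"
          by (simp add: DERIV_def)
        moreover have "filterlim h (at 0) sequentially"
          using hlim h(1) by (auto simp: filterlim_at intro!: always_eventually) (metis less_irrefl)
        ultimately have "(\<lambda>j. (kern l k ((x - y) + h j *\<^sub>R b) - kern l k (x - y)) / h j) \<longlonglongrightarrow> dkern b l k (x - y)"
          by (rule filterlim_compose)
        then have "(\<lambda>j. \<phi> y * ((kern l k ((x - y) + h j *\<^sub>R b) - kern l k (x - y)) / h j)) \<longlonglongrightarrow> \<phi> y * dkern b l k (x - y)"
          by (intro tendsto_intros)
        then show ?thesis by (simp only: q_def line right_diff_distrib times_divide_eq_right)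
      qed (simp add: q_def \<phi>0)
    qed
    show "AE y in lborel. norm (q j y) \<le> A * 2 powr a * \<bar>\<psi> y\<bar>" for j
    proof (rule AE_I2)
      fix y
      show "norm (q j y) \<le> A * 2 powr a * \<bar>\<psi> y\<bar>"
      proof (cases "norm (y - x0) \<ge> 2 * r")
        case True
        have nz: "(x - y) + t *\<^sub>R b \<noteq> 0" if "0 \<le> t" "t \<le> h j" for t
          using norm_ge(2)[OF seg True, of t] that h(2)[of j] r by (auto simp: line)
        have "((\<lambda>t. kern l k ((x - y) + t *\<^sub>R b)) has_real_derivative dkern b l k ((x - y) + t *\<^sub>R b)) (at t)" if "0 \<le> t" "t \<le> h j" for t
          by (rule kern_line_deriv[OF nz[OF that] b l])
        then obtain t where t: "0 < t" "t < h j" "kern l k ((x - y) + h j *\<^sub>R b) - kern l k ((x - y) + 0 *\<^sub>R b) = (h j - 0) * dkern b l k ((x - y) + t *\<^sub>R b)"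
          using MVT2[OF h(1)[of j], of "\<lambda>t. kern l k ((x - y) + t *\<^sub>R b)" "\<lambda>t. dkern b l k ((x - y) + t *\<^sub>R b)"] by blast
        have "q j y = \<phi> y * ((kern l k ((x - y) + h j *\<^sub>R b) - kern l k (x - y)) / h j)"
          by (simp only: q_def line right_diff_distrib times_divide_eq_right)
        also have "\<dots> = \<phi> y * dkern b l k ((x + t *\<^sub>R b) - y)" using t(3) h(1)[of j] by (simp add: line)
        finally have qe: "q j y = \<phi> y * dkern b l k ((x + t *\<^sub>R b) - y)" .
        have n: "norm (x + t *\<^sub>R b - x0) < r" using seg[of t] t h(2)[of j] by simp
        show ?thesis unfolding qe real_norm_def
          by (rule potential_integrable(2)[OF _ n A]) measurable
      next
        case False
        obtain e :: 'a where e: "norm e = r" using vector_choose_size[of r] r by auto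
        have "0 \<le> \<bar>dkern b l k e\<bar>" by simp
        also have "\<dots> \<le> A * r powr (- a)" using A[of e] e by simp
        finally have "A \<ge> 0" using r by (simp add: zero_le_mult_iff)
        then show ?thesis using False by (simp add: q_def \<phi>0)
      qed
    qed
  qed (auto simp: q_def)
  then show "(LINT y|lborel. \<phi> y * dkern b l k (x - y)) = 0"
    unfolding q0 using LIMSEQ_unique tendsto_const by metis
qed

text \<open>In \<open>dkern b l k\<close> the other term is annihilated by assumption or has
  coefficient zero, and the coefficient of \<open>kern (b # l) k\<close> is nonzero.\<close>

lemma annihilates_Cons:
  assumes an: "annihilates (kern l k)" and b: "b \<in> Basis" and l: "l \<in> lists Basis"
    and an': "b \<in> set l \<Longrightarrow> annihilates (kern (remove1 b l) (Suc k))"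
  shows "annihilates (kern (b # l) k)"
  unfolding annihilates_def
proof (intro allI impI)
  fix x assume x: "norm (x - x0) < r"
  let ?c = "a + 2 * real k + 2 * real (length l)"
  have bl: "b # l \<in> lists Basis" "remove1 b l \<in> lists Basis" using b l set_remove1_subset[of b l] by (auto simp: in_lists_conv_set)
  have i1: "integrable lborel (\<lambda>y. real (count_list l b) * (\<phi> y * kern (remove1 b l) (Suc k) (x - y)))"
    and i2: "integrable lborel (\<lambda>y. ?c * (\<phi> y * kern (b # l) k (x - y)))"
    by (intro integrable_mult_right kern_integrable bl x)+
  have "0 = (LINT y|lborel. \<phi> y * dkern b l k (x - y))"
    using annihilates_dkern[OF an b l] x by (simp add: annihilates_def)
  also have "\<dots> = (LINT y|lborel. real (count_list l b) * (\<phi> y * kern (remove1 b l) (Suc k) (x - y)) - ?c * (\<phi> y * kern (b # l) k (x - y)))"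
    unfolding dkern_def by (simp only: right_diff_distrib mult.left_commute)
  also have "\<dots> = real (count_list l b) * (LINT y|lborel. \<phi> y * kern (remove1 b l) (Suc k) (x - y)) - ?c * (LINT y|lborel. \<phi> y * kern (b # l) k (x - y))"
    unfolding Bochner_Integration.integral_diff[OF i1 i2] integral_mult_right_zero ..
  also have "real (count_list l b) * (LINT y|lborel. \<phi> y * kern (remove1 b l) (Suc k) (x - y)) = 0"
    using an' x by (cases "b \<in> set l") (auto simp: annihilates_def count_list_0_iff)
  finally have "?c * (LINT y|lborel. \<phi> y * kern (b # l) k (x - y)) = 0" by simp
  moreover have "?c > 0" using a_pos by (simp add: add_pos_nonneg)
  ultimately show "(LINT y|lborel. \<phi> y * kern (b # l) k (x - y)) = 0" by simp
qed

text \<open>The Laplacian of \<open>|z| powr -\<beta>\<close> is \<open>\<beta> (\<beta> + 2 - n) |z| powr -(\<beta> + 2)\<close>, and \<open>\<beta> + 2 - n \<noteq> 0\<close> here.\<close>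

lemma annihilates_Nil:
  assumes "annihilates (kern [] 0)" shows "annihilates (kern [] k)"
proof (induction k)
  case (Suc k)
  show ?case unfolding annihilates_def
  proof (intro allI impI)
    fix x assume x: "norm (x - x0) < r"
    let ?I = "\<lambda>l k. LINT y|lborel. \<phi> y * kern l k (x - y)"
    let ?c = "a + 2 * real k + 2"
    have "0 = ?I [] (Suc k) - ?c * ?I [b, b] k" if b: "b \<in> Basis" for b
    proof -
      have "annihilates (kern [b] k)" by (rule annihilates_Cons[OF Suc b]) auto
      from annihilates_dkern[OF this b] b have "0 = (LINT y|lborel. \<phi> y * dkern b [b] k (x - y))"
        using x by (simp add: annihilates_def)
      also have "\<dots> = (LINT y|lborel. \<phi> y * kern [] (Suc k) (x - y) - ?c * (\<phi> y * kern [b, b] k (x - y)))"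
        by (simp add: dkern_def algebra_simps)
      also have "\<dots> = ?I [] (Suc k) - (LINT y|lborel. ?c * (\<phi> y * kern [b, b] k (x - y)))"
        by (intro Bochner_Integration.integral_diff integrable_mult_right kern_integrable x) (use b in auto)
      finally show ?thesis by simp
    qed
    \<comment> \<open>The squared inversion coordinates sum to 1 / |z|^2, so the kernels
      \<open>kern [b, b] k\<close> add up to \<open>kern [] (Suc k)\<close> itself, and the total
      coefficient is n - (a + 2k + 2) < 0.\<close>
    then have "0 = (\<Sum>b\<in>(Basis::'a set). ?I [] (Suc k) - ?c * ?I [b, b] k)" by (intro sum.neutral[symmetric]) metis
    also have "\<dots> = real DIM('a) * ?I [] (Suc k) - ?c * (\<Sum>b\<in>Basis. ?I [b, b] k)"
      by (simp add: sum_subtractf sum_distrib_left)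
    also have "(\<Sum>b\<in>(Basis::'a set). ?I [b, b] k) = (LINT y|lborel. (\<Sum>b\<in>Basis. \<phi> y * kern [b, b] k (x - y)))"
      by (rule Bochner_Integration.integral_sum[symmetric]) (intro kern_integrable x, auto)
    also have "\<dots> = ?I [] (Suc k)"
    proof (rule Bochner_Integration.integral_cong[OF refl])
      fix y
      have "(\<Sum>b\<in>Basis. kern [b, b] k z) = kern [] (Suc k) z" for z :: 'a
      proof (cases "z = 0")
        case False
        have "(\<Sum>b\<in>Basis. (z \<bullet> b) * (z \<bullet> b)) = z \<bullet> z" by (subst (3) euclidean_inner) simp
        then have "(\<Sum>b\<in>Basis. invc b z * invc b z) = 1 / (z \<bullet> z)"
          using False by (simp add: invc_def sum_divide_distrib[symmetric])
        moreover have "norm z powr (- (a + 2 * real (Suc k))) = norm z powr (- (a + 2 * real k)) * norm z powr (- 2)"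
          unfolding powr_add[symmetric] by (simp add: algebra_simps)
        moreover have "norm z powr (- 2) = 1 / (z \<bullet> z)"
          using False by (simp add: powr_minus_divide power2_norm_eq_inner)
        ultimately show ?thesis by (simp add: kern_def sum_distrib_right[symmetric])
      qed (simp add: kern_def invc_def)
      then show "(\<Sum>b\<in>Basis. \<phi> y * kern [b, b] k (x - y)) = \<phi> y * kern [] (Suc k) (x - y)"
        by (simp only: sum_distrib_left[symmetric])
    qed
    finally have "(real DIM('a) - ?c) * ?I [] (Suc k) = 0" by (simp add: left_diff_distrib)
    moreover have "real DIM('a) - ?c < 0" using s by (simp add: a_def)
    ultimately show "?I [] (Suc k) = 0" by simp
  qed
qed (rule assms)

text \<open>Induction on the length with k arbitrary, since removing a basis vector raises k. The
  empty list is covered for every k by \<open>annihilates_Nil\<close>.\<close>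

lemma annihilates_kern:
  assumes base: "annihilates (kern [] 0)" and l: "l \<in> lists Basis" 
  shows "annihilates (kern l k)"
  using l
proof (induction "length l" arbitrary: l k rule: less_induct)
  case less
  show ?case
  proof (cases l)
    case Nil
    then show ?thesis using annihilates_Nil[OF base] by simp
  next
    case (Cons b l')
    have b: "b \<in> Basis" "l' \<in> lists Basis" using less.prems Cons by auto
    have "annihilates (kern (b # l') k)"
    proof (rule annihilates_Cons[OF _ b])
      show "annihilates (kern l' k)" by (rule less.hyps) (use Cons b in auto)
      show "annihilates (kern (remove1 b l') (Suc k))" if "b \<in> set l'"
        by (rule less.hyps) (use Cons b that set_remove1_subset[of b l'] in \<open>auto simp: length_remove1 in_lists_conv_set\<close>)
    qed
    then show ?thesis using Cons by simp
  qed
qed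

section \<open>Completeness of the monomials in the inverted variable\<close>

definition inv0 :: "'a \<Rightarrow> 'a" where "inv0 y = (1 / ((x0 - y) \<bullet> (x0 - y))) *\<^sub>R (x0 - y)"

lemma inv0_measurable [measurable]: "inv0 \<in> borel_measurable borel"
  unfolding inv0_def[abs_def] by measurable

lemma \<psi>_nz: "\<psi> y \<noteq> 0 \<Longrightarrow> norm (y - x0) \<ge> 2 * r"
  using \<phi>0[of y] by (auto simp: \<psi>_def tail_weight_def split: if_splits)

lemma norm_inv0: 
  assumes "\<psi> y \<noteq> 0" shows "norm (inv0 y) \<le> 1 / (2 * r)"
proof -
  have n: "norm (x0 - y) \<ge> 2 * r" using \<psi>_nz[OF assms] by (simp add: norm_minus_commute)
  then have "norm (inv0 y) = 1 / norm (x0 - y)"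
    using r by (simp add: inv0_def power2_norm_eq_inner[symmetric] power2_eq_square)
  then show ?thesis using n r by (simp add: frac_le)
qed

definition moment_zero :: "('a \<Rightarrow> real) \<Rightarrow> bool" where
  "moment_zero p \<longleftrightarrow> p \<in> borel_measurable borel \<and> integrable lborel (\<lambda>y. \<psi> y * p (inv0 y)) \<and> (LINT y|lborel. \<psi> y * p (inv0 y)) = 0"

text \<open>A linear description of polynomials: vanishing of moments is preserved by sums and
  scalar multiples but not by products, so induction over polynomial functions themselves would not
  go through.\<close>

inductive_set monomial_span :: "('a \<Rightarrow> real) set" where
  mono: "l \<in> lists Basis \<Longrightarrow> (\<lambda>w. \<Prod>b\<leftarrow>l. w \<bullet> b) \<in> monomial_span"
| add: "p \<in> monomial_span \<Longrightarrow> q \<in> monomial_span \<Longrightarrow> (\<lambda>w. p w + q w) \<in> monomial_span"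
| scale: "p \<in> monomial_span \<Longrightarrow> (\<lambda>w. c * p w) \<in> monomial_span"

lemma monomial_span_mult:
  assumes "p \<in> monomial_span" "q \<in> monomial_span" shows "(\<lambda>w. p w * q w) \<in> monomial_span"
  using assms
proof (induction arbitrary: q)
  case (mono l)
  show ?case using mono.prems
  proof induction
    case (mono l')
    have "(\<lambda>w. \<Prod>b\<leftarrow>l @ l'. w \<bullet> b) \<in> monomial_span" by (rule monomial_span.mono) (use mono \<open>l \<in> lists Basis\<close> in auto)
    then show ?case by simp
  next
    case (add p q)
    from monomial_span.add[OF add.IH] show ?case by (simp add: distrib_left)
  next
    case (scale p c)
    from monomial_span.scale[OF scale.IH, of c] show ?case by (simp add: mult.left_commute)
  qed
next
  case (add p1 p2)
  from monomial_span.add[OF add.IH(1)[OF add.prems] add.IH(2)[OF add.prems]] show ?case by (simp add: distrib_right)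
next
  case (scale p c)
  from monomial_span.scale[OF scale.IH[OF scale.prems], of c] show ?case by (simp add: mult.assoc)
qed

lemma monomial_span_zero: "(\<lambda>w. 0) \<in> monomial_span"
  using monomial_span.scale[OF monomial_span.mono[of "[]"], of 0] by simp

lemma real_polynomial_monomial_span: "real_polynomial_function p \<Longrightarrow> p \<in> monomial_span"
proof (induction rule: real_polynomial_function.induct)
  case (linear f)
  interpret bounded_linear f by fact
  have f: "f = (\<lambda>w. \<Sum>b\<in>Basis. f b * (w \<bullet> b))"
  proof
    fix w
    have "f w = f (\<Sum>b\<in>Basis. (w \<bullet> b) *\<^sub>R b)" by (simp add: euclidean_representation)
    also have "\<dots> = (\<Sum>b\<in>Basis. f b * (w \<bullet> b))" by (simp add: sum scaleR mult.commute)
    finally show "f w = (\<Sum>b\<in>Basis. f b * (w \<bullet> b))" .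
  qed
  have "(\<lambda>w. \<Sum>b\<in>B. f b * (w \<bullet> b)) \<in> monomial_span" if "finite B" "B \<subseteq> Basis" for B
    using that
  proof (induction B rule: finite_induct)
    case (insert b B)
    have "(\<lambda>w. f b * (w \<bullet> b)) \<in> monomial_span"
      using monomial_span.scale[OF monomial_span.mono[of "[b]"], of "f b"] insert.prems by simp
    from monomial_span.add[OF this insert.IH] insert show ?case by simp
  qed (simp add: monomial_span_zero)
  from this[OF finite_Basis] show ?case by (subst f) simp
next
  case (const c)
  show ?case using monomial_span.scale[OF monomial_span.mono[of "[]"], of c] by simp
qed (auto intro: monomial_span.add monomial_span_mult)

text \<open>The weight \<psi> already carries |x0 - y|^(-a), so a monomial moment is the annihilated
  integral of \<open>kern l 0\<close> at the centre x = x0.\<close>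

lemma moment_zero_monomial_span:
  assumes base: "annihilates (kern [] 0)" and p: "p \<in> monomial_span"
  shows "moment_zero p"
  using p
proof induction
  case (mono l)
  have m: "(\<Prod>b\<leftarrow>l. inv0 y \<bullet> b) = invm l (x0 - y)" for y
    unfolding invm_def invc_def inv0_def by (simp add: inner_simps)
  have eq: "\<psi> y * (\<Prod>b\<leftarrow>l. inv0 y \<bullet> b) = \<phi> y * kern l 0 (x0 - y)" for y
    unfolding m kern_def using \<phi>0[of y] by (auto simp: \<psi>_def tail_weight_def norm_minus_commute[of x0])
  have x0: "norm (x0 - x0) < r" using r by simp
  have meas: "(\<lambda>w. \<Prod>b\<leftarrow>l. w \<bullet> b) \<in> borel_measurable borel" by (induction l) auto
  show ?case unfolding moment_zero_def eq 
    using meas kern_integrable[OF mono x0] annihilates_kern[OF base mono, of 0] x0 by (simp add: annihilates_def)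
next
  case (add p q)
  then show ?case unfolding moment_zero_def by (simp add: distrib_left borel_measurable_add)
next
  case (scale p c)
  then show ?case unfolding moment_zero_def by (simp add: mult.left_commute borel_measurable_times)
qed

text \<open>Where \<psi> is nonzero, the inversion takes values in the compact ball of radius 1 /
  (2r), and there g is a uniform limit of polynomials.\<close>

lemma integral_continuous_inv0:
  assumes base: "annihilates (kern [] 0)" and g: "continuous_on UNIV g"
  shows "(LINT y|lborel. \<psi> y * g (inv0 y)) = 0"
proof (rule ccontr)
  let ?I = "LINT y|lborel. \<psi> y * g (inv0 y)"
  assume nz: "?I \<noteq> 0"
  define M where "M = (LINT y|lborel. \<bar>\<psi> y\<bar>)"
  have M0: "M \<ge> 0" by (simp add: M_def)
  \<comment> \<open>Chosen so that the total error e M is smaller than the modulus of the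
    integral.\<close>
  define e where "e = \<bar>?I\<bar> / (M + 1)"
  have e: "e > 0" using nz M0 by (simp add: e_def)
  obtain p where p: "real_polynomial_function p" "\<And>w. w \<in> cball 0 (1 / (2 * r)) \<Longrightarrow> \<bar>g w - p w\<bar> < e"
    using Stone_Weierstrass_real_polynomial_function[of "cball (0::'a) (1 / (2 * r))" g e] continuous_on_subset[OF g] e by auto
  have mz: "moment_zero p" by (rule moment_zero_monomial_span[OF base real_polynomial_monomial_span[OF p(1)]])
  have [measurable]: "g \<in> borel_measurable borel" "p \<in> borel_measurable borel"
    using g mz by (auto simp: moment_zero_def intro: borel_measurable_continuous_onI)
  have le: "\<bar>\<psi> y * (g (inv0 y) - p (inv0 y))\<bar> \<le> e * \<bar>\<psi> y\<bar>" for y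
  proof (cases "\<psi> y = 0")
    case False
    then have "\<bar>g (inv0 y) - p (inv0 y)\<bar> \<le> e" using p(2)[of "inv0 y"] norm_inv0[of y] by (simp add: less_imp_le)
    then show ?thesis by (simp add: abs_mult mult.commute[of e] mult_left_mono)
  qed simp
  have i: "integrable lborel (\<lambda>y. \<psi> y * (g (inv0 y) - p (inv0 y)))"
  proof (rule Bochner_Integration.integrable_bound)
    show "integrable lborel (\<lambda>y. e * \<bar>\<psi> y\<bar>)" using \<psi>_integrable by simp
    show "AE y in lborel. norm (\<psi> y * (g (inv0 y) - p (inv0 y))) \<le> norm (e * \<bar>\<psi> y\<bar>)"
      using le e by (intro AE_I2) simp
  qed measurable
  have "?I = (LINT y|lborel. \<psi> y * (g (inv0 y) - p (inv0 y)) + \<psi> y * p (inv0 y))"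
    by (simp add: algebra_simps)
  also have "\<dots> = (LINT y|lborel. \<psi> y * (g (inv0 y) - p (inv0 y)))"
    using i mz by (simp add: moment_zero_def)
  finally have "\<bar>?I\<bar> \<le> (LINT y|lborel. \<bar>\<psi> y * (g (inv0 y) - p (inv0 y))\<bar>)"
    using integral_norm_bound[of lborel "\<lambda>y. \<psi> y * (g (inv0 y) - p (inv0 y))"] by simp
  also have "\<dots> \<le> (LINT y|lborel. e * \<bar>\<psi> y\<bar>)"
    using i \<psi>_integrable le by (intro integral_mono integrable_abs) auto
  also have "\<dots> = e * M" by (simp add: M_def)
  also have "\<dots> < \<bar>?I\<bar>" using nz M0 by (simp add: e_def field_simps)
  finally show False by simp
qed

text \<open>The inversion is a homeomorphism away from its centre, so U corresponds to an open set V
  whose indicator is a pointwise limit of bounded continuous functions.\<close>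

lemma integral_open_zero:
  assumes base: "annihilates (kern [] 0)" and U: "open U"
  shows "(LINT y|lborel. indicator U y * \<psi> y) = 0"
proof -
  \<comment> \<open>The map taking w to x0 - w / |w|^2 undoes \<open>inv0\<close>, and V is the
    preimage of U under it.\<close>
  define V where "V = {w. w \<noteq> 0 \<and> x0 - (1 / (w \<bullet> w)) *\<^sub>R w \<in> U}"
  have "open V"
  proof -
    have "continuous_on (- {0}) (\<lambda>w::'a. x0 - (1 / (w \<bullet> w)) *\<^sub>R w)" by (intro continuous_intros) auto
    then have "open (- {0} \<inter> (\<lambda>w. x0 - (1 / (w \<bullet> w)) *\<^sub>R w) -` U)" using U by (intro continuous_open_preimage) auto
    moreover have "V = - {0} \<inter> (\<lambda>w. x0 - (1 / (w \<bullet> w)) *\<^sub>R w) -` U" by (auto simp: V_def)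
    ultimately show ?thesis by simp
  qed
  have Vc: "closed (- V)" "- V \<noteq> {}" using \<open>open V\<close> by (auto simp: V_def)
  have mem: "inv0 y \<in> V \<longleftrightarrow> y \<in> U" if "\<psi> y \<noteq> 0" for y
  proof -
    have n: "x0 - y \<noteq> 0" using \<psi>_nz[OF that] r by auto
    define c where "c = (x0 - y) \<bullet> (x0 - y)"
    have c: "c \<noteq> 0" using n by (simp add: c_def)
    have i: "inv0 y = (1 / c) *\<^sub>R (x0 - y)" by (simp add: inv0_def c_def)
    have "inv0 y \<bullet> inv0 y = 1 / c" unfolding i using c by (simp add: c_def[symmetric])
    then have "x0 - (1 / (inv0 y \<bullet> inv0 y)) *\<^sub>R inv0 y = y" unfolding i using c by simp
    moreover have "inv0 y \<noteq> 0" unfolding i using c n by simp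
    ultimately show ?thesis by (simp add: V_def)
  qed
  define g where "g k w = min 1 (real k * infdist w (- V))" for k w
  have [measurable]: "U \<in> sets borel" using U by simp
  have gc: "continuous_on UNIV (g k)" for k unfolding g_def[abs_def] by (intro continuous_intros)
  then have [measurable]: "g k \<in> borel_measurable borel" for k by (rule borel_measurable_continuous_onI)
  have glim: "(\<lambda>k. g k w) \<longlonglongrightarrow> indicator V w" for w
  proof (cases "w \<in> V")
    case True
    then have "infdist w (- V) \<noteq> 0" using in_closed_iff_infdist_zero[OF Vc] by auto
    then have pos: "infdist w (- V) > 0" using infdist_nonneg[of w "- V"] by simp
    obtain N :: nat where N: "1 / infdist w (- V) \<le> real N" using real_arch_simple by blast
    have "g k w = 1" if "k \<ge> N" for k
    proof -
      have "1 / infdist w (- V) \<le> real k" using N that by simp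
      then have "1 \<le> real k * infdist w (- V)" using pos by (simp add: divide_le_eq)
      then show ?thesis by (simp add: g_def)
    qed
    then have "\<forall>\<^sub>F k in sequentially. g k w = indicator V w" using True by (auto simp: eventually_sequentially)
    then show ?thesis by (rule tendsto_eventually)
  next
    case False
    then have "infdist w (- V) = 0" using in_closed_iff_infdist_zero[OF Vc] by auto
    then show ?thesis using False by (simp add: g_def)
  qed
  have "(\<lambda>k. LINT y|lborel. \<psi> y * g k (inv0 y)) \<longlonglongrightarrow> (LINT y|lborel. indicator U y * \<psi> y)"
  proof (rule integral_dominated_convergence[where w = "\<lambda>y. \<bar>\<psi> y\<bar>"])
    show "AE y in lborel. (\<lambda>k. \<psi> y * g k (inv0 y)) \<longlonglongrightarrow> indicator U y * \<psi> y"
    proof (rule AE_I2)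
      fix y
      have "(\<lambda>k. \<psi> y * g k (inv0 y)) \<longlonglongrightarrow> \<psi> y * indicator V (inv0 y)" by (intro tendsto_intros glim)
      also have "\<psi> y * indicator V (inv0 y) = indicator U y * \<psi> y" using mem[of y] by (cases "\<psi> y = 0") (auto simp: indicator_def)
      finally show "(\<lambda>k. \<psi> y * g k (inv0 y)) \<longlonglongrightarrow> indicator U y * \<psi> y" .
    qed
    have "\<bar>g k w\<bar> \<le> 1" for k w by (simp add: g_def infdist_nonneg abs_of_nonneg)
    then show "AE y in lborel. norm (\<psi> y * g k (inv0 y)) \<le> \<bar>\<psi> y\<bar>" for k
      by (intro AE_I2) (simp add: abs_mult mult_left_le)
  qed (use \<psi>_integrable in auto)
  then show ?thesis unfolding integral_continuous_inv0[OF base gc] using LIMSEQ_unique tendsto_const by metis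
qed

text \<open>The open sets are stable under intersection and generate the Borel sets, so all
  integrals of \<psi> over Borel sets vanish. The sets where \<psi> is positive or negative then
  finish the argument.\<close>

lemma \<psi>_zero:
  assumes base: "annihilates (kern [] 0)"
  shows "AE y in lborel. \<psi> y = 0"
proof -
  have iA: "integrable lborel (\<lambda>y. indicator A y * \<psi> y)" if "A \<in> sets borel" for A
    using integrable_real_mult_indicator[OF _ \<psi>_integrable, of A] that by (simp add: mult.commute)
  have all: "(LINT y|lborel. indicator A y * \<psi> y) = 0" if "A \<in> sets borel" for A
  proof -
    have "Int_stable {S::'a set. open S}" "{S::'a set. open S} \<subseteq> Pow UNIV" "A \<in> sigma_sets UNIV {S. open S}"
      using that by (auto simp: borel_def Int_stable_def)
    then show ?thesis
    proof (induction rule: sigma_sets_induct_disjoint)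
      case (basic A) then show ?case using integral_open_zero[OF base] by simp
    next
      case empty then show ?case by simp
    next
      case (compl A)
      then have A: "A \<in> sets borel" by (simp add: borel_def)
      have "(\<lambda>y. indicator (UNIV - A) y * \<psi> y) = (\<lambda>y. indicator UNIV y * \<psi> y - indicator A y * \<psi> y)" by (auto simp: indicator_def)
      then have "(LINT y|lborel. indicator (UNIV - A) y * \<psi> y) = (LINT y|lborel. indicator UNIV y * \<psi> y) - (LINT y|lborel. indicator A y * \<psi> y)"
        using iA[OF A] iA[of UNIV] by simp
      then show ?case using integral_open_zero[OF base, of UNIV] compl by simp
    next
      case (union A)
      have A: "A i \<in> sets borel" for i using union by (auto simp: borel_def)
      have dA: "disjoint_family A" and zA: "(LINT y|lborel. indicator (A i) y * \<psi> y) = 0" for i using union by auto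
      have "(\<lambda>k. LINT y|lborel. indicator (\<Union>i<k. A i) y * \<psi> y) \<longlonglongrightarrow> (LINT y|lborel. indicator (\<Union>i. A i) y * \<psi> y)"
      proof (rule integral_dominated_convergence[where w = "\<lambda>y. \<bar>\<psi> y\<bar>"])
        show "AE y in lborel. (\<lambda>k. indicator (\<Union>i<k. A i) y * \<psi> y) \<longlonglongrightarrow> indicator (\<Union>i. A i) y * \<psi> y"
        proof (intro AE_I2 tendsto_mult tendsto_const)
          fix y show "(\<lambda>k. indicator (\<Union>i<k. A i) y :: real) \<longlonglongrightarrow> indicator (\<Union>i. A i) y" by (rule LIMSEQ_indicator_UN)
        qed
        show "(\<lambda>y. indicator (\<Union>i<k. A i) y * \<psi> y) \<in> borel_measurable lborel" for k
          using A by (intro borel_measurable_times borel_measurable_indicator) auto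
        show "(\<lambda>y. indicator (\<Union>i. A i) y * \<psi> y) \<in> borel_measurable lborel"
          using A by (intro borel_measurable_times borel_measurable_indicator) auto
      qed (use \<psi>_integrable in \<open>auto simp: indicator_def\<close>)
      moreover have "(LINT y|lborel. indicator (\<Union>i<k. A i) y * \<psi> y) = 0" for k
      proof (induction k)
        case (Suc k)
        have "A k \<inter> A i = {}" if "i < k" for i
          using disjoint_family_onD[OF dA, of k i] that by simp
        then have "A k \<inter> (\<Union>i<k. A i) = {}" by blast
        then have eq: "indicator (\<Union>i<Suc k. A i) y * \<psi> y = indicator (A k) y * \<psi> y + indicator (\<Union>i<k. A i) y * \<psi> y" for y
          unfolding lessThan_Suc UN_insert by (cases "y \<in> A k"; cases "y \<in> (\<Union>i<k. A i)") (auto simp: indicator_def)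
        have m: "(\<Union>i<k. A i) \<in> sets borel" using A by auto
        show ?case unfolding eq using Bochner_Integration.integral_add[OF iA[OF A] iA[OF m]] Suc zA by simp
      qed simp
      ultimately show ?case by (simp add: LIMSEQ_const_iff)
    qed
  qed
  have pos: "AE y in lborel. \<sigma> * \<psi> y \<le> 0" if "\<sigma> = 1 \<or> \<sigma> = -1" for \<sigma>
  proof -
    define P where "P = {y. \<sigma> * \<psi> y > 0}"
    have P: "P \<in> sets borel" unfolding P_def by measurable
    have i: "integrable lborel (\<lambda>y. \<sigma> * (indicator P y * \<psi> y))" by (intro integrable_mult_right iA P)
    have nn: "AE y in lborel. 0 \<le> \<sigma> * (indicator P y * \<psi> y)" by (auto simp: P_def indicator_def)
    have "(LINT y|lborel. \<sigma> * (indicator P y * \<psi> y)) = 0" unfolding integral_mult_right_zero all[OF P] by simp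
    then have "AE y in lborel. \<sigma> * (indicator P y * \<psi> y) = 0" using integral_nonneg_eq_0_iff_AE[OF i nn] by simp
    then show ?thesis by eventually_elim (auto simp: P_def indicator_def split: if_splits)
  qed
  have "AE y in lborel. 1 * \<psi> y \<le> 0" "AE y in lborel. -1 * \<psi> y \<le> 0" by (rule pos, simp)+
  then show ?thesis by eventually_elim auto
qed

theorem unique_continuation:
  assumes "\<And>f. f \<in> test_fun (ball x0 r) \<Longrightarrow> (LINT t|lborel. sweight s t * (LINT y|lborel. \<phi> y * heat_op t f y)) = 0"
  shows "AE y in lborel. \<phi> y = 0"
proof -
  have "annihilates (kern [] 0)"
    unfolding annihilates_def kern_def using \<Phi>_zero[OF assms] by simp
  from \<psi>_zero[OF this] show ?thesis
  proof eventually_elim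
    case (elim y)
    show ?case
    proof (cases "norm (y - x0) \<ge> 2 * r")
      case True
      then have "norm (y - x0) > 0" using r by linarith
      then show ?thesis using elim True by (simp add: \<psi>_def tail_weight_def)
    qed (simp add: \<phi>0)
  qed
qed

end

text \<open>Each approximating test function is orthogonal to u restricted to B. In the L^2 limit
  the integral of u^2 over B is zero.\<close>

lemma hs_closure_zero_outside:
  fixes u :: "'a::euclidean_space \<Rightarrow> real"
  assumes s: "s \<ge> 0" and u: "u \<in> sobolev s" "sob s u \<in> hs_closure s \<Omega>"
    and B: "B \<in> sets borel" "B \<inter> \<Omega> = {}"
  shows "AE x in lborel. indicator B x * u x = 0"
proof -
  define J where "J X = (1 / sqrt ((2 * pi) ^ DIM('a))) *\<^sub>R hartley (mulop (bessel_symbol (- s)) X)" for X :: "'a l2"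
  have bl: "bounded_linear (mulop (bessel_symbol (- s)) :: 'a l2 \<Rightarrow> 'a l2)"
    by (rule bounded_linear_mulop(1)[OF bessel_symbol_measurable bessel_symbol_neg_le[OF s]])
  have J: "J (sob s v) = abs_l2 v" if "v \<in> sobolev s" for v
    unfolding J_def sob_inverse[OF that s] ..
  have uL: "u \<in> L2" using u(1) by (simp add: sobolev_iff)
  have um [measurable]: "u \<in> borel_measurable borel" by (rule L2_realD(1)[OF uL])
  have gL: "(\<lambda>x. indicator B x * u x) \<in> L2"
    by (rule L2_bound[OF uL, of _ 1]) (use B in \<open>auto simp: indicator_def\<close>)
  obtain \<phi> where \<phi>: "\<And>k::nat. \<phi> k \<in> test_fun \<Omega>" "(\<lambda>k. sob s (\<phi> k)) \<longlonglongrightarrow> sob s u" using hs_closureE[OF u(2)] by metis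
  have "(\<lambda>k. J (sob s (\<phi> k))) \<longlonglongrightarrow> J (sob s u)" 
    unfolding J_def by (intro tendsto_scaleR tendsto_const bounded_linear.tendsto[OF bounded_linear_hartley] bounded_linear.tendsto[OF bl] \<phi>(2))
  then have "(\<lambda>k. abs_l2 (\<phi> k)) \<longlonglongrightarrow> abs_l2 u" unfolding J[OF u(1)] J[OF test_fun_sobolev[OF \<phi>(1) s]] .
  then have "(\<lambda>k. inner (abs_l2 (\<phi> k)) (abs_l2 (\<lambda>x. indicator B x * u x))) \<longlonglongrightarrow> inner (abs_l2 u) (abs_l2 (\<lambda>x. indicator B x * u x))"
    by (intro tendsto_inner tendsto_const)
  moreover have "inner (abs_l2 (\<phi> k)) (abs_l2 (\<lambda>x. indicator B x * u x)) = 0" for k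
  proof -
    have z: "\<phi> k x * (indicator B x * u x) = 0" for x
      using not_supp[of x "\<phi> k"] test_funD(3)[OF \<phi>(1)[of k]] B(2) by (auto simp: indicator_def)
    show ?thesis unfolding inner_abs_l2[OF test_fun_hart_L2(1)[OF \<phi>(1)] gL] z by simp
  qed
  ultimately have "inner (abs_l2 u) (abs_l2 (\<lambda>x. indicator B x * u x)) = 0" by (simp add: LIMSEQ_const_iff)
  then have "(LINT x|lborel. u x * (indicator B x * u x)) = 0" unfolding inner_abs_l2[OF uL gL] .
  moreover have eq: "u x * (indicator B x * u x) = (indicator B x * u x)\<^sup>2" for x
    by (simp add: indicator_def power2_eq_square)
  ultimately have "(LINT x|lborel. (indicator B x * u x)\<^sup>2) = 0" by simp
  then have "AE x in lborel. (indicator B x * u x)\<^sup>2 = 0"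
    using integral_nonneg_eq_0_iff_AE[OF L2_realD(2)[OF gL]] by simp
  then show ?thesis by simp
qed

text \<open>The orthogonality is the weak form of (-\<Delta>)^s u = 0 on W, and u itself vanishes on
  W because W is disjoint from \<Omega>.\<close>

theorem fractional_unique_continuation:
  fixes X :: "'a::euclidean_space l2"
  assumes s: "s > 0" "s \<notin> \<int>" and X: "X \<in> hs_closure s \<Omega>" and W: "open W" "W \<noteq> {}" "W \<inter> \<Omega> = {}"
    and orth: "\<And>f. f \<in> test_fun W \<Longrightarrow> inner (mulop (fracw s) X) (mulop (fracw s) (sob s f)) = 0"
  shows "X = 0"
proof -
  have s0: "s \<ge> 0" using s by simp
  obtain u where u: "u \<in> sobolev s" "sob s u = X" using sob_surj[OF s0] by metis
  have uL: "u \<in> L2" using u(1) by (simp add: sobolev_iff)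
  have [measurable]: "u \<in> borel_measurable borel" by (rule L2_realD(1)[OF uL])
  obtain x0 R where R: "R > 0" "ball x0 R \<subseteq> W" using W(1,2) unfolding open_contains_ball by blast
  define r where "r = R / 2"
  have r: "r > 0" "ball x0 (2 * r) \<subseteq> W" using R by (simp_all add: r_def)
  define B where "B = ball x0 (2 * r)"
  have B: "B \<in> sets borel" "B \<inter> \<Omega> = {}" using r W(3) by (auto simp: B_def)
  \<comment> \<open>The locale asks for a source that is zero at every point of the ball, while u is
    zero there only almost everywhere.\<close>
  define \<phi> where "\<phi> y = u y - indicator B y * u y" for y
  have "AE y in lborel. indicator B y * u y = 0"
    by (rule hs_closure_zero_outside[OF s0 u(1) _ B]) (simp add: u(2) X)
  then have ae: "AE y in lborel. u y = \<phi> y" by eventually_elim (simp add: \<phi>_def)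
  have \<phi>L: "\<phi> \<in> L2" 
    by (rule L2_bound[OF uL, of _ 1]) (use B(1) in \<open>auto simp: \<phi>_def[abs_def] indicator_def\<close>)
  have u\<phi>: "abs_l2 u = abs_l2 \<phi>" using ae uL \<phi>L by (simp add: abs_l2_eq_iff)
  then have h: "hft \<phi> = hft u" by (simp add: hft_def)
  have \<phi>0: "\<phi> y = 0" if "y \<in> B" for y using that by (simp add: \<phi>_def)
  interpret src: exterior_source s r x0 \<phi>
    by unfold_locales (use s r \<phi>L \<phi>0 in \<open>auto simp: B_def dist_norm norm_minus_commute\<close>)
  have "AE y in lborel. \<phi> y = 0"
  proof (rule src.unique_continuation)
    fix f assume "f \<in> test_fun (ball x0 r)"
    then have f: "f \<in> test_fun B" by (rule test_fun_mono) (use r in \<open>auto simp: B_def\<close>)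
    have fS: "f \<in> sobolev s" by (rule test_fun_sobolev[OF f s0])
    note hf = test_fun_hart_L2[OF f]
    have [measurable]: "hart f \<in> borel_measurable borel" by (rule L2_realD(1)[OF hf(2)])
    have "f \<in> test_fun W" by (rule test_fun_mono[OF f r(2)[folded B_def]])
    from orth[OF this] have "inner (abs_l2 (\<lambda>\<xi>. norm \<xi> powr s * hft u \<xi>)) (abs_l2 (\<lambda>\<xi>. norm \<xi> powr s * hft f \<xi>)) = 0"
      unfolding u(2)[symmetric] mulop_fracw_sob(2)[OF u(1) s0] mulop_fracw_sob(2)[OF fS s0] by simp
    then have "(LINT \<xi>|lborel. (norm \<xi> powr s * hft u \<xi>) * (norm \<xi> powr s * hft f \<xi>)) = 0"
      unfolding inner_abs_l2[OF mulop_fracw_sob(1)[OF u(1) s0] mulop_fracw_sob(1)[OF fS s0]] .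
    moreover have "(LINT \<xi>|lborel. (norm \<xi> powr s * hft u \<xi>) * (norm \<xi> powr s * hft f \<xi>)) = (LINT \<xi>|lborel. norm \<xi> powr (2 * s) * (hft \<phi> \<xi> * hart f \<xi>))"
    proof (rule integral_cong_AE)
      show "AE \<xi> in lborel. (norm \<xi> powr s * hft u \<xi>) * (norm \<xi> powr s * hft f \<xi>) = norm \<xi> powr (2 * s) * (hft \<phi> \<xi> * hart f \<xi>)"
        using hf(3) by eventually_elim (simp add: h powr_sq[symmetric] power2_eq_square)
    qed measurable
    ultimately show "(LINT t|lborel. sweight s t * (LINT y|lborel. \<phi> y * heat_op t f y)) = 0"
      by (intro heat_integral_zero[OF s \<phi>L f \<phi>0]) simp_all
  qed
  then have "abs_l2 \<phi> = abs_l2 (\<lambda>x. 0)" using \<phi>L L2_zero by (subst abs_l2_eq_iff) auto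
  then have "abs_l2 u = abs_l2 (\<lambda>x. 0)" using u\<phi> by simp
  then have "hft u = hft (\<lambda>x. 0)" by (simp add: hft_def)
  then have "sob s u = sob s (\<lambda>x. 0)" by (simp add: sob_def)
  then show "X = 0" using sob_scale(2)[OF test_fun_sobolev[OF test_fun_zero s0], of 0] u(2) by simp
qed

section \<open>Determination of the potential\<close>

context calderon
begin

text \<open>All three cross terms pair disjoint supports, so only the interior corrections interact
  through q.\<close>

lemma qform_exterior:
  assumes F: "F \<in> hs_closure s A" and G: "G \<in> hs_closure s B" and V: "V \<in> E" "V' \<in> E"
    and disj: "A \<inter> B = {}" "A \<inter> \<Omega> = {}" "B \<inter> \<Omega> = {}"
  shows "qform (F + V) (G + V') = qform V V'"
proof -
  have H: "F \<in> H" "G \<in> H" "V \<in> H" "V' \<in> H" using F G EH[OF V(1)] EH[OF V(2)] hs_closure_mono[OF subset_UNIV] by blast+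
  have right: "qform Z (G + V') = qform Z G + qform Z V'" if "Z \<in> H" for Z
    using qform_add[OF H(2,4) that] that H by (simp add: qform_sym[of Z] H_add)
  have "qform (F + V) (G + V') = qform F (G + V') + qform V (G + V')" by (rule qform_add) (intro H H_add)+
  then show ?thesis
    using right[OF H(1)] right[OF H(3)] qform_disjoint[OF F G disj(1)] qform_disjoint[OF F V(2) disj(2)] qform_disjoint[OF V(1) G] disj(3)
    by (simp add: Int_commute)
qed

lemma corrections_dense:
  assumes "s > 0" "s \<notin> \<int>" "open W" "W \<noteq> {}" "W \<inter> \<Omega> = {}" and V: "V \<in> E"
  obtains X where "\<And>k::nat. X k \<in> corrections W" "X \<longlonglongrightarrow> V"
proof -
  have "E \<subseteq> closure (corrections W)"
    by (rule runge) (use fractional_unique_continuation[OF assms(1,2) _ assms(3-5)] assms(5) in auto)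
  then have "V \<in> closure (corrections W)" using V by blast
  then obtain X where "\<And>k::nat. X k \<in> corrections W" "X \<longlonglongrightarrow> V" unfolding closure_sequential by blast
  then show ?thesis by (rule that)
qed

end

text \<open>Alessandrini identity: both exterior pairings are rewritten as the respective form at
  the same pair, F + V from the equation for \<open>q1\<close> and G + V' from the one for
  \<open>q2\<close>. The fractional parts cancel and \<open>qform_exterior\<close> removes F and
  G.\<close>

lemma qform_eq_corrections:
  assumes c1: "calderon s K1 q1 \<Omega> \<kappa>1" and c2: "calderon s K2 q2 \<Omega> \<kappa>2"
    and disj: "W1 \<inter> W2 = {}" "W1 \<inter> \<Omega> = {}" "W2 \<inter> \<Omega> = {}"
    and DN: "\<And>f g. f \<in> test_fun W1 \<Longrightarrow> g \<in> test_fun W2 \<Longrightarrow>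
           DN_map s \<Omega> q1 (trace_class s \<Omega> f) (trace_class s \<Omega> g) =
           DN_map s \<Omega> q2 (trace_class s \<Omega> f) (trace_class s \<Omega> g)"
    and V: "V \<in> calderon.corrections s q1 \<Omega> W1" "V' \<in> calderon.corrections s q2 \<Omega> W2"
  shows "bdd_mult.qform s q1 V V' = bdd_mult.qform s q2 V V'"
proof -
  interpret c1: calderon s K1 q1 \<Omega> \<kappa>1 by fact
  interpret c2: calderon s K2 q2 \<Omega> \<kappa>2 by fact
  obtain f where VE: "V \<in> c1.E" and f: "f \<in> test_fun W1" and U: "c1.solves (sob s f) (sob s f + V)"
    using V(1) unfolding c1.corrections_def by blast
  obtain g where VE': "V' \<in> c1.E" and g: "g \<in> test_fun W2" and U': "c2.solves (sob s g) (sob s g + V')"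
    using V(2) unfolding c2.corrections_def by blast
  define F G where "F = sob s f" and "G = sob s g"
  note U = U[folded F_def] and U' = U'[folded G_def]
  have FG: "F \<in> hs_closure s W1" "G \<in> hs_closure s W2" unfolding F_def G_def using f g by (auto intro: sob_test_in)
  have H: "F \<in> c1.H" "G \<in> c1.H" "V \<in> c1.H" "V' \<in> c1.H"
    using c1.testH[OF f] c1.testH[OF g] c1.EH VE VE' unfolding F_def G_def by auto
  note UH = c1.H_add[OF H(1,3)] c1.H_add[OF H(2,4)]
  have 1: "DN_map s \<Omega> q1 (trace_class s \<Omega> f) (trace_class s \<Omega> g) = c1.bform (F + V) (G + V')"
  proof -
    have "c1.bform (F + V) (G + V') = c1.bform (F + V) G + c1.bform (F + V) V'"
      by (rule c1.bform_add_right[OF H(2,4) UH(1)])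
    moreover have "c1.bform (F + V) V' = 0" using U VE' by (simp add: c1.solves_def)
    ultimately show ?thesis
      using c1.DN_map_eq[OF test_fun_UNIV[OF f] test_fun_UNIV[OF g] U[unfolded F_def]] by (simp add: F_def G_def)
  qed
  obtain Z where Z: "c2.solves F Z" using c2.solves_exists[OF H(1)] by blast
  note ZH = c2.solves_H[OF H(1) Z]
  have 2: "DN_map s \<Omega> q2 (trace_class s \<Omega> f) (trace_class s \<Omega> g) = c2.bform (F + V) (G + V')"
  proof -
    have "DN_map s \<Omega> q2 (trace_class s \<Omega> f) (trace_class s \<Omega> g) = c2.bform Z G"
      using c2.DN_map_eq[OF test_fun_UNIV[OF f] test_fun_UNIV[OF g] Z[unfolded F_def]] by (simp add: G_def)
    \<comment> \<open>V' may be added because Z solves the equation for \<open>q2\<close>. After the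
      arguments are exchanged, Z may be replaced by F and then by F + V because G + V' solves it
      too.\<close>
    also have "\<dots> = c2.bform Z (G + V')"
      using c2.bform_add_right[OF H(2,4) ZH] Z VE' by (simp add: c2.solves_def)
    also have "\<dots> = c2.bform (G + V') Z" by (rule c2.bform_sym[OF ZH UH(2)])
    also have "\<dots> = c2.bform (G + V') F"
    proof -
      have D: "Z - F \<in> c2.E" using Z by (simp add: c2.solves_def)
      then have "c2.bform (G + V') (Z - F) = 0" using U' by (simp add: c2.solves_def)
      then show ?thesis using c2.bform_add_right[OF H(1) c2.EH[OF D] UH(2)] by simp
    qed
    also have "\<dots> = c2.bform (G + V') (F + V)"
      using c2.bform_add_right[OF H(1,3) UH(2)] U' VE by (simp add: c2.solves_def)
    also have "\<dots> = c2.bform (F + V) (G + V')" by (rule c2.bform_sym[OF UH(2,1)])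
    finally show ?thesis .
  qed
  have "c1.qform (F + V) (G + V') = c2.qform (F + V) (G + V')"
    using DN[OF f g] 1 2 unfolding c1.bform_def c2.bform_def by simp
  then show ?thesis
    unfolding c1.qform_exterior[OF FG VE VE' disj] c2.qform_exterior[OF FG VE VE' disj] .
qed

lemma qform_eq_dense:
  assumes c1: "calderon s K1 q1 \<Omega> \<kappa>1" and c2: "calderon s K2 q2 \<Omega> \<kappa>2"
    and s: "s > 0" "s \<notin> \<int>" and W1: "open W1" "W1 \<noteq> {}" and W2: "open W2" "W2 \<noteq> {}"
    and disj: "W1 \<inter> W2 = {}" "W1 \<inter> \<Omega> = {}" "W2 \<inter> \<Omega> = {}"
    and DN: "\<And>f g. f \<in> test_fun W1 \<Longrightarrow> g \<in> test_fun W2 \<Longrightarrow>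
           DN_map s \<Omega> q1 (trace_class s \<Omega> f) (trace_class s \<Omega> g) =
           DN_map s \<Omega> q2 (trace_class s \<Omega> f) (trace_class s \<Omega> g)"
    and V: "V \<in> hs_closure s \<Omega>" "V' \<in> hs_closure s \<Omega>"
  shows "bdd_mult.qform s q1 V V' = bdd_mult.qform s q2 V V'"
proof -
  interpret c1: calderon s K1 q1 \<Omega> \<kappa>1 by fact
  interpret c2: calderon s K2 q2 \<Omega> \<kappa>2 by fact
  obtain X where X: "\<And>k::nat. X k \<in> c1.corrections W1" "X \<longlonglongrightarrow> V" 
    using c1.corrections_dense[OF s W1 disj(2) V(1)] by metis
  obtain Y where Y: "\<And>k::nat. Y k \<in> c2.corrections W2" "Y \<longlonglongrightarrow> V'" 
    using c2.corrections_dense[OF s W2 disj(3) V(2)] by metis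
  have core: "c1.qform (X k) (Y j) = c2.qform (X k) (Y j)" for k j
    by (rule qform_eq_corrections[OF c1 c2 disj _ X(1) Y(1)]) (rule DN)
  have XH: "X k \<in> c1.H" and YH: "Y k \<in> c1.H" for k
    using X(1) Y(1) c1.EH unfolding c1.corrections_def c2.corrections_def by blast+
  note VH = c1.EH[OF V(1)] c1.EH[OF V(2)]
  \<comment> \<open>The limits are taken one argument at a time, each in the first slot, with
    symmetry exchanging the slots in between.\<close>
  have left: "c1.qform V (Y j) = c2.qform V (Y j)" for j
  proof (rule LIMSEQ_unique)
    show "(\<lambda>k. c1.qform (X k) (Y j)) \<longlonglongrightarrow> c1.qform V (Y j)" by (rule c1.qform_cont[OF XH X(2) YH])
    show "(\<lambda>k. c1.qform (X k) (Y j)) \<longlonglongrightarrow> c2.qform V (Y j)"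
      unfolding core by (rule c2.qform_cont[OF XH X(2) YH])
  qed
  have "c1.qform V' V = c2.qform V' V"
  proof (rule LIMSEQ_unique)
    show "(\<lambda>k. c1.qform (Y k) V) \<longlonglongrightarrow> c1.qform V' V" by (rule c1.qform_cont[OF YH Y(2) VH(1)])
    have "c1.qform (Y k) V = c2.qform (Y k) V" for k
      using left[of k] c1.qform_sym[OF YH VH(1)] c2.qform_sym[OF YH VH(1)] by simp
    then show "(\<lambda>k. c1.qform (Y k) V) \<longlonglongrightarrow> c2.qform V' V" using c2.qform_cont[OF YH Y(2) VH(1)] by simp
  qed
  then show ?thesis using c1.qform_sym[OF VH] c2.qform_sym[OF VH] by simp
qed

lemma disjoint_open_subsets:
  fixes W1 W2 :: "'a::{perfect_space, t2_space} set"
  assumes "open W1" "W1 \<noteq> {}" "open W2" "W2 \<noteq> {}"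
  obtains U1 U2 where "open U1" "U1 \<noteq> {}" "U1 \<subseteq> W1" "open U2" "U2 \<noteq> {}" "U2 \<subseteq> W2" "U1 \<inter> U2 = {}"
proof -
  obtain w1 where w1: "w1 \<in> W1" using assms by blast
  \<comment> \<open>Points are not open here, so W2 contains a point other than w1 even when the two
    sets coincide.\<close>
  have "W2 \<noteq> {w1}" using assms(3) not_open_singleton by metis
  then obtain w2 where w2: "w2 \<in> W2" "w1 \<noteq> w2" using assms(4) by blast
  obtain U V where "open U" "open V" "w1 \<in> U" "w2 \<in> V" "U \<inter> V = {}" using hausdorff[OF w2(2)] by blast
  then show ?thesis using w1 w2 assms(1,3) by (intro that[of "W1 \<inter> U" "W2 \<inter> V"]) auto
qed

theorem theorem7p11:
  fixes \<Omega> W\<^sub>1 W\<^sub>2 :: "(real ^ 'n) set" and s :: real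
    and q\<^sub>1 q\<^sub>2 :: "((real ^ 'n) \<Rightarrow> real) \<Rightarrow> real"
  assumes "open \<Omega>" and "bounded_in_one_direction \<Omega>"
    and "s > 0" and "s \<notin> \<int>"
    and "q\<^sub>1 \<in> potentials s \<Omega>" and "q\<^sub>2 \<in> potentials s \<Omega>"
    and "open W\<^sub>1" and "W\<^sub>1 \<noteq> {}" and "W\<^sub>1 \<subseteq> - closure \<Omega>"
    and "open W\<^sub>2" and "W\<^sub>2 \<noteq> {}" and "W\<^sub>2 \<subseteq> - closure \<Omega>"
    and "\<And>f g. f \<in> test_fun W\<^sub>1 \<Longrightarrow> g \<in> test_fun W\<^sub>2 \<Longrightarrow>
           DN_map s \<Omega> q\<^sub>1 (trace_class s \<Omega> f) (trace_class s \<Omega> g) =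
           DN_map s \<Omega> q\<^sub>2 (trace_class s \<Omega> f) (trace_class s \<Omega> g)"
  shows "eq_on \<Omega> q\<^sub>1 q\<^sub>2"
  unfolding eq_on_def
proof
  fix \<phi> assume \<phi>: "\<phi> \<in> test_fun \<Omega>"
  have s: "s \<ge> 0" using assms(3) by simp
  obtain K1 \<kappa>1 where c1: "calderon s K1 q\<^sub>1 \<Omega> \<kappa>1" using potentials_calderon[OF assms(5,2) s] by metis
  obtain K2 \<kappa>2 where c2: "calderon s K2 q\<^sub>2 \<Omega> \<kappa>2" using potentials_calderon[OF assms(6,2) s] by metis
  interpret c1: calderon s K1 q\<^sub>1 \<Omega> \<kappa>1 by fact
  interpret c2: calderon s K2 q\<^sub>2 \<Omega> \<kappa>2 by fact
  obtain U1 U2 where U: "open U1" "U1 \<noteq> {}" "U1 \<subseteq> W\<^sub>1" "open U2" "U2 \<noteq> {}" "U2 \<subseteq> W\<^sub>2" "U1 \<inter> U2 = {}"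
    using disjoint_open_subsets[OF assms(7,8,10,11)] by metis
  have disj: "U1 \<inter> \<Omega> = {}" "U2 \<inter> \<Omega> = {}" using U(3,6) assms(9,12) closure_subset[of \<Omega>] by blast+
  have DN: "DN_map s \<Omega> q\<^sub>1 (trace_class s \<Omega> f) (trace_class s \<Omega> g) = DN_map s \<Omega> q\<^sub>2 (trace_class s \<Omega> f) (trace_class s \<Omega> g)"
    if "f \<in> test_fun U1" "g \<in> test_fun U2" for f g
    by (intro assms(13) test_fun_mono[OF that(1) U(3)] test_fun_mono[OF that(2) U(6)])
  obtain \<psi> where \<psi>: "\<psi> \<in> test_fun \<Omega>" "\<And>x. x \<in> supp \<phi> \<Longrightarrow> \<psi> x = 1"
    using test_fun_cutoff[OF test_funD(2)[OF \<phi>] assms(1) test_funD(3)[OF \<phi>]] by metis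
  have "(\<lambda>x. \<phi> x * \<psi> x) = \<phi>"
  proof
    show "\<phi> x * \<psi> x = \<phi> x" for x using \<psi>(2)[of x] not_supp[of x \<phi>] by (cases "x \<in> supp \<phi>") auto
  qed
  then have "c1.qform (sob s \<phi>) (sob s \<psi>) = q\<^sub>1 \<phi>" "c2.qform (sob s \<phi>) (sob s \<psi>) = q\<^sub>2 \<phi>"
    using c1.qform_test[OF test_fun_UNIV[OF \<phi>] test_fun_UNIV[OF \<psi>(1)]] c2.qform_test[OF test_fun_UNIV[OF \<phi>] test_fun_UNIV[OF \<psi>(1)]] by simp_all
  moreover have "c1.qform (sob s \<phi>) (sob s \<psi>) = c2.qform (sob s \<phi>) (sob s \<psi>)"
    by (rule qform_eq_dense[OF c1 c2 assms(3,4) U(1,2,4,5,7) disj _ sob_test_in[OF \<phi>] sob_test_in[OF \<psi>(1)]]) (rule DN)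
  ultimately show "q\<^sub>1 \<phi> = q\<^sub>2 \<phi>" by simp
qed

end
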